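(* Fix a real number $\vartheta$ with $0<\vartheta<1$. Then there is a constant $C=C(\vartheta)>0$ such that for all real $x\ge 27$, \[ \left| S_{\vartheta}(x) - x^{\vartheta} F\big((1-\vartheta)\log x\big)\frac{\alpha_{\vartheta}(x)}{\vartheta}\right| \le C\, x^{\vartheta} F\big((1-\vartheta)\log x\big)\frac{\alpha_{\vartheta}(x)}{\vartheta}\sqrt{\frac{\log\log x}{\log x}} . \] Moreover, as $x\to\infty$, \[ S_{\vartheta}(x)=(1+o(1))\, x^{\vartheta} F\big((1-\vartheta)\log x\big)\frac{1}{\vartheta}\Big(\frac{2}{1-\vartheta}\Big)^{1/2}\big((\log x)\log\log x\big)^{-1/2}. \]
   Context: For a natural number $m$, let $k(m)$ denote the largest square-free divisor of $m$ (the product of the distinct primes dividing $m$). For $\vartheta>0$ and real $x\ge1$, let $S_\vartheta(x)$ be the number of natural numbers $m\le x$ with $k(m)\le m^{\vartheta}$. Let $\psi(m)=\prod_{p\mid m}(p+1)$ (product over primes), and define $F:[0,\infty)\to[0,\infty)$ by \[F(v)=\frac{6}{\pi^2}\sum_{m\ge1}\frac{1}{\psi(m)}\min\Big(1,\frac{e^v}{m}\Big).\] For $0<\vartheta<1$ and $x\ge 2$, $\alpha_\vartheta(x)$ denotes the unique real number $\alpha>0$ satisfying \[\sum_{p}\frac{p^{\alpha}\log p}{(p^{\alpha}-1)\big(1+(p+1)(p^{\alpha}-1)\big)}=(1-\vartheta)\log x,\] the sum being over all primes $p$. *)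

theory Defs
  imports "HOL-Analysis.Analysis" "HOL-Computational_Algebra.Primes" "HOL-Library.Landau_Symbols"
begin

definition sqfree_kernel :: "nat \<Rightarrow> nat" where
  "sqfree_kernel m = (\<Prod>p\<in>prime_factors m. p)"

definition S_count :: "real \<Rightarrow> real \<Rightarrow> nat" where
  "S_count \<theta> x = card {m::nat. 1 \<le> m \<and> real m \<le> x \<and> real (sqfree_kernel m) \<le> real m powr \<theta>}"

definition psi_fn :: "nat \<Rightarrow> nat" where
  "psi_fn m = (\<Prod>p\<in>prime_factors m. p + 1)"

definition F_fn :: "real \<Rightarrow> real" where
  "F_fn v = 6 / pi\<^sup>2 * (\<Sum>n. 1 / real (psi_fn (Suc n)) * min 1 (exp v / real (Suc n)))"

definition alpha_term :: "real \<Rightarrow> nat \<Rightarrow> real" where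
  "alpha_term a p = (real p powr a * ln (real p)) /
      ((real p powr a - 1) * (1 + (real p + 1) * (real p powr a - 1)))"

definition alpha_fn :: "real \<Rightarrow> real \<Rightarrow> real" where
  "alpha_fn \<theta> x = (THE a. a > 0 \<and> (\<Sum>\<^sub>\<infinity>p\<in>{p::nat. prime p}. alpha_term a p) = (1 - \<theta>) * ln x)"

end

theory Submission
  imports Defs "HOL-Number_Theory.Prime_Powers" "HOL-Real_Asymp.Real_Asymp"
    "HOL-Complex_Analysis.Complex_Analysis" "HOL-Probability.Probability"
    "HOL-Computational_Algebra.Squarefree"
begin

text \<open>
  Write \<open>m = k d\<close> with \<open>k\<close> the squarefree kernel of \<open>m\<close>. For fixed \<open>d\<close> the admissible \<open>k\<close> are the
  squarefree multiples of the kernel of \<open>d\<close> up to \<open>min (d powr \<mu>) (x / d)\<close> with \<open>\<mu> = \<theta> / (1 - \<theta>)\<close>, and a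
  sieve evaluates their number. With \<open>v = (1 - \<theta>) ln x\<close> this gives
  \<open>S \<approx> 6 / \<pi>\<^sup>2 * x powr \<theta> * (\<Sum>d. 1 / \<psi>(d) * min (exp (\<mu> (ln d - v))) (exp (v - ln d)))\<close>,
  whereas \<open>F v\<close> is the same sum with \<open>\<mu>\<close> replaced by \<open>0\<close>. After an exponential tilt by \<open>\<alpha>\<close>, Fourier
  inversion writes both sums as integrals of one and the same characteristic function
  \<open>\<Phi>(\<alpha> + i t) exp (i t v)\<close>, where \<open>\<Phi>(s) = (\<Sum>n. n powr - s / \<psi>(n))\<close>, against the kernels
  \<open>(\<mu> + 1) / ((\<mu> + s) (1 - s))\<close> and \<open>1 / (s (1 - s))\<close>. The saddle-point equation defining \<open>\<alpha>\<close> says that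
  the tilted measure has mean \<open>v\<close>, so the integrals concentrate near \<open>s = \<alpha>\<close>, and the quotient of the
  kernels there is \<open>\<alpha> / \<theta>\<close> to first order. The relative error is of order \<open>\<alpha> ln (1 / \<alpha>)\<close>, which the
  asymptotics of the saddle-point equation convert into \<open>sqrt (ln ln x / ln x)\<close>.
\<close>

section \<open>Euler products\<close>

text \<open>Write u = t / a, L = ln (1 / a), B = 1 / (a L). The two kernels, the second multiplied
  by a / \<theta>, differ by a part linear in u, much larger than the error allowed. Symmetry
  disposes of it. As ln \<Phi>(a) = O(B), the logarithm of the centred characteristic function is
  O(B u^2); its imaginary part is odd without linear term, hence O(B |u|^3). The linear part meets
  only this imaginary part, so the relative error is the size of u^2 and B u^4 at u = B^(-1/2), that
  is 1 / B = a L. The integrals are compared with each other and one is bounded from below; neither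
  is evaluated. Off the peak a bound below a (a L)^(3/2) is required. For a / 8 < |t| <= 1 / (2 L)
  the primes from 1 / a to 1 / a^2 supply it. Beyond, \<Phi>(s) is compared with zeta(1 + s) zeta(1
  + 2 s) zeta(1 + 3 s), whose poles at s = 0 give a factor a^3. The prime input is Chebyshev's bound
  and Mertens' first theorem. The sieve error loses exp (E a^(-1/2)) but saves x^(-\<theta> a / 2),
  which is at most exp (-c / (a L)).\<close>

definition primes_le :: "nat \<Rightarrow> nat set" where
  "primes_le N = {p. prime p \<and> p \<le> N}"

definition smooth_nats :: "nat \<Rightarrow> nat set" where
  "smooth_nats N = {n. 0 < n \<and> (\<forall>p\<in>prime_factors n. p \<le> N)}"

lemma finite_primes_le [simp, intro]: "finite (primes_le N)"
  unfolding primes_le_def by (rule finite_subset[of _ "{..N}"]) auto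

lemma primes_leD: "p \<in> primes_le N \<Longrightarrow> prime p" "p \<in> primes_le N \<Longrightarrow> p \<le> N"
  by (auto simp: primes_le_def)

lemma primes_le_0 [simp]: "primes_le 0 = {}"
  by (auto simp: primes_le_def)

lemma primes_le_Suc:
  "primes_le (Suc N) = (if prime (Suc N) then insert (Suc N) (primes_le N) else primes_le N)"
  by (auto simp: primes_le_def le_Suc_eq)

lemma primes_le_mono: "M \<le> N \<Longrightarrow> primes_le M \<subseteq> primes_le N"
  by (auto simp: primes_le_def)

lemma smooth_nats_0: "smooth_nats 0 = {1}"
proof -
  have "n = 1" if "0 < n" "\<forall>p\<in>prime_factors n. p \<le> 0" for n :: nat
  proof (rule ccontr)
    assume "n \<noteq> 1"
    then obtain p where "prime p" "p dvd n" using prime_factor_nat by blast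
    then show False using that(1) that(2)[rule_format, of p] by (simp add: in_prime_factors_iff)
  qed
  then show ?thesis by (auto simp: smooth_nats_def)
qed

lemma smooth_nats_Suc_nonprime: "\<not> prime (Suc N) \<Longrightarrow> smooth_nats (Suc N) = smooth_nats N"
  by (auto simp: smooth_nats_def in_prime_factors_iff le_Suc_eq)

lemma not_dvd_smooth: "prime p \<Longrightarrow> N < p \<Longrightarrow> n \<in> smooth_nats N \<Longrightarrow> \<not> p dvd n"
  by (metis (mono_tags, lifting) in_prime_factors_iff leD mem_Collect_eq not_gr_zero smooth_nats_def)

text \<open>Splitting off the exact power of the new prime is a bijection; one induction step of the
  Euler product rests on it.\<close>

lemma smooth_nats_Suc_prime:
  assumes q: "prime (Suc N)"
  shows "smooth_nats (Suc N) = (\<lambda>(n, k). n * Suc N ^ k) ` (smooth_nats N \<times> UNIV)"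
    and "inj_on (\<lambda>(n, k). n * Suc N ^ k) (smooth_nats N \<times> (UNIV :: nat set))"
    and "\<And>n. n \<in> smooth_nats N \<Longrightarrow> coprime n (Suc N)"
proof -
  show cop: "coprime n (Suc N)" if "n \<in> smooth_nats N" for n
  proof -
    have "\<not> Suc N dvd n" using that not_dvd_smooth[OF q lessI] by blast
    then show ?thesis using q by (metis coprime_commute prime_imp_coprime_nat)
  qed
  show "smooth_nats (Suc N) = (\<lambda>(n, k). n * Suc N ^ k) ` (smooth_nats N \<times> UNIV)"
  proof (intro equalityI subsetI)
    fix m assume m: "m \<in> smooth_nats (Suc N)"
    then have "m > 0" by (auto simp: smooth_nats_def)
    then obtain n where n: "m = Suc N ^ multiplicity (Suc N) m * n" "\<not> Suc N dvd n"
      using multiplicity_decompose'[of m "Suc N"] q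
      by (metis not_prime_unit not_gr_zero)
    have "n > 0" using n(2) by (intro Nat.gr0I) auto
    moreover have "p \<le> N" if "p \<in> prime_factors n" for p
    proof -
      have "p dvd m" using that by (subst n(1)) (auto simp: in_prime_factors_iff)
      then have "p \<le> Suc N" using that m \<open>m > 0\<close> by (auto simp: smooth_nats_def in_prime_factors_iff)
      moreover have "p \<noteq> Suc N" using that n(2) by (auto simp: in_prime_factors_iff)
      ultimately show ?thesis by simp
    qed
    ultimately have "n \<in> smooth_nats N" by (simp add: smooth_nats_def)
    then show "m \<in> (\<lambda>(n, k). n * Suc N ^ k) ` (smooth_nats N \<times> UNIV)"
      using n(1) by (auto simp: image_iff mult.commute intro!: bexI[of _ "(n, multiplicity (Suc N) m)"])
  next
    fix m assume "m \<in> (\<lambda>(n, k). n * Suc N ^ k) ` (smooth_nats N \<times> UNIV)"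
    then obtain n k where nk: "m = n * Suc N ^ k" "n \<in> smooth_nats N" by auto
    show "m \<in> smooth_nats (Suc N)"
      unfolding smooth_nats_def
    proof (intro CollectI conjI ballI)
      show "0 < m" using nk by (auto simp: smooth_nats_def)
      fix p assume p: "p \<in> prime_factors m"
      then have "p dvd n \<or> p dvd Suc N ^ k" using nk by (auto simp: in_prime_factors_iff prime_dvd_mult_iff)
      then show "p \<le> Suc N"
      proof
        assume "p dvd n"
        then have "p \<in> prime_factors n" using p nk(2) by (auto simp: in_prime_factors_iff smooth_nats_def)
        then show ?thesis using nk(2) by (auto simp: smooth_nats_def)
      next
        assume "p dvd Suc N ^ k"
        then have "p dvd Suc N" using p by (auto simp: in_prime_factors_iff dest: prime_dvd_power)
        then show ?thesis by (rule dvd_imp_le) simp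
      qed
    qed
  qed
  show "inj_on (\<lambda>(n, k). n * Suc N ^ k) (smooth_nats N \<times> (UNIV :: nat set))"
  proof (rule inj_onI, clarsimp)
    fix n k n' k' assume h: "n \<in> smooth_nats N" "n' \<in> smooth_nats N" "n * Suc N ^ k = n' * Suc N ^ k'"
    have mult: "multiplicity (Suc N) (n * Suc N ^ k) = k" if "n \<in> smooth_nats N" for n k
    proof -
      have "\<not> Suc N dvd n" using that not_dvd_smooth[OF q lessI] by blast
      then show ?thesis using q that
        by (subst prime_elem_multiplicity_mult_distrib)
           (auto simp: smooth_nats_def multiplicity_same_power not_dvd_imp_multiplicity_0)
    qed
    have "k = k'" using mult[OF h(1), of k] mult[OF h(2), of k'] h(3) by simp
    then show "n = n' \<and> k = k'" using h(3) by simp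
  qed
qed

text \<open>Induction on N, one prime at a time. Absolute summability is proved together with the
  value, because the step rearranges a sum over pairs (n, k) and for this the norms must be summable
  over the product set.\<close>

lemma euler_product_smooth:
  fixes g :: "nat \<Rightarrow> 'a::{real_normed_field,banach}"
  assumes g1: "g 1 = 1" and mult: "\<And>m n. coprime m n \<Longrightarrow> g (m * n) = g m * g n"
    and summ: "\<And>p. prime p \<Longrightarrow> summable (\<lambda>k. norm (g (p ^ k)))"
  shows "(\<lambda>n. norm (g n)) summable_on smooth_nats N \<and>
         (g has_sum (\<Prod>p\<in>primes_le N. \<Sum>k. g (p ^ k))) (smooth_nats N)"
proof (induction N)
  case 0
  have "(g has_sum sum g {1}) {1}" by (rule has_sum_finite) auto
  then show ?case using g1 by (simp add: smooth_nats_0)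
next
  case (Suc N)
  show ?case
  proof (cases "prime (Suc N)")
    case False
    then show ?thesis using Suc by (simp add: smooth_nats_Suc_nonprime primes_le_Suc)
  next
    case True
    define q where "q = Suc N"
    define h where "h = (\<lambda>(n::nat, k::nat). n * q ^ k)"
    have sm: "smooth_nats (Suc N) = h ` (smooth_nats N \<times> UNIV)" "inj_on h (smooth_nats N \<times> UNIV)"
      and cop: "\<And>n. n \<in> smooth_nats N \<Longrightarrow> coprime n q"
      using smooth_nats_Suc_prime[OF True] unfolding h_def q_def by auto
    have gh: "g (h (n, k)) = g n * g (q ^ k)" if "n \<in> smooth_nats N" for n k
      unfolding h_def using cop[OF that] by (simp add: mult)
    have sq: "summable (\<lambda>k. norm (g (q ^ k)))" using summ True unfolding q_def by auto
    have hs: "((\<lambda>k. g (q ^ k)) has_sum (\<Sum>k. g (q ^ k))) UNIV"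
      using sq summable_norm_cancel[OF sq] by (intro norm_summable_imp_has_sum) auto
    have hsn: "((\<lambda>k. norm (g (q ^ k))) has_sum (\<Sum>k. norm (g (q ^ k)))) UNIV"
      using sq by (intro norm_summable_imp_has_sum) auto
    have abs: "(\<lambda>x. norm ((g \<circ> h) x)) summable_on (smooth_nats N \<times> UNIV)"
      unfolding Infinite_Sum.abs_summable_on_Sigma_iff
    proof (intro conjI ballI)
      fix n assume n: "n \<in> smooth_nats N"
      have "(\<lambda>y. norm (g n) * norm (g (q ^ y))) summable_on UNIV"
        using hsn by (intro summable_on_cmult_right) (auto simp: summable_on_def)
      then show "(\<lambda>y. norm ((g \<circ> h) (n, y))) summable_on UNIV"
        using gh[OF n] by (simp add: norm_mult)
    next
      have eq: "infsum (\<lambda>y. norm ((g \<circ> h) (n, y))) UNIV = (\<Sum>k. norm (g (q ^ k))) * norm (g n)"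
        if "n \<in> smooth_nats N" for n
        using gh[OF that] has_sum_cmult_right[OF hsn, of "norm (g n)"]
        by (simp add: norm_mult infsumI mult.commute)
      have nn: "0 \<le> (\<Sum>k. norm (g (q ^ k)))" using sq by (intro suminf_nonneg) auto
      have "(\<lambda>n. (\<Sum>k. norm (g (q ^ k))) * norm (g n)) summable_on smooth_nats N"
        using Suc by (intro summable_on_cmult_right) auto
      then have "(\<lambda>n. norm ((\<Sum>k. norm (g (q ^ k))) * norm (g n))) summable_on smooth_nats N"
        using nn by (simp add: abs_mult)
      then show "(\<lambda>x. norm (\<Sum>\<^sub>\<infinity>y\<in>UNIV. norm ((g \<circ> h) (x, y)))) summable_on smooth_nats N"
        by (subst summable_on_cong[where g = "\<lambda>n. norm ((\<Sum>k. norm (g (q ^ k))) * norm (g n))"])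
           (simp_all only: eq)
    qed
    have "(g \<circ> h has_sum ((\<Prod>p\<in>primes_le N. \<Sum>k. g (p ^ k)) * (\<Sum>k. g (q ^ k)))) (smooth_nats N \<times> UNIV)"
    proof (rule has_sum_SigmaI)
      fix n assume n: "n \<in> smooth_nats N"
      show "((\<lambda>y. (g \<circ> h) (n, y)) has_sum (g n * (\<Sum>k. g (q ^ k)))) UNIV"
        using gh[OF n] has_sum_cmult_right[OF hs, of "g n"] by simp
    next
      show "((\<lambda>n. g n * (\<Sum>k. g (q ^ k))) has_sum (\<Prod>p\<in>primes_le N. \<Sum>k. g (p ^ k)) * (\<Sum>k. g (q ^ k))) (smooth_nats N)"
        using Suc by (intro has_sum_cmult_left) auto
      show "g \<circ> h summable_on smooth_nats N \<times> UNIV"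
        using abs by (rule abs_summable_summable)
    qed
    then have 1: "(g has_sum ((\<Prod>p\<in>primes_le N. \<Sum>k. g (p ^ k)) * (\<Sum>k. g (q ^ k)))) (smooth_nats (Suc N))"
      unfolding sm(1) by (subst has_sum_reindex[OF sm(2)]) auto
    have 2: "(\<lambda>n. norm (g n)) summable_on smooth_nats (Suc N)"
      unfolding sm(1) using abs by (subst summable_on_reindex[OF sm(2)]) (auto simp: o_def)
    have "q \<notin> primes_le N" by (auto simp: q_def primes_le_def)
    then have 3: "(\<Prod>p\<in>primes_le (Suc N). \<Sum>k. g (p ^ k)) = (\<Prod>p\<in>primes_le N. \<Sum>k. g (p ^ k)) * (\<Sum>k. g (q ^ k))"
      using True by (simp add: primes_le_Suc q_def mult.commute)
    show ?thesis using 1 2 unfolding 3 by blast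
  qed
qed

lemma atMost_subset_smooth_nats: "{1..N} \<subseteq> smooth_nats N"
  by (auto simp: smooth_nats_def in_prime_factors_iff dest!: dvd_imp_le)

text \<open>Summability is derived from a uniform bound on the partial products of the norms, which in
  applications is the quantity one estimates anyway.\<close>

lemma euler_product:
  fixes g :: "nat \<Rightarrow> 'a::{real_normed_field,banach}"
  assumes g0: "g 0 = 0" and g1: "g 1 = 1"
    and mult: "\<And>m n. coprime m n \<Longrightarrow> g (m * n) = g m * g n"
    and summ: "\<And>p. prime p \<Longrightarrow> summable (\<lambda>k. norm (g (p ^ k)))"
    and bound: "\<And>N. (\<Prod>p\<in>primes_le N. \<Sum>k. norm (g (p ^ k))) \<le> C"
  shows "summable (\<lambda>n. norm (g n))" and "(\<Sum>n. norm (g n)) \<le> C"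
    and "(\<lambda>N. \<Prod>p\<in>primes_le N. \<Sum>k. g (p ^ k)) \<longlonglongrightarrow> (\<Sum>n. g n)"
proof -
  have s1: "((\<lambda>n. norm (g n)) has_sum (\<Prod>p\<in>primes_le N. \<Sum>k. norm (g (p ^ k)))) (smooth_nats N)" for N
    using euler_product_smooth[of "\<lambda>n. norm (g n)" N] summ g1 mult by (simp add: norm_mult)
  have s2: "(g has_sum (\<Prod>p\<in>primes_le N. \<Sum>k. g (p ^ k))) (smooth_nats N)" for N
    using euler_product_smooth[of g N] summ g1 mult by simp
  have bd: "(\<Sum>n\<in>{..<N}. norm (g n)) \<le> C" for N
  proof -
    have "(\<Sum>n\<in>{..<N}. norm (g n)) = (\<Sum>n\<in>{1..<N}. norm (g n))"
      using g0 by (intro sum.mono_neutral_right) (auto simp: not_le)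
    also have "\<dots> \<le> (\<Sum>n\<in>{1..N}. norm (g n))"
      by (intro sum_mono2) auto
    also have "\<dots> \<le> (\<Prod>p\<in>primes_le N. \<Sum>k. norm (g (p ^ k)))"
      by (rule has_sum_mono2[OF has_sum_finite s1[of N] atMost_subset_smooth_nats]) auto
    finally show ?thesis using bound[of N] by linarith
  qed
  show summ: "summable (\<lambda>n. norm (g n))"
    by (rule summableI_nonneg_bounded[OF _ bd]) auto
  then show "(\<Sum>n. norm (g n)) \<le> C" using bd by (intro suminf_le_const) auto
  have hs: "(g has_sum (\<Sum>n. g n)) UNIV" "((\<lambda>n. norm (g n)) has_sum (\<Sum>n. norm (g n))) UNIV"
    using summ summable_norm_cancel[OF summ] by (auto intro!: norm_summable_imp_has_sum)
  \<comment> \<open>The difference is the sum of \<open>g\<close> over the numbers that are not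
    \<open>N\<close>-smooth. Apart from 0, where \<open>g\<close> vanishes, these exceed
    \<open>N\<close>, so a tail of the norm series bounds it.\<close>
  have "norm ((\<Sum>n. g n) - (\<Prod>p\<in>primes_le N. \<Sum>k. g (p ^ k))) \<le> (\<Sum>n. norm (g n)) - (\<Sum>n<N. norm (g n))" for N
  proof -
    have d1: "(g has_sum ((\<Sum>n. g n) - (\<Prod>p\<in>primes_le N. \<Sum>k. g (p ^ k)))) (UNIV - smooth_nats N)"
      by (rule has_sum_Diff[OF hs(1) s2]) auto
    have d2: "((\<lambda>n. norm (g n)) has_sum ((\<Sum>n. norm (g n)) - (\<Prod>p\<in>primes_le N. \<Sum>k. norm (g (p ^ k))))) (UNIV - smooth_nats N)"
      by (rule has_sum_Diff[OF hs(2) s1]) auto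
    have "norm ((\<Sum>n. g n) - (\<Prod>p\<in>primes_le N. \<Sum>k. g (p ^ k))) \<le> (\<Sum>n. norm (g n)) - (\<Prod>p\<in>primes_le N. \<Sum>k. norm (g (p ^ k)))"
      using norm_infsum_bound[of g "UNIV - smooth_nats N"] d1 d2 by (simp add: infsumI has_sum_imp_summable)
    moreover have "(\<Sum>n\<in>{..<N}. norm (g n)) \<le> (\<Prod>p\<in>primes_le N. \<Sum>k. norm (g (p ^ k)))"
    proof -
      have "(\<Sum>n\<in>{..<N}. norm (g n)) = (\<Sum>n\<in>{1..<N}. norm (g n))"
        using g0 by (intro sum.mono_neutral_right) (auto simp: not_le)
      also have "\<dots> \<le> (\<Sum>n\<in>{1..N}. norm (g n))"
        by (intro sum_mono2) auto
      also have "\<dots> \<le> (\<Prod>p\<in>primes_le N. \<Sum>k. norm (g (p ^ k)))"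
        by (rule has_sum_mono2[OF has_sum_finite s1[of N] atMost_subset_smooth_nats]) auto
      finally show ?thesis .
    qed
    ultimately show ?thesis by linarith
  qed
  moreover have "(\<lambda>N. (\<Sum>n. norm (g n)) - (\<Sum>n<N. norm (g n))) \<longlonglongrightarrow> 0"
    using tendsto_diff[OF tendsto_const[of "\<Sum>n. norm (g n)"] summable_LIMSEQ[OF summ]] by simp
  ultimately have "(\<lambda>N. (\<Sum>n. g n) - (\<Prod>p\<in>primes_le N. \<Sum>k. g (p ^ k))) \<longlonglongrightarrow> 0"
    by (rule Lim_null_comparison[OF always_eventually[OF allI]])
  from tendsto_diff[OF tendsto_const[of "\<Sum>n. g n"] this]
  show "(\<lambda>N. \<Prod>p\<in>primes_le N. \<Sum>k. g (p ^ k)) \<longlonglongrightarrow> (\<Sum>n. g n)" by simp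
qed

section \<open>Mertens estimates\<close>

text \<open>The two central coefficients of row 2m + 1 are equal, and the whole row sums to 2 *
  4^m.\<close>

lemma binomial_odd_le: "(2 * m + 1) choose m \<le> (4 :: nat) ^ m"
proof -
  have "2 * ((2 * m + 1) choose m) = (\<Sum>k\<in>{m, m + 1}. (2 * m + 1) choose k)"
    using binomial_symmetric[of m "2 * m + 1"] by simp
  also have "\<dots> \<le> (\<Sum>k\<le>2 * m + 1. (2 * m + 1) choose k)"
    by (intro sum_mono2) auto
  also have "\<dots> = 2 * 4 ^ m" using choose_row_sum[of "2 * m + 1"] by (simp add: power_mult)
  finally show ?thesis by simp
qed

text \<open>Erdos' argument. For n = 2m + 1 every prime in (m + 1, n] divides the coefficient in
  \<open>binomial_odd_le\<close>, so their product is at most 4^m; the primes up to m + 1 are left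
  to the induction hypothesis. An even n > 2 is not prime and reduces to n - 1.\<close>

lemma primorial_le: "(\<Prod>p\<in>primes_le n. p) \<le> (4 :: nat) ^ n"
proof (induction n rule: less_induct)
  case (less n)
  consider "n \<le> 2" | "n > 2" "even n" | "n > 2" "odd n" by linarith
  then show ?case
  proof cases
    case 1
    then have "n = 0 \<or> n = 1 \<or> n = 2" by linarith
    then show ?thesis by (auto simp: primes_le_Suc numeral_2_eq_2)
  next
    case 2
    then have "\<not> prime n" by (metis prime_odd_nat)
    then have "primes_le n = primes_le (n - 1)" using 2 primes_le_Suc[of "n - 1"] by simp
    moreover have "(\<Prod>p\<in>primes_le (n - 1). p) \<le> (4 :: nat) ^ (n - 1)" using less 2 by simp
    moreover have "(4 :: nat) ^ (n - 1) \<le> 4 ^ n" by (intro power_increasing) auto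
    ultimately show ?thesis by (metis order_trans)
  next
    case 3
    then obtain m where m: "n = 2 * m + 1" by (elim oddE)
    with 3 have "m \<ge> 1" by simp
    define T where "T = primes_le n - primes_le (m + 1)"
    have T: "p \<in> T \<longleftrightarrow> prime p \<and> m + 1 < p \<and> p \<le> n" for p
      by (auto simp: T_def primes_le_def)
    have sub: "primes_le (m + 1) \<subseteq> primes_le n" using m by (intro primes_le_mono) auto
    have dvd: "p dvd (n choose m)" if "p \<in> T" for p
    proof -
      have "fact m * fact (n - m) * (n choose m) = (fact n :: nat)"
        by (rule binomial_fact_lemma) (use m in auto)
      moreover have "p dvd (fact n :: nat)" using that T by (simp add: prime_dvd_fact_iff)
      ultimately have "p dvd fact m * fact (n - m) * (n choose m)" by simp
      moreover have "\<not> p dvd (fact m :: nat)" "\<not> p dvd (fact (n - m) :: nat)"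
        using that T[of p] m prime_dvd_fact_iff[of p m] prime_dvd_fact_iff[of p "n - m"] by linarith+
      ultimately show ?thesis using that T by (auto simp: prime_dvd_mult_iff)
    qed
    have "(\<Prod>p\<in>T. p) dvd (n choose m)"
    proof -
      have "finite S \<Longrightarrow> S \<subseteq> T \<Longrightarrow> (\<Prod>p\<in>S. p) dvd (n choose m)" for S
      proof (induction S rule: finite_induct)
        case (insert p S)
        then have "coprime p (\<Prod>q\<in>S. q)"
          by (intro prod_coprime_right primes_coprime) (auto simp: T)
        moreover have "p dvd (n choose m)" "(\<Prod>q\<in>S. q) dvd (n choose m)" using insert dvd by auto
        ultimately have "p * (\<Prod>q\<in>S. q) dvd (n choose m)" using divides_mult by blast
        then show ?case using insert by simp
      qed auto
      moreover have "finite T" unfolding T_def by simp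
      ultimately show ?thesis by simp
    qed
    then have "(\<Prod>p\<in>T. p) \<le> n choose m" using m by (intro dvd_imp_le) auto
    also have "\<dots> \<le> 4 ^ m" unfolding m by (rule binomial_odd_le)
    finally have A: "(\<Prod>p\<in>T. p) \<le> 4 ^ m" .
    have B: "(\<Prod>p\<in>primes_le (m + 1). p) \<le> 4 ^ (m + 1)" by (rule less) (use m \<open>m \<ge> 1\<close> in simp)
    have "(\<Prod>p\<in>primes_le n. p) = (\<Prod>p\<in>T. p) * (\<Prod>p\<in>primes_le (m + 1). p)"
      unfolding T_def using sub by (simp add: prod.subset_diff)
    also have "\<dots> \<le> 4 ^ m * 4 ^ (m + 1)" using A B by (rule mult_mono) auto
    also have "\<dots> = 4 ^ n" by (simp add: m power_add[symmetric] mult_2)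
    finally show ?thesis .
  qed
qed

lemma chebyshev_theta_le: "(\<Sum>p\<in>primes_le n. ln (real p)) \<le> real n * ln 4"
proof -
  have "(\<Sum>p\<in>primes_le n. ln (real p)) = ln (\<Prod>p\<in>primes_le n. real p)"
    by (rule ln_prod[symmetric]) (use finite_primes_le in \<open>auto simp: primes_le_def prime_gt_0_nat\<close>)
  also have "(\<Prod>p\<in>primes_le n. real p) = real (\<Prod>p\<in>primes_le n. p)" by simp
  also have "ln \<dots> \<le> ln (real (4 ^ n))"
  proof (rule ln_mono)
    have "(\<Prod>p\<in>primes_le n. p) > 0" by (intro prod_pos) (auto simp: primes_le_def prime_gt_0_nat)
    then show "0 < real (\<Prod>p\<in>primes_le n. p)" by linarith
    show "real (\<Prod>p\<in>primes_le n. p) \<le> real (4 ^ n)" using primorial_le[of n] by linarith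
  qed
  also have "\<dots> = real n * ln 4" by (simp add: ln_realpow)
  finally show ?thesis .
qed

text \<open>Legendre's formula: write each ln m as the sum of \<open>mangoldt d\<close> over the
  divisors d of m and exchange the summations.\<close>

lemma ln_fact_eq_mangoldt_sum: "ln (fact n) = (\<Sum>d=1..n. mangoldt d * real (n div d))"
proof -
  have "ln (fact n :: real) = (\<Sum>m=1..n. ln (real m))"
    unfolding fact_prod of_nat_prod by (subst ln_prod) auto
  also have "\<dots> = (\<Sum>m=1..n. \<Sum>d | d \<in> {1..n} \<and> d dvd m. mangoldt d)"
  proof (rule sum.cong)
    fix m assume m: "m \<in> {1..n}"
    then have "{d. d \<in> {1..n} \<and> d dvd m} = {d. d dvd m}" by (auto dest: dvd_imp_le intro: Nat.gr0I)
    then show "ln (real m) = (\<Sum>d | d \<in> {1..n} \<and> d dvd m. mangoldt d)"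
      using m mangoldt_sum[of m, where 'a = real] by simp
  qed auto
  also have "\<dots> = (\<Sum>d=1..n. \<Sum>m | m \<in> {1..n} \<and> d dvd m. mangoldt d)"
    by (rule sum.swap_restrict) auto
  also have "\<dots> = (\<Sum>d=1..n. mangoldt d * real (n div d))"
  proof (rule sum.cong)
    fix d assume d: "d \<in> {1..n}"
    have "{m. m \<in> {1..n} \<and> d dvd m} = (\<lambda>k. d * k) ` {1..n div d}"
    proof (intro equalityI subsetI)
      fix m assume "m \<in> {m. m \<in> {1..n} \<and> d dvd m}"
      then obtain k where "m = d * k" "1 \<le> m" "m \<le> n" by auto
      then show "m \<in> (\<lambda>k. d * k) ` {1..n div d}"
        using d by (auto simp: less_eq_div_iff_mult_less_eq mult.commute intro!: imageI)
    qed (use d in \<open>auto simp: less_eq_div_iff_mult_less_eq mult.commute\<close>)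
    moreover have "card ((\<lambda>k. d * k) ` {1..n div d}) = n div d"
      using d by (subst card_image) (auto simp: inj_on_def)
    ultimately show "(\<Sum>m | m \<in> {1..n} \<and> d dvd m. mangoldt d) = mangoldt d * real (n div d)"
      by simp
  qed auto
  finally show ?thesis .
qed

lemma ln_fact_bounds:
  assumes "n \<ge> 1"
  shows "ln (fact n :: real) \<le> real n * ln n" "real n * ln n - real n \<le> ln (fact n :: real)"
proof -
  have "(fact n :: real) \<le> real n ^ n" using fact_le_power[of n] by simp
  then have "ln (fact n :: real) \<le> ln (real n ^ n)" using assms by (intro ln_mono) auto
  then show "ln (fact n :: real) \<le> real n * ln n" using assms by (simp add: ln_realpow)
  \<comment> \<open>The left side is a single term of the power series of e^n.\<close>
  have "real n ^ n / fact n \<le> exp (real n)"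
  proof -
    have "(\<Sum>k\<in>{n}. inverse (fact k) *\<^sub>R real n ^ k) \<le> (\<Sum>k. inverse (fact k) *\<^sub>R real n ^ k)"
      by (intro sum_le_suminf summable_exp_generic) auto
    then show ?thesis by (simp add: exp_def field_simps)
  qed
  then have "real n ^ n \<le> exp (real n) * fact n" by (simp add: field_simps)
  then have "ln (real n ^ n) \<le> ln (exp (real n) * fact n)" using assms by (intro ln_mono) auto
  then show "real n * ln n - real n \<le> ln (fact n :: real)" using assms by (simp add: ln_realpow ln_mult)
qed

lemma summable_ln_div_square: "summable (\<lambda>n. ln (real n) / (real n * (real n - 1)))"
proof (rule summable_comparison_test_bigo)
  show "summable (\<lambda>n. norm (real n powr (-3/2)))" using summable_real_powr_iff[of "-3/2"] by simp
  show "(\<lambda>n. ln (real n) / (real n * (real n - 1))) \<in> O(\<lambda>n. real n powr (-3/2))" by real_asymp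
qed

text \<open>Both bounds compare n times the sum of ln p / p with ln n!. From above, replacing n div
  p by n / p costs at most the sum of ln p, which is O(n) by Chebyshev. From below, the proper prime
  powers add at most the convergent series \<open>K2\<close>, and ln n! >= n ln n - n.\<close>

lemma mertens_first:
  obtains K :: real where "K > 0"
    "\<And>n. n \<ge> 1 \<Longrightarrow> \<bar>(\<Sum>p\<in>primes_le n. ln (real p) / real p) - ln (real n)\<bar> \<le> K"
proof -
  define K2 where "K2 = (\<Sum>n. ln (real n) / (real n * (real n - 1)))"
  have nn: "0 \<le> ln (real n) / (real n * (real n - 1))" for n
    by (cases "n = 0"; cases "n = 1") auto
  have K2: "K2 \<ge> 0" unfolding K2_def by (rule suminf_nonneg[OF summable_ln_div_square nn])
  show ?thesis
  proof (rule that[of "2 + K2"])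
    show "2 + K2 > 0" using K2 by simp
    fix n :: nat assume n: "n \<ge> 1"
    define A where "A = (\<Sum>p\<in>primes_le n. ln (real p) / real p)"
    have "real n * A - real n * ln 4 \<le> (\<Sum>p\<in>primes_le n. real n * (ln (real p) / real p)) - (\<Sum>p\<in>primes_le n. ln (real p))"
      using chebyshev_theta_le[of n] by (simp add: A_def sum_distrib_left)
    also have "\<dots> = (\<Sum>p\<in>primes_le n. ln (real p) * (real n / real p - 1))"
      by (simp add: sum_subtractf[symmetric] algebra_simps)
    also have "\<dots> \<le> (\<Sum>p\<in>primes_le n. mangoldt p * real (n div p))"
    proof (rule sum_mono)
      fix p assume p: "p \<in> primes_le n"
      then have "prime p" by (simp add: primes_le_def)
      have "real n / real p - 1 \<le> real (n div p)"
        using floor_divide_of_nat_eq[of n p, where ?'a = real] by linarith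
      then show "ln (real p) * (real n / real p - 1) \<le> mangoldt p * real (n div p)"
        using \<open>prime p\<close> prime_ge_1_nat[OF \<open>prime p\<close>] by (simp add: mult_left_mono)
    qed
    also have "\<dots> \<le> (\<Sum>d=1..n. mangoldt d * real (n div d))"
      by (intro sum_mono2) (auto simp: primes_le_def prime_gt_0_nat Suc_le_eq mangoldt_nonneg)
    also have "\<dots> = ln (fact n)" by (simp add: ln_fact_eq_mangoldt_sum)
    also have "\<dots> \<le> real n * ln n" by (rule ln_fact_bounds[OF n])
    finally have "real n * (A - ln n) \<le> real n * ln 4" by (simp add: algebra_simps)
    then have "A - ln n \<le> ln 4" using n by (simp add: mult_le_cancel_left)
    moreover have "ln 4 \<le> (2::real)"
    proof -
      have "ln 4 = 2 * ln (2::real)" using ln_realpow[of 2 2] by simp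
      then show ?thesis using ln_2_less_1 by simp
    qed
    ultimately have up: "A - ln n \<le> 2" by linarith
    have "real n * ln n - real n \<le> ln (fact n)" by (rule ln_fact_bounds[OF n])
    also have "\<dots> = (\<Sum>d=1..n. mangoldt d * real (n div d))" by (simp add: ln_fact_eq_mangoldt_sum)
    also have "\<dots> \<le> (\<Sum>d=1..n. real n * (mangoldt d / real d))"
    proof (rule sum_mono)
      fix d
      show "mangoldt d * real (n div d) \<le> real n * (mangoldt d / real d)"
        using mult_left_mono[OF of_nat_div_le_of_nat[of n d, where ?'a = real] mangoldt_nonneg[of d]]
        by (simp add: mult.commute)
    qed
    also have "\<dots> = real n * (\<Sum>d=1..n. mangoldt d / real d)" by (simp add: sum_distrib_left)
    also have "(\<Sum>d=1..n. mangoldt d / real d) \<le> (\<Sum>(p, k)\<in>primes_le n \<times> {1..n}. ln (real p) / real p ^ k)"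
    proof -
      have "(\<Sum>d=1..n. mangoldt d / real d) = (\<Sum>d\<in>{d\<in>{1..n}. primepow d}. mangoldt d / real d)"
        by (rule sum.mono_neutral_right) (auto simp: mangoldt_def)
      also have "\<dots> \<le> (\<Sum>d\<in>(\<lambda>(p, k). p ^ k) ` (primes_le n \<times> {1..n}). mangoldt d / real d)"
      proof (rule sum_mono2)
        show "{d \<in> {1..n}. primepow d} \<subseteq> (\<lambda>(p, k). p ^ k) ` (primes_le n \<times> {1..n})"
        proof clarsimp
          fix d assume d: "Suc 0 \<le> d" "d \<le> n" "primepow d"
          then obtain p k where pk: "prime p" "k > 0" "d = p ^ k" by (auto simp: primepow_def)
          have "p \<le> d" using pk prime_ge_1_nat[OF pk(1)] by (simp add: self_le_power)
          have "k < 2 ^ k" by simp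
          also have "(2::nat) ^ k \<le> p ^ k" using prime_ge_2_nat[OF pk(1)] by (intro power_mono) auto
          finally have "k \<le> d" using pk by simp
          then show "d \<in> (\<lambda>(p, k). p ^ k) ` (primes_le n \<times> {Suc 0..n})"
            using pk d \<open>p \<le> d\<close> by (intro image_eqI[of _ _ "(p, k)"]) (auto simp: primes_le_def)
        qed
      qed (auto simp: mangoldt_nonneg)
      also have "\<dots> \<le> (\<Sum>(p, k)\<in>primes_le n \<times> {1..n}. mangoldt (p ^ k) / real (p ^ k))"
        using sum_image_le[of "primes_le n \<times> {1..n}" "\<lambda>d. mangoldt d / real d" "\<lambda>(p, k). p ^ k"]
        by (auto simp: mangoldt_nonneg case_prod_unfold o_def)
      also have "\<dots> = (\<Sum>(p, k)\<in>primes_le n \<times> {1..n}. ln (real p) / real p ^ k)"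
        by (rule sum.cong) (auto simp: primes_le_def)
      finally show ?thesis .
    qed
    also have "(\<Sum>(p, k)\<in>primes_le n \<times> {1..n}. ln (real p) / real p ^ k) =
        (\<Sum>p\<in>primes_le n. \<Sum>k=1..n. ln (real p) / real p ^ k)"
      by (simp add: sum.cartesian_product)
    also have "\<dots> \<le> (\<Sum>p\<in>primes_le n. ln (real p) / real p + ln (real p) / (real p * (real p - 1)))"
    proof (rule sum_mono)
      fix p assume "p \<in> primes_le n"
      then have p: "real p \<ge> 2" using prime_ge_2_nat by (auto simp: primes_le_def)
      \<comment> \<open>The remainder of the geometric series is kept so that the induction on m
        closes; it is dropped afterwards.\<close>
      have geo: "(\<Sum>k=1..m. 1 / real p ^ k) \<le> 1 / (real p - 1) - 1 / (real p ^ m * (real p - 1))" for m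

      proof (induction m)
        case (Suc m)
        have "1 / (real p ^ m * (real p - 1)) = 1 / real p ^ Suc m + 1 / (real p ^ Suc m * (real p - 1))"
          using p by (simp add: divide_simps)
        then show ?case using Suc by simp
      qed simp
      have "(\<Sum>k=1..n. ln (real p) / real p ^ k) = ln (real p) * (\<Sum>k=1..n. 1 / real p ^ k)"
        by (simp add: sum_distrib_left)
      also have "\<dots> \<le> ln (real p) * (1 / (real p - 1))"
      proof (rule mult_left_mono)
        have "0 \<le> 1 / (real p ^ n * (real p - 1))" using p by simp
        then show "(\<Sum>k=1..n. 1 / real p ^ k) \<le> 1 / (real p - 1)" using geo[of n] by linarith
      qed (use p in auto)
      also have "\<dots> = ln (real p) / real p + ln (real p) / (real p * (real p - 1))"
        using p by (simp add: field_simps)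
      finally show "(\<Sum>k=1..n. ln (real p) / real p ^ k) \<le> ln (real p) / real p + ln (real p) / (real p * (real p - 1))" .
    qed
    also have "\<dots> = A + (\<Sum>p\<in>primes_le n. ln (real p) / (real p * (real p - 1)))"
      by (simp add: A_def sum.distrib)
    also have "(\<Sum>p\<in>primes_le n. ln (real p) / (real p * (real p - 1))) \<le> K2"
      unfolding K2_def using nn by (intro sum_le_suminf summable_ln_div_square) auto
    finally have "real n * ln n - real n \<le> real n * (A + K2)" using n by (simp add: mult_left_mono)
    then have "real n * (ln n - 1) \<le> real n * (A + K2)" by (simp add: algebra_simps)
    then have "ln n - 1 \<le> A + K2" using n by (simp add: mult_le_cancel_left)
    with up K2 show "\<bar>(\<Sum>p\<in>primes_le n. ln (real p) / real p) - ln (real n)\<bar> \<le> 2 + K2"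
      unfolding A_def[symmetric] by linarith
  qed
qed

text \<open>Summation by parts. For decreasing weights the total variation of \<open>g\<close> from
  m to M is g m - g M, so the partial sums of \<open>c\<close> contribute at most \<open>K\<close>
  times this, and the boundary term at M at most K times g M.\<close>

lemma abel_bound:
  fixes c g :: "nat \<Rightarrow> real"
  assumes K: "\<And>n. n \<ge> m \<Longrightarrow> \<bar>\<Sum>k\<in>{m<..n}. c k\<bar> \<le> K"
    and dec: "\<And>n. n \<ge> m \<Longrightarrow> g (Suc n) \<le> g n" and nonneg: "\<And>n. n \<ge> m \<Longrightarrow> 0 \<le> g n"
    and "M \<ge> m"
  shows "\<bar>\<Sum>k\<in>{m<..M}. c k * g k\<bar> \<le> K * g m"
proof -
  define D where "D = (\<lambda>n. \<Sum>k\<in>{m<..n}. c k)"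
  have ins: "{m<..Suc n} = insert (Suc n) {m<..n}" if "n \<ge> m" for n using that by auto
  have "\<bar>(\<Sum>k\<in>{m<..M}. c k * g k) - D M * g M\<bar> \<le> K * (g m - g M)"
    using \<open>M \<ge> m\<close>
  proof (induction M rule: dec_induct)
    case base
    then show ?case by (simp add: D_def)
  next
    case (step n)
    have "(\<Sum>k\<in>{m<..Suc n}. c k * g k) - D (Suc n) * g (Suc n)
       = ((\<Sum>k\<in>{m<..n}. c k * g k) - D n * g n) + D n * (g n - g (Suc n))"
      using step by (simp add: D_def ins algebra_simps)
    moreover have "\<bar>D n * (g n - g (Suc n))\<bar> \<le> K * (g n - g (Suc n))"
      using K[of n] dec[of n] step by (simp add: abs_mult D_def mult_right_mono)
    ultimately show ?case using step.IH by (simp add: algebra_simps)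
  qed
  moreover have "\<bar>D M * g M\<bar> \<le> K * g M"
    using K[of M] nonneg[of M] \<open>M \<ge> m\<close> by (simp add: abs_mult D_def mult_right_mono)
  ultimately show ?thesis by (simp add: algebra_simps)
qed

lemma ln_diff_le_inverse: "k \<ge> 1 \<Longrightarrow> ln (real (Suc k)) - ln (real k) \<le> 1 / real k"
proof -
  assume "k \<ge> 1"
  then have "real (Suc k) = (1 + 1 / real k) * real k" by (simp add: field_simps)
  then have "ln (real (Suc k)) = ln (1 + 1 / real k) + ln (real k)"
    using \<open>k \<ge> 1\<close> by (metis divide_nonneg_nonneg ln_mult_pos add_pos_nonneg less_numeral_extra(1) of_nat_0_le_iff
        of_nat_0_less_iff less_le_trans zero_le_one)
  then have "ln (real (Suc k)) - ln (real k) = ln (1 + 1 / real k)" by simp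
  also have "\<dots> \<le> 1 / real k" by (rule ln_add_one_self_le_self) auto
  finally show ?thesis .
qed

text \<open>Mertens' theorem says that the partial sums of \<open>a - b\<close> are bounded, where b
  k = ln k - ln (k - 1) is the smooth model of ln p / p. Summation by parts against 1 / (ln k)^2
  transfers this to 1 / (p ln p), and the model becomes a Riemann sum for the integral of 1 / (t (ln
  t)^2).\<close>

lemma sum_prime_inverse_ln_nat:
  obtains K :: real where "K > 0"
    "\<And>m M. 2 \<le> m \<Longrightarrow> m \<le> M \<Longrightarrow>
      \<bar>(\<Sum>p\<in>primes_le M - primes_le m. 1 / (real p * ln (real p))) - (1 / ln (real m) - 1 / ln (real M))\<bar>
        \<le> K / (ln (real m))\<^sup>2"
proof -
  obtain K where K: "K > 0" "\<And>n. n \<ge> 1 \<Longrightarrow> \<bar>(\<Sum>p\<in>primes_le n. ln (real p) / real p) - ln (real n)\<bar> \<le> K"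
    using mertens_first by metis
  show ?thesis
  proof (rule that[of "2 * K + 1"])
    show "2 * K + 1 > 0" using K by simp
    fix m M :: nat assume mM: "2 \<le> m" "m \<le> M"
    define a where "a = (\<lambda>k::nat. if prime k then ln (real k) / real k else 0)"
    define b where "b = (\<lambda>k::nat. ln (real k) - ln (real (k - 1)))"
    define g where "g = (\<lambda>k::nat. 1 / (ln (real k))\<^sup>2)"
    have suma: "(\<Sum>k\<in>{m<..n}. a k * h k) = (\<Sum>p\<in>primes_le n - primes_le m. ln (real p) / real p * h p)" for n and h :: "nat \<Rightarrow> real"
      by (rule sum.mono_neutral_cong_right) (auto simp: a_def primes_le_def)
    have sumb: "(\<Sum>k\<in>{m<..n}. b k) = ln (real n) - ln (real m)" if "n \<ge> m" for n
      using that
    proof (induction n rule: dec_induct)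
      case (step n)
      have "{m<..Suc n} = insert (Suc n) {m<..n}" using step by auto
      then show ?case using step by (simp add: b_def)
    qed simp
    have "\<bar>\<Sum>k\<in>{m<..M}. (a k - b k) * g k\<bar> \<le> 2 * K * g m"
    proof (rule abel_bound)
      fix n assume n: "m \<le> n"
      have "(\<Sum>k\<in>{m<..n}. a k) = (\<Sum>p\<in>primes_le n. ln (real p) / real p) - (\<Sum>p\<in>primes_le m. ln (real p) / real p)"
        using suma[of "\<lambda>_. 1"] primes_le_mono[OF n] by (simp add: sum_diff)
      then show "\<bar>\<Sum>k\<in>{m<..n}. a k - b k\<bar> \<le> 2 * K"
        using K(2)[of n] K(2)[of m] n mM sumb[OF n] by (simp add: sum_subtractf)
      show "g (Suc n) \<le> g n" using n mM unfolding g_def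
        by (intro divide_left_mono power_mono) (auto intro!: mult_pos_pos)
      show "0 \<le> g n" by (simp add: g_def)
    qed (use mM in auto)
    moreover have "(\<Sum>k\<in>{m<..M}. (a k - b k) * g k) = (\<Sum>k\<in>{m<..M}. a k * g k) - (\<Sum>k\<in>{m<..M}. b k * g k)"
      by (simp add: algebra_simps sum_subtractf)
    moreover have "(\<Sum>k\<in>{m<..M}. a k * g k) = (\<Sum>p\<in>primes_le M - primes_le m. 1 / (real p * ln (real p)))"
      unfolding suma
    proof (rule sum.cong)
      fix p assume "p \<in> primes_le M - primes_le m"
      then have "p > 1" using prime_gt_1_nat by (auto simp: primes_le_def)
      then have "ln (real p) > 0" by simp
      then show "ln (real p) / real p * g p = 1 / (real p * ln (real p))"
        by (simp add: g_def power2_eq_square)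
    qed auto
    \<comment> \<open>Each term lies between two differences of 1 / ln. The lower one is shifted by
      one index, which is possible because the increments of ln decrease
      (\<open>conc\<close>).\<close>
    moreover have "(\<Sum>k\<in>{m<..n}. b k * g k) \<le> 1 / ln (real m) - 1 / ln (real n)
        \<and> (\<Sum>k\<in>{m<..n}. b k * g k) \<ge> 1 / ln (real (Suc m)) - 1 / ln (real (Suc n))" if "n \<ge> m" for n
      using that
    proof (induction n rule: dec_induct)
      case (step n)
      define u where "u = ln (real n)"
      define w where "w = ln (real (Suc n))"
      define z where "z = ln (real (Suc (Suc n)))"
      have pos: "0 < u" "u < w" "w < z" using step mM by (auto simp: u_def w_def z_def)
      have ins: "{m<..Suc n} = insert (Suc n) {m<..n}" using step by auto
      have conc: "z - w \<le> w - u"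
      proof -
        have "real (Suc (Suc n)) * real n \<le> real (Suc n) * real (Suc n)" by (simp add: algebra_simps)
        then have "ln (real (Suc (Suc n)) * real n) \<le> ln (real (Suc n) * real (Suc n))"
          using step mM by (intro ln_mono) auto
        then show ?thesis using step mM by (simp add: ln_mult u_def w_def z_def)
      qed
      have bg: "b (Suc n) * g (Suc n) = (w - u) / w\<^sup>2" by (simp add: b_def g_def u_def w_def)
      have "(w - u) / w\<^sup>2 \<le> (w - u) / (u * w)"
        using pos by (intro divide_left_mono) (auto simp: power2_eq_square)
      also have "\<dots> = 1 / u - 1 / w" using pos by (simp add: field_simps)
      finally have 1: "(w - u) / w\<^sup>2 \<le> 1 / u - 1 / w" .
      have "1 / w - 1 / z = (z - w) / (w * z)" using pos by (simp add: field_simps)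
      also have "\<dots> \<le> (z - w) / w\<^sup>2"
        using pos by (intro divide_left_mono) (auto simp: power2_eq_square)
      also have "\<dots> \<le> (w - u) / w\<^sup>2" using conc by (intro divide_right_mono) auto
      finally have 2: "1 / w - 1 / z \<le> (w - u) / w\<^sup>2" .
      show ?case using step.IH 1 2 unfolding ins by (simp add: bg u_def w_def z_def)
    qed simp
    moreover have "1 / ln (real m) - 1 / ln (real (Suc m)) \<le> 1 / (ln (real m))\<^sup>2"
    proof -
      define u where "u = ln (real m)"
      define w where "w = ln (real (Suc m))"
      have pos: "0 < u" "u < w" using mM by (auto simp: u_def w_def)
      have wu: "w - u \<le> 1"
      proof -
        have "1 / real m \<le> 1" using mM by simp
        then show ?thesis using ln_diff_le_inverse[of m] mM unfolding u_def w_def by linarith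
      qed
      have "1 / u - 1 / w = (w - u) / (u * w)" using pos by (simp add: field_simps)
      also have "\<dots> \<le> 1 / (u * w)" using pos wu by (intro divide_right_mono) auto
      also have "\<dots> \<le> 1 / u\<^sup>2" using pos by (intro divide_left_mono) (auto simp: power2_eq_square)
      finally show ?thesis by (simp add: u_def w_def)
    qed
    moreover have "1 / ln (real (Suc M)) \<le> 1 / ln (real M)"
      using mM by (intro divide_left_mono) auto
    ultimately show "\<bar>(\<Sum>p\<in>primes_le M - primes_le m. 1 / (real p * ln (real p))) - (1 / ln (real m) - 1 / ln (real M))\<bar>
        \<le> (2 * K + 1) / (ln (real m))\<^sup>2"
      using mM unfolding g_def add_divide_distrib by (simp add: abs_le_iff) (smt (verit, best))
  qed
qed

text \<open>Passage to real endpoints. With m the integer part of Y one has Y <= m^2, so ln m >= ln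
  Y / 2, and rounding costs O(1 / (ln Y)^2), the size of the error already present.\<close>

lemma sum_prime_inverse_ln:
  obtains K :: real where "K > 0"
    "\<And>Y M. 2 \<le> Y \<Longrightarrow> (\<Sum>p\<in>{p\<in>primes_le M. Y < real p}. 1 / (real p * ln (real p))) \<le> 1 / ln Y + K / (ln Y)\<^sup>2"
    "\<And>Y Z. 2 \<le> Y \<Longrightarrow> Y \<le> Z \<Longrightarrow>
      1 / ln Y - 1 / ln Z - K / (ln Y)\<^sup>2 \<le> (\<Sum>p\<in>{p. prime p \<and> Y < real p \<and> real p \<le> Z}. 1 / (real p * ln (real p)))"
proof -
  obtain K where K: "K > 0" "\<And>m M. 2 \<le> m \<Longrightarrow> m \<le> M \<Longrightarrow>
      \<bar>(\<Sum>p\<in>primes_le M - primes_le m. 1 / (real p * ln (real p))) - (1 / ln (real m) - 1 / ln (real M))\<bar>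
        \<le> K / (ln (real m))\<^sup>2"
    by (rule sum_prime_inverse_ln_nat) blast
  have half: "ln Y / 2 \<le> ln (nat \<lfloor>Y\<rfloor>)" "1 / ln (nat \<lfloor>Y\<rfloor>) \<le> 1 / ln Y + 2 / (ln Y)\<^sup>2"
    "K / (ln (nat \<lfloor>Y\<rfloor>))\<^sup>2 \<le> 4 * K / (ln Y)\<^sup>2" "1 / ln Y \<le> 1 / ln (nat \<lfloor>Y\<rfloor>)" "2 \<le> nat \<lfloor>Y\<rfloor>" if "2 \<le> Y" for Y :: real
  proof -
    define m where "m = nat \<lfloor>Y\<rfloor>"
    have m: "2 \<le> m" "real m \<le> Y" "Y < real m + 1"
      using that by (auto simp: m_def) linarith+
    then show "2 \<le> nat \<lfloor>Y\<rfloor>" by (simp add: m_def)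
    have pos: "0 < ln (real m)" "ln (real m) \<le> ln Y" using m by (auto intro!: ln_mono)
    have "Y \<le> real m ^ 2"
    proof -
      have "real m * 2 \<le> real m * real m" using m by (intro mult_left_mono) auto
      moreover have "Y \<le> real m * 2" using m by linarith
      ultimately show ?thesis by (simp add: power2_eq_square)
    qed
    then have "ln Y \<le> ln (real m ^ 2)" using that by (intro ln_mono) auto
    then have h: "ln Y / 2 \<le> ln (real m)" using m by (simp add: ln_realpow)
    then show "ln Y / 2 \<le> ln (nat \<lfloor>Y\<rfloor>)" by (simp add: m_def)
    have "ln Y \<le> ln (real (Suc m))" using m that by (intro ln_mono) auto
    moreover have "ln (real (Suc m)) - ln (real m) \<le> 1"

    proof -
      have "1 / real m \<le> 1" using m by simp
      then show ?thesis using ln_diff_le_inverse[of m] m by linarith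
    qed
    ultimately have d: "ln Y - ln (real m) \<le> 1" by linarith
    have lY: "ln Y > 0" using that by simp
    have "1 / ln (real m) - 1 / ln Y = (ln Y - ln (real m)) / (ln (real m) * ln Y)"
      using pos lY by (simp add: field_simps)
    also have "\<dots> \<le> 1 / (ln (real m) * ln Y)" using d pos lY by (intro divide_right_mono) auto
    also have "\<dots> \<le> 1 / (ln Y / 2 * ln Y)" using h pos lY by (intro divide_left_mono mult_right_mono) auto
    also have "\<dots> = 2 / (ln Y)\<^sup>2" by (simp add: power2_eq_square)
    finally show "1 / ln (nat \<lfloor>Y\<rfloor>) \<le> 1 / ln Y + 2 / (ln Y)\<^sup>2" by (simp add: m_def)
    have "K / (ln (real m))\<^sup>2 \<le> K / (ln Y / 2)\<^sup>2"
      using h pos lY K by (intro divide_left_mono power_mono) auto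
    then show "K / (ln (nat \<lfloor>Y\<rfloor>))\<^sup>2 \<le> 4 * K / (ln Y)\<^sup>2" by (simp add: m_def power_divide mult.commute)
    show "1 / ln Y \<le> 1 / ln (nat \<lfloor>Y\<rfloor>)" using pos lY unfolding m_def[symmetric] by (intro divide_left_mono) auto
  qed
  show ?thesis
  proof (rule that[of "4 * K + 2"])
    show "4 * K + 2 > 0" using K by simp
    fix Y :: real and M :: nat assume Y: "2 \<le> Y"
    have eq: "{p\<in>primes_le M. Y < real p} = primes_le M - primes_le (nat \<lfloor>Y\<rfloor>)"
      using Y by (auto simp: primes_le_def) linarith+
    show "(\<Sum>p\<in>{p\<in>primes_le M. Y < real p}. 1 / (real p * ln (real p))) \<le> 1 / ln Y + (4 * K + 2) / (ln Y)\<^sup>2"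
    proof (cases "nat \<lfloor>Y\<rfloor> \<le> M")
      case True
      have "1 / ln (real M) \<ge> 0" using True half(5)[OF Y] by simp
      then show ?thesis using K(2)[of "nat \<lfloor>Y\<rfloor>" M] True half[OF Y] unfolding eq add_divide_distrib
        by linarith
    next
      case False
      then have e: "primes_le M - primes_le (nat \<lfloor>Y\<rfloor>) = {}" using primes_le_mono[of M "nat \<lfloor>Y\<rfloor>"] by auto
      have "0 \<le> 1 / ln Y + (4 * K + 2) / (ln Y)\<^sup>2" using Y K by simp
      then show ?thesis unfolding eq e by simp
    qed
  next
    fix Y Z :: real assume Y: "2 \<le> Y" "Y \<le> Z"
    have eq: "{p. prime p \<and> Y < real p \<and> real p \<le> Z} = primes_le (nat \<lfloor>Z\<rfloor>) - primes_le (nat \<lfloor>Y\<rfloor>)"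
      using Y by (auto simp: primes_le_def le_nat_iff le_floor_iff)
    have "2 / (ln Z)\<^sup>2 \<le> 2 / (ln Y)\<^sup>2" using Y by (intro divide_left_mono power_mono) auto
    moreover have "nat \<lfloor>Y\<rfloor> \<le> nat \<lfloor>Z\<rfloor>" using Y by (intro nat_mono floor_mono)
    ultimately show "1 / ln Y - 1 / ln Z - (4 * K + 2) / (ln Y)\<^sup>2 \<le> (\<Sum>p\<in>{p. prime p \<and> Y < real p \<and> real p \<le> Z}. 1 / (real p * ln (real p)))"
      using K(2)[of "nat \<lfloor>Y\<rfloor>" "nat \<lfloor>Z\<rfloor>"] half[OF Y(1)] half[of Z] Y unfolding eq add_divide_distrib
      by linarith
  qed
qed

section \<open>Dirichlet series of kernel functions\<close>

lemma sum_prime_inverse_ln_bounded: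
  obtains T :: real where "T > 0" "\<And>N. (\<Sum>p\<in>primes_le N. 1 / (real p * ln (real p))) \<le> T"
proof -
  obtain K where K: "K > 0"
    "\<And>Y M. 2 \<le> Y \<Longrightarrow> (\<Sum>p\<in>{p\<in>primes_le M. Y < real p}. 1 / (real p * ln (real p))) \<le> 1 / ln Y + K / (ln Y)\<^sup>2"
    by (rule sum_prime_inverse_ln) blast
  have pos: "0 \<le> 1 / (real p * ln (real p))" for p :: nat by (cases "p = 0") auto
  show ?thesis
  proof (rule that[of "1 / (2 * ln 2) + (1 / ln 2 + K / (ln 2)\<^sup>2)"])
    show "1 / (2 * ln 2) + (1 / ln 2 + K / (ln 2)\<^sup>2) > 0" using K by (intro add_pos_pos) auto
    fix N
    have "(\<Sum>p\<in>primes_le N. 1 / (real p * ln (real p))) \<le>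
       (\<Sum>p\<in>{2} \<union> {p\<in>primes_le N. 2 < real p}. 1 / (real p * ln (real p)))"
    proof (rule sum_mono2)
      show "primes_le N \<subseteq> {2} \<union> {p \<in> primes_le N. 2 < real p}"
      proof
        fix p assume p: "p \<in> primes_le N"
        then have "p \<ge> 2" using prime_ge_2_nat primes_leD by blast
        then show "p \<in> {2} \<union> {p \<in> primes_le N. 2 < real p}" using p by (cases "p = 2") auto
      qed
    qed (auto simp: pos)
    also have "\<dots> = 1 / (2 * ln 2) + (\<Sum>p\<in>{p\<in>primes_le N. 2 < real p}. 1 / (real p * ln (real p)))"
      by (subst sum.union_disjoint) auto
    finally show "(\<Sum>p\<in>primes_le N. 1 / (real p * ln (real p))) \<le> 1 / (2 * ln 2) + (1 / ln 2 + K / (ln 2)\<^sup>2)"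
      using K(2)[of 2 N] by simp
  qed
qed

lemma ln_2_ge_half: "1 / 2 \<le> ln (2::real)"
  using ln_le_minus_one[of "1 / 2 :: real"] by (simp add: ln_div)

lemma powr_minus_1_ge: "p > 0 \<Longrightarrow> a * ln p \<le> p powr a - (1::real)"
proof -
  assume "p > 0"
  then have "p powr a = exp (a * ln p)" by (simp add: powr_def)
  moreover have "1 + a * ln p \<le> exp (a * ln p)" by (rule exp_ge_add_one_self)
  ultimately show ?thesis by linarith
qed

lemma prime_powr_gt_1: "prime (p::nat) \<Longrightarrow> a > 0 \<Longrightarrow> 1 < real p powr a"
  using prime_gt_1_nat[of p] by (intro gr_one_powr) auto

text \<open>One notation for the three series of the proof: \<open>c p = 1 / (p + 1)\<close> gives 1
  / \<psi>(n), \<open>c p = 1\<close> gives zeta, and \<open>error_coeff\<close> gives the sieve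
  errors. At n = 0 the value is 1, the empty product, but 0 powr s = 0 removes this term from every
  series.\<close>

definition kernel_coeff :: "(nat \<Rightarrow> real) \<Rightarrow> nat \<Rightarrow> real" where
  "kernel_coeff c n = (\<Prod>p\<in>prime_factors n. c p)"

definition dirichlet_term :: "(nat \<Rightarrow> real) \<Rightarrow> complex \<Rightarrow> nat \<Rightarrow> complex" where
  "dirichlet_term c s n = of_real (kernel_coeff c n) * of_nat n powr (- s)"

text \<open>The coefficient is the same at all powers p^k with k >= 1, so the factor is 1 plus c p
  times a geometric series in p^(-s).\<close>

lemma dirichlet_term_euler_factor:
  assumes p: "prime p" and s: "Re s > 0"
  shows "(\<lambda>k. dirichlet_term c s (p ^ k)) sums (1 + of_real (c p) / (of_nat p powr s - 1))"
    and "summable (\<lambda>k. norm (dirichlet_term c s (p ^ k)))"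
proof -
  define z where "z = (of_nat p :: complex) powr (- s)"
  have p0: "p > 0" "p > 1" using p prime_gt_1_nat by (auto simp: prime_gt_0_nat)
  have "norm z = real p powr (- Re s)" unfolding z_def by (simp add: norm_powr_real_powr)
  then have nz: "norm z < 1" using p0 s gr_one_powr[of "real p" "Re s"]
    by (simp add: powr_minus inverse_less_1_iff)
  have t: "dirichlet_term c s (p ^ k) = (if k = 0 then 1 else of_real (c p) * z ^ k)" for k
  proof (cases "k = 0")
    case False
    then have "prime_factors (p ^ k) = {p}" using p by (simp add: prime_factorization_prime_power set_mset_replicate_mset_subset)
    moreover have "of_nat (p ^ k) powr (- s) = z ^ k"
    proof (induction k)
      case (Suc k)
      have "(of_nat p * of_nat (p ^ k)) powr (- s) = (of_nat p powr (- s) :: complex) * of_nat (p ^ k) powr (- s)"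
        by (rule powr_times_real) auto
      then show ?case using Suc by (simp add: z_def)
    qed simp
    ultimately show ?thesis using False by (simp add: dirichlet_term_def kernel_coeff_def)
  qed (simp add: dirichlet_term_def kernel_coeff_def)
  have g: "(\<lambda>k. z ^ k) sums (1 / (1 - z))" by (rule geometric_sums[OF nz])
  have "(\<lambda>k. z * z ^ k) sums (z * (1 / (1 - z)))" by (rule sums_mult[OF g])
  then have "(\<lambda>k. of_real (c p) * z ^ Suc k) sums (of_real (c p) * (z / (1 - z)))"
    using sums_mult[of "\<lambda>k. z * z ^ k" "z * (1 / (1 - z))" "of_real (c p)"] by simp
  then have "(\<lambda>k. dirichlet_term c s (p ^ Suc k)) sums (of_real (c p) * (z / (1 - z)))"
    by (subst t) auto
  then have "(\<lambda>k. dirichlet_term c s (p ^ k)) sums (of_real (c p) * (z / (1 - z)) + dirichlet_term c s (p ^ 0))"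
    by (subst (asm) sums_Suc_iff) simp
  moreover have "z / (1 - z) = 1 / (of_nat p powr s - 1)"
  proof -
    have "(of_nat p :: complex) powr s \<noteq> 0" using p0 by simp
    moreover have zi: "z = 1 / of_nat p powr s" by (simp add: z_def powr_minus field_simps)
    moreover have "of_nat p powr s \<noteq> (1::complex)" using nz zi by auto
    moreover have "z \<noteq> 1" using nz by auto
    ultimately show ?thesis by (simp add: field_simps)
  qed
  ultimately show "(\<lambda>k. dirichlet_term c s (p ^ k)) sums (1 + of_real (c p) / (of_nat p powr s - 1))"
    using t[of 0] by (simp add: add.commute)
  have "summable (\<lambda>k. \<bar>c p\<bar> * norm z ^ k)" using nz by (intro summable_mult summable_geometric) auto
  then have "summable (\<lambda>k. \<bar>c p\<bar> * norm z ^ Suc k)" by (subst summable_Suc_iff)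
  then have "summable (\<lambda>k. norm (dirichlet_term c s (p ^ Suc k)))"
    unfolding t by (simp add: norm_mult norm_power)
  then show "summable (\<lambda>k. norm (dirichlet_term c s (p ^ k)))" by (subst (asm) summable_Suc_iff)
qed

lemma kernel_coeff_mult: "coprime m n \<Longrightarrow> m > 0 \<Longrightarrow> n > 0 \<Longrightarrow> kernel_coeff c (m * n) = kernel_coeff c m * kernel_coeff c n"
proof -
  assume a: "coprime m n" "m > 0" "n > 0"
  have "prime_factors (m * n) = prime_factors m \<union> prime_factors n"
    using a by (simp add: prime_factorization_mult)
  moreover have "prime_factors m \<inter> prime_factors n = {}"
    using a by (auto simp: in_prime_factors_iff) (metis coprime_common_divisor not_prime_unit)
  ultimately show ?thesis unfolding kernel_coeff_def by (simp add: prod.union_disjoint)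
qed

lemma norm_dirichlet_term:
  assumes "\<And>p. prime p \<Longrightarrow> c p \<ge> 0"
  shows "norm (dirichlet_term c s n) = kernel_coeff c n * real n powr (- Re s)"
proof -
  have "kernel_coeff c n \<ge> 0" unfolding kernel_coeff_def using assms by (intro prod_nonneg) (auto simp: in_prime_factors_iff)
  then show ?thesis unfolding dirichlet_term_def by (simp add: norm_mult norm_powr_real_powr)
qed

lemma dirichlet_term_of_real: "dirichlet_term c (of_real a) n = of_real (kernel_coeff c n * real n powr (- a))"
  unfolding dirichlet_term_def using powr_of_real[of "real n" "-a"] by (simp add: powr_of_real)

lemma dirichlet_euler_product:
  fixes c :: "nat \<Rightarrow> real"
  assumes c: "\<And>p. prime p \<Longrightarrow> c p \<ge> 0" and s: "Re s > 0"
    and bound: "\<And>N. (\<Prod>p\<in>primes_le N. 1 + c p / (real p powr Re s - 1)) \<le> C"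
  shows "summable (\<lambda>n. norm (dirichlet_term c s n))" and "(\<Sum>n. norm (dirichlet_term c s n)) \<le> C"
    and "(\<lambda>N. \<Prod>p\<in>primes_le N. 1 + of_real (c p) / (of_nat p powr s - 1)) \<longlonglongrightarrow> (\<Sum>n. dirichlet_term c s n)"
proof -
  have ef: "(\<Sum>k. dirichlet_term c s (p ^ k)) = 1 + of_real (c p) / (of_nat p powr s - 1)" if "prime p" for p
    using dirichlet_term_euler_factor[OF that s, of c] by (simp add: sums_iff)
  have efn: "(\<Sum>k. norm (dirichlet_term c s (p ^ k))) = 1 + c p / (real p powr Re s - 1)" if "prime p" for p
  proof -
    have "norm (dirichlet_term c s n) = Re (dirichlet_term c (of_real (Re s)) n)" for n
      using norm_dirichlet_term[of c s n, OF c] by (simp add: dirichlet_term_of_real)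
    moreover have "(\<lambda>k. Re (dirichlet_term c (of_real (Re s)) (p ^ k))) sums Re (1 + of_real (c p) / (of_nat p powr of_real (Re s) - 1))"
      using dirichlet_term_euler_factor(1)[OF that, of "of_real (Re s)" c] s by (intro sums_Re) auto
    moreover have "Re (1 + of_real (c p) / (of_nat p powr of_real (Re s) - 1)) = 1 + c p / (real p powr Re s - 1)"
    proof -
      have "of_nat p powr of_real (Re s) = (of_real (real p powr Re s) :: complex)"
        using powr_of_real[of "real p" "Re s"] by simp
      then have "1 + of_real (c p) / (of_nat p powr of_real (Re s) - 1) = (of_real (1 + c p / (real p powr Re s - 1)) :: complex)"
        by simp
      then show ?thesis by (simp only: Re_complex_of_real)
    qed
    ultimately show ?thesis by (simp add: sums_iff)
  qed
  have 0: "dirichlet_term c s 0 = 0" by (simp add: dirichlet_term_def)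
  have 1: "dirichlet_term c s 1 = 1" by (simp add: dirichlet_term_def kernel_coeff_def)
  have m: "dirichlet_term c s (m * n) = dirichlet_term c s m * dirichlet_term c s n" if "coprime m n" for m n
  proof (cases "m = 0 \<or> n = 0")
    case True
    then show ?thesis using 0 by auto
  next
    case False
    have "(of_nat m * of_nat n) powr (- s) = (of_nat m powr (- s) :: complex) * of_nat n powr (- s)"
      by (rule powr_times_real) auto
    then show ?thesis using False that by (simp add: dirichlet_term_def kernel_coeff_mult)
  qed
  have b: "(\<Prod>p\<in>primes_le N. \<Sum>k. norm (dirichlet_term c s (p ^ k))) \<le> C" for N
    using bound[of N] by (simp add: efn primes_leD cong: prod.cong)
  note E = euler_product[OF 0 1 m dirichlet_term_euler_factor(2)[OF _ s] b]
  show "summable (\<lambda>n. norm (dirichlet_term c s n))" "(\<Sum>n. norm (dirichlet_term c s n)) \<le> C" using E by auto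
  show "(\<lambda>N. \<Prod>p\<in>primes_le N. 1 + of_real (c p) / (of_nat p powr s - 1)) \<longlonglongrightarrow> (\<Sum>n. dirichlet_term c s n)"
    using E(3) by (simp add: ef primes_leD cong: prod.cong)
qed

lemma dirichlet_euler_product_real:
  fixes c :: "nat \<Rightarrow> real"
  assumes c: "\<And>p. prime p \<Longrightarrow> c p \<ge> 0" and a: "a > 0"
    and bound: "\<And>N. (\<Prod>p\<in>primes_le N. 1 + c p / (real p powr a - 1)) \<le> C"
  shows "summable (\<lambda>n. kernel_coeff c n * real n powr (- a))"
    and "(\<Sum>n. kernel_coeff c n * real n powr (- a)) \<le> C"
    and "(\<lambda>N. \<Prod>p\<in>primes_le N. 1 + c p / (real p powr a - 1)) \<longlonglongrightarrow> (\<Sum>n. kernel_coeff c n * real n powr (- a))"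
proof -
  note E = dirichlet_euler_product[of c "of_real a" C, OF c]
  have n: "norm (dirichlet_term c (of_real a) n) = kernel_coeff c n * real n powr (- a)" for n
    using norm_dirichlet_term[of c "of_real a" n, OF c] by simp
  show 1: "summable (\<lambda>n. kernel_coeff c n * real n powr (- a))"
    and "(\<Sum>n. kernel_coeff c n * real n powr (- a)) \<le> C"
    using E(1,2) a bound n by auto
  have "(\<lambda>N. \<Prod>p\<in>primes_le N. 1 + of_real (c p) / (of_nat p powr of_real a - 1)) \<longlonglongrightarrow>
      (\<Sum>n. dirichlet_term c (of_real a) n)"
    using E(3) a bound by auto
  moreover have "(\<Sum>n. dirichlet_term c (of_real a) n) = of_real (\<Sum>n. kernel_coeff c n * real n powr (- a))"
    unfolding dirichlet_term_of_real by (rule suminf_of_real[OF 1, symmetric])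
  moreover have "(\<Prod>p\<in>primes_le N. 1 + of_real (c p) / (of_nat p powr of_real a - 1)) =
      (of_real (\<Prod>p\<in>primes_le N. 1 + c p / (real p powr a - 1)) :: complex)" for N
    using powr_of_real[of _ a] by (simp add: powr_of_real[symmetric])
  ultimately show "(\<lambda>N. \<Prod>p\<in>primes_le N. 1 + c p / (real p powr a - 1)) \<longlonglongrightarrow> (\<Sum>n. kernel_coeff c n * real n powr (- a))"
    by (simp only: tendsto_of_real_iff)
qed

lemma prod_one_plus_le_exp:
  fixes f :: "'b \<Rightarrow> real"
  assumes "\<And>i. i \<in> A \<Longrightarrow> 0 \<le> f i"
  shows "(\<Prod>i\<in>A. 1 + f i) \<le> exp (\<Sum>i\<in>A. f i)"
proof (cases "finite A")
  case True
  have "(\<Prod>i\<in>A. 1 + f i) \<le> (\<Prod>i\<in>A. exp (f i))"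
    by (rule prod_mono) (use assms in \<open>auto intro: add_nonneg_nonneg\<close>)
  then show ?thesis using True by (simp add: exp_sum)
qed auto

definition euler_weight :: "nat \<Rightarrow> real \<Rightarrow> real" where
  "euler_weight p a = (1 / (real p + 1)) / (real p powr a - 1)"

definition euler_factor :: "nat \<Rightarrow> complex \<Rightarrow> complex" where
  "euler_factor p s = 1 + of_real (1 / (real p + 1)) / (of_nat p powr s - 1)"

definition psi_series :: "complex \<Rightarrow> complex" where
  "psi_series s = (\<Sum>n. dirichlet_term (\<lambda>p. 1 / (real p + 1)) s n)"

definition psi_series_real :: "real \<Rightarrow> real" where
  "psi_series_real a = (\<Sum>n. kernel_coeff (\<lambda>p. 1 / (real p + 1)) n * real n powr (- a))"

lemma kernel_coeff_psi: "kernel_coeff (\<lambda>p. 1 / (real p + 1)) n = 1 / real (psi_fn n)"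
  unfolding kernel_coeff_def psi_fn_def by (simp add: prod_dividef add.commute)

text \<open>From p^a - 1 >= a ln p. This is why the sums of 1 / (p ln p) govern the proof: their
  convergence gives that of \<Phi> for every a > 0, and their tails give its growth as a tends to
  0.\<close>

lemma euler_weight_bounds:
  assumes "prime p" "a > 0"
  shows "0 < euler_weight p a" "euler_weight p a \<le> 1 / a * (1 / (real p * ln (real p)))"
proof -
  have p: "real p > 1" using prime_gt_1_nat[OF assms(1)] by simp
  have P: "0 < real p powr a - 1" using prime_powr_gt_1[OF assms] by simp
  show "0 < euler_weight p a" unfolding euler_weight_def using P p by simp
  have "a * ln (real p) > 0" using p assms by simp
  moreover have "a * ln (real p) \<le> real p powr a - 1" using powr_minus_1_ge[of "real p" a] p by simp
  ultimately have "real p * (a * ln (real p)) \<le> (real p + 1) * (real p powr a - 1)"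
    using p by (intro mult_mono) auto
  then have "1 / ((real p + 1) * (real p powr a - 1)) \<le> 1 / (real p * (a * ln (real p)))"
    using \<open>a * ln (real p) > 0\<close> p P by (intro divide_left_mono) auto
  then show "euler_weight p a \<le> 1 / a * (1 / (real p * ln (real p)))"
    unfolding euler_weight_def by (simp add: mult_ac)
qed

lemma euler_weight_antimono:
  assumes "prime p" "0 < a" "a \<le> b"
  shows "euler_weight p b \<le> euler_weight p a"
proof -
  have p: "real p > 1" using prime_gt_1_nat[OF assms(1)] by simp
  have "real p powr a \<le> real p powr b" using p assms by (intro powr_mono) auto
  then show ?thesis unfolding euler_weight_def
    using prime_powr_gt_1[OF assms(1,2)] prime_powr_gt_1[of p b] assms p by (intro divide_left_mono mult_pos_pos) auto
qed

lemma euler_weight_sum_bounded: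
  obtains T :: real where "T > 0" "\<And>N a. a > 0 \<Longrightarrow> (\<Sum>p\<in>primes_le N. euler_weight p a) \<le> T / a"
    "\<And>N. (\<Sum>p\<in>primes_le N. 1 / (real p * ln (real p))) \<le> T"
proof -
  obtain T where T: "T > 0" "\<And>N. (\<Sum>p\<in>primes_le N. 1 / (real p * ln (real p))) \<le> T"
    using sum_prime_inverse_ln_bounded by blast
  show ?thesis
  proof (rule that[of T])
    fix N and a :: real assume a: "a > 0"
    have "(\<Sum>p\<in>primes_le N. euler_weight p a) \<le> (\<Sum>p\<in>primes_le N. 1 / a * (1 / (real p * ln (real p))))"
      by (intro sum_mono euler_weight_bounds) (use a in \<open>auto simp: primes_leD\<close>)
    also have "\<dots> = 1 / a * (\<Sum>p\<in>primes_le N. 1 / (real p * ln (real p)))" by (simp only: sum_distrib_left)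
    also have "\<dots> \<le> 1 / a * T" using T(2)[of N] a by (intro mult_left_mono) auto
    finally show "(\<Sum>p\<in>primes_le N. euler_weight p a) \<le> T / a" by simp
  qed (use T in auto)
qed

lemma psi_euler_prod_bounded:
  assumes "a > 0"
  obtains C where "\<And>N. (\<Prod>p\<in>primes_le N. 1 + (1 / (real p + 1)) / (real p powr a - 1)) \<le> C"
proof -
  obtain T :: real where T: "T > 0" "\<And>N a. a > 0 \<Longrightarrow> (\<Sum>p\<in>primes_le N. euler_weight p a) \<le> T / a"
    by (rule euler_weight_sum_bounded) blast
  have "(\<Prod>p\<in>primes_le N. 1 + euler_weight p a) \<le> exp (T / a)" for N
  proof -
    have "(\<Prod>p\<in>primes_le N. 1 + euler_weight p a) \<le> exp (\<Sum>p\<in>primes_le N. euler_weight p a)"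
      by (rule prod_one_plus_le_exp) (use assms in \<open>auto intro!: less_imp_le euler_weight_bounds simp: primes_leD\<close>)
    also have "\<dots> \<le> exp (T / a)" using T(2)[OF assms] by simp
    finally show ?thesis .
  qed
  then show ?thesis using that unfolding euler_weight_def by blast
qed

lemma psi_series_props:
  assumes "Re s > 0"
  shows "summable (\<lambda>n. norm (dirichlet_term (\<lambda>p. 1 / (real p + 1)) s n))"
    and "(\<lambda>N. \<Prod>p\<in>primes_le N. euler_factor p s) \<longlonglongrightarrow> psi_series s"
proof -
  obtain C where "\<And>N. (\<Prod>p\<in>primes_le N. 1 + (1 / (real p + 1)) / (real p powr Re s - 1)) \<le> C"
    using psi_euler_prod_bounded[OF assms] by blast
  from dirichlet_euler_product[OF _ assms this]
  show "summable (\<lambda>n. norm (dirichlet_term (\<lambda>p. 1 / (real p + 1)) s n))"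
    "(\<lambda>N. \<Prod>p\<in>primes_le N. euler_factor p s) \<longlonglongrightarrow> psi_series s"
    by (simp_all add: euler_factor_def psi_series_def)
qed

lemma psi_series_real_props:
  assumes "a > 0"
  shows "summable (\<lambda>n. kernel_coeff (\<lambda>p. 1 / (real p + 1)) n * real n powr (- a))"
    and "(\<lambda>N. \<Prod>p\<in>primes_le N. 1 + euler_weight p a) \<longlonglongrightarrow> psi_series_real a"
    and "(\<Prod>p\<in>primes_le N. 1 + euler_weight p a) \<le> psi_series_real a"
    and "1 \<le> psi_series_real a"
proof -
  obtain C where C: "\<And>N. (\<Prod>p\<in>primes_le N. 1 + (1 / (real p + 1)) / (real p powr a - 1)) \<le> C"
    using psi_euler_prod_bounded[OF assms] by blast
  from dirichlet_euler_product_real[OF _ assms C]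
  show "summable (\<lambda>n. kernel_coeff (\<lambda>p. 1 / (real p + 1)) n * real n powr (- a))"
    and L: "(\<lambda>N. \<Prod>p\<in>primes_le N. 1 + euler_weight p a) \<longlonglongrightarrow> psi_series_real a"
    by (simp_all add: euler_weight_def psi_series_real_def)
  have inc: "incseq (\<lambda>N. \<Prod>p\<in>primes_le N. 1 + euler_weight p a)"
  proof (rule incseq_SucI)
    fix N
    have "0 \<le> (\<Prod>p\<in>primes_le N. 1 + euler_weight p a)"
      by (intro prod_nonneg add_nonneg_nonneg less_imp_le[OF euler_weight_bounds(1)])
         (use assms in \<open>auto simp: primes_leD\<close>)
    moreover have "0 < euler_weight (Suc N) a" if "prime (Suc N)" using that assms by (rule euler_weight_bounds)
    moreover have "Suc N \<notin> primes_le N" by (auto simp: primes_le_def)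
    ultimately show "(\<Prod>p\<in>primes_le N. 1 + euler_weight p a) \<le> (\<Prod>p\<in>primes_le (Suc N). 1 + euler_weight p a)"
      by (auto simp: primes_le_Suc distrib_right)
  qed
  show le: "(\<Prod>p\<in>primes_le N. 1 + euler_weight p a) \<le> psi_series_real a" for N
    by (rule incseq_le[OF inc L])
  show "1 \<le> psi_series_real a" using le[of 0] by simp
qed

text \<open>Split at Y = a^(-1/2). There are at most Y primes below, each contributing at most ln (1
  + 1 / a). Above, the weights sum to at most 1 / a times a tail of size 1 / ln Y = 2 / ln (1 / a).
  The gain of a logarithm over \<open>euler_weight_sum_bounded\<close> fixes the width of the saddle
  point.\<close>

lemma ln_psi_series_bound:
  obtains C :: real where "C > 0"
    "\<forall>\<^sub>F a in at_right 0. \<forall>N. (\<Sum>p\<in>primes_le N. ln (1 + euler_weight p a)) \<le> C / (a * ln (1 / a))"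
proof -
  obtain K where K: "K > 0"
    "\<And>Y M. 2 \<le> Y \<Longrightarrow> (\<Sum>p\<in>{p\<in>primes_le M. Y < real p}. 1 / (real p * ln (real p))) \<le> 1 / ln Y + K / (ln Y)\<^sup>2"
    by (rule sum_prime_inverse_ln) blast
  have e1: "\<forall>\<^sub>F a in at_right (0::real). sqrt (1 / a) * ln (1 + 1 / a) \<le> 1 / (a * ln (1 / a))" by real_asymp
  have e2: "\<forall>\<^sub>F a in at_right (0::real). sqrt (1 / a) \<ge> 2" by real_asymp
  have e3: "\<forall>\<^sub>F a in at_right (0::real). K / (ln (sqrt (1 / a)))\<^sup>2 \<le> 1 / ln (1 / a)" by real_asymp
  have e4: "\<forall>\<^sub>F a in at_right (0::real). a \<in> {0<..<1}"
    by (rule eventually_at_right_real) simp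
  show ?thesis
  proof (rule that[of 4])
    show "\<forall>\<^sub>F a in at_right 0. \<forall>N. (\<Sum>p\<in>primes_le N. ln (1 + euler_weight p a)) \<le> 4 / (a * ln (1 / a))"
      using e1 e2 e3 e4
    proof (eventually_elim, intro allI)
      case (elim a)
      fix N
      define Y where "Y = sqrt (1 / a)"
      have a: "0 < a" "a < 1" using elim by auto
      have lY: "ln Y = ln (1 / a) / 2" unfolding Y_def using a by (simp add: ln_sqrt)
      have L: "ln (1 / a) > 0" using a by simp
      have "(\<Sum>p\<in>primes_le N. ln (1 + euler_weight p a)) =
          (\<Sum>p\<in>{p\<in>primes_le N. real p \<le> Y}. ln (1 + euler_weight p a)) + (\<Sum>p\<in>{p\<in>primes_le N. Y < real p}. ln (1 + euler_weight p a))"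
        by (subst sum.union_disjoint[symmetric]) (auto intro!: sum.cong)
      also have "(\<Sum>p\<in>{p\<in>primes_le N. real p \<le> Y}. ln (1 + euler_weight p a)) \<le> (\<Sum>p\<in>{p\<in>primes_le N. real p \<le> Y}. ln (1 + 1 / a))"
      proof (rule sum_mono)
        fix p assume "p \<in> {p\<in>primes_le N. real p \<le> Y}"
        then have p: "prime p" by (auto simp: primes_le_def)
        \<comment> \<open>By p >= 2 and ln 2 >= 1/2; hence no weight exceeds 1 / a.\<close>
        have "1 \<le> real p * ln (real p)"
        proof -
          have p2: "real p \<ge> 2" using prime_ge_2_nat[OF p] by simp
          have "1 / 2 \<le> ln (2::real)" by (rule ln_2_ge_half)
          also have "ln (2::real) \<le> ln (real p)" using p2 by (intro ln_mono) auto
          finally have "2 * (1 / 2) \<le> real p * ln (real p)" using p2 by (intro mult_mono) auto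
          then show ?thesis by simp
        qed
        then have "1 / a * (1 / (real p * ln (real p))) \<le> 1 / a * 1"
          using a by (intro mult_left_mono) (auto simp: divide_le_eq_1)
        then have "euler_weight p a \<le> 1 / a" using euler_weight_bounds(2)[OF p a(1)] by linarith
        then show "ln (1 + euler_weight p a) \<le> ln (1 + 1 / a)"
          using euler_weight_bounds(1)[OF p a(1)] a by (intro ln_mono) auto
      qed
      also have "\<dots> \<le> Y * ln (1 + 1 / a)"
      proof -
        have "{p\<in>primes_le N. real p \<le> Y} \<subseteq> {1..nat \<lfloor>Y\<rfloor>}"
          using prime_ge_1_nat by (auto simp: primes_le_def le_nat_iff le_floor_iff)
        then have "card {p\<in>primes_le N. real p \<le> Y} \<le> nat \<lfloor>Y\<rfloor>" using card_mono[of "{1..nat \<lfloor>Y\<rfloor>}"] by fastforce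
        moreover have "real (nat \<lfloor>Y\<rfloor>) \<le> Y" using elim by (simp add: Y_def)
        ultimately have "real (card {p\<in>primes_le N. real p \<le> Y}) \<le> Y" by linarith
        then show ?thesis using a by (simp add: mult_right_mono)
      qed
      also have "(\<Sum>p\<in>{p\<in>primes_le N. Y < real p}. ln (1 + euler_weight p a)) \<le> (\<Sum>p\<in>{p\<in>primes_le N. Y < real p}. 1 / a * (1 / (real p * ln (real p))))"
      proof (rule sum_mono)
        fix p assume "p \<in> {p\<in>primes_le N. Y < real p}"
        then have p: "prime p" by (auto simp: primes_le_def)
        show "ln (1 + euler_weight p a) \<le> 1 / a * (1 / (real p * ln (real p)))"
          using euler_weight_bounds[OF p a(1)] ln_add_one_self_le_self[of "euler_weight p a"] by linarith
      qed
      also have "\<dots> = 1 / a * (\<Sum>p\<in>{p\<in>primes_le N. Y < real p}. 1 / (real p * ln (real p)))" by (simp only: sum_distrib_left)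
      also have "\<dots> \<le> 1 / a * (1 / ln Y + K / (ln Y)\<^sup>2)"
        using K(2)[of Y N] elim a by (intro mult_left_mono) (auto simp: Y_def)
      also have "\<dots> \<le> 1 / a * (3 / ln (1 / a))"
        using elim(3) a by (intro mult_left_mono) (auto simp: Y_def[symmetric] lY)
      also have "Y * ln (1 + 1 / a) + 1 / a * (3 / ln (1 / a)) \<le> 4 / (a * ln (1 / a))"
        using elim(1) unfolding Y_def[symmetric] by simp
      finally show "(\<Sum>p\<in>primes_le N. ln (1 + euler_weight p a)) \<le> 4 / (a * ln (1 / a))" by simp
    qed
  qed simp
qed

section \<open>The saddle-point equation\<close>

text \<open>Links the unordered sum over all primes in the definition of \<open>alpha_fn\<close>
  with the partial sums over \<open>primes_le N\<close> that the estimates concern.\<close>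

lemma prime_infsum:
  fixes h :: "nat \<Rightarrow> real"
  assumes nn: "\<And>p. prime p \<Longrightarrow> 0 \<le> h p" and bd: "\<And>N. sum h (primes_le N) \<le> T"
  shows "h summable_on {p. prime p}" and "(\<lambda>N. sum h (primes_le N)) \<longlonglongrightarrow> infsum h {p. prime p}"
    and "infsum h {p. prime p} \<le> T"
proof -
  define H where "H = (\<lambda>n. if prime n then h n else 0)"
  have sH: "sum H {..N} = sum h (primes_le N)" for N
    unfolding H_def primes_le_def by (rule sum.mono_neutral_cong_right) auto
  have H0: "0 \<le> H n" for n using nn by (auto simp: H_def)
  have bH: "sum H {..<N} \<le> T" for N
  proof -
    have "sum H {..<N} \<le> sum H {..N}" using H0 by (intro sum_mono2) auto
    then show ?thesis using sH bd[of N] by simp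
  qed
  have summ: "summable H" by (rule summableI_nonneg_bounded[OF H0 bH])
  have "(H has_sum suminf H) UNIV" using summ H0 by (intro norm_summable_imp_has_sum) auto
  then have hs: "(h has_sum suminf H) {p. prime p}"
    by (rule has_sum_cong_neutral[THEN iffD1, rotated -1]) (auto simp: H_def)
  show "h summable_on {p. prime p}" using hs by (rule has_sum_imp_summable)
  have eq: "infsum h {p. prime p} = suminf H" using hs by (rule infsumI)
  show "(\<lambda>N. sum h (primes_le N)) \<longlonglongrightarrow> infsum h {p. prime p}"
    unfolding eq sH[symmetric] using summable_LIMSEQ'[OF summ] by simp
  show "infsum h {p. prime p} \<le> T" unfolding eq by (rule suminf_le_const[OF summ bH])
qed

text \<open>This is x <= sinh x, multiplied by 2 e^x. With x = h / 2 it yields e^h / (e^h - 1)^2 <=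
  1 / h^2, the sharp upper bound behind \<open>alpha_term_bounds\<close>.\<close>

lemma sinh_type_bound:
  fixes x :: real assumes "x \<ge> 0" shows "2 * x * exp x \<le> exp (2 * x) - 1"
proof -
  have "(\<lambda>x. exp (2 * x) - 1 - 2 * x * exp x) 0 \<le> (\<lambda>x. exp (2 * x) - 1 - 2 * x * exp x) x"
  proof (rule DERIV_nonneg_imp_nondecreasing[OF assms])
    fix y :: real assume "0 \<le> y" "y \<le> x"
    have "((\<lambda>x. exp (2 * x) - 1 - 2 * x * exp x) has_real_derivative (2 * exp y * (exp y - 1 - y))) (at y)"

    proof -
      have "((\<lambda>x. exp (2 * x) - 1 - 2 * x * exp x) has_real_derivative (2 * exp (2 * y) - (2 * exp y + 2 * y * exp y))) (at y)"
        by (auto intro!: derivative_eq_intros)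
      moreover have "2 * exp (2 * y) - (2 * exp y + 2 * y * exp y) = 2 * exp y * (exp y - 1 - y)"
        unfolding exp_double power2_eq_square by (simp add: algebra_simps)
      ultimately show ?thesis by simp
    qed
    moreover have "0 \<le> 2 * exp y * (exp y - 1 - y)"
    proof -
      have "1 + y \<le> exp y" by (rule exp_ge_add_one_self)
      then have X: "0 \<le> exp y - 1 - y" by linarith
      show ?thesis by (rule mult_nonneg_nonneg[OF _ X]) simp
    qed
    ultimately show "\<exists>z. ((\<lambda>x. exp (2 * x) - 1 - 2 * x * exp x) has_real_derivative z) (at y) \<and> 0 \<le> z" by blast
  qed
  then show ?thesis by simp
qed

lemma alpha_term_alt:
  assumes "prime p" "a > 0"
  defines "u \<equiv> real p powr a - 1"
  shows "alpha_term a p = ln (real p) * (1 + 1 / u) / (1 + (real p + 1) * u)" "u > 0"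
proof -
  show u: "u > 0" unfolding u_def using prime_powr_gt_1[OF assms(1,2)] by simp
  have P: "real p powr a = 1 + u" by (simp add: u_def)
  show "alpha_term a p = ln (real p) * (1 + 1 / u) / (1 + (real p + 1) * u)"
    unfolding alpha_term_def P using u by (simp add: field_simps)
qed

lemma alpha_term_strict_antimono:
  assumes "prime p" "0 < a" "a < b"
  shows "alpha_term b p < alpha_term a p"
proof -
  define u where "u = real p powr a - 1"
  define w where "w = real p powr b - 1"
  have p: "real p > 1" using prime_gt_1_nat[OF assms(1)] by simp
  have u: "u > 0" "alpha_term a p = ln (real p) * (1 + 1 / u) / (1 + (real p + 1) * u)"
    using alpha_term_alt[OF assms(1,2)] by (auto simp: u_def)
  have w: "w > 0" "alpha_term b p = ln (real p) * (1 + 1 / w) / (1 + (real p + 1) * w)"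
    using alpha_term_alt[of p b] assms by (auto simp: w_def)
  have uw: "u < w" unfolding u_def w_def using p assms by simp
  have "ln (real p) * (1 + 1 / w) < ln (real p) * (1 + 1 / u)"
    using u w uw p by (intro mult_strict_left_mono add_strict_left_mono divide_strict_left_mono) auto
  moreover have "1 + (real p + 1) * u \<le> 1 + (real p + 1) * w"
    using p uw by (intro add_left_mono mult_left_mono) auto
  moreover have "0 < 1 + (real p + 1) * u" using u p by (simp add: add_pos_pos)
  moreover have "0 \<le> ln (real p) * (1 + 1 / w)" using p w by simp
  ultimately show ?thesis unfolding u(2) w(2) by (intro frac_less) auto
qed

text \<open>The second bound is the true size of the term when a ln p is small and a p ln p is
  large; the fourth is a matching lower bound whose first factor tends to 1 in that range. The third
  serves the primes below about 1 / a, where the second is too large.\<close>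

lemma alpha_term_bounds:
  assumes "prime p" "a > 0"
  shows "0 < alpha_term a p" "alpha_term a p \<le> 1 / a\<^sup>2 * (1 / (real p * ln (real p)))"
    "alpha_term a p \<le> ln (real p) + 1 / a"
    "exp (- 2 * (a * ln (real p))) / (1 + 1 / real p + 1 / (a * (real p * ln (real p)))) *
       (1 / a\<^sup>2 * (1 / (real p * ln (real p)))) \<le> alpha_term a p"
proof -
  define h where "h = a * ln (real p)"
  define u where "u = real p powr a - 1"
  have p: "real p > 1" using prime_gt_1_nat[OF assms(1)] by simp
  have lp: "ln (real p) > 0" using p by simp
  have h: "h > 0" using lp assms by (simp add: h_def)
  have ue: "u = exp h - 1" using p by (simp add: u_def h_def powr_def)
  have u: "u > 0" "alpha_term a p = ln (real p) * (1 + 1 / u) / (1 + (real p + 1) * u)"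
    using alpha_term_alt[OF assms] by (auto simp: u_def)
  have u': "alpha_term a p = ln (real p) * exp h / (u * (1 + (real p + 1) * u))"

  proof -
    have "exp h / u = (1 + u) / u" by (simp add: ue)
    then have "1 + 1 / u = exp h / u" using u(1) by (simp add: add_divide_distrib)
    then show ?thesis unfolding u(2) by simp
  qed
  have den: "0 < 1 + (real p + 1) * u" using u p by (simp add: add_pos_pos)
  show "0 < alpha_term a p" unfolding u'  using u den lp by simp
  have uh: "h \<le> u" unfolding ue using exp_ge_add_one_self[of h] by linarith
  have "h\<^sup>2 * exp h \<le> u\<^sup>2"
  proof -
    have "h * exp (h / 2) \<le> u" using sinh_type_bound[of "h / 2"] h by (simp add: ue)
    then have "(h * exp (h / 2))\<^sup>2 \<le> u\<^sup>2" using h by (intro power_mono) auto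
    moreover have "(exp (h / 2))\<^sup>2 = exp h" by (simp add: power2_eq_square exp_add[symmetric])
    ultimately show ?thesis by (simp add: power_mult_distrib)
  qed
  then have q: "exp h / u\<^sup>2 \<le> 1 / h\<^sup>2" using u h by (simp add: field_simps)
  have "alpha_term a p \<le> ln (real p) * exp h / (u * (real p * u))"

  proof -
    have "real p * u \<le> 1 + (real p + 1) * u" using u(1) by (simp add: distrib_right)
    then have "u * (real p * u) \<le> u * (1 + (real p + 1) * u)" using u(1) by (intro mult_left_mono) auto
    moreover have "0 < u * (real p * u)" "0 < u * (1 + (real p + 1) * u)"
      using u(1) p den by (auto intro!: mult_pos_pos)
    ultimately show ?thesis unfolding u' using lp u(1) p den by (intro divide_left_mono mult_pos_pos) auto
  qed
  also have "\<dots> = ln (real p) / real p * (exp h / u\<^sup>2)" by (simp add: power2_eq_square mult_ac)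
  also have "\<dots> \<le> ln (real p) / real p * (1 / h\<^sup>2)" using q lp by (intro mult_left_mono) auto
  also have "\<dots> = 1 / a\<^sup>2 * (1 / (real p * ln (real p)))"
    using lp assms p unfolding h_def by (simp add: power2_eq_square field_simps)
  finally show "alpha_term a p \<le> 1 / a\<^sup>2 * (1 / (real p * ln (real p)))" .
  have "alpha_term a p \<le> ln (real p) * (1 + 1 / u) / 1"
    unfolding u using u lp p den by (intro divide_left_mono) auto
  also have "\<dots> \<le> ln (real p) * (1 + 1 / h)"
    using u h uh lp by (simp add: frac_le)
  also have "\<dots> = ln (real p) + 1 / a" using lp by (simp add: h_def field_simps)
  finally show "alpha_term a p \<le> ln (real p) + 1 / a" .
  define \<kappa> where "\<kappa> = 1 + 1 / real p + 1 / (real p * h)"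
  have kp: "\<kappa> > 0" using p h by (simp add: \<kappa>_def add_pos_pos)
  have e1: "1 \<le> exp h" using h by simp
  have uhe: "u \<le> h * exp h"
  proof -
    have "1 - h \<le> exp (- h)" using exp_ge_add_one_self[of "- h"] by simp
    then have "(1 - h) * exp h \<le> exp (- h) * exp h" by (intro mult_right_mono) auto
    then show ?thesis by (simp add: ue exp_minus algebra_simps)
  qed
  have "1 + (real p + 1) * u \<le> exp h * (real p * h) * \<kappa>"
  proof -
    have "1 + (real p + 1) * u \<le> exp h * 1 + (real p + 1) * (h * exp h)"
      using e1 uhe p by (intro add_mono mult_left_mono) auto
    also have "\<dots> = exp h * (real p * h) * \<kappa>" using p h by (simp add: \<kappa>_def field_simps)
    finally show ?thesis .
  qed
  then have "u * (1 + (real p + 1) * u) \<le> (h * exp h) * (exp h * (real p * h) * \<kappa>)"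
    using uhe u h den by (intro mult_mono) auto
  moreover have "ln (real p) * 1 \<le> ln (real p) * exp h" using e1 lp by (intro mult_left_mono) auto
  ultimately have "ln (real p) / ((h * exp h) * (exp h * (real p * h) * \<kappa>)) \<le> alpha_term a p"
    unfolding u' using u den lp h p kp by (intro frac_le) auto
  moreover have "ln (real p) / ((h * exp h) * (exp h * (real p * h) * \<kappa>)) = exp (- 2 * h) / \<kappa> * (1 / a\<^sup>2 * (1 / (real p * ln (real p))))"
  proof -
    have e: "exp (- 2 * h) = 1 / (exp h * exp h)" by (simp add: exp_add[symmetric] exp_minus inverse_eq_divide)
    have "ln (real p) / ((h * E) * (E * (real p * h) * \<kappa>)) = 1 / (E * E) / \<kappa> * (1 / a\<^sup>2 * (1 / (real p * ln (real p))))" for E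
      using lp assms p unfolding h_def by (simp add: power2_eq_square)
    then show ?thesis unfolding e .
  qed
  ultimately show "exp (- 2 * (a * ln (real p))) / (1 + 1 / real p + 1 / (a * (real p * ln (real p)))) *
       (1 / a\<^sup>2 * (1 / (real p * ln (real p)))) \<le> alpha_term a p"
    unfolding \<kappa>_def h_def by (simp add: mult_ac)
qed

text \<open>Minus the logarithmic derivative of \<Phi> at a (compare
  \<open>log_euler_deriv\<close>), hence the mean of ln n under the tilted measure.\<close>

definition saddle_sum :: "real \<Rightarrow> real" where
  "saddle_sum a = (\<Sum>\<^sub>\<infinity>p\<in>{p::nat. prime p}. alpha_term a p)"

lemma alpha_term_sum_bounded:
  obtains T :: real where "T > 0" "\<And>a N. a > 0 \<Longrightarrow> (\<Sum>p\<in>primes_le N. alpha_term a p) \<le> T / a\<^sup>2"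
proof -
  obtain T where T: "T > 0" "\<And>N. (\<Sum>p\<in>primes_le N. 1 / (real p * ln (real p))) \<le> T"
    using sum_prime_inverse_ln_bounded by blast
  have b: "(\<Sum>p\<in>primes_le N. alpha_term a p) \<le> T / a\<^sup>2" if "a > 0" for a N
  proof -
    have "(\<Sum>p\<in>primes_le N. alpha_term a p) \<le> (\<Sum>p\<in>primes_le N. 1 / a\<^sup>2 * (1 / (real p * ln (real p))))"
      by (intro sum_mono alpha_term_bounds) (use that in \<open>auto simp: primes_leD\<close>)
    also have "\<dots> = 1 / a\<^sup>2 * (\<Sum>p\<in>primes_le N. 1 / (real p * ln (real p)))" by (simp only: sum_distrib_left)
    also have "\<dots> \<le> 1 / a\<^sup>2 * T" using T(2)[of N] by (intro mult_left_mono) auto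
    finally show ?thesis by simp
  qed
  show ?thesis using that[OF T(1)] b by blast
qed

lemma saddle_sum_limit:
  assumes "a > 0"
  shows "(\<lambda>p. alpha_term a p) summable_on {p. prime p}"
    and "(\<lambda>N. \<Sum>p\<in>primes_le N. alpha_term a p) \<longlonglongrightarrow> saddle_sum a"
proof -
  obtain T where T: "T > 0" "\<And>a N. a > 0 \<Longrightarrow> (\<Sum>p\<in>primes_le N. alpha_term a p) \<le> T / a\<^sup>2"
    by (rule alpha_term_sum_bounded) blast
  have nn: "0 \<le> alpha_term a p" if "prime p" for p
    using alpha_term_bounds(1)[OF that assms] by simp
  note P = prime_infsum[of "alpha_term a" "T / a\<^sup>2", OF nn T(2)[OF assms]]
  show "(\<lambda>p. alpha_term a p) summable_on {p. prime p}" by (rule P(1))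
  show "(\<lambda>N. \<Sum>p\<in>primes_le N. alpha_term a p) \<longlonglongrightarrow> saddle_sum a" unfolding saddle_sum_def by (rule P(2))
qed

lemma saddle_sum_le:
  obtains T :: real where "T > 0" "\<And>a. a > 0 \<Longrightarrow> saddle_sum a \<le> T / a\<^sup>2"
proof -
  obtain T where T: "T > 0" "\<And>a N. a > 0 \<Longrightarrow> (\<Sum>p\<in>primes_le N. alpha_term a p) \<le> T / a\<^sup>2"
    by (rule alpha_term_sum_bounded) blast
  show ?thesis
  proof (rule that[OF T(1)])
    fix a :: real assume a: "a > 0"
    show "saddle_sum a \<le> T / a\<^sup>2"
      by (rule LIMSEQ_le_const2[OF saddle_sum_limit(2)[OF a]]) (use T(2)[OF a] in auto)
  qed
qed

lemma saddle_sum_ge_finite: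
  assumes "a > 0" "finite F" "\<And>p. p \<in> F \<Longrightarrow> prime p"
  shows "(\<Sum>p\<in>F. alpha_term a p) \<le> saddle_sum a"
proof -
  show ?thesis unfolding saddle_sum_def

  proof (rule finite_sum_le_infsum[OF saddle_sum_limit(1)[OF assms(1)] assms(2)])
    show "F \<subseteq> {p. prime p}" using assms(3) by blast
    show "0 \<le> alpha_term a p" if "p \<in> {p. prime p} - F" for p
      using alpha_term_bounds(1)[of p a] assms(1) that by simp
  qed
qed

text \<open>The sum behaves like a^(-2) times the sum of 1 / (p ln p) over the primes beyond 1 / a,
  which is about 1 / L with L = ln (1 / a). The upper bound cuts at 1 / (a L^2), so that the smaller
  primes, at most 2 / a each, give only 2 / (a^2 L^2). The lower bound keeps the primes from L^2 / a
  to exp (1 / (a L)): there a p ln p >= L^2 and a ln p <= 1 / L, so the correction factor in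
  \<open>alpha_term_bounds\<close> tends to 1.\<close>

lemma saddle_sum_asymp: "((\<lambda>a. saddle_sum a * (a\<^sup>2 * ln (1 / a))) \<longlongrightarrow> 1) (at_right 0)"
proof -
  obtain K where K: "K > 0"
    "\<And>Y M. 2 \<le> Y \<Longrightarrow> (\<Sum>p\<in>{p\<in>primes_le M. Y < real p}. 1 / (real p * ln (real p))) \<le> 1 / ln Y + K / (ln Y)\<^sup>2"
    "\<And>Y Z. 2 \<le> Y \<Longrightarrow> Y \<le> Z \<Longrightarrow>
      1 / ln Y - 1 / ln Z - K / (ln Y)\<^sup>2 \<le> (\<Sum>p\<in>{p. prime p \<and> Y < real p \<and> real p \<le> Z}. 1 / (real p * ln (real p)))"
    by (rule sum_prime_inverse_ln) blast
  define up where "up = (\<lambda>a::real. 2 / ln (1 / a) + ln (1 / a) * (1 / ln (1 / a / (ln (1 / a))\<^sup>2) + K / (ln (1 / a / (ln (1 / a))\<^sup>2))\<^sup>2))"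
  define lo where "lo = (\<lambda>a::real. exp (- 2 / ln (1 / a)) / (1 + 2 / (ln (1 / a))\<^sup>2) *
      (ln (1 / a) * (1 / ln (1 / a * (ln (1 / a))\<^sup>2) - 1 / ln (exp (1 / (a * ln (1 / a)))) - K / (ln (1 / a * (ln (1 / a))\<^sup>2))\<^sup>2)))"
  have a01: "\<forall>\<^sub>F a in at_right (0::real). a \<in> {0<..<1}" by (rule eventually_at_right_real) simp
  have u1: "\<forall>\<^sub>F a in at_right (0::real). 2 \<le> 1 / a / (ln (1 / a))\<^sup>2" by real_asymp
  have u2: "\<forall>\<^sub>F a in at_right (0::real). ln (1 / a) \<le> 1 / a" by real_asymp
  have u3: "\<forall>\<^sub>F a in at_right (0::real). 1 \<le> ln (1 / a)" by real_asymp
  have u4: "\<forall>\<^sub>F a in at_right (0::real). 3 \<le> 1 / a * (ln (1 / a))\<^sup>2" by real_asymp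
  have u5: "\<forall>\<^sub>F a in at_right (0::real). 1 / a * (ln (1 / a))\<^sup>2 \<le> exp (1 / (a * ln (1 / a)))" by real_asymp
  have u6: "\<forall>\<^sub>F a in at_right (0::real). (ln (1 / a))\<^sup>2 \<le> 1 / a * (ln (1 / a))\<^sup>2" by real_asymp
  have ul: "\<forall>\<^sub>F a in at_right 0. saddle_sum a * (a\<^sup>2 * ln (1 / a)) \<le> up a"
    using a01 u1 u2 u3
  proof eventually_elim
    case (elim a)
    define L where "L = ln (1 / a)"
    define Y where "Y = 1 / a / L\<^sup>2"
    have a: "0 < a" "a < 1" using elim by auto
    have L: "L \<ge> 1" "L \<le> 1 / a" using elim by (auto simp: L_def)
    have Y: "2 \<le> Y" "Y \<le> 1 / a"
    proof -
      show "2 \<le> Y" using elim by (simp add: Y_def L_def)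
      have "1 / a / L\<^sup>2 \<le> 1 / a / 1" using L a by (intro divide_left_mono) auto
      then show "Y \<le> 1 / a" by (simp add: Y_def)
    qed
    have "(\<Sum>p\<in>primes_le N. alpha_term a p) \<le> 2 / (a\<^sup>2 * L\<^sup>2) + 1 / a\<^sup>2 * (1 / ln Y + K / (ln Y)\<^sup>2)" for N
    proof -
      have "(\<Sum>p\<in>primes_le N. alpha_term a p) =
          (\<Sum>p\<in>{p\<in>primes_le N. real p \<le> Y}. alpha_term a p) + (\<Sum>p\<in>{p\<in>primes_le N. Y < real p}. alpha_term a p)"
        by (subst sum.union_disjoint[symmetric]) (auto intro!: sum.cong)
      also have "(\<Sum>p\<in>{p\<in>primes_le N. real p \<le> Y}. alpha_term a p) \<le> (\<Sum>p\<in>{p\<in>primes_le N. real p \<le> Y}. 2 / a)"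
      proof (rule sum_mono)
        fix p assume p: "p \<in> {p\<in>primes_le N. real p \<le> Y}"
        then have pp: "prime p" by (auto simp: primes_le_def)
        have "ln (real p) \<le> ln (1 / a)" using p Y prime_gt_0_nat[OF pp] by (intro ln_mono) auto
        then show "alpha_term a p \<le> 2 / a" using alpha_term_bounds(3)[OF pp a(1)] L by (simp add: L_def)
      qed
      also have "\<dots> \<le> Y * (2 / a)"
      proof -
        have "{p\<in>primes_le N. real p \<le> Y} \<subseteq> {1..nat \<lfloor>Y\<rfloor>}"
          using prime_ge_1_nat by (auto simp: primes_le_def le_nat_iff le_floor_iff)
        then have "card {p\<in>primes_le N. real p \<le> Y} \<le> nat \<lfloor>Y\<rfloor>" using card_mono[of "{1..nat \<lfloor>Y\<rfloor>}"] by fastforce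
        moreover have "real (nat \<lfloor>Y\<rfloor>) \<le> Y" using Y by simp
        ultimately have "real (card {p\<in>primes_le N. real p \<le> Y}) \<le> Y" by linarith
        then show ?thesis using a by (simp add: divide_right_mono)
      qed
      also have "Y * (2 / a) = 2 / (a\<^sup>2 * L\<^sup>2)" using a L by (simp add: Y_def power2_eq_square)
      also have "(\<Sum>p\<in>{p\<in>primes_le N. Y < real p}. alpha_term a p) \<le> (\<Sum>p\<in>{p\<in>primes_le N. Y < real p}. 1 / a\<^sup>2 * (1 / (real p * ln (real p))))"
        by (intro sum_mono alpha_term_bounds) (use a in \<open>auto simp: primes_leD\<close>)
      also have "\<dots> = 1 / a\<^sup>2 * (\<Sum>p\<in>{p\<in>primes_le N. Y < real p}. 1 / (real p * ln (real p)))" by (simp only: sum_distrib_left)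
      also have "\<dots> \<le> 1 / a\<^sup>2 * (1 / ln Y + K / (ln Y)\<^sup>2)" using K(2)[OF Y(1), of N] by (intro mult_left_mono) auto
      finally show ?thesis by simp
    qed
    then have "saddle_sum a \<le> 2 / (a\<^sup>2 * L\<^sup>2) + 1 / a\<^sup>2 * (1 / ln Y + K / (ln Y)\<^sup>2)"
      by (intro LIMSEQ_le_const2[OF saddle_sum_limit(2)[OF a(1)]]) auto
    then have "saddle_sum a * (a\<^sup>2 * L) \<le> (2 / (a\<^sup>2 * L\<^sup>2) + 1 / a\<^sup>2 * (1 / ln Y + K / (ln Y)\<^sup>2)) * (a\<^sup>2 * L)"
      using L by (intro mult_right_mono) auto
    also have "\<dots> = 2 / (a\<^sup>2 * L\<^sup>2) * (a\<^sup>2 * L) + 1 / a\<^sup>2 * (1 / ln Y + K / (ln Y)\<^sup>2) * (a\<^sup>2 * L)"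
      by (rule distrib_right)
    also have "2 / (a\<^sup>2 * L\<^sup>2) * (a\<^sup>2 * L) = 2 / L" using a L by (simp add: power2_eq_square)
    also have "1 / a\<^sup>2 * (1 / ln Y + K / (ln Y)\<^sup>2) * (a\<^sup>2 * L) = L * (1 / ln Y + K / (ln Y)\<^sup>2)" using a by simp
    finally show ?case unfolding up_def Y_def L_def .
  qed
  have ll: "\<forall>\<^sub>F a in at_right 0. lo a \<le> saddle_sum a * (a\<^sup>2 * ln (1 / a))"
    using a01 u3 u4 u5 u6
  proof eventually_elim
    case (elim a)
    define L where "L = ln (1 / a)"
    define Y where "Y = 1 / a * L\<^sup>2"
    define Z where "Z = exp (1 / (a * L))"
    define c where "c = exp (- 2 / L) / (1 + 2 / L\<^sup>2)"
    have a: "0 < a" "a < 1" using elim by auto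
    have L: "L \<ge> 1" using elim by (auto simp: L_def)
    have Y: "3 \<le> Y" "Y \<le> Z" "L\<^sup>2 \<le> Y" using elim by (auto simp: Y_def L_def Z_def)
    have c: "c \<ge> 0" by (simp add: c_def)
    define F where "F = {p. prime p \<and> Y < real p \<and> real p \<le> Z}"
    have fin: "finite F"
    proof (rule finite_subset)
      show "F \<subseteq> {..nat \<lfloor>Z\<rfloor>}" by (auto simp: F_def le_nat_iff le_floor_iff)
    qed simp
    have "c * (1 / a\<^sup>2 * (1 / ln Y - 1 / ln Z - K / (ln Y)\<^sup>2)) \<le> c * (1 / a\<^sup>2 * (\<Sum>p\<in>F. 1 / (real p * ln (real p))))"
      using K(3)[of Y Z] Y c unfolding F_def by (intro mult_left_mono) auto
    also have "\<dots> = (\<Sum>p\<in>F. c * (1 / a\<^sup>2 * (1 / (real p * ln (real p)))))" by (simp only: sum_distrib_left)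
    also have "\<dots> \<le> (\<Sum>p\<in>F. alpha_term a p)"
    proof (rule sum_mono)
      fix p assume p: "p \<in> F"
      then have pp: "prime p" by (simp add: F_def)
      have pY: "Y < real p" "real p \<le> Z" using p by (auto simp: F_def)
      have lp: "ln (real p) \<ge> 1"
      proof -
        have "exp 1 \<le> real p" using exp_le pY Y by linarith
        then show ?thesis using prime_gt_0_nat[OF pp] by (subst ln_ge_iff) auto
      qed
      have "ln (real p) \<le> ln Z" using pY prime_gt_0_nat[OF pp] by (intro ln_mono) auto
      then have "a * ln (real p) \<le> a * (1 / (a * L))" using a by (intro mult_left_mono) (auto simp: Z_def)
      then have hL: "a * ln (real p) \<le> 1 / L" using a by simp
      have "L\<^sup>2 \<le> a * (real p * ln (real p))"
      proof -
        have "L\<^sup>2 = a * (Y * 1)" using a by (simp add: Y_def)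
        also have "\<dots> \<le> a * (real p * ln (real p))" using a pY lp Y by (intro mult_left_mono mult_mono) auto
        finally show ?thesis .
      qed
      moreover have "0 < a * (real p * ln (real p))" using a lp prime_gt_1_nat[OF pp] by (intro mult_pos_pos) auto
      ultimately have "1 / (a * (real p * ln (real p))) \<le> 1 / L\<^sup>2"
        using L by (intro frac_le) auto
      moreover have "1 / real p \<le> 1 / L\<^sup>2" using L Y pY by (intro divide_left_mono) auto
      ultimately have "1 + 1 / real p + 1 / (a * (real p * ln (real p))) \<le> 1 + 2 / L\<^sup>2" by simp
      moreover have "exp (- 2 / L) \<le> exp (- 2 * (a * ln (real p)))" using hL by simp
      moreover have "0 < 1 + 1 / real p + 1 / (a * (real p * ln (real p)))"
        using a lp by (intro add_pos_nonneg) auto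
      ultimately have "c \<le> exp (- 2 * (a * ln (real p))) / (1 + 1 / real p + 1 / (a * (real p * ln (real p))))"
        unfolding c_def by (intro frac_le) auto
      then have "c * (1 / a\<^sup>2 * (1 / (real p * ln (real p)))) \<le>
        exp (- 2 * (a * ln (real p))) / (1 + 1 / real p + 1 / (a * (real p * ln (real p)))) * (1 / a\<^sup>2 * (1 / (real p * ln (real p))))"
        using lp by (intro mult_right_mono) auto
      also have "\<dots> \<le> alpha_term a p" by (rule alpha_term_bounds(4)[OF pp a(1)])
      finally show "c * (1 / a\<^sup>2 * (1 / (real p * ln (real p)))) \<le> alpha_term a p" .
    qed
    also have "\<dots> \<le> saddle_sum a" by (rule saddle_sum_ge_finite[OF a(1) fin]) (auto simp: F_def)
    finally have "c * (1 / a\<^sup>2 * (1 / ln Y - 1 / ln Z - K / (ln Y)\<^sup>2)) * (a\<^sup>2 * L) \<le> saddle_sum a * (a\<^sup>2 * L)"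
      using L by (intro mult_right_mono) auto
    moreover have "c * (1 / a\<^sup>2 * (1 / ln Y - 1 / ln Z - K / (ln Y)\<^sup>2)) * (a\<^sup>2 * L) = c * (L * (1 / ln Y - 1 / ln Z - K / (ln Y)\<^sup>2))"
      using a by simp
    ultimately show ?case unfolding lo_def c_def Y_def Z_def L_def by simp
  qed
  have "(up \<longlongrightarrow> 1) (at_right 0)" unfolding up_def by real_asymp
  moreover have "(lo \<longlongrightarrow> 1) (at_right 0)" unfolding lo_def by (simp only: ln_exp) real_asymp
  ultimately show ?thesis by (rule tendsto_sandwich[OF ll ul, rotated])
qed

section \<open>The tilted characteristic function\<close>

lemma nat_powr_Complex:
  "p > 0 \<Longrightarrow> of_nat p powr Complex a t = of_real (real p powr a) * cis (t * ln (real p))"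
proof -
  assume "p > 0"
  then have "of_nat p powr Complex a t = exp (Complex a t * of_real (ln (real p)))"
    by (simp add: powr_def Ln_of_nat)
  also have "Complex a t * of_real (ln (real p)) = Complex (a * ln (real p)) (t * ln (real p))"
    by (simp add: complex_eq_iff)
  also have "exp \<dots> = of_real (exp (a * ln (real p))) * cis (t * ln (real p))"
    by (simp add: complex_eq_iff Re_exp Im_exp)
  also have "exp (a * ln (real p)) = real p powr a" using \<open>p > 0\<close> by (simp add: powr_def)
  finally show ?thesis .
qed

text \<open>Law of cosines. The term with 1 - cos measures how much the Euler factor loses off the
  real axis.\<close>

lemma norm_nat_powr_minus_1_sq:
  assumes "p > 0"
  shows "(norm (of_nat p powr Complex a t - 1))\<^sup>2 = (real p powr a - 1)\<^sup>2 + 2 * real p powr a * (1 - cos (t * ln (real p)))"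
proof -
  define P where "P = real p powr a"
  define x where "x = t * ln (real p)"
  have "(norm (of_real P * cis x - 1))\<^sup>2 = (P * cos x - 1)\<^sup>2 + (P * sin x)\<^sup>2"
    by (simp add: cmod_power2)
  also have "\<dots> = P\<^sup>2 * ((sin x)\<^sup>2 + (cos x)\<^sup>2) - 2 * P * cos x + 1" by algebra
  also have "\<dots> = (P - 1)\<^sup>2 + 2 * P * (1 - cos x)" unfolding sin_cos_squared_add by algebra
  finally show ?thesis unfolding nat_powr_Complex[OF assms] P_def x_def .
qed

lemma norm_nat_powr_minus_1_ge: "p > 0 \<Longrightarrow> real p powr Re s - 1 \<le> norm (of_nat p powr s - 1 :: complex)"
  using norm_triangle_ineq2[of "of_nat p powr s :: complex" 1] by (simp add: norm_powr_real_powr)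

lemma norm_euler_factor_minus_1_le:
  assumes "prime p" "Re s > 0"
  shows "norm (euler_factor p s - 1) \<le> euler_weight p (Re s)"
proof -
  have "real p powr Re s - 1 > 0" using prime_powr_gt_1[OF assms] by simp
  moreover have "real p powr Re s - 1 \<le> norm (of_nat p powr s - 1 :: complex)"
    by (rule norm_nat_powr_minus_1_ge[OF prime_gt_0_nat[OF assms(1)]])
  moreover have "norm (euler_factor p s - 1) = (1 / (real p + 1)) / norm (of_nat p powr s - 1 :: complex)"
    unfolding euler_factor_def add_diff_cancel_left' norm_divide norm_of_real by simp
  ultimately show ?thesis unfolding euler_weight_def
    by (simp only:) (intro divide_left_mono mult_pos_pos, auto)
qed

lemma norm_euler_factor_le:
  assumes "prime p" "Re s > 0"
  shows "norm (euler_factor p s) \<le> 1 + euler_weight p (Re s)"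
  using norm_euler_factor_minus_1_le[OF assms] norm_triangle_ineq[of 1 "euler_factor p s - 1"] by simp

text \<open>For |z| > 1 inversion gives Re (1 / (z - 1)) >= -1/2, and 1 / (p + 1) <= 1/3, hence 1 -
  1/6. The factors thus stay away from the branch cut of \<open>Ln\<close>.\<close>

lemma Re_euler_factor_ge:
  assumes "prime p" "Re s > 0"
  shows "5 / 6 \<le> Re (euler_factor p s)"
proof -
  define z where "z = (of_nat p powr s :: complex)"
  have nz: "norm z > 1" using prime_powr_gt_1[OF assms] by (simp add: z_def norm_powr_real_powr)
  then have n1: "(norm (z - 1))\<^sup>2 > 0" by auto
  have "(norm (z - 1))\<^sup>2 = (norm z)\<^sup>2 - 2 * Re z + 1"
    unfolding cmod_power2 by (simp add: power2_eq_square algebra_simps)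
  moreover have "(norm z)\<^sup>2 \<ge> 1" using nz by (simp add: one_le_power)
  ultimately have "(norm (z - 1))\<^sup>2 \<ge> - 2 * Re (z - 1)" by simp
  then have "- 1 / 2 * (norm (z - 1))\<^sup>2 \<le> Re (z - 1)" by simp
  then have "- 1 / 2 \<le> Re (z - 1) / (norm (z - 1))\<^sup>2" using n1 by (subst pos_le_divide_eq) auto
  moreover have "Re (1 / (z - 1)) = Re (z - 1) / (norm (z - 1))\<^sup>2" by (simp add: Re_divide cmod_power2)
  ultimately have r: "- 1 / 2 \<le> Re (1 / (z - 1))" by simp
  have p: "real p \<ge> 2" using prime_ge_2_nat[OF assms(1)] by simp
  define c where "c = 1 / (real p + 1)"
  have "Re (of_real c / w) = c * Re (1 / w)" for c w
    by (metis Re_complex_of_real Im_complex_of_real times_complex.sel(1) mult_zero_left diff_zero times_divide_eq_right mult.right_neutral)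
  then have "Re (euler_factor p s) = 1 + 1 / (real p + 1) * Re (1 / (z - 1))"
    unfolding euler_factor_def z_def[symmetric] by (simp only: plus_complex.sel one_complex.sel)
  moreover have "1 / (real p + 1) * (- 1 / 2) \<le> 1 / (real p + 1) * Re (1 / (z - 1))"
    using r by (intro mult_left_mono) auto
  moreover have "1 / (real p + 1) \<le> 1 / 3" using p by (intro divide_left_mono) auto
  ultimately show ?thesis unfolding c_def[symmetric] by linarith
qed

text \<open>Linear near 1 but only logarithmic for large z. For small primes z - 1 can be of order 1
  / a, and a bound by |z - 1| would lose the logarithm gained in \<open>ln_psi_series_bound\<close>.
  The constant: away from 1 one has ln (1 + |z - 1|) >= 1/4, and the summand 3 is 12 times
  that.\<close>

lemma norm_Ln_le_ln:
  assumes "1 / 2 \<le> Re z"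
  shows "norm (Ln z) \<le> 13 * ln (1 + norm (z - 1))"
proof (cases "norm (z - 1) < 1 / 2")
  case True
  define x where "x = norm (z - 1)"
  have "norm (Ln (1 + (z - 1))) \<le> 2 * x" unfolding x_def using True by (intro norm_Ln_le)
  moreover have "x - x\<^sup>2 \<le> ln (1 + x)" using True by (intro ln_one_plus_pos_lower_bound) (auto simp: x_def)
  moreover have "x\<^sup>2 \<le> x * (1 / 2)" unfolding power2_eq_square using True by (intro mult_left_mono) (auto simp: x_def)
  moreover have "0 \<le> x" by (simp add: x_def)
  ultimately have "norm (Ln (1 + (z - 1))) \<le> 13 * ln (1 + x)" by linarith
  then show ?thesis by (simp add: x_def)
next
  case False
  define x where "x = norm (z - 1)"
  have x: "x \<ge> 1 / 2" using False by (simp add: x_def)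
  have "1 / 2 - (1 / 2)\<^sup>2 \<le> ln (1 + 1 / 2 :: real)" by (intro ln_one_plus_pos_lower_bound) auto
  also have "\<dots> \<le> ln (1 + x)" using x by (intro ln_mono) auto
  finally have lx: "1 / 4 \<le> ln (1 + x)" by (simp add: power2_eq_square)
  have z0: "z \<noteq> 0" using assms by auto
  have nz: "1 / 2 \<le> norm z" using assms complex_Re_le_cmod[of z] by linarith
  have "norm z \<le> 1 + x" using norm_triangle_ineq[of 1 "z - 1"] by (simp add: x_def)
  then have "ln (norm z) \<le> ln (1 + x)" using z0 by (intro ln_mono) auto
  moreover have "- 1 \<le> ln (norm z)"
  proof -
    have "ln (1 / 2 :: real) \<le> ln (norm z)" using nz by (intro ln_mono) auto
    then show ?thesis using ln_2_less_1 by (simp add: ln_div)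
  qed
  ultimately have "\<bar>Re (Ln z)\<bar> \<le> ln (1 + x) + 1" using z0 lx by auto
  moreover have "\<bar>Im (Ln z)\<bar> \<le> 2"
    using Re_Ln_pos_le[OF z0] assms pi_less_4 by auto
  ultimately have "norm (Ln z) \<le> ln (1 + x) + 3" using cmod_le[of "Ln z"] by linarith
  then show ?thesis using lx by (simp add: x_def)
qed

text \<open>A sum of principal logarithms, not the logarithm of the product: each summand is
  holomorphic on the right half plane, whatever the argument of the product.\<close>

definition log_euler :: "nat \<Rightarrow> complex \<Rightarrow> complex" where
  "log_euler N s = (\<Sum>p\<in>primes_le N. Ln (euler_factor p s))"

lemma euler_factor_nonzero:
  assumes "prime p" "Re s > 0"
  shows "euler_factor p s \<noteq> 0" "euler_factor p s \<notin> \<real>\<^sub>\<le>\<^sub>0" "of_nat p powr s \<noteq> (1::complex)"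
proof -
  show "euler_factor p s \<noteq> 0" using Re_euler_factor_ge[OF assms] by auto
  show "euler_factor p s \<notin> \<real>\<^sub>\<le>\<^sub>0" using Re_euler_factor_ge[OF assms] by (auto simp: complex_nonpos_Reals_iff)
  have "norm (of_nat p powr s :: complex) > 1" using prime_powr_gt_1[OF assms] by (simp add: norm_powr_real_powr)
  then show "of_nat p powr s \<noteq> (1::complex)" by auto
qed

lemma exp_log_euler: "Re s > 0 \<Longrightarrow> exp (log_euler N s) = (\<Prod>p\<in>primes_le N. euler_factor p s)"
  unfolding log_euler_def by (subst exp_sum) (auto intro!: prod.cong simp: euler_factor_nonzero primes_leD)

lemma euler_factor_cnj: "euler_factor p (cnj s) = cnj (euler_factor p s)"
  unfolding euler_factor_def by (cases "p = 0") (simp_all add: cnj_powr)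

lemma log_euler_cnj: "Re s > 0 \<Longrightarrow> log_euler N (cnj s) = cnj (log_euler N s)"
  unfolding log_euler_def cnj_sum
  by (intro sum.cong) (auto simp: euler_factor_cnj cnj_Ln euler_factor_nonzero primes_leD)

lemma log_euler_holomorphic: "log_euler N holomorphic_on {s. Re s > 0}"
proof -
  have "(\<lambda>s. \<Sum>p\<in>primes_le N. Ln (euler_factor p s)) holomorphic_on {s. Re s > 0}"
  proof (intro holomorphic_on_sum holomorphic_on_Ln')
    fix p assume p: "p \<in> primes_le N"
    show "euler_factor p holomorphic_on {s. Re s > 0}"
      unfolding euler_factor_def[abs_def]
      using euler_factor_nonzero(3) primes_leD[OF p] by (intro holomorphic_intros) auto
    show "euler_factor p s \<notin> \<real>\<^sub>\<le>\<^sub>0" if "s \<in> {s. Re s > 0}" for s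
      using euler_factor_nonzero(2) primes_leD[OF p] that by auto
  qed
  then show ?thesis unfolding log_euler_def[abs_def] .
qed

lemma euler_factor_of_real: "euler_factor p (of_real a) = of_real (1 + euler_weight p a)"
  unfolding euler_factor_def euler_weight_def using powr_of_real[of "real p" a] by simp

text \<open>The origin of \<open>alpha_term\<close>: it is minus the logarithmic derivative of one
  Euler factor at the real point a.\<close>

lemma log_euler_deriv:
  assumes "a > 0"
  shows "deriv (log_euler N) (of_real a) = - of_real (\<Sum>p\<in>primes_le N. alpha_term a p)"
proof -
  have "(log_euler N has_field_derivative (\<Sum>p\<in>primes_le N. - of_real (alpha_term a p))) (at (of_real a))"
    unfolding log_euler_def[abs_def]
  proof (rule DERIV_sum)
    fix p assume "p \<in> primes_le N"
    then have p: "prime p" by (simp add: primes_leD)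
    define P where "P = real p powr a"
    define c where "c = 1 / (real p + 1)"
    have p0: "p > 0" using prime_gt_0_nat[OF p] .
    have P: "P > 1" using prime_powr_gt_1[OF p assms] by (simp add: P_def)
    have c: "c > 0" by (simp add: c_def)
    have pw: "(of_nat p :: complex) powr of_real a = of_real P"
      using powr_of_real[of "real p" a] by (simp add: P_def)
    have P1: "(of_real P :: complex) - 1 = of_real (P - 1)" by simp
    have "((\<lambda>s. 1 + of_real c / (of_nat p powr s - 1)) has_field_derivative
        - (of_real c * (Ln (of_nat p) * of_nat p powr (of_real a))) / ((of_nat p powr (of_real a) - 1) * (of_nat p powr (of_real a) - 1))) (at (of_real a))"
      using p0 euler_factor_nonzero(3)[OF p, of "of_real a"] assms
      by (auto intro!: derivative_eq_intros simp: has_field_derivative_powr_right)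
    then have d: "(euler_factor p has_field_derivative of_real (- (c * (ln (real p) * P)) / ((P - 1) * (P - 1)))) (at (of_real a))"
      unfolding euler_factor_def[abs_def] c_def[symmetric] pw using p0 by (simp add: Ln_of_nat)
    have "((\<lambda>s. Ln (euler_factor p s)) has_field_derivative
        (inverse (euler_factor p (of_real a)) * of_real (- (c * (ln (real p) * P)) / ((P - 1) * (P - 1))))) (at (of_real a))"
      by (rule DERIV_chain2[OF has_field_derivative_Ln d]) (use euler_factor_nonzero(2)[OF p] assms in auto)
    moreover have "inverse (euler_factor p (of_real a)) * of_real (- (c * (ln (real p) * P)) / ((P - 1) * (P - 1))) = - (of_real (alpha_term a p) :: complex)"
    proof -
      have "inverse (1 + c / (P - 1)) * (- (c * (ln (real p) * P)) / ((P - 1) * (P - 1))) = - alpha_term a p"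
      proof -
        have "1 + c / (P - 1) = (P - 1 + c) / (P - 1)" using P by (simp add: field_simps)
        moreover have "P - 1 + c = c * (1 + (real p + 1) * (P - 1))" by (simp add: c_def field_simps)
        ultimately have "inverse (1 + c / (P - 1)) = (P - 1) / (c * (1 + (real p + 1) * (P - 1)))" by simp
        moreover have "1 + (real p + 1) * (P - 1) > 0" using P by (simp add: add_pos_pos)
        ultimately show ?thesis unfolding alpha_term_def P_def[symmetric] using P c by (simp add: mult_ac)
      qed
      then show ?thesis unfolding euler_factor_of_real euler_weight_def c_def[symmetric] P_def[symmetric]
        by (metis of_real_inverse of_real_minus of_real_mult)
    qed
    ultimately show "((\<lambda>s. Ln (euler_factor p s)) has_field_derivative - of_real (alpha_term a p)) (at (of_real a))" by simp
  qed
  then show ?thesis by (simp add: DERIV_imp_deriv sum_negf)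
qed

lemma norm_log_euler_le:
  assumes "0 < b" "b \<le> Re s"
  shows "norm (log_euler N s) \<le> 13 * (\<Sum>p\<in>primes_le N. ln (1 + euler_weight p b))"
proof -
  have "norm (log_euler N s) \<le> (\<Sum>p\<in>primes_le N. norm (Ln (euler_factor p s)))"
    unfolding log_euler_def by (rule norm_sum)
  also have "\<dots> \<le> (\<Sum>p\<in>primes_le N. 13 * ln (1 + euler_weight p b))"
  proof (rule sum_mono)
    fix p assume "p \<in> primes_le N"
    then have p: "prime p" by (simp add: primes_leD)
    have s: "Re s > 0" using assms by simp
    have "norm (Ln (euler_factor p s)) \<le> 13 * ln (1 + norm (euler_factor p s - 1))"
      using Re_euler_factor_ge[OF p s] by (intro norm_Ln_le_ln) auto
    also have "\<dots> \<le> 13 * ln (1 + euler_weight p b)"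
    proof -
      have "norm (euler_factor p s - 1) \<le> euler_weight p b"
        using norm_euler_factor_minus_1_le[OF p s] euler_weight_antimono[OF p assms] by linarith
      then have "ln (1 + norm (euler_factor p s - 1)) \<le> ln (1 + euler_weight p b)"
        by (intro ln_mono add_left_mono) (auto intro: add_pos_nonneg)
      then show ?thesis by simp
    qed
    finally show "norm (Ln (euler_factor p s)) \<le> 13 * ln (1 + euler_weight p b)" .
  qed
  finally show ?thesis by (simp add: sum_distrib_left)
qed

text \<open>Cauchy's inequality on the circle of radius r / 2 bounds the nth coefficient by M / (r /
  2)^n. For |h| <= r / 4 the terms from the third on are dominated by a geometric series of ratio at
  most 1/2, which gives 2 M (2 |h| / r)^3.\<close>

lemma holomorphic_taylor2:
  assumes hol: "g holomorphic_on ball c r" and r: "r > 0"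
    and M: "\<And>z. z \<in> ball c r \<Longrightarrow> norm (g z) \<le> M" and h: "norm h \<le> r / 4"
  shows "norm (g (c + h) - g c - deriv g c * h - (deriv ^^ 2) g c / 2 * h\<^sup>2) \<le> 16 * M * (norm h / r) ^ 3"
    and "norm ((deriv ^^ 2) g c / 2) \<le> 4 * M / r\<^sup>2"
proof -
  define A where "A = (\<lambda>n. (deriv ^^ n) g c / fact n)"
  have M0: "M \<ge> 0" using order_trans[OF norm_ge_zero M[of c]] r by simp
  have A: "norm (A n) \<le> M / (r / 2) ^ n" for n
  proof -
    have "norm ((deriv ^^ n) g c) \<le> fact n * M / (r / 2) ^ n"
    proof (rule Cauchy_inequality)
      show "g holomorphic_on ball c (r / 2)" using hol by (rule holomorphic_on_subset) (use r in auto)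
      show "continuous_on (cball c (r / 2)) g"
        using holomorphic_on_imp_continuous_on[OF hol] by (rule continuous_on_subset) (use r in auto)
      show "norm (g x) \<le> M" if "norm (c - x) = r / 2" for x using M[of x] that r by (simp add: dist_norm)
    qed (use r in auto)
    then have "norm ((deriv ^^ n) g c) / fact n \<le> (fact n * M / (r / 2) ^ n) / fact n"
      by (rule divide_right_mono) simp
    then show ?thesis unfolding A_def by (simp add: norm_divide)
  qed
  have sums: "(\<lambda>n. A n * h ^ n) sums g (c + h)"
    using holomorphic_power_series[OF hol, of "c + h"] h r by (simp add: A_def dist_norm)
  define q where "q = norm h / (r / 2)"
  have q: "0 \<le> q" "q \<le> 1 / 2" using h r by (auto simp: q_def field_simps)
  have term_le: "norm (A (n + 3) * h ^ (n + 3)) \<le> M * q ^ 3 * q ^ n" for n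
  proof -
    have "norm (A (n + 3) * h ^ (n + 3)) \<le> M / (r / 2) ^ (n + 3) * norm h ^ (n + 3)"
      unfolding norm_mult norm_power by (intro mult_right_mono A) auto
    also have "\<dots> = M * q ^ 3 * q ^ n" by (simp add: q_def power_divide power_add mult_ac)
    finally show ?thesis .
  qed
  have geo: "(\<lambda>n. M * q ^ 3 * q ^ n) sums (M * q ^ 3 * (1 / (1 - q)))"
    using q by (intro sums_mult geometric_sums) auto
  have sums3: "(\<lambda>n. A (n + 3) * h ^ (n + 3)) sums (g (c + h) - (\<Sum>n<3. A n * h ^ n))"
    using sums by (rule sums_split_initial_segment)
  have "norm (g (c + h) - (\<Sum>n<3. A n * h ^ n)) \<le> M * q ^ 3 * (1 / (1 - q))"
    using norm_suminf_le[OF term_le sums_summable[OF geo]] sums3 geo by (simp add: sums_iff)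
  also have "\<dots> \<le> M * q ^ 3 * 2"
    using q M0 by (intro mult_left_mono) (auto simp: divide_le_eq)
  also have "\<dots> = 16 * M * (norm h / r) ^ 3" by (simp add: q_def power3_eq_cube)
  also have "g (c + h) - (\<Sum>n<3. A n * h ^ n) = g (c + h) - g c - deriv g c * h - (deriv ^^ 2) g c / 2 * h\<^sup>2"
    by (simp add: A_def eval_nat_numeral algebra_simps)
  finally show "norm (g (c + h) - g c - deriv g c * h - (deriv ^^ 2) g c / 2 * h\<^sup>2) \<le> 16 * M * (norm h / r) ^ 3" .
  show "norm ((deriv ^^ 2) g c / 2) \<le> 4 * M / r\<^sup>2"
    using A[of 2] by (simp add: A_def power_divide fact_numeral mult.commute)
qed

text \<open>The tilted characteristic function of the measure that puts mass \<open>1 / \<psi>(n)\<close> at \<open>ln n\<close>,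
  centred at its mean.\<close>

definition tilted_char :: "real \<Rightarrow> real \<Rightarrow> complex" where
  "tilted_char a t = psi_series (Complex a t) * cis (t * saddle_sum a) / of_real (psi_series_real a)"

text \<open>For a finite product the logarithm is a finite sum. The bounds are proved here uniformly
  in N and carried over by \<open>tilted_char_limit\<close>.\<close>

definition tilted_char_partial :: "nat \<Rightarrow> real \<Rightarrow> real \<Rightarrow> complex" where
  "tilted_char_partial N a t = (\<Prod>p\<in>primes_le N. euler_factor p (Complex a t)) *
     cis (t * (\<Sum>p\<in>primes_le N. alpha_term a p)) / of_real (\<Prod>p\<in>primes_le N. 1 + euler_weight p a)"

lemma tilted_char_limit:
  assumes "a > 0"
  shows "(\<lambda>N. tilted_char_partial N a t) \<longlonglongrightarrow> tilted_char a t"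
  unfolding tilted_char_partial_def tilted_char_def
proof (intro tendsto_divide tendsto_mult)
  show "(\<lambda>N. \<Prod>p\<in>primes_le N. euler_factor p (Complex a t)) \<longlonglongrightarrow> psi_series (Complex a t)"
    using psi_series_props(2)[of "Complex a t"] assms by simp
  show "(\<lambda>N. cis (t * (\<Sum>p\<in>primes_le N. alpha_term a p))) \<longlonglongrightarrow> cis (t * saddle_sum a)"
    by (intro tendsto_intros saddle_sum_limit(2)[OF assms])
  show "(\<lambda>N. of_real (\<Prod>p\<in>primes_le N. 1 + euler_weight p a)) \<longlonglongrightarrow> complex_of_real (psi_series_real a)"
    by (intro tendsto_of_real psi_series_real_props(2)[OF assms])
  show "complex_of_real (psi_series_real a) \<noteq> 0" using psi_series_real_props(4)[OF assms] by auto
qed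

text \<open>Taylor expansion of the logarithm at a, on a disc of radius a / 2. The factor
  \<open>cis\<close> removes the linear term, since the mean is minus the derivative. The imaginary
  part of the rest is odd in t, so the quadratic term drops out of it and it is of third order. The
  error term of the theorem rests on this symmetry.\<close>

lemma tilted_char_partial_exp:
  assumes a: "a > 0" and M: "13 * (\<Sum>p\<in>primes_le N. ln (1 + euler_weight p (a / 2))) \<le> M" and t: "\<bar>t\<bar> \<le> a / 8"
  obtains E where "tilted_char_partial N a t = exp E" "\<bar>Im E\<bar> \<le> 128 * M * \<bar>t / a\<bar> ^ 3" "norm E \<le> 32 * M * (t / a)\<^sup>2"
proof -
  define V where "V = (\<Sum>p\<in>primes_le N. alpha_term a p)"
  define E where "E = (\<lambda>t. log_euler N (Complex a t) - log_euler N (of_real a) + \<i> * of_real (t * V))"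
  define c2 where "c2 = (deriv ^^ 2) (log_euler N) (of_real a) / 2"
  have ball: "Re z > a / 2" if "z \<in> ball (of_real a) (a / 2)" for z
    using that abs_Re_le_cmod[of "of_real a - z"] by (auto simp: dist_norm)
  have hol: "log_euler N holomorphic_on ball (of_real a) (a / 2)"
    using log_euler_holomorphic by (rule holomorphic_on_subset) (use ball a in force)
  have bd: "norm (log_euler N z) \<le> M" if "z \<in> ball (of_real a) (a / 2)" for z
    using norm_log_euler_le[of "a / 2" z N] ball[OF that] a M by simp
  have M0: "M \<ge> 0" using order_trans[OF norm_ge_zero bd[of "of_real a"]] a by simp
  have c2: "norm c2 \<le> 16 * M / a\<^sup>2"
    using holomorphic_taylor2(2)[OF hol _ bd, of 0] a unfolding c2_def by (simp add: power_divide)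
  have R: "norm (E t + c2 * of_real (t\<^sup>2)) \<le> 128 * M * \<bar>t / a\<bar> ^ 3" if "\<bar>t\<bar> \<le> a / 8" for t
  proof -
    have eq: "of_real a + \<i> * of_real t = Complex a t" by (simp add: complex_eq_iff)
    have "norm (log_euler N (of_real a + \<i> * of_real t) - log_euler N (of_real a) - deriv (log_euler N) (of_real a) * (\<i> * of_real t) - c2 * (\<i> * of_real t)\<^sup>2)
        \<le> 16 * M * (norm (\<i> * of_real t) / (a / 2)) ^ 3"
      unfolding c2_def by (rule holomorphic_taylor2(1)[OF hol _ bd]) (use a that in \<open>auto simp: norm_mult\<close>)
    moreover have "log_euler N (of_real a + \<i> * of_real t) - log_euler N (of_real a) - deriv (log_euler N) (of_real a) * (\<i> * of_real t) - c2 * (\<i> * of_real t)\<^sup>2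
       = E t + c2 * of_real (t\<^sup>2)"
      unfolding eq log_euler_deriv[OF a] E_def V_def by (simp add: power_mult_distrib algebra_simps)
    moreover have "16 * M * (norm (\<i> * of_real t) / (a / 2)) ^ 3 = 128 * M * \<bar>t / a\<bar> ^ 3"
      using a by (simp add: norm_mult power_divide power3_eq_cube)
    ultimately show ?thesis by (simp only:)
  qed
  have cn: "E (- t) = cnj (E t)"
  proof -
    have 1: "log_euler N (Complex a (- t)) = cnj (log_euler N (Complex a t))"
      using log_euler_cnj[of "Complex a t" N] a by (simp add: complex_cnj)
    have 2: "cnj (log_euler N (of_real a)) = log_euler N (of_real a)"
      using log_euler_cnj[of "of_real a" N] a by simp
    show ?thesis unfolding E_def 1 by (simp add: 2)
  qed
  \<comment> \<open>The same multiple of t^2 is added to E(t) and to E(-t), the conjugate of E(t),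
    so it cancels in the difference whatever the value of \<open>c2\<close>.\<close>
  have "2 * \<bar>Im (E t)\<bar> = norm (E t - cnj (E t))"
    by (simp add: complex_diff_cnj norm_mult)
  also have "E t - cnj (E t) = (E t + c2 * of_real (t\<^sup>2)) - (E (- t) + c2 * of_real ((- t)\<^sup>2))" by (simp add: cn)
  also have "norm \<dots> \<le> 128 * M * \<bar>t / a\<bar> ^ 3 + 128 * M * \<bar>(- t) / a\<bar> ^ 3"
    by (rule order_trans[OF norm_triangle_ineq4 add_mono[OF R R]]) (use t in auto)
  finally have im: "\<bar>Im (E t)\<bar> \<le> 128 * M * \<bar>t / a\<bar> ^ 3" by simp
  have "norm (E t) \<le> norm (E t + c2 * of_real (t\<^sup>2)) + norm (c2 * of_real (t\<^sup>2))"
    using norm_triangle_ineq4[of "E t + c2 * of_real (t\<^sup>2)" "c2 * of_real (t\<^sup>2)"] by simp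
  also have "\<dots> \<le> 128 * M * \<bar>t / a\<bar> ^ 3 + 16 * M / a\<^sup>2 * t\<^sup>2"
    using R[OF t] mult_right_mono[OF c2, of "t\<^sup>2"] by (intro add_mono) (auto simp: norm_mult norm_power)
  also have "\<dots> \<le> 32 * M * (t / a)\<^sup>2"
  proof -
    have "\<bar>t / a\<bar> \<le> 1 / 8" using t a by (simp add: field_simps)
    then have "\<bar>t / a\<bar> ^ 2 * \<bar>t / a\<bar> \<le> \<bar>t / a\<bar> ^ 2 * (1 / 8)" by (intro mult_left_mono) auto
    then have "\<bar>t / a\<bar> ^ 3 \<le> (t / a)\<^sup>2 / 8" by (simp add: power3_eq_cube power2_eq_square)
    then have "128 * M * \<bar>t / a\<bar> ^ 3 \<le> 128 * M * ((t / a)\<^sup>2 / 8)" using M0 by (intro mult_left_mono) auto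
    then show ?thesis by (simp add: power_divide)
  qed
  finally have nE: "norm (E t) \<le> 32 * M * (t / a)\<^sup>2" .
  have "exp (E t) = exp (log_euler N (Complex a t)) / exp (log_euler N (of_real a)) * cis (t * V)"
    unfolding E_def by (simp add: exp_add exp_diff cis_conv_exp)
  also have "exp (log_euler N (Complex a t)) = (\<Prod>p\<in>primes_le N. euler_factor p (Complex a t))"
    using a by (simp add: exp_log_euler)
  also have "exp (log_euler N (of_real a)) = of_real (\<Prod>p\<in>primes_le N. 1 + euler_weight p a)"
    using a by (subst exp_log_euler) (auto simp: euler_factor_of_real)
  finally have "tilted_char_partial N a t = exp (E t)"
    unfolding tilted_char_partial_def V_def by simp
  then show ?thesis using that im nE by blast
qed

text \<open>All bounds are relative to the modulus. For W = exp E the imaginary part is |W| sin (Im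
  E) and the real part |W| cos (Im E); in this form they pass to the limit in N directly, without a
  logarithm of the limit function.\<close>

lemma tilted_char_central:
  obtains C where "C > 0" "\<forall>\<^sub>F a in at_right 0. \<forall>t. \<bar>t\<bar> \<le> a / 8 \<longrightarrow>
    \<bar>Im (tilted_char a t)\<bar> \<le> norm (tilted_char a t) * (C / (a * ln (1 / a)) * \<bar>t / a\<bar> ^ 3) \<and>
    norm (tilted_char a t) * (1 - (C / (a * ln (1 / a)) * \<bar>t / a\<bar> ^ 3)\<^sup>2 / 2) \<le> Re (tilted_char a t) \<and>
    exp (- (C / (a * ln (1 / a)) * (t / a)\<^sup>2)) \<le> norm (tilted_char a t)"
proof -
  obtain C0 where C0: "C0 > 0"
    "\<forall>\<^sub>F a in at_right 0. \<forall>N. (\<Sum>p\<in>primes_le N. ln (1 + euler_weight p a)) \<le> C0 / (a * ln (1 / a))"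
    by (rule ln_psi_series_bound) blast
  have fl: "filterlim (\<lambda>a::real. a / 2) (at_right 0) (at_right 0)" by real_asymp
  have e: "\<forall>\<^sub>F a in at_right 0. \<forall>N. (\<Sum>p\<in>primes_le N. ln (1 + euler_weight p (a / 2))) \<le> C0 / (a / 2 * ln (1 / (a / 2)))"
    using filterlim_iff[THEN iffD1, OF fl, rule_format, OF C0(2)] .
  have a01: "\<forall>\<^sub>F a in at_right (0::real). a \<in> {0<..<1}" by (rule eventually_at_right_real) simp
  \<comment> \<open>128 is the constant of \<open>tilted_char_partial_exp\<close>, 13 that of
    \<open>norm_Ln_le_ln\<close>, and 2 comes from bounding the logarithm at a / 2, the left end of
    the disc.\<close>
  define C where "C = 128 * (13 * (2 * C0))"
  show ?thesis
  proof (rule that[of C])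
    show "C > 0" using C0 by (simp add: C_def)
    show "\<forall>\<^sub>F a in at_right 0. \<forall>t. \<bar>t\<bar> \<le> a / 8 \<longrightarrow>
      \<bar>Im (tilted_char a t)\<bar> \<le> norm (tilted_char a t) * (C / (a * ln (1 / a)) * \<bar>t / a\<bar> ^ 3) \<and>
      norm (tilted_char a t) * (1 - (C / (a * ln (1 / a)) * \<bar>t / a\<bar> ^ 3)\<^sup>2 / 2) \<le> Re (tilted_char a t) \<and>
      exp (- (C / (a * ln (1 / a)) * (t / a)\<^sup>2)) \<le> norm (tilted_char a t)"
      using e a01
    proof (eventually_elim, intro allI impI)
      case (elim a)
      fix t assume t: "\<bar>t\<bar> \<le> a / 8"
      have a: "0 < a" "a < 1" using elim by auto
      define M where "M = 13 * (2 * C0) / (a * ln (1 / a))"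
      define W where "W = (\<lambda>N. tilted_char_partial N a t)"
      define w where "w = 128 * M * \<bar>t / a\<bar> ^ 3"
      have La: "ln (1 / a) > 0" using a by simp
      have M0: "M \<ge> 0" using C0 a La by (simp add: M_def)
      have CM: "C / (a * ln (1 / a)) = 128 * M" by (simp add: C_def M_def)
      have M: "13 * (\<Sum>p\<in>primes_le N. ln (1 + euler_weight p (a / 2))) \<le> M" for N
      proof -
        have "ln (1 / a) \<le> ln (1 / (a / 2))" using a by (intro ln_mono) (auto simp: field_simps)
        then have "C0 / (a / 2 * ln (1 / (a / 2))) \<le> C0 / (a / 2 * ln (1 / a))"
          using a La C0 by (intro divide_left_mono mult_left_mono mult_pos_pos) auto
        then have "(\<Sum>p\<in>primes_le N. ln (1 + euler_weight p (a / 2))) \<le> C0 / (a / 2 * ln (1 / a))"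
          using elim(1) by (meson order_trans)
        then show ?thesis by (simp add: M_def)
      qed
      have W: "\<bar>Im (W N)\<bar> \<le> norm (W N) * w \<and> norm (W N) * (1 - w\<^sup>2 / 2) \<le> Re (W N) \<and> exp (- (128 * M * (t / a)\<^sup>2)) \<le> norm (W N)" for N
      proof -
        obtain E where E: "W N = exp E" "\<bar>Im E\<bar> \<le> w" "norm E \<le> 32 * M * (t / a)\<^sup>2"
          using tilted_char_partial_exp[OF a(1) M t] unfolding W_def w_def by blast
        have nW: "norm (W N) = exp (Re E)" by (simp add: E)
        have "\<bar>Im (W N)\<bar> = norm (W N) * \<bar>sin (Im E)\<bar>" unfolding E(1) by (simp add: Im_exp abs_mult)
        also have "\<dots> \<le> norm (W N) * w" using abs_sin_x_le_abs_x[of "Im E"] E(2) by (intro mult_left_mono) auto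
        finally have 1: "\<bar>Im (W N)\<bar> \<le> norm (W N) * w" .
        have "1 - w\<^sup>2 / 2 \<le> cos (Im E)"
        proof -
          have "1 - (Im E)\<^sup>2 / 2 \<le> cos (Im E)"
          proof -
            have "cos (Im E) = 1 - 2 * (sin (Im E / 2))\<^sup>2" using cos_double_sin[of "Im E / 2"] by simp
            moreover have "(sin (Im E / 2))\<^sup>2 \<le> (Im E / 2)\<^sup>2"
              using abs_sin_x_le_abs_x[of "Im E / 2"] by (rule abs_le_square_iff[THEN iffD1])
            ultimately show ?thesis by (simp add: power_divide)
          qed
          moreover have "(Im E)\<^sup>2 \<le> w\<^sup>2" using E(2) by (intro abs_le_square_iff[THEN iffD1]) auto
          ultimately show ?thesis by linarith
        qed
        then have 2: "norm (W N) * (1 - w\<^sup>2 / 2) \<le> Re (W N)"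
          unfolding E(1) Re_exp norm_exp_eq_Re by (intro mult_left_mono) auto
        have "- (128 * M * (t / a)\<^sup>2) \<le> Re E"
        proof -
          have "\<bar>Re E\<bar> \<le> 32 * M * (t / a)\<^sup>2" using E(3) abs_Re_le_cmod[of E] by linarith
          moreover have "0 \<le> M * (t / a)\<^sup>2" using M0 by simp
          ultimately show ?thesis by linarith
        qed
        then have 3: "exp (- (128 * M * (t / a)\<^sup>2)) \<le> norm (W N)" unfolding nW by simp
        show ?thesis using 1 2 3 by blast
      qed
      have lim: "W \<longlonglongrightarrow> tilted_char a t" unfolding W_def by (rule tilted_char_limit[OF a(1)])
      have "\<bar>Im (tilted_char a t)\<bar> \<le> norm (tilted_char a t) * w"
        by (rule LIMSEQ_le[where X = "\<lambda>N. \<bar>Im (W N)\<bar>" and Y = "\<lambda>N. norm (W N) * w"]) (use W lim in \<open>auto intro!: tendsto_intros\<close>)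
      moreover have "norm (tilted_char a t) * (1 - w\<^sup>2 / 2) \<le> Re (tilted_char a t)"
        by (rule LIMSEQ_le[where Y = "\<lambda>N. Re (W N)" and X = "\<lambda>N. norm (W N) * (1 - w\<^sup>2 / 2)"]) (use W lim in \<open>auto intro!: tendsto_mult_right tendsto_norm tendsto_Re\<close>)
      moreover have "exp (- (128 * M * (t / a)\<^sup>2)) \<le> norm (tilted_char a t)"
        by (rule LIMSEQ_le_const[OF tendsto_norm[OF lim]]) (use W in auto)
      ultimately show "\<bar>Im (tilted_char a t)\<bar> \<le> norm (tilted_char a t) * (C / (a * ln (1 / a)) * \<bar>t / a\<bar> ^ 3) \<and>
        norm (tilted_char a t) * (1 - (C / (a * ln (1 / a)) * \<bar>t / a\<bar> ^ 3)\<^sup>2 / 2) \<le> Re (tilted_char a t) \<and>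
        exp (- (C / (a * ln (1 / a)) * (t / a)\<^sup>2)) \<le> norm (tilted_char a t)"
        unfolding CM w_def by blast
    qed
  qed
qed

section \<open>Decay of the characteristic function at moderate height\<close>

lemma one_minus_cos_ge:
  fixes x :: real assumes "\<bar>x\<bar> \<le> 1" shows "x\<^sup>2 / 4 \<le> 1 - cos x"
proof -
  have cos_ge: "1 - y\<^sup>2 / 2 \<le> cos y" for y :: real
  proof -
    have "cos y = 1 - 2 * (sin (y / 2))\<^sup>2" using cos_double_sin[of "y / 2"] by simp
    moreover have "(sin (y / 2))\<^sup>2 \<le> (y / 2)\<^sup>2"
      using abs_sin_x_le_abs_x[of "y / 2"] by (rule abs_le_square_iff[THEN iffD1])
    ultimately show ?thesis by (simp add: power_divide)
  qed
  have sin_ge: "y / 2 \<le> sin y" if "0 \<le> y" "y \<le> 1" for y :: real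
  proof -
    have "(\<lambda>y. sin y - y / 2) 0 \<le> (\<lambda>y. sin y - y / 2) y"
    proof (rule DERIV_nonneg_imp_nondecreasing[OF that(1)])
      fix u :: real assume u: "0 \<le> u" "u \<le> y"
      have "u\<^sup>2 \<le> 1" using u that by (simp add: power_le_one)
      then have "0 \<le> cos u - 1 / 2" using cos_ge[of u] by linarith
      moreover have "((\<lambda>y. sin y - y / 2) has_real_derivative (cos u - 1 / 2)) (at u)"
        by (auto intro!: derivative_eq_intros)
      ultimately show "\<exists>z. ((\<lambda>y. sin y - y / 2) has_real_derivative z) (at u) \<and> 0 \<le> z" by blast
    qed
    then show ?thesis by simp
  qed
  have pos: "x\<^sup>2 / 4 \<le> 1 - cos x" if "0 \<le> x" "x \<le> 1" for x :: real
  proof -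
    have "(\<lambda>x. 1 - cos x - x\<^sup>2 / 4) 0 \<le> (\<lambda>x. 1 - cos x - x\<^sup>2 / 4) x"
    proof (rule DERIV_nonneg_imp_nondecreasing[OF that(1)])
      fix u :: real assume u: "0 \<le> u" "u \<le> x"
      have "0 \<le> sin u - u / 2" using sin_ge[of u] u that by simp
      moreover have "((\<lambda>x. 1 - cos x - x\<^sup>2 / 4) has_real_derivative (sin u - u / 2)) (at u)"
        by (auto intro!: derivative_eq_intros)
      ultimately show "\<exists>z. ((\<lambda>x. 1 - cos x - x\<^sup>2 / 4) has_real_derivative z) (at u) \<and> 0 \<le> z" by blast
    qed
    then show ?thesis by simp
  qed
  show ?thesis using pos[of "\<bar>x\<bar>"] assms by simp
qed

lemma exp_minus_1_le: "0 \<le> h \<Longrightarrow> exp h - 1 \<le> h * exp (h::real)"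
proof -
  have "1 - h \<le> exp (- h)" using exp_ge_add_one_self[of "- h"] by simp
  then have "(1 - h) * exp h \<le> exp (- h) * exp h" by (intro mult_right_mono) auto
  then show ?thesis by (simp add: exp_minus algebra_simps)
qed

text \<open>As a ln p and |t| ln p are at most 1, one has |p^s - 1|^2 >= (p^a - 1)^2 (1 + u^2 / 6),
  so the part of the Euler factor beyond 1 shrinks by sqrt (1 + u^2 / 6). The assumption
  \<open>w1\<close> makes the real weight at most 1, so a fixed share of the gain survives the
  addition of 1. The second claim says that such primes have weights of full size.\<close>

lemma euler_factor_decay:
  assumes p: "prime p" and a: "a > 0" and h: "a * ln (real p) \<le> 1" and t: "\<bar>t\<bar> * ln (real p) \<le> 1"
    and w1: "1 \<le> a * (real p * ln (real p))"
  defines "u \<equiv> t / a"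
  shows "norm (euler_factor p (Complex a t)) \<le> (1 + euler_weight p a) * exp (- (euler_weight p a * (u\<^sup>2 / (24 * (1 + u\<^sup>2)))))"
    and "1 / (6 * a) * (1 / (real p * ln (real p))) \<le> euler_weight p a"
proof -
  define h where "h = a * ln (real p)"
  define P where "P = real p powr a"
  define w where "w = euler_weight p a"
  have p1: "real p > 1" using prime_gt_1_nat[OF p] by simp
  have p0: "p > 0" using prime_gt_0_nat[OF p] .
  have lp: "ln (real p) > 0" using p1 by simp
  have h: "0 < h" "h \<le> 1" using lp a h by (auto simp: h_def)
  have Pe: "P = exp h" using p1 by (simp add: P_def h_def powr_def)
  have P1: "P > 1" using h by (simp add: Pe)
  have P3: "P \<le> 3" using exp_le h order_trans[of "exp h" "exp 1" 3] by (simp add: Pe)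
  have Ph: "P - 1 \<le> h * P" using exp_minus_1_le[of h] h by (simp add: Pe)
  have w: "w > 0" unfolding w_def using euler_weight_bounds(1)[OF p a] .
  have "1 / a * (1 / (real p * ln (real p))) \<le> 1" using w1 a p1 lp by (simp add: divide_le_eq_1)
  then have wle: "w \<le> 1" using euler_weight_bounds(2)[OF p a] by (simp add: w_def)
  have "P - 1 \<le> 3 * h"
  proof -
    have "h * P \<le> h * 3" using P3 h by (intro mult_left_mono) auto
    then show ?thesis using Ph by simp
  qed
  then have "(real p + 1) * (P - 1) \<le> (2 * real p) * (3 * h)"
    using p1 P1 by (intro mult_mono) auto
  moreover have "0 < (real p + 1) * (P - 1)" using p1 P1 by (intro mult_pos_pos) auto
  ultimately have "1 / ((2 * real p) * (3 * h)) \<le> 1 / ((real p + 1) * (P - 1))"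
    by (intro frac_le) auto
  then show "1 / (6 * a) * (1 / (real p * ln (real p))) \<le> euler_weight p a"
    unfolding euler_weight_def P_def[symmetric] h_def by (simp add: mult_ac)
  define N where "N = norm (of_nat p powr Complex a t - 1 :: complex)"
  have "\<bar>t * ln (real p)\<bar> \<le> 1" using t lp by (simp add: abs_mult)
  then have c: "(t * ln (real p))\<^sup>2 / 4 \<le> 1 - cos (t * ln (real p))" by (rule one_minus_cos_ge)
  have hu: "h * u = t * ln (real p)" using a by (simp add: h_def u_def)
  have "N\<^sup>2 = (P - 1)\<^sup>2 + 2 * P * (1 - cos (t * ln (real p)))"
    unfolding N_def P_def by (rule norm_nat_powr_minus_1_sq[OF p0])
  moreover have "2 * P * ((h * u)\<^sup>2 / 4) \<le> 2 * P * (1 - cos (t * ln (real p)))"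
    using c P1 by (intro mult_left_mono) (auto simp: hu)
  moreover have "(P - 1)\<^sup>2 * (u\<^sup>2 / 6) \<le> 2 * P * ((h * u)\<^sup>2 / 4)"
  proof -
    have "(P - 1)\<^sup>2 \<le> (h * P)\<^sup>2" using Ph P1 by (intro power_mono) auto
    also have "\<dots> = h\<^sup>2 * (P * P)" by (simp add: power2_eq_square)
    also have "\<dots> \<le> h\<^sup>2 * (P * 3)" using P3 P1 by (intro mult_left_mono) auto
    finally have "(P - 1)\<^sup>2 * (u\<^sup>2 / 6) \<le> h\<^sup>2 * (P * 3) * (u\<^sup>2 / 6)" by (intro mult_right_mono) auto
    then show ?thesis by (simp add: power_mult_distrib)
  qed
  ultimately have "(P - 1)\<^sup>2 + (P - 1)\<^sup>2 * (u\<^sup>2 / 6) \<le> N\<^sup>2" by linarith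
  then have N2: "(P - 1)\<^sup>2 * (1 + u\<^sup>2 / 6) \<le> N\<^sup>2" by (simp add: distrib_left)
  define r where "r = sqrt (1 + u\<^sup>2 / 6)"
  have u0: "1 + u\<^sup>2 / 6 \<ge> 1" by simp
  have r: "r \<ge> 1" unfolding r_def by simp
  have r2: "r\<^sup>2 = 1 + u\<^sup>2 / 6" unfolding r_def by (rule real_sqrt_pow2) (use u0 in linarith)
  have "((P - 1) * r)\<^sup>2 \<le> N\<^sup>2" using N2 by (simp add: power_mult_distrib r2)
  then have Nr: "(P - 1) * r \<le> N" by (rule power2_le_imp_le) (simp add: N_def)
  have "norm (euler_factor p (Complex a t) - 1) = (1 / (real p + 1)) / N"
    unfolding euler_factor_def add_diff_cancel_left' norm_divide norm_of_real N_def by simp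
  also have "\<dots> \<le> (1 / (real p + 1)) / ((P - 1) * r)"
  proof -
    have "0 < (P - 1) * r" using P1 r by (intro mult_pos_pos) auto
    then show ?thesis using Nr by (intro frac_le) auto
  qed
  also have "\<dots> = w / r" unfolding w_def euler_weight_def P_def by simp
  finally have "norm (euler_factor p (Complex a t)) \<le> 1 + w / r"
    using norm_triangle_ineq[of 1 "euler_factor p (Complex a t) - 1"] by simp
  also have "1 + w / r = (1 + w) * (1 - (1 - 1 / r) * w / (1 + w))"
    using w by (simp add: field_simps)
  also have "\<dots> \<le> (1 + w) * exp (- (w * (u\<^sup>2 / (24 * (1 + u\<^sup>2)))))"
  proof (rule mult_left_mono)
    define d where "d = 1 - 1 / r"
    have "u\<^sup>2 / (12 * (1 + u\<^sup>2)) \<le> d"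
    proof -
      \<comment> \<open>The inequality of arithmetic and geometric means removes the square root in
        \<open>r\<close>.\<close>
      have "1 / r \<le> (1 + 1 / r\<^sup>2) / 2"
      proof -
        have "0 \<le> (1 - 1 / r)\<^sup>2" by simp
        then show ?thesis by (simp add: power2_eq_square algebra_simps)
      qed
      then have "(1 - 1 / r\<^sup>2) / 2 \<le> d" by (simp add: d_def field_simps)
      moreover have "u\<^sup>2 / (12 * (1 + u\<^sup>2)) \<le> (1 - 1 / r\<^sup>2) / 2"
      proof -
        have s: "u\<^sup>2 \<ge> 0" by simp
        have "1 + u\<^sup>2 > 0" "6 + u\<^sup>2 > 0" using s by linarith+
        have "(1 - 1 / r\<^sup>2) / 2 = u\<^sup>2 / (2 * (6 + u\<^sup>2))"
          unfolding r2 using \<open>6 + u\<^sup>2 > 0\<close> by (simp add: field_simps)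
        also have "\<dots> \<ge> u\<^sup>2 / (12 * (1 + u\<^sup>2))"
          using s by (intro frac_le) (auto simp: add_pos_nonneg)
        finally show ?thesis .
      qed
      ultimately show ?thesis by linarith
    qed
    then have "u\<^sup>2 / (12 * (1 + u\<^sup>2)) / 2 \<le> d / 2" by (rule divide_right_mono) simp
    moreover have "u\<^sup>2 / (12 * (1 + u\<^sup>2)) / 2 = u\<^sup>2 / (24 * (1 + u\<^sup>2))" by simp
    ultimately have "u\<^sup>2 / (24 * (1 + u\<^sup>2)) \<le> d / 2" by (simp only:)
    then have "w * (u\<^sup>2 / (24 * (1 + u\<^sup>2))) \<le> w * (d / 2)"
      by (rule mult_left_mono) (use w in simp)
    \<comment> \<open>Here w <= 1 gives 1 / (1 + w) >= 1/2, the second factor in 24 = 12 *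
      2.\<close>
    also have "\<dots> \<le> d * w / (1 + w)"
    proof -
      have "0 \<le> d" using r by (simp add: d_def)
      then have "d * w / 2 \<le> d * w / (1 + w)" using w wle by (intro divide_left_mono) auto
      then show ?thesis by (simp add: mult_ac)
    qed
    finally have le: "w * (u\<^sup>2 / (24 * (1 + u\<^sup>2))) \<le> d * w / (1 + w)" .
    have "1 - d * w / (1 + w) \<le> exp (- (d * w / (1 + w)))"
      using exp_ge_add_one_self[of "- (d * w / (1 + w))"] by simp
    also have "\<dots> \<le> exp (- (w * (u\<^sup>2 / (24 * (1 + u\<^sup>2)))))" using le by simp
    finally show "1 - (1 - 1 / r) * w / (1 + w) \<le> exp (- (w * (u\<^sup>2 / (24 * (1 + u\<^sup>2)))))" by (simp add: d_def)
  qed (use w in simp)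
  finally show "norm (euler_factor p (Complex a t)) \<le> (1 + euler_weight p a) * exp (- (euler_weight p a * (u\<^sup>2 / (24 * (1 + u\<^sup>2)))))"
    unfolding w_def .
qed

lemma norm_tilted_char_partial:
  "a > 0 \<Longrightarrow> norm (tilted_char_partial N a t) = (\<Prod>p\<in>primes_le N. norm (euler_factor p (Complex a t)) / (1 + euler_weight p a))"
proof -
  assume a: "a > 0"
  have "0 < (\<Prod>p\<in>primes_le N. 1 + euler_weight p a)"
    by (intro prod_pos add_pos_pos euler_weight_bounds(1)) (use a in \<open>auto simp: primes_leD\<close>)
  then show ?thesis unfolding tilted_char_partial_def
    by (simp only: norm_divide norm_mult norm_cis norm_of_real prod_norm[symmetric] prod_dividef abs_of_pos mult_1_right)
qed

text \<open>Only the primes between 1 / a and 1 / a^2 are used; every other factor is bounded by its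
  value at t = 0. By Mertens their weights sum to at least 1 / (24 a L) with L = ln (1 / a). Since
  ln p <= 2 L, the condition on t ensures |t| ln p <= 1. The constant is 576 = 24 * 24.\<close>

lemma tilted_char_decay:
  obtains c where "c > 0" "\<forall>\<^sub>F a in at_right 0. \<forall>t. \<bar>t\<bar> \<le> 1 / (2 * ln (1 / a)) \<longrightarrow>
    norm (tilted_char a t) \<le> exp (- (c / (a * ln (1 / a)) * ((t / a)\<^sup>2 / (1 + (t / a)\<^sup>2))))"
proof -
  obtain K where K: "K > 0"
    "\<And>Y Z. 2 \<le> Y \<Longrightarrow> Y \<le> Z \<Longrightarrow>
      1 / ln Y - 1 / ln Z - K / (ln Y)\<^sup>2 \<le> (\<Sum>p\<in>{p. prime p \<and> Y < real p \<and> real p \<le> Z}. 1 / (real p * ln (real p)))"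
    by (rule sum_prime_inverse_ln) blast
  have a01: "\<forall>\<^sub>F a in at_right (0::real). a \<in> {0<..<1}" by (rule eventually_at_right_real) simp
  have e1: "\<forall>\<^sub>F a in at_right (0::real). 3 \<le> 1 / a" by real_asymp
  have e2: "\<forall>\<^sub>F a in at_right (0::real). 2 * a * ln (1 / a) \<le> 1" by real_asymp
  have e3: "\<forall>\<^sub>F a in at_right (0::real). K / (ln (1 / a))\<^sup>2 \<le> 1 / (4 * ln (1 / a))" by real_asymp
  show ?thesis
  proof (rule that[of "1 / 576"])
    show "\<forall>\<^sub>F a in at_right 0. \<forall>t. \<bar>t\<bar> \<le> 1 / (2 * ln (1 / a)) \<longrightarrow>
      norm (tilted_char a t) \<le> exp (- (1 / 576 / (a * ln (1 / a)) * ((t / a)\<^sup>2 / (1 + (t / a)\<^sup>2))))"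
      using a01 e1 e2 e3
    proof (eventually_elim, intro allI impI)
      case (elim a)
      fix t assume t: "\<bar>t\<bar> \<le> 1 / (2 * ln (1 / a))"
      define L where "L = ln (1 / a)"
      define u where "u = t / a"
      define g where "g = u\<^sup>2 / (24 * (1 + u\<^sup>2))"
      have a: "0 < a" "a < 1" using elim by auto
      have L: "L > 0" using a by (simp add: L_def)
      have g: "g \<ge> 0" by (simp add: g_def)
      define A where "A = {p. prime p \<and> 1 / a < real p \<and> real p \<le> 1 / a\<^sup>2}"
      have AN: "A \<subseteq> primes_le N" if "N \<ge> nat \<lfloor>1 / a\<^sup>2\<rfloor>" for N
        using that le_nat_floor order_trans unfolding A_def primes_le_def by blast
      have finA: "finite A" using AN[of "nat \<lfloor>1 / a\<^sup>2\<rfloor>"] finite_primes_le finite_subset by blast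
      have pA: "a * ln (real p) \<le> 1" "\<bar>t\<bar> * ln (real p) \<le> 1" "1 \<le> a * (real p * ln (real p))" "prime p" if "p \<in> A" for p
      proof -
        have p: "prime p" "1 / a < real p" "real p \<le> 1 / a\<^sup>2" using that by (auto simp: A_def)
        show "prime p" by fact
        have "ln (real p) \<le> ln (1 / a\<^sup>2)" using p prime_gt_0_nat by (intro ln_mono) auto
        also have "ln (1 / a\<^sup>2) = 2 * L" using a by (simp add: L_def ln_div ln_realpow)
        finally have lp: "ln (real p) \<le> 2 * L" .
        have "exp 1 \<le> real p" using exp_le p elim by linarith
        then have lp1: "1 \<le> ln (real p)" using prime_gt_0_nat[OF p(1)] by (subst ln_ge_iff) auto
        have "a * ln (real p) \<le> a * (2 * L)" using lp a by (intro mult_left_mono) auto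
        then show "a * ln (real p) \<le> 1" using elim(3) by (simp add: L_def)
        have "\<bar>t\<bar> * ln (real p) \<le> 1 / (2 * L) * (2 * L)" using t lp lp1 L by (intro mult_mono) (auto simp: L_def)
        then show "\<bar>t\<bar> * ln (real p) \<le> 1" using L by simp
        have "1 \<le> a * real p" using p a by (simp add: field_simps)
        then have "1 * 1 \<le> (a * real p) * ln (real p)" using lp1 by (intro mult_mono) auto
        then show "1 \<le> a * (real p * ln (real p))" by simp
      qed
      define \<Sigma> where "\<Sigma> = (\<Sum>p\<in>A. euler_weight p a)"
      have Sg: "1 / (24 * (a * L)) \<le> \<Sigma>"
      proof -
        have "1 / a \<le> 1 / a\<^sup>2" using a by (simp add: power2_eq_square field_simps)
        then have "1 / ln (1 / a) - 1 / ln (1 / a\<^sup>2) - K / (ln (1 / a))\<^sup>2 \<le> (\<Sum>p\<in>A. 1 / (real p * ln (real p)))"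
          unfolding A_def using elim by (intro K(2)) auto
        moreover have "ln (1 / a\<^sup>2) = 2 * L" using a by (simp add: L_def ln_div ln_realpow)
        ultimately have "1 / L - 1 / (2 * L) - 1 / (4 * L) \<le> (\<Sum>p\<in>A. 1 / (real p * ln (real p)))"
          using elim(4) by (simp add: L_def)
        moreover have "1 / L - 1 / (2 * L) - 1 / (4 * L) = 1 / (4 * L)" using L by (simp add: field_simps)
        ultimately have "1 / (4 * L) \<le> (\<Sum>p\<in>A. 1 / (real p * ln (real p)))" by simp
        then have "1 / (6 * a) * (1 / (4 * L)) \<le> 1 / (6 * a) * (\<Sum>p\<in>A. 1 / (real p * ln (real p)))"
          using a by (intro mult_left_mono) auto
        also have "\<dots> = (\<Sum>p\<in>A. 1 / (6 * a) * (1 / (real p * ln (real p))))" by (simp only: sum_distrib_left)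
        also have "\<dots> \<le> \<Sigma>" unfolding \<Sigma>_def using pA a by (intro sum_mono euler_factor_decay(2)) auto
        finally show ?thesis by (simp add: mult_ac)
      qed
      have "norm (tilted_char_partial N a t) \<le> exp (- (\<Sigma> * g))" if N: "N \<ge> nat \<lfloor>1 / a\<^sup>2\<rfloor>" for N
      proof -
        have "norm (tilted_char_partial N a t) \<le> (\<Prod>p\<in>primes_le N. exp (- (if p \<in> A then euler_weight p a * g else 0)))"
          unfolding norm_tilted_char_partial[OF a(1)]
        proof (rule prod_mono)
          fix p assume "p \<in> primes_le N"
          then have p: "prime p" by (simp add: primes_leD)
          have w: "1 + euler_weight p a > 0" using euler_weight_bounds(1)[OF p a(1)] by simp
          show "0 \<le> norm (euler_factor p (Complex a t)) / (1 + euler_weight p a) \<and>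
            norm (euler_factor p (Complex a t)) / (1 + euler_weight p a) \<le> exp (- (if p \<in> A then euler_weight p a * g else 0))"
          proof (cases "p \<in> A")
            case True
            then show ?thesis using euler_factor_decay(1)[OF p a(1) pA(1-3)[OF True]] w
              unfolding g_def u_def by (simp add: divide_le_eq mult.commute)
          next
            case False
            then show ?thesis using norm_euler_factor_le[OF p, of "Complex a t"] a w by simp
          qed
        qed
        also have "\<dots> = exp (- (\<Sum>p\<in>primes_le N. if p \<in> A then euler_weight p a * g else 0))"
          by (simp add: exp_sum[symmetric] sum_negf)
        also have "(\<Sum>p\<in>primes_le N. if p \<in> A then euler_weight p a * g else 0) = \<Sigma> * g"
          unfolding \<Sigma>_def sum_distrib_right using AN[OF N] by (simp add: sum.If_cases Int_absorb1)
        finally show ?thesis .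
      qed
      then have "norm (tilted_char a t) \<le> exp (- (\<Sigma> * g))"
        by (intro LIMSEQ_le_const2[OF tendsto_norm[OF tilted_char_limit[OF a(1)]]]) blast
      also have "\<dots> \<le> exp (- (1 / (24 * (a * L)) * g))" using mult_right_mono[OF Sg g] by (simp only: exp_le_cancel_iff neg_le_iff_le)
      also have "1 / (24 * (a * L)) * g = 1 / 576 / (a * L) * (u\<^sup>2 / (1 + u\<^sup>2))" unfolding g_def by simp
      finally show "norm (tilted_char a t) \<le> exp (- (1 / 576 / (a * ln (1 / a)) * ((t / a)\<^sup>2 / (1 + (t / a)\<^sup>2))))"
        unfolding L_def u_def .
    qed
  qed simp
qed

section \<open>Zeta bounds and decay at large height\<close>

text \<open>This is zeta(1 + s): the argument is shifted so that the pole lies at s = 0.\<close>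

definition zeta_series :: "complex \<Rightarrow> complex" where
  "zeta_series s = (\<Sum>n. dirichlet_term (\<lambda>_. 1) (1 + s) n)"

lemma kernel_coeff_1 [simp]: "kernel_coeff (\<lambda>_. 1) n = 1"
  by (simp add: kernel_coeff_def)

lemma zeta_factor_weight_le:
  assumes "prime p" "a > 0"
  shows "0 < 1 / (real p powr (1 + a) - 1)" "1 / (real p powr (1 + a) - 1) \<le> 1 / a * (1 / (real p * ln (real p)))"
proof -
  have p: "real p > 1" using prime_gt_1_nat[OF assms(1)] by simp
  have lp: "ln (real p) > 0" using p by simp
  show "0 < 1 / (real p powr (1 + a) - 1)" using prime_powr_gt_1[OF assms(1), of "1 + a"] assms by simp
  have "real p * (a * ln (real p)) \<le> real p * (real p powr a - 1)"
    using powr_minus_1_ge[of "real p" a] p by (intro mult_left_mono) auto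
  also have "\<dots> \<le> real p powr (1 + a) - 1" using p by (simp add: powr_add algebra_simps)
  finally have "1 / (real p powr (1 + a) - 1) \<le> 1 / (real p * (a * ln (real p)))"
    using p lp assms by (intro frac_le) auto
  then show "1 / (real p powr (1 + a) - 1) \<le> 1 / a * (1 / (real p * ln (real p)))" by (simp add: mult_ac)
qed

lemma zeta_prod_bounded:
  assumes "a > 0"
  obtains C where "\<And>N. (\<Prod>p\<in>primes_le N. 1 + 1 / (real p powr (1 + a) - 1)) \<le> C"
proof -
  obtain T where T: "T > 0" "\<And>N. (\<Sum>p\<in>primes_le N. 1 / (real p * ln (real p))) \<le> T"
    using sum_prime_inverse_ln_bounded by blast
  have "(\<Prod>p\<in>primes_le N. 1 + 1 / (real p powr (1 + a) - 1)) \<le> exp (1 / a * T)" for N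
  proof -
    have "(\<Prod>p\<in>primes_le N. 1 + 1 / (real p powr (1 + a) - 1)) \<le> exp (\<Sum>p\<in>primes_le N. 1 / (real p powr (1 + a) - 1))"
      by (rule prod_one_plus_le_exp, rule less_imp_le, rule zeta_factor_weight_le(1)) (use assms in \<open>auto simp: primes_leD\<close>)
    also have "(\<Sum>p\<in>primes_le N. 1 / (real p powr (1 + a) - 1)) \<le> (\<Sum>p\<in>primes_le N. 1 / a * (1 / (real p * ln (real p))))"
      by (intro sum_mono zeta_factor_weight_le(2)) (use assms in \<open>auto simp: primes_leD\<close>)
    also have "\<dots> = 1 / a * (\<Sum>p\<in>primes_le N. 1 / (real p * ln (real p)))" by (simp only: sum_distrib_left)
    also have "\<dots> \<le> 1 / a * T" using T(2)[of N] assms by (intro mult_left_mono) auto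
    finally show ?thesis by simp
  qed
  then show ?thesis using that by blast
qed

lemma zeta_series_props:
  assumes "Re s > 0"
  shows "summable (\<lambda>n. norm (dirichlet_term (\<lambda>_. 1) (1 + s) n))"
    and "(\<lambda>N. \<Prod>p\<in>primes_le N. 1 + 1 / (of_nat p powr (1 + s) - 1)) \<longlonglongrightarrow> zeta_series s"
proof -
  obtain C where C: "\<And>N. (\<Prod>p\<in>primes_le N. 1 + 1 / (real p powr (1 + Re s) - 1)) \<le> C"
    using zeta_prod_bounded[OF assms] by blast
  from dirichlet_euler_product[of "\<lambda>_. 1" "1 + s" C] C assms
  show "summable (\<lambda>n. norm (dirichlet_term (\<lambda>_. 1) (1 + s) n))"
    "(\<lambda>N. \<Prod>p\<in>primes_le N. 1 + 1 / (of_nat p powr (1 + s) - 1)) \<longlonglongrightarrow> zeta_series s"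
    by (simp_all add: zeta_series_def)
qed

text \<open>The last claim, zeta(1 + a) >= 1 / a, follows by telescoping n^(-a). It turns the
  normalising zeta values in \<open>tilted_char_le_zeta\<close> into powers of a.\<close>

lemma zeta_real_props:
  assumes "a > 0"
  shows "summable (\<lambda>n. real n powr (- (1 + a)))"
    and "(\<lambda>N. \<Prod>p\<in>primes_le N. 1 + 1 / (real p powr (1 + a) - 1)) \<longlonglongrightarrow> (\<Sum>n. real n powr (- (1 + a)))"
    and "(\<Prod>p\<in>primes_le N. 1 + 1 / (real p powr (1 + a) - 1)) \<le> (\<Sum>n. real n powr (- (1 + a)))"
    and "1 / a \<le> (\<Sum>n. real n powr (- (1 + a)))"
proof -
  obtain C where C: "\<And>N. (\<Prod>p\<in>primes_le N. 1 + 1 / (real p powr (1 + a) - 1)) \<le> C"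
    using zeta_prod_bounded[OF assms] by blast
  from dirichlet_euler_product_real[of "\<lambda>_. 1" "1 + a" C] C assms
  show summ: "summable (\<lambda>n. real n powr (- (1 + a)))"
    and L: "(\<lambda>N. \<Prod>p\<in>primes_le N. 1 + 1 / (real p powr (1 + a) - 1)) \<longlonglongrightarrow> (\<Sum>n. real n powr (- (1 + a)))"
    by simp_all
  have inc: "incseq (\<lambda>N. \<Prod>p\<in>primes_le N. 1 + 1 / (real p powr (1 + a) - 1))"
  proof (rule incseq_SucI)
    fix N
    have "0 \<le> (\<Prod>p\<in>primes_le N. 1 + 1 / (real p powr (1 + a) - 1))"
      by (intro prod_nonneg add_nonneg_nonneg less_imp_le[OF zeta_factor_weight_le(1)])
         (use assms in \<open>auto simp: primes_leD\<close>)
    moreover have "0 < 1 / (real (Suc N) powr (1 + a) - 1)" if "prime (Suc N)" using that assms by (rule zeta_factor_weight_le)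
    moreover have "Suc N \<notin> primes_le N" by (auto simp: primes_le_def)
    ultimately show "(\<Prod>p\<in>primes_le N. 1 + 1 / (real p powr (1 + a) - 1)) \<le> (\<Prod>p\<in>primes_le (Suc N). 1 + 1 / (real p powr (1 + a) - 1))"
      by (auto simp: primes_le_Suc distrib_right simp del: of_nat_Suc)
  qed
  show "(\<Prod>p\<in>primes_le N. 1 + 1 / (real p powr (1 + a) - 1)) \<le> (\<Sum>n. real n powr (- (1 + a)))"
    by (rule incseq_le[OF inc L])
  have term_ge: "real n powr (- a) - real (Suc n) powr (- a) \<le> a * real n powr (- (1 + a))" if "n \<ge> 1" for n
  proof -
    have n: "real n > 0" using that by simp
    have "1 - a / real n \<le> (real (Suc n) / real n) powr (- a)"
    proof -
      have "ln (real (Suc n) / real n) \<le> 1 / real n"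
        using ln_diff_le_inverse[OF that] n by (simp add: ln_div)
      then have "- a / real n \<le> - a * ln (real (Suc n) / real n)" using assms mult_left_mono[of _ "1 / real n" a] by simp
      also have "1 + (- a * ln (real (Suc n) / real n)) \<le> exp (- a * ln (real (Suc n) / real n))" by (rule exp_ge_add_one_self)
      also have "\<dots> = (real (Suc n) / real n) powr (- a)" using n by (simp add: powr_def)
      finally show ?thesis by simp
    qed
    then have "(1 - a / real n) * real n powr (- a) \<le> (real (Suc n) / real n) powr (- a) * real n powr (- a)"
      by (intro mult_right_mono) auto
    also have "\<dots> = real (Suc n) powr (- a)" using n by (simp add: powr_divide powr_minus field_simps)
    finally have "real n powr (- a) - real (Suc n) powr (- a) \<le> a / real n * real n powr (- a)" by (simp add: algebra_simps)
    also have "a / real n * real n powr (- a) = a * (real n powr (- 1) * real n powr (- a))" using n by (simp add: powr_minus divide_inverse)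
    also have "\<dots> = a * real n powr (- (1 + a))" by (simp only: minus_add_distrib powr_add)
    finally show ?thesis .
  qed
  have tel: "1 - real (Suc N) powr (- a) \<le> a * (\<Sum>n\<le>N. real n powr (- (1 + a)))" for N
  proof (induction N)
    case (Suc N)
    then show ?case using term_ge[of "Suc N"] by (simp add: distrib_left del: of_nat_Suc)
  qed simp
  have "(\<lambda>N. 1 - real (Suc N) powr (- a)) \<longlonglongrightarrow> 1" using assms by real_asymp
  moreover have "(\<lambda>N. a * (\<Sum>n\<le>N. real n powr (- (1 + a)))) \<longlonglongrightarrow> a * (\<Sum>n. real n powr (- (1 + a)))"
    by (intro tendsto_mult_left summable_LIMSEQ' summ)
  ultimately have "1 \<le> a * (\<Sum>n. real n powr (- (1 + a)))"
    by (rule LIMSEQ_le) (use tel in auto)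
  then show "1 / a \<le> (\<Sum>n. real n powr (- (1 + a)))" using assms by (simp add: field_simps)
qed

section \<open>Growth of zeta to the right of its pole\<close>

lemma vector_derivative_bound:
  fixes f :: "real \<Rightarrow> 'b::real_normed_vector"
  assumes "convex S" "\<And>x. x \<in> S \<Longrightarrow> (f has_vector_derivative f' x) (at x within S)"
    "\<And>x. x \<in> S \<Longrightarrow> norm (f' x) \<le> B" "x \<in> S" "y \<in> S"
  shows "norm (f x - f y) \<le> B * norm (x - y)"
proof (rule differentiable_bound[OF assms(1) _ _ assms(4,5)])
  show "(f has_derivative (\<lambda>h. h *\<^sub>R f' z)) (at z within S)" if "z \<in> S" for z
    using assms(2)[OF that] by (simp add: has_vector_derivative_def)
  show "onorm (\<lambda>h. h *\<^sub>R f' z) \<le> B" if "z \<in> S" for z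
  proof (rule onorm_bound)
    show "0 \<le> B" using order_trans[OF norm_ge_zero assms(3)[OF that]] .
    show "norm (h *\<^sub>R f' z) \<le> B * norm h" for h
      using mult_right_mono[OF assms(3)[OF that], of "\<bar>h\<bar>"] by (simp add: mult.commute)
  qed
qed

lemma has_vector_derivative_of_real_powr:
  "x > 0 \<Longrightarrow> ((\<lambda>x. of_real x powr w :: complex) has_vector_derivative (w * of_real x powr (w - 1))) (at x within S)"
  by (rule has_vector_derivative_at_within, rule has_vector_derivative_real_field)
     (auto intro!: derivative_eq_intros)

text \<open>First-order Taylor expansion of x^(-s) on [n, n + 1]: s times a term of the zeta series
  is a telescoping difference up to O(1 / n^2).\<close>

lemma powr_increment_bound:
  fixes s :: complex
  assumes n: "n \<ge> 1" and s: "Re s > 0"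
  shows "norm (s * of_nat n powr (- (1 + s)) - (of_nat n powr (- s) - of_nat (Suc n) powr (- s))) \<le> norm s * norm (1 + s) * (1 / (real n)\<^sup>2)"
proof -
  define I where "I = {real n..real n + 1}"
  have pos: "x > 0" if "x \<in> I" for x using that n by (auto simp: I_def)
  have inner: "norm (of_real x powr (- (1 + s)) - of_real (real n) powr (- (1 + s)) :: complex) \<le> norm (1 + s) * (1 / (real n)\<^sup>2)" if "x \<in> I" for x
  proof -
    have "norm (of_real x powr (- (1 + s)) - of_real (real n) powr (- (1 + s)) :: complex) \<le> (norm (1 + s) * (1 / (real n)\<^sup>2)) * norm (x - real n)"
    proof (rule vector_derivative_bound[where S = I])
      show "convex I" by (simp add: I_def)
      show "((\<lambda>x. of_real x powr (- (1 + s)) :: complex) has_vector_derivative ((- (1 + s)) * of_real y powr (- (1 + s) - 1))) (at y within I)" if "y \<in> I" for y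
        using pos[OF that] by (rule has_vector_derivative_of_real_powr)
      show "norm ((- (1 + s)) * of_real y powr (- (1 + s) - 1) :: complex) \<le> norm (1 + s) * (1 / (real n)\<^sup>2)" if y: "y \<in> I" for y
      proof -
        have "norm (of_real y powr (- (1 + s) - 1) :: complex) = y powr (- (2 + Re s))"
          using pos[OF y] by (simp add: norm_powr_real_powr)
        also have "\<dots> \<le> y powr (- 2)" using y n s by (intro powr_mono) (auto simp: I_def)
        also have "\<dots> = 1 / y\<^sup>2" using pos[OF y] by (simp add: powr_minus powr_numeral divide_inverse)
        also have "\<dots> \<le> 1 / (real n)\<^sup>2" using y n by (intro frac_le power_mono) (auto simp: I_def)
        finally show ?thesis unfolding norm_mult norm_minus_cancel by (intro mult_left_mono) auto
      qed
      show "x \<in> I" "real n \<in> I" using that by (auto simp: I_def)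
    qed
    also have "\<dots> \<le> (norm (1 + s) * (1 / (real n)\<^sup>2)) * 1" using that by (intro mult_left_mono) (auto simp: I_def)
    finally show ?thesis by simp
  qed
  have A: "norm (of_real (real n + 1) powr (- s) - of_real (real n) powr (- s) - ((real n + 1) - real n) *\<^sub>R ((- s) * of_real (real n) powr (- s - 1)))
     \<le> norm ((real n + 1) - real n) * (norm s * (norm (1 + s) * (1 / (real n)\<^sup>2)))"
  proof (rule vector_differentiable_bound_linearization[where S = I])
    show "((\<lambda>x. of_real x powr (- s) :: complex) has_vector_derivative ((- s) * of_real y powr (- s - 1))) (at y within I)" if "y \<in> I" for y
      using pos[OF that] by (rule has_vector_derivative_of_real_powr)
    show "norm ((- s) * of_real y powr (- s - 1) - (- s) * of_real (real n) powr (- s - 1)) \<le> norm s * (norm (1 + s) * (1 / (real n)\<^sup>2))" if "y \<in> I" for y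
    proof -
      have "- s - 1 = - (1 + s)" by simp
      then have "(- s) * of_real y powr (- s - 1) - (- s) * of_real (real n) powr (- s - 1) =
          (- s) * (of_real y powr (- (1 + s)) - of_real (real n) powr (- (1 + s)))"
        by (simp only: right_diff_distrib)
      then show ?thesis using inner[OF that] by (simp only: norm_mult norm_minus_cancel) (intro mult_left_mono, auto)
    qed
    show "closed_segment (real n) (real n + 1) \<subseteq> I" by (simp add: I_def closed_segment_eq_real_ivl)
    show "real n \<in> I" by (auto simp: I_def)
  qed
  have B: "of_real (real n + 1) powr (- s) - of_real (real n) powr (- s) - ((real n + 1) - real n) *\<^sub>R ((- s) * of_real (real n) powr (- s - 1))
     = s * of_nat n powr (- (1 + s)) - (of_nat n powr (- s) - of_nat (Suc n) powr (- s))"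
  proof -
    have e: "- s - 1 = - (1 + s)" by simp
    show ?thesis unfolding e by (simp add: add.commute)
  qed
  show ?thesis using A unfolding B by (simp add: mult.assoc)
qed

lemma dirichlet_term_1: "dirichlet_term (\<lambda>_. 1) s n = of_nat n powr (- s)"
  by (simp add: dirichlet_term_def)

lemma sum_inverse_le: "(\<Sum>n=1..N. 1 / real n) \<le> 1 + ln (real N)" if "N \<ge> 1"
  using that
proof (induction N rule: dec_induct)
  case (step N)
  have "1 / real (Suc N) \<le> ln (real (Suc N)) - ln (real N)"
  proof -
    have "ln (real N / real (Suc N)) \<le> real N / real (Suc N) - 1" using step by (intro ln_le_minus_one) auto
    also have "\<dots> = - 1 / real (Suc N)" by (simp add: field_simps)
    finally show ?thesis using step by (simp add: ln_div del: of_nat_Suc)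
  qed
  then show ?case using step by simp
qed simp

text \<open>The terms up to N are bounded by the harmonic sum. The tail, multiplied by s, telescopes
  up to |s| |1 + s| / N; division by s leaves the pole term 1 / |s| and |1 + s| / N. With N of the
  order of |t| the bound is logarithmic in t.\<close>

lemma norm_zeta_series_le:
  assumes s: "Re s > 0" and N: "N \<ge> 1"
  shows "norm (zeta_series s) \<le> 1 + ln (real N) + 1 / norm s + norm (1 + s) / real N"
proof -
  define z where "z = (\<lambda>n. of_nat n powr (- (1 + s)) :: complex)"
  have s0: "s \<noteq> 0" using s by auto
  have summ: "summable (\<lambda>n. norm (z n))" using zeta_series_props(1)[OF s] by (simp add: z_def dirichlet_term_1)
  have nz: "norm (z n) = real n powr (- (1 + Re s))" for n by (simp add: z_def norm_powr_real_powr)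
  have Z: "zeta_series s = suminf z" by (simp add: zeta_series_def z_def dirichlet_term_1)
  have split: "suminf z = (\<Sum>n. z (n + Suc N)) + (\<Sum>n<Suc N. z n)"
    by (rule suminf_split_initial_segment[OF summable_norm_cancel[OF summ]])
  have "norm (\<Sum>n<Suc N. z n) \<le> (\<Sum>n<Suc N. norm (z n))" by (rule norm_sum)
  also have "\<dots> = (\<Sum>n=1..N. norm (z n))"
    by (rule sum.mono_neutral_right) (auto simp: z_def not_le)
  also have "\<dots> \<le> (\<Sum>n=1..N. 1 / real n)"
  proof (rule sum_mono)
    fix n assume n: "n \<in> {1..N}"
    have "norm (z n) \<le> real n powr (- 1)" unfolding nz using n s by (intro powr_mono) auto
    then show "norm (z n) \<le> 1 / real n" using n by (simp add: powr_minus divide_inverse)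
  qed
  also have "\<dots> \<le> 1 + ln (real N)" by (rule sum_inverse_le[OF N])
  finally have A: "norm (\<Sum>n<Suc N. z n) \<le> 1 + ln (real N)" .
  define d where "d = (\<lambda>n. (of_nat (n + Suc N) powr (- s) - of_nat (Suc (n + Suc N)) powr (- s)) :: complex)"
  have dsums: "d sums (of_nat (Suc N) powr (- s))"
  proof -
    have "(\<lambda>n. of_nat n powr (- s) :: complex) \<longlonglongrightarrow> 0"
    proof (rule tendsto_norm_zero_cancel)
      have "(\<lambda>n. real n powr (- Re s)) \<longlonglongrightarrow> 0" using s by real_asymp
      then show "(\<lambda>n. norm (of_nat n powr (- s) :: complex)) \<longlonglongrightarrow> 0" by (simp add: norm_powr_real_powr)
    qed
    then have "(\<lambda>n. of_nat (n + Suc N) powr (- s) :: complex) \<longlonglongrightarrow> 0" by (rule LIMSEQ_ignore_initial_segment)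
    from telescope_sums'[OF this] show ?thesis by (simp add: d_def)
  qed
  \<comment> \<open>A telescoping majorant for the errors of order 1 / (n + N + 1)^2.\<close>
  define e where "e = (\<lambda>n. norm s * norm (1 + s) * (1 / real (n + N) - 1 / real (Suc n + N)))"
  have esums: "e sums (norm s * norm (1 + s) * (1 / real N))"
  proof -
    have "(\<lambda>n. 1 / real (n + N)) \<longlonglongrightarrow> 0" by real_asymp
    from telescope_sums'[OF this] show ?thesis unfolding e_def by (intro sums_mult) simp
  qed
  have bound: "norm (s * z (n + Suc N) - d n) \<le> e n" for n
  proof -
    have "norm (s * z (n + Suc N) - d n) \<le> norm s * norm (1 + s) * (1 / (real (n + Suc N))\<^sup>2)"
      unfolding z_def d_def by (rule powr_increment_bound[OF _ s]) simp
    also have "\<dots> \<le> e n"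
      unfolding e_def
    proof (intro mult_left_mono mult_nonneg_nonneg norm_ge_zero)
      have "1 / real (n + N) - 1 / real (Suc n + N) = 1 / (real (n + N) * real (n + Suc N))"
        using N by (simp add: field_simps)
      also have "\<dots> \<ge> 1 / (real (n + Suc N))\<^sup>2"
        unfolding power2_eq_square using N by (intro frac_le mult_right_mono) auto
      finally show "1 / (real (n + Suc N))\<^sup>2 \<le> 1 / real (n + N) - 1 / real (Suc n + N)" .
    qed
    finally show ?thesis .
  qed
  have zs: "(\<lambda>n. z (n + Suc N)) sums (\<Sum>n. z (n + Suc N))"
    by (intro summable_sums summable_ignore_initial_segment summable_norm_cancel[OF summ])
  have "(\<lambda>n. s * z (n + Suc N) - d n) sums (s * (\<Sum>n. z (n + Suc N)) - of_nat (Suc N) powr (- s))"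
    by (intro sums_diff sums_mult zs dsums)
  then have "norm (s * (\<Sum>n. z (n + Suc N)) - of_nat (Suc N) powr (- s)) \<le> norm s * norm (1 + s) * (1 / real N)"
    using norm_suminf_le[OF bound sums_summable[OF esums]] esums by (simp add: sums_iff)
  moreover have "norm (of_nat (Suc N) powr (- s) :: complex) \<le> 1"
  proof -
    have "norm (of_nat (Suc N) powr (- s) :: complex) = real (Suc N) powr (- Re s)" by (subst norm_powr_real_powr) (simp_all del: of_nat_Suc)
    also have "\<dots> \<le> real (Suc N) powr 0" using s by (intro powr_mono) auto
    finally show ?thesis by simp
  qed
  ultimately have "norm (s * (\<Sum>n. z (n + Suc N))) \<le> norm s * norm (1 + s) * (1 / real N) + 1"
    using norm_triangle_sub[of "s * (\<Sum>n. z (n + Suc N))" "of_nat (Suc N) powr (- s)"] by linarith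
  then have "norm (\<Sum>n. z (n + Suc N)) \<le> norm (1 + s) / real N + 1 / norm s"
    using s0 by (simp add: norm_mult field_simps)
  then show ?thesis unfolding Z split using A norm_triangle_ineq[of "\<Sum>n. z (n + Suc N)" "\<Sum>n<Suc N. z n"] by linarith
qed

text \<open>Here z stands for p^(-s), \<open>e\<close> for 1 / p and \<open>q\<close> for 1 / (p +
  1). Multiplying the Euler factor of \<Phi> by the inverse zeta factors for j = 1, 2, 3 cancels the
  terms in z, z^2 and z^3 up to O(1 / p^2). The remaining multiple of z^4 / (1 - z) is kept exactly,
  because z may be close to 1. The constant is 44 = 3 + 9 + 8 + 24, from \<open>T1\<close> to
  \<open>T4\<close>.\<close>

lemma euler_poly_estimate:
  fixes z e q :: complex and \<epsilon> :: real
  assumes z: "norm z < 1" and e: "norm e = \<epsilon>" "\<epsilon> \<le> 1 / 2" and q: "norm q \<le> \<epsilon>" "norm q \<le> 1 / 3" "norm (q - e) \<le> \<epsilon>\<^sup>2"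
  shows "norm ((1 + q * (z / (1 - z))) * ((1 - z * e) * (1 - z\<^sup>2 * e) * (1 - z ^ 3 * e)) -
           (1 + q * ((1 - e) ^ 3) * (z ^ 4 / (1 - z)))) \<le> 44 * \<epsilon>\<^sup>2"
proof -
  define i where "i = 1 / (1 - z)"
  define A where "A = z + z\<^sup>2 + z ^ 3"
  define B where "B = z ^ 3 + z ^ 4 + z ^ 5"
  define P where "P = (1 - z * e) * (1 - z\<^sup>2 * e) * (1 - z ^ 3 * e)"
  define R1 where "R1 = 3 + 2 * z + z\<^sup>2"
  define R2 where "R2 = 3 + 3 * z + 3 * z\<^sup>2 + 2 * z ^ 3 + z ^ 4"
  define R3 where "R3 = 1 + z + z\<^sup>2 + z ^ 3 + z ^ 4 + z ^ 5"
  define R where "R = e * R1 - e\<^sup>2 * R2 + e ^ 3 * R3"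
  have z1: "1 - z \<noteq> 0" using z by auto
  have i: "i * (1 - z) = 1" using z1 by (simp add: i_def)
  have h1: "z * i = A + z ^ 4 * i" using i unfolding A_def by algebra
  \<comment> \<open>At z = 1 the polynomial \<open>P\<close> equals (1 - e)^3; the rest carries a
    factor 1 - z, which cancels the pole.\<close>
  have h2: "P = (1 - e) ^ 3 + (1 - z) * R" unfolding P_def R_def R1_def R2_def R3_def by algebra
  have h3: "(1 + q * A) * P = 1 + ((q - e) * A - q * e * A\<^sup>2) + (1 + q * A) * (e\<^sup>2 * B - e ^ 3 * z ^ 6)"
    unfolding P_def A_def B_def by algebra
  have "(1 + q * (z * i)) * P - (1 + q * ((1 - e) ^ 3) * (z ^ 4 * i)) =
      ((q - e) * A - q * e * A\<^sup>2) + (1 + q * A) * (e\<^sup>2 * B - e ^ 3 * z ^ 6) + q * z ^ 4 * R"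
  proof -
    have "(1 + q * (z * i)) * P = (1 + q * A) * P + q * z ^ 4 * (i * P)" unfolding h1 by algebra
    moreover have "i * P = i * (1 - e) ^ 3 + R" unfolding h2 using i by algebra
    ultimately show ?thesis using h3 by algebra
  qed
  moreover have "norm (((q - e) * A - q * e * A\<^sup>2) + (1 + q * A) * (e\<^sup>2 * B - e ^ 3 * z ^ 6) + q * z ^ 4 * R) \<le> 44 * \<epsilon>\<^sup>2"
  proof -
    have e0: "0 \<le> \<epsilon>" using e norm_ge_zero[of e] by simp
    have zk: "norm (z ^ k) \<le> 1" for k using z by (simp add: norm_power power_le_one)
    have A: "norm A \<le> 3" unfolding A_def
      using zk[of 1] zk[of 2] zk[of 3] norm_triangle_ineq[of "z + z\<^sup>2" "z ^ 3"] norm_triangle_ineq[of z "z\<^sup>2"] by simp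
    have B: "norm B \<le> 3" unfolding B_def
      using zk[of 3] zk[of 4] zk[of 5] norm_triangle_ineq[of "z ^ 3 + z ^ 4" "z ^ 5"] norm_triangle_ineq[of "z ^ 3" "z ^ 4"] by simp
    have m: "norm (of_nat k * z ^ j) \<le> real k" for k j
      unfolding norm_mult norm_of_nat using mult_left_mono[OF zk[of j], of "real k"] by simp
    have R1: "norm R1 \<le> 6"
      unfolding R1_def using zk[of 2] m[of 2 1] norm_triangle_ineq[of "3 + 2 * z" "z\<^sup>2"] norm_triangle_ineq[of 3 "2 * z"] by simp
    have R2: "norm R2 \<le> 12"
      unfolding R2_def using m[of 3 1] m[of 3 2] m[of 2 3] zk[of 4]
        norm_triangle_ineq[of "3 + 3 * z + 3 * z\<^sup>2 + 2 * z ^ 3" "z ^ 4"] norm_triangle_ineq[of "3 + 3 * z + 3 * z\<^sup>2" "2 * z ^ 3"]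
        norm_triangle_ineq[of "3 + 3 * z" "3 * z\<^sup>2"] norm_triangle_ineq[of 3 "3 * z"] by simp
    have R3: "norm R3 \<le> 6"
      unfolding R3_def using zk[of 1] zk[of 2] zk[of 3] zk[of 4] zk[of 5]
        norm_triangle_ineq[of "1 + z + z\<^sup>2 + z ^ 3 + z ^ 4" "z ^ 5"] norm_triangle_ineq[of "1 + z + z\<^sup>2 + z ^ 3" "z ^ 4"]
        norm_triangle_ineq[of "1 + z + z\<^sup>2" "z ^ 3"] norm_triangle_ineq[of "1 + z" "z\<^sup>2"] norm_triangle_ineq[of 1 z] by simp
    have e2: "\<epsilon>\<^sup>2 \<le> \<epsilon>" using e0 e power_decreasing[of 1 2 \<epsilon>] by simp
    have e3: "\<epsilon> ^ 3 \<le> \<epsilon>\<^sup>2" using e0 e power_decreasing[of 2 3 \<epsilon>] by simp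
    have R: "norm R \<le> 24 * \<epsilon>"
    proof -
      have "norm (e * R1) \<le> \<epsilon> * 6" unfolding norm_mult e(1) using R1 e0 by (intro mult_left_mono)
      moreover have "norm (e\<^sup>2 * R2) \<le> \<epsilon>\<^sup>2 * 12" unfolding norm_mult norm_power e(1) using R2 by (intro mult_left_mono) auto
      moreover have "norm (e ^ 3 * R3) \<le> \<epsilon> ^ 3 * 6" unfolding norm_mult norm_power e(1) using R3 e0 by (intro mult_left_mono) auto
      ultimately show ?thesis unfolding R_def
        using norm_triangle_ineq[of "e * R1 - e\<^sup>2 * R2" "e ^ 3 * R3"] norm_triangle_ineq4[of "e * R1" "e\<^sup>2 * R2"] e2 e3 by linarith
    qed
    have T1: "norm ((q - e) * A) \<le> \<epsilon>\<^sup>2 * 3" unfolding norm_mult using q(3) A by (intro mult_mono) auto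
    have T2: "norm (q * e * A\<^sup>2) \<le> \<epsilon>\<^sup>2 * 9"
    proof -
      have "norm (A\<^sup>2) \<le> 3\<^sup>2" unfolding norm_power using A by (intro power_mono) auto
      moreover have "norm (q * e) \<le> \<epsilon> * \<epsilon>" unfolding norm_mult e(1) using q(1) e0 by (intro mult_right_mono) auto
      ultimately have "norm (q * e) * norm (A\<^sup>2) \<le> (\<epsilon> * \<epsilon>) * 3\<^sup>2" using e0 by (intro mult_mono) auto
      then show ?thesis by (simp add: norm_mult power2_eq_square)
    qed
    have T3: "norm ((1 + q * A) * (e\<^sup>2 * B - e ^ 3 * z ^ 6)) \<le> 2 * (\<epsilon>\<^sup>2 * 4)"
    proof -
      have "norm (q * A) \<le> 1 / 3 * 3" unfolding norm_mult using q(2) A by (intro mult_mono) auto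
      then have 1: "norm (1 + q * A) \<le> 2" using norm_triangle_ineq[of 1 "q * A"] by simp
      have "norm (e\<^sup>2 * B) \<le> \<epsilon>\<^sup>2 * 3" unfolding norm_mult norm_power e(1) using B by (intro mult_left_mono) auto
      moreover have "norm (e ^ 3 * z ^ 6) \<le> \<epsilon> ^ 3 * 1" unfolding norm_mult norm_power[of e] e(1) using zk[of 6] e0 by (intro mult_left_mono) auto
      ultimately have 2: "norm (e\<^sup>2 * B - e ^ 3 * z ^ 6) \<le> \<epsilon>\<^sup>2 * 4"
        using norm_triangle_ineq4[of "e\<^sup>2 * B" "e ^ 3 * z ^ 6"] e3 by linarith
      show ?thesis unfolding norm_mult using 1 2 by (intro mult_mono) auto
    qed
    have T4: "norm (q * z ^ 4 * R) \<le> \<epsilon>\<^sup>2 * 24"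
    proof -
      have "norm (q * z ^ 4) \<le> \<epsilon> * 1" unfolding norm_mult using q(1) zk[of 4] e0 by (intro mult_mono) auto
      then have "norm (q * z ^ 4) * norm R \<le> (\<epsilon> * 1) * (24 * \<epsilon>)" using R e0 by (intro mult_mono) auto
      then show ?thesis by (simp add: norm_mult power2_eq_square)
    qed
    show ?thesis
      using T1 T2 T3 T4 norm_triangle_ineq[of "((q - e) * A - q * e * A\<^sup>2) + (1 + q * A) * (e\<^sup>2 * B - e ^ 3 * z ^ 6)" "q * z ^ 4 * R"]
        norm_triangle_ineq[of "(q - e) * A - q * e * A\<^sup>2" "(1 + q * A) * (e\<^sup>2 * B - e ^ 3 * z ^ 6)"]
        norm_triangle_ineq4[of "(q - e) * A" "q * e * A\<^sup>2"] by linarith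
  qed
  ultimately show ?thesis unfolding P_def i_def by simp
qed

text \<open>The explicit term has a nonnegative coefficient, so by |1 - z| >= 1 - r its modulus is
  largest at the real point r. The two errors 44 / x^2 become relative because |X(r)| >= 1/8: 2 * 44
  * 8 = 704.\<close>

lemma euler_poly_compare:
  fixes z :: complex and x :: real
  assumes x: "x \<ge> 2" and r: "norm z = r" "r < 1"
  defines "X \<equiv> (\<lambda>z::complex. (1 + of_real (1 / (x + 1)) * (z / (1 - z))) * ((1 - z * of_real (1 / x)) * (1 - z\<^sup>2 * of_real (1 / x)) * (1 - z ^ 3 * of_real (1 / x))))"
  shows "norm (X z) \<le> norm (X (of_real r)) * (1 + 704 / x\<^sup>2)"
proof -
  define \<epsilon> where "\<epsilon> = 1 / x"
  define q where "q = 1 / (x + 1)"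
  define c where "c = q * (1 - \<epsilon>) ^ 3"
  have r0: "r \<ge> 0" using r norm_ge_zero[of z] by simp
  have eps: "0 < \<epsilon>" "\<epsilon> \<le> 1 / 2" using x by (auto simp: \<epsilon>_def field_simps)
  have q: "0 < q" "q \<le> \<epsilon>" "q \<le> 1 / 3" using x by (auto simp: \<epsilon>_def q_def field_simps)
  have qe: "\<bar>q - \<epsilon>\<bar> \<le> \<epsilon>\<^sup>2"
  proof -
    have "\<epsilon> - q = 1 / (x * (x + 1))" using x by (simp add: \<epsilon>_def q_def field_simps)
    also have "\<dots> \<le> 1 / (x * x)" using x by (intro frac_le mult_left_mono) auto
    finally show ?thesis using q by (simp add: \<epsilon>_def power2_eq_square)
  qed
  have c0: "c \<ge> 0" unfolding c_def using q eps by auto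
  have est: "norm (X y - (1 + of_real c * (y ^ 4 / (1 - y)))) \<le> 44 * \<epsilon>\<^sup>2" if "norm y < 1" for y :: complex
  proof -
    have "norm (of_real q - of_real \<epsilon> :: complex) = \<bar>q - \<epsilon>\<bar>" by (metis norm_of_real of_real_diff)
    then show ?thesis
      using euler_poly_estimate[OF that, of "of_real \<epsilon>" \<epsilon> "of_real q"] eps q qe
      unfolding X_def c_def q_def[symmetric] \<epsilon>_def[symmetric] by simp
  qed
  have "norm (X z) \<le> 1 + c * (r ^ 4 / (1 - r)) + 44 * \<epsilon>\<^sup>2"
  proof -
    have "norm (z ^ 4 / (1 - z)) \<le> r ^ 4 / (1 - r)"
    proof -
      have "1 - r \<le> norm (1 - z)" using norm_triangle_ineq2[of 1 z] r by simp
      then show ?thesis unfolding norm_divide norm_power r(1) using r r0 by (intro divide_left_mono mult_pos_pos) auto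
    qed
    then have "norm (of_real c * (z ^ 4 / (1 - z))) \<le> c * (r ^ 4 / (1 - r))"
      unfolding norm_mult norm_of_real using c0 by (simp add: mult_left_mono del: times_divide_eq_right)
    then have "norm (1 + of_real c * (z ^ 4 / (1 - z))) \<le> 1 + c * (r ^ 4 / (1 - r))"
      using norm_triangle_ineq[of 1 "of_real c * (z ^ 4 / (1 - z))"] by simp
    then show ?thesis using est[of z] r norm_triangle_sub[of "X z" "1 + of_real c * (z ^ 4 / (1 - z))"] by simp
  qed
  also have "1 + c * (r ^ 4 / (1 - r)) \<le> norm (X (of_real r)) + 44 * \<epsilon>\<^sup>2"
  proof -
    have "1 + of_real c * ((of_real r) ^ 4 / (1 - of_real r)) = (of_real (1 + c * (r ^ 4 / (1 - r))) :: complex)" by simp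
    then have "norm (1 + of_real c * ((of_real r) ^ 4 / (1 - of_real r)) :: complex) = 1 + c * (r ^ 4 / (1 - r))"
      using c0 r r0 by (simp only: norm_of_real) (intro abs_of_nonneg add_nonneg_nonneg mult_nonneg_nonneg, auto)
    then show ?thesis using est[of "of_real r"] r r0
        norm_triangle_sub[of "1 + of_real c * ((of_real r) ^ 4 / (1 - of_real r))" "X (of_real r)"]
      by (simp add: norm_minus_commute)
  qed
  also have "norm (X (of_real r)) + 44 * \<epsilon>\<^sup>2 + 44 * \<epsilon>\<^sup>2 \<le> norm (X (of_real r)) * (1 + 704 * \<epsilon>\<^sup>2)"
  proof -
    define y where "y = (1 + q * (r / (1 - r))) * ((1 - r * \<epsilon>) * (1 - r\<^sup>2 * \<epsilon>) * (1 - r ^ 3 * \<epsilon>))"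
    have "X (of_real r) = of_real y" unfolding X_def y_def q_def \<epsilon>_def by simp
    have f: "1 / 2 \<le> 1 - r ^ k * \<epsilon>" for k
    proof -
      have "r ^ k * \<epsilon> \<le> 1 * (1 / 2)" using r r0 eps by (intro mult_mono) (auto simp: power_le_one)
      then show ?thesis by simp
    qed
    have "(1 / 2) * (1 / 2) \<le> (1 - r * \<epsilon>) * (1 - r\<^sup>2 * \<epsilon>)" using f[of 1] f[of 2] by (intro mult_mono) auto
    then have "((1 / 2) * (1 / 2)) * (1 / 2) \<le> (1 - r * \<epsilon>) * (1 - r\<^sup>2 * \<epsilon>) * (1 - r ^ 3 * \<epsilon>)"
      using f[of 3] f[of 1] f[of 2] by (intro mult_mono mult_nonneg_nonneg) auto
    moreover have "1 \<le> 1 + q * (r / (1 - r))" using q r r0 by simp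
    ultimately have "1 * (((1 / 2) * (1 / 2)) * (1 / 2)) \<le> y"
      unfolding y_def by (intro mult_mono[of 1 _ "((1 / 2) * (1 / 2)) * (1 / 2 :: real)"]) auto
    then have "1 / 8 \<le> norm (X (of_real r))" unfolding \<open>X (of_real r) = of_real y\<close> by simp
    then have "1 / 8 * (704 * \<epsilon>\<^sup>2) \<le> norm (X (of_real r)) * (704 * \<epsilon>\<^sup>2)" by (intro mult_right_mono) auto
    then show ?thesis by (simp add: distrib_left)
  qed
  finally show ?thesis by (simp add: \<epsilon>_def power_divide)
qed

text \<open>The Euler factor is \<open>X\<close> times three zeta factors, both at a + i t and at a.
  Dividing, the zeta factors form the product on the right and the quotient of the two values of
  \<open>X\<close> is at most 1 + 704 / p^2.\<close>

lemma zeta_factor_compare: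
  assumes p: "prime p" and a: "a > 0"
  shows "norm (euler_factor p (Complex a t)) / (1 + euler_weight p a) \<le>
    (\<Prod>j\<in>{1,2,3::nat}. norm (1 + 1 / (of_nat p powr (1 + of_nat j * Complex a t) - 1)) / (1 + 1 / (real p powr (1 + real j * a) - 1))) * (1 + 704 / (real p)\<^sup>2)"
proof -
  define x where "x = real p"
  define X where "X = (\<lambda>z::complex. (1 + of_real (1 / (x + 1)) * (z / (1 - z))) * ((1 - z * of_real (1 / x)) * (1 - z\<^sup>2 * of_real (1 / x)) * (1 - z ^ 3 * of_real (1 / x))))"
  define y where "y = (\<lambda>s. (of_nat p :: complex) powr (- s))"
  define r where "r = x powr (- a)"
  define zf where "zf = (\<lambda>(j::nat) s. 1 + 1 / (of_nat p powr (1 + of_nat j * s) - 1) :: complex)"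
  have x2: "x \<ge> 2" using prime_ge_2_nat[OF p] by (simp add: x_def)
  have p0: "(of_nat p :: complex) \<noteq> 0" using prime_gt_0_nat[OF p] by simp
  have ny: "norm (y s) < 1" if "Re s > 0" for s
    using that x2 powr_less_cancel_iff[of x "- Re s" 0] by (simp add: y_def norm_powr_real_powr x_def)
  have ef: "euler_factor p s = 1 + of_real (1 / (x + 1)) * (y s / (1 - y s))" if "Re s > 0" for s
  proof -
    have ys: "y s = 1 / of_nat p powr s" by (simp add: y_def powr_minus field_simps)
    have "of_nat p powr s \<noteq> (0::complex)" using p0 by simp
    then have "y s / (1 - y s) = 1 / (of_nat p powr s - 1)"
      unfolding ys using euler_factor_nonzero(3)[OF p that] by (simp add: divide_simps)
    then show ?thesis unfolding euler_factor_def x_def by simp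
  qed
  have zfe: "zf j s * (1 - y s ^ j * of_real (1 / x)) = 1" "zf j s \<noteq> 0" if "Re s > 0" for j s
  proof -
    define v where "v = (of_nat p :: complex) powr (1 + of_nat j * s)"
    have v0: "v \<noteq> 0" using p0 by (simp add: v_def)
    have "norm v = x powr (1 + real j * Re s)" by (simp add: v_def norm_powr_real_powr x_def)
    moreover have "x powr (1 + real j * Re s) > 1" using that x2 by (intro gr_one_powr) (auto intro: add_pos_nonneg)
    ultimately have v1: "v \<noteq> 1" by auto
    have "y s ^ j * of_real (1 / x) = 1 / v"
    proof -
      have "v = of_nat p * (of_nat p powr s) ^ j"

      proof -
        have "(of_nat p :: complex) powr (of_nat j * s) = (of_nat p powr s) ^ j"
          using p0 by (simp add: powr_def exp_of_nat_mult[symmetric] mult_ac)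
        moreover have "v = of_nat p powr 1 * of_nat p powr (of_nat j * s)" unfolding v_def by (rule powr_add)
        ultimately show ?thesis using p0 by simp
      qed
      then show ?thesis using p0 by (simp add: y_def powr_minus x_def field_simps)
    qed
    then have e: "1 - y s ^ j * of_real (1 / x) = (v - 1) / v" using v0 by (simp add: field_simps)
    have z: "zf j s = v / (v - 1)" unfolding zf_def v_def[symmetric] using v1 by (simp add: field_simps)
    show "zf j s * (1 - y s ^ j * of_real (1 / x)) = 1" unfolding e z using v0 v1 by simp
    show "zf j s \<noteq> 0" unfolding z using v0 v1 by simp
  qed
  have Xe: "euler_factor p s = X (y s) * (zf 1 s * zf 2 s * zf 3 s)" if "Re s > 0" for s
  proof -
    have "X (y s) * (zf 1 s * zf 2 s * zf 3 s) = euler_factor p s *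
      ((zf 1 s * (1 - y s ^ 1 * of_real (1 / x))) * (zf 2 s * (1 - y s ^ 2 * of_real (1 / x))) * (zf 3 s * (1 - y s ^ 3 * of_real (1 / x))))"
      unfolding X_def ef[OF that] by (simp add: mult_ac)
    then show ?thesis unfolding zfe(1)[OF that] by simp
  qed
  have ya: "y (of_real a) = of_real r" unfolding y_def r_def x_def using powr_of_real[of "real p" "- a"] by simp
  have nyr: "norm (y (Complex a t)) = r" by (simp add: y_def r_def x_def norm_powr_real_powr)
  have r1: "r < 1" using ny[of "Complex a t"] a nyr by simp
  have cmp: "norm (X (y (Complex a t))) \<le> norm (X (of_real r)) * (1 + 704 / x\<^sup>2)"
    unfolding X_def by (rule euler_poly_compare[OF x2 nyr r1])
  have zfr: "zf j (of_real a) = of_real (1 + 1 / (x powr (1 + real j * a) - 1))" for j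
  proof -
    have "1 + of_nat j * of_real a = (of_real (1 + real j * a) :: complex)" by simp
    then have "(of_nat p :: complex) powr (1 + of_nat j * of_real a) = of_real (x powr (1 + real j * a))"
      unfolding x_def using powr_of_real[of "real p" "1 + real j * a"] by (simp only: of_nat_0_le_iff of_real_of_nat_eq)
    then show ?thesis unfolding zf_def by simp
  qed
  have zfp: "0 < 1 + 1 / (x powr (1 + real j * a) - 1)" for j :: nat
  proof -
    have "x powr (1 + real j * a) > 1" using a x2 by (intro gr_one_powr) (auto intro: add_pos_nonneg)
    then show ?thesis by (simp add: add_pos_pos)
  qed
  define G where "G = (\<lambda>j::nat. 1 + 1 / (x powr (1 + real j * a) - 1))"
  have G: "G j > 0" "norm (zf j (of_real a)) = G j" for j
    unfolding G_def zfr norm_of_real using zfp[of j] by auto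
  have w: "1 + euler_weight p a > 0" using euler_weight_bounds(1)[OF p a] by simp
  have W: "1 + euler_weight p a = norm (X (of_real r)) * (G 1 * G 2 * G 3)"
  proof -
    have "1 + euler_weight p a = norm (euler_factor p (of_real a))"
      unfolding euler_factor_of_real norm_of_real using w by simp
    also have "\<dots> = norm (X (of_real r)) * (G 1 * G 2 * G 3)"
      using Xe[of "of_real a"] a by (simp add: ya norm_mult G(2))
    finally show ?thesis .
  qed
  have Xr: "norm (X (of_real r)) > 0"
    using w W by (metis norm_ge_zero less_eq_real_def mult_zero_left not_less_iff_gr_or_eq)
  have "norm (euler_factor p (Complex a t)) = norm (X (y (Complex a t))) * (norm (zf 1 (Complex a t)) * norm (zf 2 (Complex a t)) * norm (zf 3 (Complex a t)))"
    using Xe[of "Complex a t"] a by (simp add: norm_mult)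
  also have "\<dots> \<le> (norm (X (of_real r)) * (1 + 704 / x\<^sup>2)) * (norm (zf 1 (Complex a t)) * norm (zf 2 (Complex a t)) * norm (zf 3 (Complex a t)))"
    by (intro mult_right_mono cmp) auto
  finally have "norm (euler_factor p (Complex a t)) / (1 + euler_weight p a) \<le>
     (norm (X (of_real r)) * (1 + 704 / x\<^sup>2)) * (norm (zf 1 (Complex a t)) * norm (zf 2 (Complex a t)) * norm (zf 3 (Complex a t))) / (1 + euler_weight p a)"
    using w by (intro divide_right_mono) auto
  also have "\<dots> = (norm (zf 1 (Complex a t)) / G 1 * (norm (zf 2 (Complex a t)) / G 2 * (norm (zf 3 (Complex a t)) / G 3))) * (1 + 704 / x\<^sup>2)"
    unfolding W using Xr G(1)[of 1] G(1)[of 2] G(1)[of 3] by (simp add: mult_ac)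
  also have "norm (zf 1 (Complex a t)) / G 1 * (norm (zf 2 (Complex a t)) / G 2 * (norm (zf 3 (Complex a t)) / G 3)) = (\<Prod>j\<in>{1,2,3}. norm (zf j (Complex a t)) / G j)"
    by simp
  finally show ?thesis unfolding zf_def G_def x_def .
qed

text \<open>The factors 1 + 704 / p^2 have a convergent product, and the real zeta values in the
  denominators are at least 1 / (j a).\<close>

lemma tilted_char_le_zeta:
  obtains E where "E > 0" "\<And>a t. a > 0 \<Longrightarrow>
    norm (tilted_char a t) \<le> (\<Prod>j\<in>{1,2,3::nat}. norm (zeta_series (of_nat j * Complex a t)) * (real j * a)) * E"
proof -
  define E where "E = exp (704 * (\<Sum>n. 1 / (real n)\<^sup>2))"
  have s2: "summable (\<lambda>n. 1 / (real n)\<^sup>2)" using inverse_power_summable[of 2, where 'a = real] by (simp add: divide_inverse)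
  show ?thesis
  proof (rule that[of E])
    show "E > 0" by (simp add: E_def)
    fix a t :: real assume a: "a > 0"
    define Zc where "Zc = (\<lambda>N (j::nat). \<Prod>p\<in>primes_le N. 1 + 1 / (of_nat p powr (1 + of_nat j * Complex a t) - 1) :: complex)"
    define Zr where "Zr = (\<lambda>N (j::nat). \<Prod>p\<in>primes_le N. 1 + 1 / (real p powr (1 + real j * a) - 1))"
    define ZR where "ZR = (\<lambda>j::nat. \<Sum>n. real n powr (- (1 + real j * a)))"
    have bd: "norm (tilted_char_partial N a t) \<le> (\<Prod>j\<in>{1,2,3}. norm (Zc N j) / Zr N j) * E" for N
    proof -
      have "norm (tilted_char_partial N a t) \<le> (\<Prod>p\<in>primes_le N. (\<Prod>j\<in>{1,2,3::nat}. norm (1 + 1 / (of_nat p powr (1 + of_nat j * Complex a t) - 1)) / (1 + 1 / (real p powr (1 + real j * a) - 1))) * (1 + 704 / (real p)\<^sup>2))"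
        unfolding norm_tilted_char_partial[OF a]
      proof (rule prod_mono)
        fix p assume "p \<in> primes_le N"
        then have p: "prime p" by (simp add: primes_leD)
        show "0 \<le> norm (euler_factor p (Complex a t)) / (1 + euler_weight p a) \<and> norm (euler_factor p (Complex a t)) / (1 + euler_weight p a) \<le>
           (\<Prod>j\<in>{1,2,3::nat}. norm (1 + 1 / (of_nat p powr (1 + of_nat j * Complex a t) - 1)) / (1 + 1 / (real p powr (1 + real j * a) - 1))) * (1 + 704 / (real p)\<^sup>2)"
          using zeta_factor_compare[OF p a, of t] euler_weight_bounds(1)[OF p a] by (intro conjI) auto
      qed
      also have "\<dots> = (\<Prod>j\<in>{1,2,3}. norm (Zc N j) / Zr N j) * (\<Prod>p\<in>primes_le N. 1 + 704 / (real p)\<^sup>2)"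
        unfolding Zc_def Zr_def prod.distrib
        by (subst prod.swap) (simp only: prod_dividef prod_norm)
      also have "\<dots> \<le> (\<Prod>j\<in>{1,2,3}. norm (Zc N j) / Zr N j) * E"
      proof (rule mult_left_mono)
        have "(\<Prod>p\<in>primes_le N. 1 + 704 / (real p)\<^sup>2) \<le> exp (\<Sum>p\<in>primes_le N. 704 / (real p)\<^sup>2)"
          by (rule prod_one_plus_le_exp) auto
        also have "(\<Sum>p\<in>primes_le N. 704 / (real p)\<^sup>2) = 704 * (\<Sum>p\<in>primes_le N. 1 / (real p)\<^sup>2)" by (simp add: sum_distrib_left)
        also have "exp \<dots> \<le> E" unfolding E_def exp_le_cancel_iff
          by (intro mult_left_mono sum_le_suminf s2) auto
        finally show "(\<Prod>p\<in>primes_le N. 1 + 704 / (real p)\<^sup>2) \<le> E" .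
        have "0 \<le> Zr N j" if "j \<in> {1,2,3}" for j
          unfolding Zr_def using a that by (intro prod_nonneg add_nonneg_nonneg less_imp_le[OF zeta_factor_weight_le(1)]) (auto simp: primes_leD)
        then show "0 \<le> (\<Prod>j\<in>{1,2,3}. norm (Zc N j) / Zr N j)" by (intro prod_nonneg divide_nonneg_nonneg) auto
      qed
      finally show ?thesis .
    qed
    have lim: "(\<lambda>N. (\<Prod>j\<in>{1,2,3}. norm (Zc N j) / Zr N j) * E) \<longlonglongrightarrow> (\<Prod>j\<in>{1,2,3}. norm (zeta_series (of_nat j * Complex a t)) / ZR j) * E"
    proof (intro tendsto_mult_right tendsto_prod tendsto_divide tendsto_norm)
      fix j :: nat assume j: "j \<in> {1,2,3}"
      have ja: "real j * a > 0" using j a by auto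
      show "(\<lambda>N. Zc N j) \<longlonglongrightarrow> zeta_series (of_nat j * Complex a t)"
        unfolding Zc_def by (rule zeta_series_props(2)) (use ja in simp)
      show "(\<lambda>N. Zr N j) \<longlonglongrightarrow> ZR j" unfolding Zr_def ZR_def by (rule zeta_real_props(2)[OF ja])
      have "0 < 1 / (real j * a)" using ja by simp
      then show "ZR j \<noteq> 0" using zeta_real_props(4)[OF ja] unfolding ZR_def by linarith
    qed
    have "norm (tilted_char a t) \<le> (\<Prod>j\<in>{1,2,3}. norm (zeta_series (of_nat j * Complex a t)) / ZR j) * E"
      by (rule LIMSEQ_le[OF tendsto_norm[OF tilted_char_limit[OF a]] lim]) (use bd in blast)
    also have "\<dots> \<le> (\<Prod>j\<in>{1,2,3::nat}. norm (zeta_series (of_nat j * Complex a t)) * (real j * a)) * E"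
    proof (intro mult_right_mono prod_mono)
      fix j :: nat assume j: "j \<in> {1,2,3}"
      have ja: "real j * a > 0" using j a by auto
      have "1 / (real j * a) \<le> ZR j" using zeta_real_props(4)[OF ja] by (simp add: ZR_def)
      moreover have "0 < 1 / (real j * a)" using ja by simp
      moreover from calculation have "0 < ZR j" by linarith
      ultimately have "norm (zeta_series (of_nat j * Complex a t)) / ZR j \<le> norm (zeta_series (of_nat j * Complex a t)) / (1 / (real j * a))"
        by (intro divide_left_mono mult_pos_pos) auto
      moreover have "0 \<le> ZR j" using \<open>0 < 1 / (real j * a)\<close> \<open>1 / (real j * a) \<le> ZR j\<close> by linarith
      ultimately show "0 \<le> norm (zeta_series (of_nat j * Complex a t)) / ZR j \<and> norm (zeta_series (of_nat j * Complex a t)) / ZR j \<le> norm (zeta_series (of_nat j * Complex a t)) * (real j * a)"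
        by simp
    qed (simp add: E_def)
    finally show "norm (tilted_char a t) \<le> (\<Prod>j\<in>{1,2,3::nat}. norm (zeta_series (of_nat j * Complex a t)) * (real j * a)) * E" .
  qed
qed

text \<open>Each zeta value is at most 15 L (1 + |t|)^(1/4) with L = ln (1 / a), where 15 = 1 + 8 +
  2 + 4 collects the terms of \<open>norm_zeta_series_le\<close> for N near 1 + |t|. The exponent
  1/4 absorbs the logarithm in t and keeps the cube integrable against 1 / (1 + t^2).\<close>

lemma tilted_char_far:
  obtains C where "C > 0" "\<forall>\<^sub>F a in at_right 0. \<forall>t. \<bar>t\<bar> \<ge> 1 / (2 * ln (1 / a)) \<longrightarrow>
    norm (tilted_char a t) \<le> C * a ^ 3 * (ln (1 / a)) ^ 3 * (1 + \<bar>t\<bar>) powr (3 / 4)"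
proof -
  obtain E where E: "E > 0" "\<And>a t. a > 0 \<Longrightarrow>
    norm (tilted_char a t) \<le> (\<Prod>j\<in>{1,2,3::nat}. norm (zeta_series (of_nat j * Complex a t)) * (real j * a)) * E"
    by (rule tilted_char_le_zeta) blast
  have a01: "\<forall>\<^sub>F a in at_right (0::real). a \<in> {0<..<1}" by (rule eventually_at_right_real) simp
  have e1: "\<forall>\<^sub>F a in at_right (0::real). 1 \<le> ln (1 / a)" by real_asymp
  show ?thesis
  proof (rule that[of "6 * 15 ^ 3 * E"])
    show "\<forall>\<^sub>F a in at_right 0. \<forall>t. \<bar>t\<bar> \<ge> 1 / (2 * ln (1 / a)) \<longrightarrow>
      norm (tilted_char a t) \<le> 6 * 15 ^ 3 * E * a ^ 3 * (ln (1 / a)) ^ 3 * (1 + \<bar>t\<bar>) powr (3 / 4)"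
      using a01 e1
    proof (eventually_elim, intro allI impI)
      case (elim a)
      fix t assume t: "\<bar>t\<bar> \<ge> 1 / (2 * ln (1 / a))"
      define L where "L = ln (1 / a)"
      define X where "X = (1 + \<bar>t\<bar>) powr (1 / 4)"
      have a: "0 < a" "a < 1" and L: "L \<ge> 1" using elim by (auto simp: L_def)
      have X: "X \<ge> 1" unfolding X_def using ge_one_powr_ge_zero[of "1 + \<bar>t\<bar>" "1 / 4"] by simp
      have zb: "norm (zeta_series (of_nat j * Complex a t)) \<le> 15 * L * X" if j: "j \<in> {1,2,3}" for j :: nat
      proof -
        define s where "s = of_nat j * Complex a t"
        define N where "N = nat \<lceil>1 + \<bar>t\<bar>\<rceil>"
        have N: "N \<ge> 1" "1 + \<bar>t\<bar> \<le> real N" "real N \<le> 2 * (1 + \<bar>t\<bar>)"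
        proof -
          show N1: "1 + \<bar>t\<bar> \<le> real N" unfolding N_def by linarith
          have "real N = of_int \<lceil>1 + \<bar>t\<bar>\<rceil>" by (simp add: N_def)
          also have "\<dots> \<le> (1 + \<bar>t\<bar>) + 1" by (rule of_int_ceiling_le_add_one)
          also have "\<dots> \<le> 2 * (1 + \<bar>t\<bar>)" by simp
          finally show "real N \<le> 2 * (1 + \<bar>t\<bar>)" .
          show "N \<ge> 1" using N1 by linarith
        qed
        have j1: "1 \<le> real j" "real j \<le> 3" using j by auto
        have Res: "Re s = real j * a" "Im s = real j * t" by (auto simp: s_def)
        have "norm (zeta_series s) \<le> 1 + ln (real N) + 1 / norm s + norm (1 + s) / real N"
          by (rule norm_zeta_series_le) (use N j1 a Res in auto)
        moreover have "ln (real N) \<le> 8 * X"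
        proof -
          have "ln (real N) \<le> ln (2 * (1 + \<bar>t\<bar>))" using N by (intro ln_mono) auto
          also have "\<dots> = ln 2 + ln (1 + \<bar>t\<bar>)" by (rule ln_mult_pos) auto
          finally have "ln (real N) \<le> ln 2 + ln (1 + \<bar>t\<bar>)" .
          moreover have "ln (1 + \<bar>t\<bar>) = 4 * ln X" unfolding X_def by (simp add: ln_powr)
          moreover have "ln X \<le> X - 1" using X by (intro ln_le_minus_one) auto
          ultimately show ?thesis using ln_2_less_1 X by linarith
        qed
        moreover have "1 / norm s \<le> 2 * L"
        proof -
          have "1 * \<bar>t\<bar> \<le> real j * \<bar>t\<bar>" using j1 by (intro mult_right_mono) auto
          then have "\<bar>t\<bar> \<le> \<bar>Im s\<bar>" using Res by (simp add: abs_mult)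
          then have "1 / (2 * L) \<le> norm s" using t abs_Im_le_cmod[of s] by (simp add: L_def)
          then have "1 / norm s \<le> 1 / (1 / (2 * L))" using L by (intro frac_le) auto
          then show ?thesis by simp
        qed
        moreover have "norm (1 + s) / real N \<le> 4"
        proof -
          have "norm (Complex a t) \<le> a + \<bar>t\<bar>" using cmod_le[of "Complex a t"] a by simp
          then have "norm s \<le> 3 * (a + \<bar>t\<bar>)" unfolding s_def norm_mult norm_of_nat using j1 a by (intro mult_mono) auto
          then have "norm (1 + s) \<le> 4 * (1 + \<bar>t\<bar>)" using norm_triangle_ineq[of 1 s] a by simp
          also have "4 * (1 + \<bar>t\<bar>) \<le> 4 * real N" using N(2) by (rule mult_left_mono) simp
          finally have "norm (1 + s) \<le> 4 * real N" .
          then show ?thesis using N by (simp add: divide_le_eq)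
        qed
        moreover have "X \<le> L * X" "L \<le> L * X" "1 \<le> L * X"
          using L X mult_right_mono[of 1 L X] mult_left_mono[of 1 X L] mult_mono[of 1 L 1 X] by auto
        ultimately show ?thesis unfolding s_def by linarith
      qed
      have "norm (tilted_char a t) \<le> (\<Prod>j\<in>{1,2,3::nat}. norm (zeta_series (of_nat j * Complex a t)) * (real j * a)) * E"
        by (rule E(2)[OF a(1)])
      also have "\<dots> \<le> (\<Prod>j\<in>{1,2,3::nat}. (15 * L * X) * (real j * a)) * E"
        using zb a E(1) by (intro mult_right_mono prod_mono conjI mult_nonneg_nonneg) auto
      also have "\<dots> = 6 * 15 ^ 3 * E * a ^ 3 * L ^ 3 * X ^ 3" by (simp add: power3_eq_cube)
      also have "X ^ 3 = (1 + \<bar>t\<bar>) powr (3 / 4)"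
        unfolding X_def using powr_power[of "1 + \<bar>t\<bar>" "1 / 4" 3] by (simp add: add_nonneg_eq_0_iff)
      finally show "norm (tilted_char a t) \<le> 6 * 15 ^ 3 * E * a ^ 3 * (ln (1 / a)) ^ 3 * (1 + \<bar>t\<bar>) powr (3 / 4)"
        unfolding L_def .
    qed
  qed (use E in simp)
qed

section \<open>Fourier inversion\<close>

lemma integrable_exp_minus_half_line:
  fixes a :: real assumes "a > 0"
  shows "integrable lborel (\<lambda>u. indicator {0..} u *\<^sub>R exp (- a * u))"
proof -
  have "(\<lambda>u. exp (- a * u)) absolutely_integrable_on {0..}"
    using has_integral_exp_minus_to_infinity[OF assms, of 0]
    by (intro nonnegative_absolutely_integrable_1) (auto simp: integrable_on_def)
  then show ?thesis unfolding set_integrable_def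
    by (subst (asm) integrable_completion) auto
qed

lemma has_bochner_integral_cexp_half_line:
  fixes c :: complex assumes c: "Re c > 0"
  shows "has_bochner_integral lborel (\<lambda>u. indicator {0..} u *\<^sub>R exp (- c * of_real u)) (1 / c)"
proof -
  define f where "f = (\<lambda>u. indicator {0..} u *\<^sub>R exp (- c * of_real u) :: complex)"
  define s where "s = (\<lambda>(n::nat) u. indicator {0..real n} u *\<^sub>R exp (- c * of_real u) :: complex)"
  have c0: "c \<noteq> 0" using c by auto
  have sint: "integral\<^sup>L lborel (s n) = - exp (- c * of_real (real n)) / c - (- exp (- c * of_real 0) / c)" for n
    unfolding s_def
  proof (rule integral_FTC_Icc)
    fix x :: real
    show "((\<lambda>u. - exp (- c * of_real u) / c) has_vector_derivative exp (- c * of_real x)) (at x within {0..real n})"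
    proof (rule has_vector_derivative_at_within, rule has_vector_derivative_real_field[where f = "\<lambda>z. - exp (- c * z) / c"])
      show "((\<lambda>z. - exp (- c * z) / c) has_field_derivative exp (- c * of_real x)) (at (of_real x))"
        using c0 by (auto intro!: derivative_eq_intros)
    qed
    show "continuous_on {0..real n} (\<lambda>u. exp (- c * of_real u))" by (intro continuous_intros)
  qed simp
  have fm: "f \<in> borel_measurable lborel" unfolding f_def by measurable
  have sm: "s n \<in> borel_measurable lborel" for n unfolding s_def by measurable
  have lim: "AE u in lborel. (\<lambda>n. s n u) \<longlonglongrightarrow> f u"
  proof (rule AE_I2)
    fix u :: real
    obtain N where N: "u \<le> real N" using real_arch_simple by blast
    have "s n u = f u" if "n \<ge> N" for n
      using that N unfolding s_def f_def by (auto simp: indicator_def)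
    then show "(\<lambda>n. s n u) \<longlonglongrightarrow> f u"
      by (intro tendsto_eventually) (auto simp: eventually_sequentially)
  qed
  have bd: "AE u in lborel. norm (s n u) \<le> indicator {0..} u *\<^sub>R exp (- Re c * u)" for n
    unfolding s_def by (intro AE_I2) (auto simp: indicator_def)
  note dct = fm sm integrable_exp_minus_half_line[OF c] lim bd
  have fi: "integrable lborel f" by (rule integrable_dominated_convergence[OF dct])
  have "(\<lambda>n. integral\<^sup>L lborel (s n)) \<longlonglongrightarrow> integral\<^sup>L lborel f" by (rule integral_dominated_convergence[OF dct])
  moreover have "(\<lambda>n. integral\<^sup>L lborel (s n)) \<longlonglongrightarrow> - 0 / c - (- exp (- c * of_real 0) / c)"
    unfolding sint
  proof (intro tendsto_intros c0)
    show "(\<lambda>n. exp (- c * of_real (real n))) \<longlonglongrightarrow> 0"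
    proof (rule tendsto_norm_zero_cancel)
      have "(\<lambda>n. exp (- Re c * real n)) \<longlonglongrightarrow> 0" using c by real_asymp
      then show "(\<lambda>n. norm (exp (- c * of_real (real n)))) \<longlonglongrightarrow> 0" by simp
    qed
  qed
  ultimately have "integral\<^sup>L lborel f = 1 / c" using LIMSEQ_unique by force
  then show ?thesis using fi unfolding has_bochner_integral_iff f_def by simp
qed

text \<open>Two-sided exponential with peak at 0. For \<open>b = 1 - a\<close> and A = \<mu> + a it
  is exp (-a u) times the weight min (exp (-\<mu> u)) (exp u) of the count; A = a corresponds to
  \<mu> = 0, the weight in F.\<close>

definition two_exp :: "real \<Rightarrow> real \<Rightarrow> real \<Rightarrow> real" where
  "two_exp A b u = min (exp (- A * u)) (exp (b * u))"

definition two_exp_ft :: "real \<Rightarrow> real \<Rightarrow> real \<Rightarrow> complex" where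
  "two_exp_ft A b t = of_real (A + b) / (Complex A t * Complex b (- t))"

lemma borel_measurable_two_exp [measurable]: "two_exp A b \<in> borel_measurable borel"
  unfolding two_exp_def[abs_def] by measurable

lemma borel_measurable_cis [measurable]: "f \<in> borel_measurable M \<Longrightarrow> (\<lambda>x. cis (f x)) \<in> borel_measurable M"
  unfolding cis_conv_exp by measurable

lemma two_exp_cases: "A > 0 \<Longrightarrow> b > 0 \<Longrightarrow> two_exp A b u = indicator {0..} u * exp (- A * u) + indicator {..<0} u * exp (b * u)"
proof -
  assume A: "A > 0" "b > 0"
  show ?thesis
  proof (cases "u \<ge> 0")
    case True
    have "- A * u \<le> 0" "0 \<le> b * u" using A True by auto
    then have "- A * u \<le> b * u" by linarith
    then show ?thesis using True by (simp add: two_exp_def)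
  next
    case False
    have "b * u \<le> - A * u" using A False mult_right_mono_neg[of "- A" b u] by simp
    then show ?thesis using False by (simp add: two_exp_def)
  qed
qed

lemma two_exp_nonneg: "0 \<le> two_exp A b u" by (simp add: two_exp_def)

lemma two_exp_le_1: "A > 0 \<Longrightarrow> b > 0 \<Longrightarrow> two_exp A b u \<le> 1"
  by (cases "u \<ge> 0") (auto simp: two_exp_def min_le_iff_disj mult_nonneg_nonpos)

lemma has_bochner_integral_two_exp_cis:
  assumes A: "A > 0" and b: "b > 0"
  shows "has_bochner_integral lborel (\<lambda>u. of_real (two_exp A b u) * cis (- (t * u))) (two_exp_ft A b t)"
proof -
  have 1: "has_bochner_integral lborel (\<lambda>u. indicator {0..} u *\<^sub>R exp (- Complex A t * of_real u)) (1 / Complex A t)"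
    by (rule has_bochner_integral_cexp_half_line) (use A in simp)
  have 2: "has_bochner_integral lborel (\<lambda>u. indicator {0..} u *\<^sub>R exp (- Complex b (- t) * of_real u)) (1 / Complex b (- t))"
    by (rule has_bochner_integral_cexp_half_line) (use b in simp)
  have "has_bochner_integral lborel (\<lambda>u. indicator {0..} (0 + (- 1) * u) *\<^sub>R exp (- Complex b (- t) * of_real (0 + (- 1) * u))) ((1 / Complex b (- t)) /\<^sub>R \<bar>- 1\<bar>)"
    using 2 by (subst lborel_has_bochner_integral_real_affine_iff[symmetric]) auto
  then have 3: "has_bochner_integral lborel (\<lambda>u. indicator {..0} u *\<^sub>R exp (Complex b (- t) * of_real u)) (1 / Complex b (- t))"
    by (rule has_bochner_integral_cong[THEN iffD1, rotated -1]) (auto simp: indicator_def)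
  have sum: "has_bochner_integral lborel (\<lambda>u. indicator {0..} u *\<^sub>R exp (- Complex A t * of_real u) + indicator {..0} u *\<^sub>R exp (Complex b (- t) * of_real u))
      (1 / Complex A t + 1 / Complex b (- t))"
    by (rule has_bochner_integral_add[OF 1 3])
  have "has_bochner_integral lborel (\<lambda>u. of_real (two_exp A b u) * cis (- (t * u))) (1 / Complex A t + 1 / Complex b (- t))"
  proof (rule has_bochner_integral_cong_AE[THEN iffD1, OF _ _ _ sum])
    show "(\<lambda>u. of_real (two_exp A b u) * cis (- (t * u))) \<in> borel_measurable lborel" by measurable
    show "(\<lambda>u. indicator {0..} u *\<^sub>R exp (- Complex A t * of_real u) + indicator {..0} u *\<^sub>R exp (Complex b (- t) * of_real u)) \<in> borel_measurable lborel"
      by (rule borel_measurable_has_bochner_integral[OF sum])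
    have "AE u in lborel. u \<noteq> (0::real)" by (rule AE_lborel_singleton)
    then show "AE u in lborel. indicator {0..} u *\<^sub>R exp (- Complex A t * of_real u) + indicator {..0} u *\<^sub>R exp (Complex b (- t) * of_real u) = of_real (two_exp A b u) * cis (- (t * u))"
    proof eventually_elim
      case (elim u)
      have e: "exp (Complex x y * of_real u) = of_real (exp (x * u)) * cis (y * u)" for x y
        by (simp add: complex_eq_iff Re_exp Im_exp)
      have "- Complex A t = Complex (- A) (- t)" by (simp add: complex_eq_iff)
      then show ?case unfolding two_exp_cases[OF A b] using elim by (auto simp: e indicator_def scaleR_conv_of_real)
    qed
  qed
  moreover have "1 / Complex A t + 1 / Complex b (- t) = two_exp_ft A b t"
  proof -
    have "Complex A t \<noteq> 0" "Complex b (- t) \<noteq> 0" using A b by (auto simp: complex_eq_iff)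
    moreover have "of_real (A + b) = Complex A t + Complex b (- t)" by (simp add: complex_eq_iff)
    ultimately show ?thesis unfolding two_exp_ft_def by (simp add: field_simps)
  qed
  ultimately show ?thesis by simp
qed

lemma integrable_inverse_1_plus_sq: "integrable lborel (\<lambda>x::real. 1 / (1 + x\<^sup>2))"
  using integrable_inverse_1_plus_square by (simp add: set_integrable_def einterval_eq_UNIV inverse_eq_divide)

lemma norm_Complex_ge:
  assumes "0 < m" "m \<le> A" "m \<le> 1"
  shows "m * sqrt (1 + t\<^sup>2) \<le> norm (Complex A t)"
proof -
  have "m\<^sup>2 * (1 + t\<^sup>2) \<le> A\<^sup>2 + t\<^sup>2"
  proof -
    have "m\<^sup>2 \<le> A\<^sup>2" using assms by (intro power_mono) auto
    moreover have "m\<^sup>2 * t\<^sup>2 \<le> 1 * t\<^sup>2" using assms by (intro mult_right_mono) (auto simp: power_le_one)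
    ultimately show ?thesis by (simp add: distrib_left)
  qed
  then have "sqrt (m\<^sup>2 * (1 + t\<^sup>2)) \<le> sqrt (A\<^sup>2 + t\<^sup>2)" by (rule real_sqrt_le_mono)
  then show ?thesis using assms by (simp add: real_sqrt_mult cmod_def)
qed

lemma norm_two_exp_ft_le:
  assumes "0 < m" "m \<le> A" "m \<le> b" "m \<le> 1"
  shows "norm (two_exp_ft A b t) \<le> (A + b) / m\<^sup>2 * (1 / (1 + t\<^sup>2))"
proof -
  have q: "sqrt (1 + t\<^sup>2) > 0" by (simp add: add_pos_nonneg)
  have "m * sqrt (1 + t\<^sup>2) * (m * sqrt (1 + t\<^sup>2)) \<le> norm (Complex A t) * norm (Complex b (- t))"
    using norm_Complex_ge[of m A t] norm_Complex_ge[of m b "- t"] assms q by (intro mult_mono) auto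
  moreover have "m * sqrt (1 + t\<^sup>2) * (m * sqrt (1 + t\<^sup>2)) = m\<^sup>2 * (1 + t\<^sup>2)"
    using real_sqrt_mult_self[of "1 + t\<^sup>2"] by (simp add: power2_eq_square mult_ac)
  ultimately have le: "m\<^sup>2 * (1 + t\<^sup>2) \<le> norm (Complex A t) * norm (Complex b (- t))" by simp
  have pos: "0 < m\<^sup>2 * (1 + t\<^sup>2)" using assms by (intro mult_pos_pos) (auto intro: add_pos_nonneg)
  have "norm (two_exp_ft A b t) = (A + b) / (norm (Complex A t) * norm (Complex b (- t)))"
    unfolding two_exp_ft_def norm_divide norm_mult norm_of_real using assms by simp
  also have "\<dots> \<le> (A + b) / (m\<^sup>2 * (1 + t\<^sup>2))" using le pos assms by (intro frac_le) auto
  finally show ?thesis by simp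
qed

lemma borel_measurable_two_exp_ft [measurable]: "two_exp_ft A b \<in> borel_measurable borel"
proof -
  have C: "Complex x (f t) = of_real x + \<i> * of_real (f t)" for x :: real and f :: "real \<Rightarrow> real" and t by (simp add: complex_eq_iff)
  show ?thesis unfolding two_exp_ft_def[abs_def] C[where f = "\<lambda>t. t"] C[where f = "\<lambda>t. - t"] by measurable
qed

lemma integrable_two_exp_ft:
  assumes "A > 0" "b > 0"
  shows "integrable lborel (two_exp_ft A b)"
proof -
  define m where "m = min 1 (min A b)"
  have m: "0 < m" "m \<le> A" "m \<le> b" "m \<le> 1" using assms by (auto simp: m_def)
  show ?thesis
  proof (rule Bochner_Integration.integrable_bound)
    show "integrable lborel (\<lambda>t. (A + b) / m\<^sup>2 * (1 / (1 + t\<^sup>2)))"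
      by (intro integrable_mult_right integrable_inverse_1_plus_sq)
    show "AE t in lborel. norm (two_exp_ft A b t) \<le> norm ((A + b) / m\<^sup>2 * (1 / (1 + t\<^sup>2)))"
    proof (rule AE_I2)
      fix t
      show "norm (two_exp_ft A b t) \<le> norm ((A + b) / m\<^sup>2 * (1 / (1 + t\<^sup>2)))"
        using norm_two_exp_ft_le[OF m, of t] by (rule order_trans) (simp only: real_norm_def abs_ge_self)
    qed
  qed measurable
qed

lemma gauss_fourier: "(\<integral>x. cis (x * y) * of_real (std_normal_density x) \<partial>lborel) = of_real (exp (- y\<^sup>2 / 2))"
proof -
  have "char std_normal_distribution y = (\<integral>x. std_normal_density x *\<^sub>R iexp (y * x) \<partial>lborel)"
    unfolding char_def by (subst integral_density) auto
  also have "(\<lambda>x. std_normal_density x *\<^sub>R iexp (y * x)) = (\<lambda>x. cis (x * y) * of_real (std_normal_density x))"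
    by (auto simp: cis_conv_exp scaleR_conv_of_real mult_ac)
  finally show ?thesis by (simp add: char_std_normal_distribution)
qed

lemma gauss_fourier_scaled:
  assumes "n > 0"
  shows "(\<integral>t. cis (t * y) * of_real (std_normal_density (t / n)) \<partial>lborel) = of_real (n * exp (- (n * y)\<^sup>2 / 2))"
proof -
  have "(\<integral>t. cis (t * y) * of_real (std_normal_density (t / n)) \<partial>lborel) =
     \<bar>n\<bar> *\<^sub>R (\<integral>x. cis ((0 + n * x) * y) * of_real (std_normal_density ((0 + n * x) / n)) \<partial>lborel)"
    by (rule lborel_integral_real_affine) (use assms in simp)
  also have "(\<lambda>x. cis ((0 + n * x) * y) * of_real (std_normal_density ((0 + n * x) / n))) = (\<lambda>x. cis (x * (n * y)) * complex_of_real (std_normal_density x))"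
    using assms by (auto simp: mult_ac)
  finally show ?thesis unfolding gauss_fourier using assms by (simp add: scaleR_conv_of_real)
qed

text \<open>Gaussian regularisation. With an extra factor \<phi>(t / (n + 1)) Fubini turns the
  integral into a constant times the average of \<open>two_exp\<close> over a Gaussian of width 1 /
  (n + 1) about w. Both forms converge by domination as n grows, and \<phi>(0)^2 = 1 / (2 pi) gives
  the normalisation.\<close>

lemma two_exp_inversion:
  assumes A: "A > 0" and b: "b > 0"
  shows "(\<integral>t. two_exp_ft A b t * cis (t * w) \<partial>lborel) = of_real (2 * pi * two_exp A b w)"
proof -
  define \<phi> where "\<phi> = std_normal_density"
  define c where "c = \<phi> 0"
  have c: "c = 1 / sqrt (2 * pi)" by (simp add: c_def \<phi>_def std_normal_density_def)
  have c0: "c > 0" by (simp add: c)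
  have ph: "\<phi> x = c * exp (- x\<^sup>2 / 2)" for x by (simp add: c \<phi>_def std_normal_density_def)
  have phm [measurable]: "\<phi> \<in> borel_measurable borel" unfolding \<phi>_def by measurable
  have ph0: "0 \<le> \<phi> x" "\<phi> x \<le> c" for x unfolding ph using c0 by auto
  have phi: "integrable lborel \<phi>" "integral\<^sup>L lborel \<phi> = 1" unfolding \<phi>_def by auto
  have E: "integrable lborel (two_exp A b)"
  proof -
    have "integrable lborel (\<lambda>u. of_real (two_exp A b u) * cis (- (0 * u)))"
      using has_bochner_integral_two_exp_cis[OF A b, of 0] by (rule integrable.intros)
    then have "integrable lborel (\<lambda>u. complex_of_real (two_exp A b u))" by simp
    then show ?thesis by (simp only: complex_of_real_integrable_eq)
  qed
  define I where "I = (\<lambda>n::nat. \<integral>t. two_exp_ft A b t * cis (t * w) * of_real (\<phi> (t / Suc n)) \<partial>lborel)"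
  have I1: "I n = (\<integral>x. of_real (two_exp A b (w - x / Suc n) * (exp (- x\<^sup>2 / 2))) \<partial>lborel)" for n
  proof -
    define N where "N = real (Suc n)"
    have N: "N > 0" by (simp add: N_def)
    have gi: "integrable lborel (\<lambda>t. \<phi> (t / N))"
      using lborel_integrable_real_affine[OF phi(1), of "1 / N" 0] N by simp
    define f where "f = (\<lambda>u t. of_real (two_exp A b u) * cis (t * (w - u)) * complex_of_real (\<phi> (t / N)))"
    have fi: "integrable (lborel \<Otimes>\<^sub>M lborel) (case_prod f)"
    proof (rule lborel_pair.Fubini_integrable)
      show "case_prod f \<in> borel_measurable (lborel \<Otimes>\<^sub>M lborel)" unfolding f_def by measurable
      have "(\<integral>t. norm (case_prod f (u, t)) \<partial>lborel) = two_exp A b u * (\<integral>t. \<phi> (t / N) \<partial>lborel)" for u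
        unfolding f_def using ph0 by (simp add: norm_mult two_exp_nonneg abs_of_nonneg)
      then show "integrable lborel (\<lambda>u. \<integral>t. norm (case_prod f (u, t)) \<partial>lborel)"
        using E by simp
      show "AE u in lborel. integrable lborel (\<lambda>t. case_prod f (u, t))"
      proof (rule AE_I2)
        fix u
        show "integrable lborel (\<lambda>t. case_prod f (u, t))"
        proof (rule Bochner_Integration.integrable_bound[OF gi])
          show "(\<lambda>t. case_prod f (u, t)) \<in> borel_measurable lborel" unfolding f_def case_prod_conv by measurable
          show "AE t in lborel. norm (case_prod f (u, t)) \<le> norm (\<phi> (t / N))"
            unfolding f_def using two_exp_le_1[OF A b, of u] two_exp_nonneg[of A b u] ph0(1)
            by (intro AE_I2) (auto simp: norm_mult intro!: mult_left_le_one_le)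
        qed
      qed
    qed
    have "I n = (\<integral>t. (\<integral>u. f u t \<partial>lborel) \<partial>lborel)"
      unfolding I_def
    proof (rule Bochner_Integration.integral_cong)
      fix t
      have "f u t = (of_real (two_exp A b u) * cis (- (t * u))) * (cis (t * w) * of_real (\<phi> (t / N)))" for u
      proof -
        have "cis (t * (w - u)) = cis (- (t * u)) * cis (t * w)" unfolding cis_mult by (simp add: algebra_simps)
        then show ?thesis unfolding f_def by (simp only: mult.assoc)
      qed
      then have "(\<integral>u. f u t \<partial>lborel) = (\<integral>u. (of_real (two_exp A b u) * cis (- (t * u))) * (cis (t * w) * of_real (\<phi> (t / N))) \<partial>lborel)"
        by (simp only:)
      also have "\<dots> = (\<integral>u. of_real (two_exp A b u) * cis (- (t * u)) \<partial>lborel) * (cis (t * w) * of_real (\<phi> (t / N)))"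
        by (rule integral_mult_left_zero)
      also have "(\<integral>u. of_real (two_exp A b u) * cis (- (t * u)) \<partial>lborel) = two_exp_ft A b t"
        using has_bochner_integral_two_exp_cis[OF A b, of t] by (rule has_bochner_integral_integral_eq)
      finally show "two_exp_ft A b t * cis (t * w) * of_real (\<phi> (t / Suc n)) = (\<integral>u. f u t \<partial>lborel)" by (simp add: N_def mult_ac)
    qed simp
    also have "\<dots> = (\<integral>u. (\<integral>t. f u t \<partial>lborel) \<partial>lborel)" by (rule lborel_pair.Fubini_integral[OF fi])
    also have "\<dots> = (\<integral>u. of_real (two_exp A b u * (N * exp (- (N * (w - u))\<^sup>2 / 2))) \<partial>lborel)"
    proof (rule Bochner_Integration.integral_cong)
      fix u
      have "(\<integral>t. f u t \<partial>lborel) = of_real (two_exp A b u) * (\<integral>t. cis (t * (w - u)) * of_real (\<phi> (t / N)) \<partial>lborel)"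
        unfolding f_def by (simp add: mult.assoc)
      then show "(\<integral>t. f u t \<partial>lborel) = of_real (two_exp A b u * (N * exp (- (N * (w - u))\<^sup>2 / 2)))"
        unfolding \<phi>_def gauss_fourier_scaled[OF N] by simp
    qed simp
    also have "\<dots> = \<bar>- 1 / N\<bar> *\<^sub>R (\<integral>x. of_real (two_exp A b (w + (- 1 / N) * x) * (N * exp (- (N * (w - (w + (- 1 / N) * x)))\<^sup>2 / 2))) \<partial>lborel)"
      by (rule lborel_integral_real_affine) (use N in simp)
    also have "(\<lambda>x. of_real (two_exp A b (w + (- 1 / N) * x) * (N * exp (- (N * (w - (w + (- 1 / N) * x)))\<^sup>2 / 2))) :: complex) =
       (\<lambda>x. of_real N * of_real (two_exp A b (w - x / N) * exp (- x\<^sup>2 / 2)))"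
      using N by (auto simp: mult_ac)
    also have "\<bar>- 1 / N\<bar> *\<^sub>R (\<integral>x. of_real N * of_real (two_exp A b (w - x / N) * exp (- x\<^sup>2 / 2)) \<partial>lborel) = (\<integral>x. complex_of_real (two_exp A b (w - x / N) * exp (- x\<^sup>2 / 2)) \<partial>lborel)"
      unfolding integral_mult_right_zero using N by (simp add: scaleR_conv_of_real del: integral_complex_of_real of_real_mult)
    finally show ?thesis by (simp only: N_def)
  qed
  have gauss: "integrable lborel (\<lambda>x::real. exp (- x\<^sup>2 / 2))" "(\<integral>x. exp (- (x::real)\<^sup>2 / 2) \<partial>lborel) = 1 / c"
  proof -
    have e: "exp (- x\<^sup>2 / 2) = 1 / c * \<phi> x" for x using c0 by (simp add: ph)
    show "integrable lborel (\<lambda>x::real. exp (- x\<^sup>2 / 2))" unfolding e using phi by simp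
    show "(\<integral>x. exp (- (x::real)\<^sup>2 / 2) \<partial>lborel) = 1 / c" unfolding e using phi by simp
  qed
  have "I \<longlonglongrightarrow> (\<integral>x. of_real (two_exp A b w * exp (- x\<^sup>2 / 2)) \<partial>lborel)"
    unfolding I1
  proof (rule integral_dominated_convergence[where w = "\<lambda>x. exp (- x\<^sup>2 / 2)"])
    show "(\<lambda>x. complex_of_real (two_exp A b w * exp (- x\<^sup>2 / 2))) \<in> borel_measurable lborel" by measurable
    show "(\<lambda>x. complex_of_real (two_exp A b (w - x / Suc n) * exp (- x\<^sup>2 / 2))) \<in> borel_measurable lborel" for n by measurable
    show "AE x in lborel. (\<lambda>n. complex_of_real (two_exp A b (w - x / Suc n) * exp (- x\<^sup>2 / 2))) \<longlonglongrightarrow> of_real (two_exp A b w * exp (- x\<^sup>2 / 2))"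
    proof (intro AE_I2 tendsto_of_real tendsto_mult_right)
      fix x :: real
      have "(\<lambda>n. x / real (Suc n)) \<longlonglongrightarrow> 0" by real_asymp
      then have "(\<lambda>n. w - x / real (Suc n)) \<longlonglongrightarrow> w - 0" by (intro tendsto_intros)
      then show "(\<lambda>n. two_exp A b (w - x / real (Suc n))) \<longlonglongrightarrow> two_exp A b w"
        unfolding two_exp_def by (intro tendsto_intros) simp_all
    qed
    show "AE x in lborel. norm (complex_of_real (two_exp A b (w - x / Suc n) * exp (- x\<^sup>2 / 2))) \<le> exp (- x\<^sup>2 / 2)" for n
    proof (rule AE_I2)
      fix x :: real
      have "norm (complex_of_real (two_exp A b (w - x / Suc n) * exp (- x\<^sup>2 / 2))) = two_exp A b (w - x / Suc n) * exp (- x\<^sup>2 / 2)"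
        unfolding norm_of_real by (rule abs_of_nonneg) (simp add: two_exp_nonneg)
      also have "\<dots> \<le> 1 * exp (- x\<^sup>2 / 2)" by (intro mult_right_mono two_exp_le_1[OF A b]) simp
      finally show "norm (complex_of_real (two_exp A b (w - x / Suc n) * exp (- x\<^sup>2 / 2))) \<le> exp (- x\<^sup>2 / 2)" by simp
    qed
  qed (rule gauss)
  also have "(\<integral>x. complex_of_real (two_exp A b w * exp (- x\<^sup>2 / 2)) \<partial>lborel) = of_real (two_exp A b w / c)"
    using gauss by (simp only: integral_complex_of_real integral_mult_right_zero) simp
  finally have L1: "I \<longlonglongrightarrow> of_real (two_exp A b w / c)" .
  have L2: "I \<longlonglongrightarrow> (\<integral>t. two_exp_ft A b t * cis (t * w) * of_real c \<partial>lborel)"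
    unfolding I_def
  proof (rule integral_dominated_convergence[where w = "\<lambda>t. norm (two_exp_ft A b t) * c"])
    show "integrable lborel (\<lambda>t. norm (two_exp_ft A b t) * c)"
      by (intro integrable_mult_left integrable_norm integrable_two_exp_ft A b)
    show "AE t in lborel. (\<lambda>n. two_exp_ft A b t * cis (t * w) * of_real (\<phi> (t / Suc n))) \<longlonglongrightarrow> two_exp_ft A b t * cis (t * w) * of_real c"
    proof (intro AE_I2 tendsto_mult_left tendsto_of_real)
      fix t :: real
      have "(\<lambda>n. t / real (Suc n)) \<longlonglongrightarrow> 0" by real_asymp
      then have "(\<lambda>n. c * exp (- (t / real (Suc n))\<^sup>2 / 2)) \<longlonglongrightarrow> c * exp (- 0\<^sup>2 / 2)" by (intro tendsto_intros) auto
      then show "(\<lambda>n. \<phi> (t / real (Suc n))) \<longlonglongrightarrow> c" unfolding ph by simp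
    qed
    show "AE t in lborel. norm (two_exp_ft A b t * cis (t * w) * of_real (\<phi> (t / Suc n))) \<le> norm (two_exp_ft A b t) * c" for n
      using ph0 by (intro AE_I2) (auto simp: norm_mult intro!: mult_left_mono)
  qed measurable
  have "of_real (two_exp A b w / c) = (\<integral>t. two_exp_ft A b t * cis (t * w) * of_real c \<partial>lborel)"
    by (rule LIMSEQ_unique[OF L1 L2])
  also have "\<dots> = (\<integral>t. two_exp_ft A b t * cis (t * w) \<partial>lborel) * of_real c" by simp
  finally have "(\<integral>t. two_exp_ft A b t * cis (t * w) \<partial>lborel) = of_real (two_exp A b w / c) / of_real c"
    using c0 by (simp add: field_simps)
  also have "\<dots> = of_real (two_exp A b w / (c * c))" by simp
  also have "c * c = 1 / (2 * pi)" by (simp add: c)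
  finally show ?thesis by (simp add: mult_ac)
qed

section \<open>Inversion formula for the tilted series\<close>

abbreviation psi_coeff :: "nat \<Rightarrow> real" where
  "psi_coeff n \<equiv> kernel_coeff (\<lambda>p. 1 / (real p + 1)) n"

lemma psi_coeff_bounds: "0 < psi_coeff n" "psi_coeff n \<le> 1"
proof -
  show "0 < psi_coeff n" unfolding kernel_coeff_def by (intro prod_pos) (auto intro: add_nonneg_pos)
  show "psi_coeff n \<le> 1" unfolding kernel_coeff_def by (intro prod_le_1) auto
qed

lemma dirichlet_term_Complex:
  "dirichlet_term c (Complex a t) n = of_real (kernel_coeff c n * real n powr (- a)) * cis (- (t * ln (real n)))"
proof (cases "n = 0")
  case False
  have "- Complex a t = Complex (- a) (- t)" by (simp add: complex_eq_iff)
  then have "of_nat n powr (- Complex a t) = of_real (real n powr (- a)) * cis (- t * ln (real n))"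
    using nat_powr_Complex[of n "- a" "- t"] False by simp
  then show ?thesis by (simp add: dirichlet_term_def)
qed (simp add: dirichlet_term_def)

text \<open>A Perron formula whose kernel is absolutely integrable, so that the Dirichlet series can
  be integrated term by term. The sum on the left is real, hence the real part on the right.\<close>

lemma perron_two_exp:
  assumes a: "a > 0" and A: "A > 0" and b: "b > 0"
  shows "integrable lborel (\<lambda>t. psi_series (Complex a t) * cis (t * v) * two_exp_ft A b t)"
    and "(\<lambda>n. psi_coeff n * real n powr (- a) * (2 * pi * two_exp A b (v - ln (real n)))) sums
      (\<integral>t. Re (psi_series (Complex a t) * cis (t * v) * two_exp_ft A b t) \<partial>lborel)"
proof -
  define f where "f = (\<lambda>n t. dirichlet_term (\<lambda>p. 1 / (real p + 1)) (Complex a t) n * cis (t * v) * two_exp_ft A b t)"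
  have f_eq: "f n t = of_real (psi_coeff n * real n powr (- a)) * (two_exp_ft A b t * cis (t * (v - ln (real n))))" for n t
  proof -
    have "cis (- (t * ln (real n))) * cis (t * v) = cis (t * (v - ln (real n)))" unfolding cis_mult by (simp add: algebra_simps)
    then show ?thesis unfolding f_def dirichlet_term_Complex by (simp add: mult_ac)
  qed
  have ti: "integrable lborel (\<lambda>t. two_exp_ft A b t * cis (t * w))" for w
    by (rule Bochner_Integration.integrable_bound[OF integrable_two_exp_ft[OF A b]]) (auto simp: norm_mult)
  have fi: "integrable lborel (f n)" for n unfolding f_eq[abs_def] by (intro integrable_mult_right ti)
  have fint: "integral\<^sup>L lborel (f n) = of_real (psi_coeff n * real n powr (- a) * (2 * pi * two_exp A b (v - ln (real n))))" for n
    unfolding f_eq[abs_def] integral_mult_right_zero two_exp_inversion[OF A b] by simp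
  have nf: "norm (f n t) = psi_coeff n * real n powr (- a) * norm (two_exp_ft A b t)" for n t
    unfolding f_eq norm_mult norm_of_real norm_cis using psi_coeff_bounds(1)[of n] by (simp add: abs_mult)
  have summ: "summable (\<lambda>n. psi_coeff n * real n powr (- a))" by (rule psi_series_real_props(1)[OF a])
  have s1: "AE t in lborel. summable (\<lambda>n. norm (f n t))"
    unfolding nf by (rule AE_I2, rule summable_mult2[OF summ])
  have s2: "summable (\<lambda>n. \<integral>t. norm (f n t) \<partial>lborel)"
    unfolding nf integral_mult_right_zero by (rule summable_mult2[OF summ])
  have sumf: "(\<Sum>n. f n t) = psi_series (Complex a t) * cis (t * v) * two_exp_ft A b t" for t
  proof -
    have "summable (\<lambda>n. dirichlet_term (\<lambda>p. 1 / (real p + 1)) (Complex a t) n)"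
      by (rule summable_norm_cancel[OF psi_series_props(1)]) (use a in simp)
    from suminf_mult2[OF this, of "cis (t * v) * two_exp_ft A b t"]
    show ?thesis unfolding f_def psi_series_def by (simp only: mult.assoc)
  qed
  show int: "integrable lborel (\<lambda>t. psi_series (Complex a t) * cis (t * v) * two_exp_ft A b t)"
    using integrable_suminf[OF fi s1 s2] unfolding sumf .
  have "(\<lambda>n. integral\<^sup>L lborel (f n)) sums (\<integral>t. psi_series (Complex a t) * cis (t * v) * two_exp_ft A b t \<partial>lborel)"
    using sums_integral[OF fi s1 s2] unfolding sumf .
  then have "(\<lambda>n. Re (integral\<^sup>L lborel (f n))) sums Re (\<integral>t. psi_series (Complex a t) * cis (t * v) * two_exp_ft A b t \<partial>lborel)"
    by (rule sums_Re)
  then show "(\<lambda>n. psi_coeff n * real n powr (- a) * (2 * pi * two_exp A b (v - ln (real n)))) sums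
      (\<integral>t. Re (psi_series (Complex a t) * cis (t * v) * two_exp_ft A b t) \<partial>lborel)"
    unfolding fint Re_complex_of_real integral_Re[OF int] .
qed

lemma tilted_char_integral:
  assumes a: "a > 0" and A: "A > 0" and b: "b > 0"
  shows "integrable lborel (\<lambda>t. tilted_char a t * two_exp_ft A b t)"
    and "(\<lambda>n. psi_coeff n * real n powr (- a) * two_exp A b (saddle_sum a - ln (real n))) sums
      (psi_series_real a / (2 * pi) * (\<integral>t. Re (tilted_char a t * two_exp_ft A b t) \<partial>lborel))"
proof -
  define R where "R = psi_series_real a"
  have R: "R > 0" using psi_series_real_props(4)[OF a] by (simp add: R_def)
  have eq: "psi_series (Complex a t) * cis (t * saddle_sum a) * two_exp_ft A b t = of_real R * (tilted_char a t * two_exp_ft A b t)" for t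
    unfolding tilted_char_def R_def[symmetric] using R by simp
  note P = perron_two_exp[OF a A b, of "saddle_sum a"]
  have "integrable lborel (\<lambda>t. (1 / of_real R) * (of_real R * (tilted_char a t * two_exp_ft A b t)))"
    using P(1) unfolding eq by (rule integrable_mult_right)
  then show "integrable lborel (\<lambda>t. tilted_char a t * two_exp_ft A b t)" using R by simp
  have "(\<integral>t. Re (psi_series (Complex a t) * cis (t * saddle_sum a) * two_exp_ft A b t) \<partial>lborel) = R * (\<integral>t. Re (tilted_char a t * two_exp_ft A b t) \<partial>lborel)"
  proof -
    have "Re (of_real R * z) = R * Re z" for z by simp
    then show ?thesis unfolding eq by (simp only: integral_mult_right_zero)
  qed
  then have "(\<lambda>n. psi_coeff n * real n powr (- a) * (2 * pi * two_exp A b (saddle_sum a - ln (real n)))) sums (R * (\<integral>t. Re (tilted_char a t * two_exp_ft A b t) \<partial>lborel))"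
    using P(2) by simp
  from sums_mult[OF this, of "1 / (2 * pi)"]
  show "(\<lambda>n. psi_coeff n * real n powr (- a) * two_exp A b (saddle_sum a - ln (real n))) sums
      (psi_series_real a / (2 * pi) * (\<integral>t. Re (tilted_char a t * two_exp_ft A b t) \<partial>lborel))"
    by (simp add: R_def mult_ac)
qed

section \<open>Integrable majorants on the t line\<close>

lemma integral_inverse_1_plus_scaled:
  assumes "k > 0"
  shows "integrable lborel (\<lambda>t::real. 1 / (1 + (k * t)\<^sup>2))" "(\<integral>t. 1 / (1 + (k * t)\<^sup>2) \<partial>lborel) = pi / k"
proof -
  have I: "(\<integral>x. 1 / (1 + (x::real)\<^sup>2) \<partial>lborel) = pi"
    using LBINT_inverse_1_plus_square
    by (simp add: interval_lebesgue_integral_def set_lebesgue_integral_def einterval_eq_UNIV inverse_eq_divide)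
  show "integrable lborel (\<lambda>t::real. 1 / (1 + (k * t)\<^sup>2))"
    using lborel_integrable_real_affine[OF integrable_inverse_1_plus_sq, of k 0] assms by simp
  have "(\<integral>x. 1 / (1 + (x::real)\<^sup>2) \<partial>lborel) = \<bar>k\<bar> *\<^sub>R (\<integral>t. 1 / (1 + (0 + k * t)\<^sup>2) \<partial>lborel)"
    by (rule lborel_integral_real_affine) (use assms in simp)
  then show "(\<integral>t. 1 / (1 + (k * t)\<^sup>2) \<partial>lborel) = pi / k" using assms by (simp add: I field_simps)
qed

text \<open>The majorant for large t, with the exponent of \<open>tilted_char_far\<close>. By (1 +
  |t|)^2 <= 2 (1 + t^2) it is O((1 + |t|)^(-5/4)).\<close>

lemma integrable_powr_over_1_plus_sq: "integrable lborel (\<lambda>t::real. (1 + \<bar>t\<bar>) powr (3 / 4) * (1 / (1 + t\<^sup>2)))"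
proof -
  have "(\<lambda>x::real. x powr (- 5 / 4)) absolutely_integrable_on {1..}"
    using has_integral_powr_to_inf[of "- 5 / 4" 1] by (intro nonnegative_absolutely_integrable_1) (auto simp: integrable_on_def)
  then have i1: "integrable lborel (\<lambda>x::real. indicator {1..} x *\<^sub>R x powr (- 5 / 4))"
    unfolding set_integrable_def by (subst (asm) integrable_completion) auto
  have i2: "integrable lborel (\<lambda>x::real. indicator {1..} (1 + 1 * x) *\<^sub>R (1 + 1 * x) powr (- 5 / 4))"
    by (rule lborel_integrable_real_affine[OF i1]) simp
  have i3: "integrable lborel (\<lambda>x::real. indicator {1..} (1 + (- 1) * x) *\<^sub>R (1 + (- 1) * x) powr (- 5 / 4))"
    by (rule lborel_integrable_real_affine[OF i1]) simp
  have i4: "integrable lborel (\<lambda>x::real. 2 * (indicator {1..} (1 + 1 * x) *\<^sub>R (1 + 1 * x) powr (- 5 / 4) + indicator {1..} (1 + (- 1) * x) *\<^sub>R (1 + (- 1) * x) powr (- 5 / 4)))"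
    by (intro integrable_mult_right Bochner_Integration.integrable_add i2 i3)
  show ?thesis
  proof (rule Bochner_Integration.integrable_bound[OF i4])
    show "AE t in (lborel :: real measure). norm ((1 + \<bar>t\<bar>) powr (3 / 4) * (1 / (1 + t\<^sup>2))) \<le>
      norm (2 * (indicator {1..} (1 + 1 * t) *\<^sub>R (1 + 1 * t) powr (- 5 / 4) + indicator {1..} (1 + (- 1) * t) *\<^sub>R (1 + (- 1) * t) powr (- 5 / 4)))"
    proof (rule AE_I2)
      fix t :: real
      have "(1 + \<bar>t\<bar>)\<^sup>2 \<le> 2 * (1 + t\<^sup>2)"
      proof -
        have "0 \<le> (1 - \<bar>t\<bar>)\<^sup>2" by simp
        then show ?thesis by (simp add: power2_eq_square algebra_simps)
      qed
      moreover have p: "0 < 1 + t\<^sup>2" "0 < (1 + \<bar>t\<bar>)\<^sup>2" by (auto intro: add_pos_nonneg)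
      ultimately have "2 / (2 * (1 + t\<^sup>2)) \<le> 2 / (1 + \<bar>t\<bar>)\<^sup>2" by (intro frac_le) auto
      moreover have "2 / (2 * x) = 1 / x" for x :: real by simp
      ultimately have "1 / (1 + t\<^sup>2) \<le> 2 / (1 + \<bar>t\<bar>)\<^sup>2" by (simp only:)
      also have "\<dots> = 2 * (1 + \<bar>t\<bar>) powr (- 2)" by (simp add: powr_minus powr_numeral divide_inverse add_pos_nonneg)
      finally have "(1 + \<bar>t\<bar>) powr (3 / 4) * (1 / (1 + t\<^sup>2)) \<le> (1 + \<bar>t\<bar>) powr (3 / 4) * (2 * (1 + \<bar>t\<bar>) powr (- 2))"
        by (intro mult_left_mono) auto
      also have "\<dots> = 2 * (1 + \<bar>t\<bar>) powr (3 / 4 + - 2)" unfolding powr_add by simp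
      also have "3 / 4 + - 2 = (- 5 / 4 :: real)" by simp
      also have "(1 + \<bar>t\<bar>) powr (- 5 / 4) \<le> indicator {1..} (1 + 1 * t) *\<^sub>R (1 + 1 * t) powr (- 5 / 4) + indicator {1..} (1 + (- 1) * t) *\<^sub>R (1 + (- 1) * t) powr (- 5 / 4)"
        by (cases "t \<ge> 0") (auto simp: indicator_def)
      finally have m1: "(1 + \<bar>t\<bar>) powr (3 / 4) * (1 / (1 + t\<^sup>2)) \<le> 2 * (indicator {1..} (1 + 1 * t) *\<^sub>R (1 + 1 * t) powr (- 5 / 4) + indicator {1..} (1 + (- 1) * t) *\<^sub>R (1 + (- 1) * t) powr (- 5 / 4))"
        by simp
      have m2: "norm ((1 + \<bar>t\<bar>) powr (3 / 4) * (1 / (1 + t\<^sup>2))) = (1 + \<bar>t\<bar>) powr (3 / 4) * (1 / (1 + t\<^sup>2))"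
        using p by simp
      show "norm ((1 + \<bar>t\<bar>) powr (3 / 4) * (1 / (1 + t\<^sup>2))) \<le>
        norm (2 * (indicator {1..} (1 + 1 * t) *\<^sub>R (1 + 1 * t) powr (- 5 / 4) + indicator {1..} (1 + (- 1) * t) *\<^sub>R (1 + (- 1) * t) powr (- 5 / 4)))"
        unfolding m2 using m1 by (rule order_trans) (simp only: real_norm_def abs_ge_self)
    qed
  qed measurable
qed

section \<open>Saddle-point integrals\<close>

text \<open>Used with y = B u^2, B being the reciprocal of a ln (1 / a): the exponential decay
  absorbs the polynomial factor of the central estimates and leaves a function whose integral is a
  multiple of a / sqrt B.\<close>

lemma exp_times_power_bounded:
  assumes "c > (0::real)"
  obtains K where "K > 0" "\<And>y. y \<ge> 0 \<Longrightarrow> exp (- (c * y)) * (1 + y) ^ 3 \<le> K * (1 / (1 + y))"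
proof -
  define m where "m = min 1 (c / 4)"
  have m: "0 < m" "m \<le> 1" "m \<le> c / 4" using assms by (auto simp: m_def)
  show ?thesis
  proof (rule that[of "1 / m ^ 4"])
    show "1 / m ^ 4 > 0" using m by simp
    fix y :: real assume y: "y \<ge> 0"
    have "m * (1 + y) \<le> 1 + c / 4 * y" using m y mult_right_mono[of m "c / 4" y] by (simp add: distrib_left)
    also have "\<dots> \<le> exp (c / 4 * y)" by (rule exp_ge_add_one_self)
    finally have "(m * (1 + y)) ^ 4 \<le> (exp (c / 4 * y)) ^ 4" using m y by (intro power_mono) auto
    also have "\<dots> = exp (c * y)" by (simp add: exp_of_nat_mult[symmetric])
    finally have "m ^ 4 * (1 + y) ^ 4 \<le> exp (c * y)" by (simp add: power_mult_distrib)
    then have "exp (- (c * y)) * (m ^ 4 * (1 + y) ^ 4) \<le> exp (- (c * y)) * exp (c * y)" by (intro mult_left_mono) auto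
    then have "exp (- (c * y)) * (m ^ 4 * (1 + y) ^ 4) \<le> 1" by (simp add: exp_minus)
    moreover have "(1 + y) ^ 4 = (1 + y) ^ 3 * (1 + y)" by (simp add: eval_nat_numeral)
    ultimately have "(exp (- (c * y)) * (1 + y) ^ 3) * (m ^ 4 * (1 + y)) \<le> 1" by (simp add: mult_ac)
    then have "exp (- (c * y)) * (1 + y) ^ 3 \<le> 1 / (m ^ 4 * (1 + y))"
      using m y by (subst pos_le_divide_eq) (auto intro!: mult_pos_pos)
    then show "exp (- (c * y)) * (1 + y) ^ 3 \<le> 1 / m ^ 4 * (1 / (1 + y))" by simp
  qed
qed

text \<open>With s = a + i t this is 1 / ((1 - s) (\<mu> + s)), the part of the kernel difference
  that stays bounded near s = 0.\<close>

definition regular_kernel :: "real \<Rightarrow> real \<Rightarrow> real \<Rightarrow> complex" where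
  "regular_kernel \<mu> a t = 1 / (Complex (1 - a) (- t) * Complex (\<mu> + a) t)"

text \<open>The quotient of the kernels is (1 + \<mu>) s / (\<mu> + s), at s = a equal to a /
  \<theta> to first order. After the subtraction the pole at s = 0 survives only in i t / s, which
  is bounded by 1 and vanishes at t = 0.\<close>

lemma kernel_difference:
  assumes "0 < \<theta>" "\<theta> < 1" "0 < a" "a < 1"
  defines "\<mu> \<equiv> \<theta> / (1 - \<theta>)"
  shows "two_exp_ft (\<mu> + a) (1 - a) t - of_real (a / \<theta>) * two_exp_ft a (1 - a) t =
     regular_kernel \<mu> a t * (of_real (1 + \<mu>) * (\<i> * of_real t / Complex a t) - of_real (a / \<theta>))"
proof -
  define s where "s = Complex a t"
  define l where "l = complex_of_real \<mu>"
  define k where "k = complex_of_real (a / \<theta>)"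
  have s0: "s \<noteq> 0" "1 - s \<noteq> 0" using assms by (auto simp: s_def complex_eq_iff)
  have l0: "\<mu> > 0" using assms by (simp add: \<mu>_def)
  have "Re (l + s) = \<mu> + a" by (simp add: l_def s_def)
  then have ls: "l + s \<noteq> 0" using l0 assms(3) by force
  have c1: "Complex (1 - a) (- t) = 1 - s" by (simp add: s_def complex_eq_iff)
  have c2: "Complex (\<mu> + a) t = l + s" by (simp add: s_def l_def complex_eq_iff)
  have it: "\<i> * of_real t = s - of_real a" by (simp add: s_def complex_eq_iff)
  have kl: "k * l = (1 + l) * of_real a"
  proof -
    have "a / \<theta> * \<mu> = (1 + \<mu>) * a" using assms unfolding \<mu>_def by (simp add: field_simps)
    then show ?thesis unfolding k_def l_def by (metis of_real_1 of_real_add of_real_mult)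
  qed
  have "two_exp_ft (\<mu> + a) (1 - a) t - k * two_exp_ft a (1 - a) t = (1 + l) / ((l + s) * (1 - s)) - k * (1 / (s * (1 - s)))"
    unfolding two_exp_ft_def c1 c2 s_def[symmetric] by (simp add: l_def add.commute)
  also have "\<dots> = ((1 + l) * s - k * (l + s)) / (s * (1 - s) * (l + s))"
  proof -
    have "p / (Y * X) - k * (1 / (A * X)) = (p * A - k * Y) / (A * X * Y)"
      if "A \<noteq> 0" "X \<noteq> 0" "Y \<noteq> 0" for p A X Y :: complex
      using that by (simp add: field_simps)
    from this[OF s0 ls] show ?thesis .
  qed
  also have "(1 + l) * s - k * (l + s) = (1 + l) * (s - of_real a) - k * s" using kl by (simp add: algebra_simps)
  also have "((1 + l) * (s - of_real a) - k * s) / (s * (1 - s) * (l + s)) = (1 / ((1 - s) * (l + s))) * ((1 + l) * ((s - of_real a) / s) - k)"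
  proof -
    have "(p * B - k * A) / (A * X * Y) = (1 / (X * Y)) * (p * (B / A) - k)"
      if "A \<noteq> 0" "X \<noteq> 0" "Y \<noteq> 0" for p A B X Y :: complex
      using that by (simp add: field_simps)
    from this[OF s0 ls] show ?thesis .
  qed
  finally show ?thesis unfolding regular_kernel_def c1 c2 it s_def[symmetric] k_def l_def by simp
qed

lemma Re_of_real_times: "Re (of_real c * z) = c * Re z"
  by simp

text \<open>The value at t = 0 is real, so \<open>central_upper_bound\<close> can take it out of a
  real part; the second claim controls the variation from that value.\<close>

lemma regular_kernel_bounds:
  assumes l: "\<mu> > 0" and a: "0 < a" "a \<le> 1 / 2"
  defines "CH \<equiv> 2 / min 1 \<mu>"
  shows "norm (regular_kernel \<mu> a t) \<le> CH * (1 / (1 + t\<^sup>2))"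
    and "\<bar>t\<bar> \<le> 1 \<Longrightarrow> norm (regular_kernel \<mu> a t - regular_kernel \<mu> a 0) \<le> CH\<^sup>2 * (2 + \<mu>) * \<bar>t\<bar>"
    and "Im (regular_kernel \<mu> a 0) = 0"
proof -
  define X where "X = (\<lambda>t. Complex (1 - a) (- t) * Complex (\<mu> + a) t)"
  have m: "0 < min 1 \<mu>" using l by simp
  show b1: "norm (regular_kernel \<mu> a t) \<le> CH * (1 / (1 + t\<^sup>2))" for t
  proof -
    have q: "sqrt (1 + t\<^sup>2) > 0" by (simp add: add_pos_nonneg)
    have "1 / 2 * sqrt (1 + t\<^sup>2) \<le> norm (Complex (1 - a) (- t))"
      using norm_Complex_ge[of "1 / 2" "1 - a" "- t"] a by simp
    moreover have "min 1 \<mu> * sqrt (1 + t\<^sup>2) \<le> norm (Complex (\<mu> + a) t)"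
      using a l by (intro norm_Complex_ge) auto
    ultimately have "(1 / 2 * sqrt (1 + t\<^sup>2)) * (min 1 \<mu> * sqrt (1 + t\<^sup>2)) \<le> norm (X t)"
      unfolding X_def norm_mult using q m by (intro mult_mono) auto
    moreover have "(1 / 2 * sqrt (1 + t\<^sup>2)) * (min 1 \<mu> * sqrt (1 + t\<^sup>2)) = (1 + t\<^sup>2) / CH"
    proof -
      have "sqrt (1 + t\<^sup>2) * sqrt (1 + t\<^sup>2) = 1 + t\<^sup>2" by (rule real_sqrt_mult_self[THEN trans]) simp
      then show ?thesis unfolding CH_def using m by (simp add: mult_ac)
    qed
    ultimately have "(1 + t\<^sup>2) / CH \<le> norm (X t)" by (simp only:)
    moreover have "0 < (1 + t\<^sup>2) / CH" unfolding CH_def using m by (simp add: add_pos_nonneg)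
    ultimately have "1 / norm (X t) \<le> 1 / ((1 + t\<^sup>2) / CH)" by (intro frac_le) auto
    then show ?thesis unfolding regular_kernel_def X_def by (simp add: norm_divide)
  qed
  have CH0: "CH > 0" unfolding CH_def using m by simp
  show "norm (regular_kernel \<mu> a t - regular_kernel \<mu> a 0) \<le> CH\<^sup>2 * (2 + \<mu>) * \<bar>t\<bar>" if t: "\<bar>t\<bar> \<le> 1"
  proof -
    have X0: "X t \<noteq> 0" "X 0 \<noteq> 0" unfolding X_def mult_eq_0_iff using a l by (auto simp: Complex_eq_0)
    have "regular_kernel \<mu> a t - regular_kernel \<mu> a 0 = regular_kernel \<mu> a t * regular_kernel \<mu> a 0 * (X 0 - X t)"
      unfolding regular_kernel_def X_def[symmetric] using X0[unfolded X_def] X0 by (simp add: X_def field_simps)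
    moreover have "norm (X 0 - X t) \<le> (2 + \<mu>) * \<bar>t\<bar>"
    proof -
      have "X 0 - X t = Complex (- t\<^sup>2) (t * (2 * a + \<mu> - 1))"
        unfolding X_def by (simp add: complex_eq_iff power2_eq_square algebra_simps)
      then have "norm (X 0 - X t) \<le> \<bar>- t\<^sup>2\<bar> + \<bar>t * (2 * a + \<mu> - 1)\<bar>" using cmod_le[of "X 0 - X t"] by simp
      moreover have "\<bar>- t\<^sup>2\<bar> \<le> \<bar>t\<bar>"
      proof -
        have "\<bar>- t\<^sup>2\<bar> = \<bar>t\<bar> * \<bar>t\<bar>" by (simp add: power2_eq_square)
        also have "\<dots> \<le> \<bar>t\<bar> * 1" using t by (intro mult_left_mono) auto
        finally show ?thesis by simp
      qed
      moreover have "\<bar>t * (2 * a + \<mu> - 1)\<bar> \<le> \<bar>t\<bar> * (1 + \<mu>)" unfolding abs_mult using a l by (intro mult_left_mono) auto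
      moreover have "(2 + \<mu>) * \<bar>t\<bar> = \<bar>t\<bar> + \<bar>t\<bar> * (1 + \<mu>)" by (simp add: algebra_simps)
      ultimately show ?thesis by linarith
    qed
    moreover have "norm (regular_kernel \<mu> a t) \<le> CH" "norm (regular_kernel \<mu> a 0) \<le> CH"
    proof -
      have "CH * (1 / (1 + x\<^sup>2)) \<le> CH * 1" for x using CH0 by (intro mult_left_mono) (auto simp: divide_le_eq_1 add_pos_nonneg)
      then show "norm (regular_kernel \<mu> a t) \<le> CH" "norm (regular_kernel \<mu> a 0) \<le> CH"
        using b1[of t] b1[of 0] by (auto intro: order_trans)
    qed
    ultimately have "norm (regular_kernel \<mu> a t - regular_kernel \<mu> a 0) \<le> CH * CH * ((2 + \<mu>) * \<bar>t\<bar>)"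
      by (simp only: norm_mult) (intro mult_mono mult_nonneg_nonneg, use CH0 l in auto)
    then show ?thesis by (simp add: power2_eq_square mult_ac)
  qed
  have "regular_kernel \<mu> a 0 = of_real (1 / ((1 - a) * (\<mu> + a)))"
    unfolding regular_kernel_def by (simp add: complex_eq_iff Complex_eq)
  then show "Im (regular_kernel \<mu> a 0) = 0" by simp
qed

text \<open>With u = t / a, the real part of i t / (a + i t) is at most u^2 and its imaginary part
  at most |u| in modulus. The linear part therefore multiplies only Im W, which is itself of third
  order.\<close>

lemma Re_times_ratio:
  assumes "a > 0"
  shows "\<bar>Re (W * (\<i> * of_real t / Complex a t))\<bar> \<le> (t / a)\<^sup>2 * norm W + \<bar>t / a\<bar> * \<bar>Im W\<bar>"
    and "norm (\<i> * of_real t / Complex a t) \<le> 1"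
proof -
  define d where "d = a\<^sup>2 + t\<^sup>2"
  have d: "d > 0" "a\<^sup>2 \<le> d" unfolding d_def using assms by (auto intro: add_pos_nonneg)
  have r: "\<i> * of_real t / Complex a t = Complex (t\<^sup>2 / d) (a * t / d)"
    using d by (simp add: complex_eq_iff Re_divide Im_divide d_def power2_eq_square)
  have "t\<^sup>2 / d \<le> t\<^sup>2 / a\<^sup>2" using d assms by (intro divide_left_mono) auto
  then have 1: "t\<^sup>2 / d \<le> (t / a)\<^sup>2" by (simp add: power_divide)
  have "\<bar>a * t / d\<bar> \<le> \<bar>a * t\<bar> / a\<^sup>2" using d assms by (simp add: abs_divide) (intro divide_left_mono, auto)
  also have "\<dots> = \<bar>t / a\<bar>" using assms by (simp add: abs_mult power2_eq_square)
  finally have 2: "\<bar>a * t / d\<bar> \<le> \<bar>t / a\<bar>" .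
  have "Re (W * Complex (t\<^sup>2 / d) (a * t / d)) = t\<^sup>2 / d * Re W - a * t / d * Im W" by (simp add: mult_ac)
  then have "\<bar>Re (W * Complex (t\<^sup>2 / d) (a * t / d))\<bar> \<le> \<bar>t\<^sup>2 / d * Re W\<bar> + \<bar>a * t / d * Im W\<bar>" by (simp only: abs_triangle_ineq4)
  also have "\<dots> \<le> (t / a)\<^sup>2 * norm W + \<bar>t / a\<bar> * \<bar>Im W\<bar>"
    unfolding abs_mult using 1 2 d abs_Re_le_cmod[of W] by (intro add_mono mult_mono) auto
  finally show "\<bar>Re (W * (\<i> * of_real t / Complex a t))\<bar> \<le> (t / a)\<^sup>2 * norm W + \<bar>t / a\<bar> * \<bar>Im W\<bar>" unfolding r .
  have "\<bar>t\<bar> \<le> norm (Complex a t)" using abs_Im_le_cmod[of "Complex a t"] by simp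
  moreover have "0 < norm (Complex a t)" using assms by (auto simp: complex_eq_iff)
  ultimately show "norm (\<i> * of_real t / Complex a t) \<le> 1" by (simp add: norm_divide norm_mult divide_le_eq_1)
qed

text \<open>The error of the theorem arises here: up to powers of 1 + B u^2 the integrand is norm W
  times 1 / B. It has three sources: the ratio i t / s against the real value of the regular kernel
  at 0, which gives u^2 and B u^4; the variation of that kernel, of order |t| <= a; and the
  remainder a / \<theta>. By \<open>Ba\<close> the last two are O(1 / B) as well.\<close>

lemma central_upper_bound:
  assumes \<theta>: "0 < \<theta>" "\<theta> < 1" and a: "0 < a" "a \<le> 1 / 2" and t: "\<bar>t\<bar> \<le> a / 8" and Ba: "a \<le> 1 / B" and B: "B > 0"
    and C: "C > 0" and im: "\<bar>Im W\<bar> \<le> norm W * (C * B * \<bar>t / a\<bar> ^ 3)"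
  defines "\<mu> \<equiv> \<theta> / (1 - \<theta>)"
  defines "CH \<equiv> 2 / min 1 \<mu>"
  shows "\<bar>Re (W * (two_exp_ft (\<mu> + a) (1 - a) t - of_real (a / \<theta>) * two_exp_ft a (1 - a) t))\<bar> \<le>
     (CH * (1 + \<mu>) * (1 + C) + CH\<^sup>2 * (2 + \<mu>) * (1 + \<mu>) + CH / \<theta>) * (1 / B) * (norm W * (1 + B * (t / a)\<^sup>2) ^ 3)"
proof -
  define u where "u = t / a"
  define y where "y = B * u\<^sup>2"
  define H where "H = regular_kernel \<mu> a"
  define r where "r = \<i> * of_real t / Complex a t"
  define h where "h = Re (H 0)"
  have l: "\<mu> > 0" using \<theta> by (simp add: \<mu>_def)
  have y: "y \<ge> 0" using B by (simp add: y_def)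
  have t1: "\<bar>t\<bar> \<le> 1" "\<bar>t\<bar> \<le> a" using t a by auto
  note RK = regular_kernel_bounds[OF l a]
  have CH0: "CH > 0" using l by (simp add: CH_def)
  have H0: "H 0 = of_real h" unfolding h_def H_def using RK(3) by (simp add: complex_eq_iff)
  have hle: "\<bar>h\<bar> \<le> CH" using RK(1)[of 0] unfolding h_def H_def CH_def using abs_Re_le_cmod order_trans by fastforce
  have Hle: "norm (H t) \<le> CH"
  proof -
    have "CH * (1 / (1 + t\<^sup>2)) \<le> CH * 1" using CH0 by (intro mult_left_mono) (auto simp: divide_le_eq_1 add_pos_nonneg)
    then show ?thesis using RK(1)[of t] unfolding H_def CH_def by linarith
  qed
  have Hd: "norm (H t - H 0) \<le> CH\<^sup>2 * (2 + \<mu>) * \<bar>t\<bar>" using RK(2)[OF t1(1)] unfolding H_def CH_def .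
  have r1: "norm r \<le> 1" unfolding r_def by (rule Re_times_ratio(2)[OF a(1)])
  have Rr: "\<bar>Re (W * r)\<bar> \<le> norm W * (u\<^sup>2 + C * B * u ^ 4)"
  proof -
    have "\<bar>Re (W * r)\<bar> \<le> u\<^sup>2 * norm W + \<bar>u\<bar> * \<bar>Im W\<bar>" unfolding r_def u_def by (rule Re_times_ratio(1)[OF a(1)])
    also have "\<bar>u\<bar> * \<bar>Im W\<bar> \<le> \<bar>u\<bar> * (norm W * (C * B * \<bar>u\<bar> ^ 3))" using im by (intro mult_left_mono) (auto simp: u_def)
    also have "\<bar>u\<bar> * (norm W * (C * B * \<bar>u\<bar> ^ 3)) = norm W * (C * B * \<bar>u\<bar> ^ 4)" by (simp add: eval_nat_numeral mult_ac)
    finally show ?thesis by (simp add: algebra_simps)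
  qed
  have a1: "a < 1" using a by simp
  have kd: "two_exp_ft (\<mu> + a) (1 - a) t - of_real (a / \<theta>) * two_exp_ft a (1 - a) t = H t * (of_real (1 + \<mu>) * r - of_real (a / \<theta>))"
    unfolding \<mu>_def H_def r_def by (rule kernel_difference[OF \<theta> a(1) a1])
  have "W * (two_exp_ft (\<mu> + a) (1 - a) t - of_real (a / \<theta>) * two_exp_ft a (1 - a) t) =
      of_real (h * (1 + \<mu>)) * (W * r) + of_real (1 + \<mu>) * (W * (H t - H 0) * r) - of_real (a / \<theta>) * (W * H t)"
    unfolding kd H0 of_real_mult by (simp add: algebra_simps)
  then have main: "\<bar>Re (W * (two_exp_ft (\<mu> + a) (1 - a) t - of_real (a / \<theta>) * two_exp_ft a (1 - a) t))\<bar> \<le>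
      \<bar>h * (1 + \<mu>) * Re (W * r)\<bar> + \<bar>(1 + \<mu>) * Re (W * (H t - H 0) * r)\<bar> + \<bar>a / \<theta> * Re (W * H t)\<bar>"
    by (simp only: minus_complex.sel plus_complex.sel Re_of_real_times)
  have S1: "\<bar>h * (1 + \<mu>) * Re (W * r)\<bar> \<le> CH * (1 + \<mu>) * (norm W * (u\<^sup>2 + C * B * u ^ 4))"
    unfolding abs_mult using hle Rr l CH0 by (intro mult_mono) auto
  have S2: "\<bar>(1 + \<mu>) * Re (W * (H t - H 0) * r)\<bar> \<le> (1 + \<mu>) * (norm W * (CH\<^sup>2 * (2 + \<mu>) * a))"
  proof -
    have "\<bar>Re (W * (H t - H 0) * r)\<bar> \<le> norm (W * (H t - H 0) * r)" by (rule abs_Re_le_cmod)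
    also have "\<dots> \<le> norm (W * (H t - H 0)) * 1" unfolding norm_mult[of _ r] using r1 by (intro mult_left_mono) auto
    also have "\<dots> \<le> norm W * (CH\<^sup>2 * (2 + \<mu>) * a)"
    proof -
      have "CH\<^sup>2 * (2 + \<mu>) * \<bar>t\<bar> \<le> CH\<^sup>2 * (2 + \<mu>) * a" using t1 l by (intro mult_left_mono) auto
      then have "norm (H t - H 0) \<le> CH\<^sup>2 * (2 + \<mu>) * a" using Hd by linarith
      then show ?thesis unfolding norm_mult mult_1_right by (intro mult_left_mono) auto
    qed
    finally show ?thesis unfolding abs_mult using l by (intro mult_mono) auto
  qed
  have S3: "\<bar>a / \<theta> * Re (W * H t)\<bar> \<le> a / \<theta> * (norm W * CH)"
  proof -
    have "\<bar>Re (W * H t)\<bar> \<le> norm W * CH" using abs_Re_le_cmod[of "W * H t"] Hle mult_left_mono[OF Hle, of "norm W"] by (simp add: norm_mult)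
    then show ?thesis unfolding abs_mult using a \<theta> by (intro mult_mono) auto
  qed
  have "CH * (1 + \<mu>) * (norm W * (u\<^sup>2 + C * B * u ^ 4)) + (1 + \<mu>) * (norm W * (CH\<^sup>2 * (2 + \<mu>) * a)) + a / \<theta> * (norm W * CH)
     \<le> CH * (1 + \<mu>) * (norm W * ((1 + C) * (1 / B) * (1 + y) ^ 3)) + (1 + \<mu>) * (norm W * (CH\<^sup>2 * (2 + \<mu>) * ((1 / B) * (1 + y) ^ 3))) + (1 / B * (1 + y) ^ 3) / \<theta> * (norm W * CH)"
  proof -
    have y3: "1 \<le> (1 + y) ^ 3" using y by simp
    have yy: "y + y\<^sup>2 \<le> (1 + y) ^ 3" using y by (simp add: power3_eq_cube power2_eq_square algebra_simps)
    have y1: "y \<le> (1 + y) ^ 3" "y\<^sup>2 \<le> (1 + y) ^ 3" using yy y zero_le_power2[of y] by linarith+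
    have "u\<^sup>2 + C * B * u ^ 4 = (1 / B) * (y + C * y\<^sup>2)" unfolding y_def using B by (simp add: eval_nat_numeral field_simps)
    also have "\<dots> \<le> (1 / B) * ((1 + C) * (1 + y) ^ 3)"
    proof -
      have "C * y\<^sup>2 \<le> C * (1 + y) ^ 3" using y1 C by (intro mult_left_mono) auto
      then have "y + C * y\<^sup>2 \<le> (1 + C) * (1 + y) ^ 3" using y1 by (simp add: distrib_right)
      then show ?thesis using B by (intro mult_left_mono) auto
    qed
    finally have e1: "u\<^sup>2 + C * B * u ^ 4 \<le> (1 + C) * (1 / B) * (1 + y) ^ 3" by (simp add: mult_ac)
    have "a * 1 \<le> 1 / B * (1 + y) ^ 3" using Ba y3 a B by (intro mult_mono) auto
    then have e2: "a \<le> 1 / B * (1 + y) ^ 3" by simp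
    show ?thesis
      using e1 e2 CH0 l \<theta> by (intro add_mono mult_left_mono mult_right_mono divide_right_mono) auto
  qed
  also have "\<dots> = (CH * (1 + \<mu>) * (1 + C) + CH\<^sup>2 * (2 + \<mu>) * (1 + \<mu>) + CH / \<theta>) * (1 / B) * (norm W * (1 + y) ^ 3)"
    using \<theta> B by (simp add: field_simps)
  finally show ?thesis using main S1 S2 S3 unfolding y_def u_def by linarith
qed

text \<open>The kernel is 1 / s + 1 / (1 - s), and only 1 / s is large. For |t| <= a / sqrt B the
  modulus of W is at least exp (-C), which gives the indicator term. The phase of W and the bounded
  part of the kernel are smaller by a factor 1 / B, up to powers of 1 + B u^2.\<close>

lemma central_lower_bound:
  assumes a: "0 < a" "a \<le> 1 / 2" and t: "\<bar>t\<bar> \<le> a / 8" and Ba: "a \<le> 1 / B" and B: "B > 0"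
    and C: "C > 0" and im: "\<bar>Im W\<bar> \<le> norm W * (C * B * \<bar>t / a\<bar> ^ 3)"
    and re: "norm W * (1 - (C * B * \<bar>t / a\<bar> ^ 3)\<^sup>2 / 2) \<le> Re W"
    and lo: "exp (- (C * B * (t / a)\<^sup>2)) \<le> norm W"
  shows "exp (- C) / 2 / a * indicator {- (a / sqrt B)..a / sqrt B} t - (C\<^sup>2 + C + 2) / (a * B) * (norm W * (1 + B * (t / a)\<^sup>2) ^ 3) \<le> Re (W * two_exp_ft a (1 - a) t)"
proof -
  define u where "u = t / a"
  define y where "y = B * u\<^sup>2"
  define w where "w = C * B * \<bar>u\<bar> ^ 3"
  define d where "d = a\<^sup>2 + t\<^sup>2"
  have y: "y \<ge> 0" using B by (simp add: y_def)
  have d: "d > 0" unfolding d_def using a by (auto intro: add_pos_nonneg)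
  have du: "d = a\<^sup>2 * (1 + u\<^sup>2)" using a by (simp add: d_def u_def power_divide field_simps)
  have w0: "w \<ge> 0" using C B by (simp add: w_def)
  have u1: "\<bar>u\<bar> \<le> 1 / 8" using t a by (simp add: u_def field_simps)
  have u2: "u\<^sup>2 \<le> 1"
  proof -
    have "\<bar>u\<bar>\<^sup>2 \<le> 1\<^sup>2" using u1 by (intro power_mono) auto
    then show ?thesis by simp
  qed
  have K: "two_exp_ft a (1 - a) t = 1 / Complex a t + 1 / Complex (1 - a) (- t)"
  proof -
    have "Complex a t \<noteq> 0" "Complex (1 - a) (- t) \<noteq> 0" using a by (auto simp: complex_eq_iff)
    moreover have "of_real (a + (1 - a)) = Complex a t + Complex (1 - a) (- t)" by (simp add: complex_eq_iff)
    ultimately show ?thesis unfolding two_exp_ft_def by (simp add: field_simps)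
  qed
  have r: "1 / Complex a t = Complex (a / d) (- t / d)"
    using d by (simp add: complex_eq_iff Re_divide Im_divide d_def power2_eq_square)
  have "Re (W * (1 / Complex a t)) = (a * Re W + t * Im W) / d" unfolding r by (simp add: add_divide_distrib mult_ac)
  also have "\<dots> \<ge> (a * (norm W * (1 - w\<^sup>2 / 2)) - \<bar>t\<bar> * (norm W * w)) / d"
  proof -
    have "a * (norm W * (1 - w\<^sup>2 / 2)) \<le> a * Re W" using re a unfolding w_def u_def by (intro mult_left_mono) auto
    moreover have "- (\<bar>t\<bar> * (norm W * w)) \<le> t * Im W"
    proof -
      have "\<bar>t * Im W\<bar> \<le> \<bar>t\<bar> * (norm W * w)" unfolding abs_mult using im unfolding w_def u_def by (intro mult_left_mono) auto
      then show ?thesis by linarith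
    qed
    ultimately show ?thesis using d by (intro divide_right_mono) auto
  qed
  also have "(a * (norm W * (1 - w\<^sup>2 / 2)) - \<bar>t\<bar> * (norm W * w)) / d = norm W / (a * (1 + u\<^sup>2)) - norm W * (w\<^sup>2 / 2 + \<bar>u\<bar> * w) / (a * (1 + u\<^sup>2))"
  proof -
    have ta: "\<bar>t\<bar> = a * \<bar>u\<bar>" using a by (simp add: u_def)
    have "(a * (norm W * (1 - w\<^sup>2 / 2)) - a * \<bar>u\<bar> * (norm W * w)) / (a * (a * (1 + u\<^sup>2))) = (norm W * (1 - w\<^sup>2 / 2) - \<bar>u\<bar> * (norm W * w)) / (a * (1 + u\<^sup>2))"
      using a by (subst mult_divide_mult_cancel_left[symmetric, of a]) (auto simp: algebra_simps)
    moreover have "d = a * (a * (1 + u\<^sup>2))" unfolding du by (simp add: power2_eq_square)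
    ultimately have "(a * (norm W * (1 - w\<^sup>2 / 2)) - \<bar>t\<bar> * (norm W * w)) / d = (norm W * (1 - w\<^sup>2 / 2) - \<bar>u\<bar> * (norm W * w)) / (a * (1 + u\<^sup>2))"
      unfolding ta by simp
    also have "\<dots> = norm W / (a * (1 + u\<^sup>2)) - norm W * (w\<^sup>2 / 2 + \<bar>u\<bar> * w) / (a * (1 + u\<^sup>2))"
      unfolding diff_divide_distrib[symmetric] by (simp add: algebra_simps)
    finally show ?thesis .
  qed
  also have "\<dots> \<ge> norm W / (a * 2) - norm W * (w\<^sup>2 + \<bar>u\<bar> * w) / a"
  proof -
    have "norm W / (a * 2) \<le> norm W / (a * (1 + u\<^sup>2))" using a u2 by (intro divide_left_mono mult_left_mono mult_pos_pos) (auto intro: add_pos_nonneg)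
    moreover have "norm W * (w\<^sup>2 / 2 + \<bar>u\<bar> * w) / (a * (1 + u\<^sup>2)) \<le> norm W * (w\<^sup>2 + \<bar>u\<bar> * w) / (a * 1)"
      using a w0 by (intro frac_le mult_left_mono add_right_mono) auto
    ultimately show ?thesis by simp
  qed
  finally have R1: "norm W / (a * 2) - norm W * (w\<^sup>2 + \<bar>u\<bar> * w) / a \<le> Re (W * (1 / Complex a t))" .
  have R2: "- (2 * norm W) \<le> Re (W * (1 / Complex (1 - a) (- t)))"
  proof -
    have "1 / 2 \<le> norm (Complex (1 - a) (- t))" using abs_Re_le_cmod[of "Complex (1 - a) (- t)"] a by simp
    then have "1 / norm (Complex (1 - a) (- t)) \<le> 1 / (1 / 2)" by (intro frac_le) auto
    then have "norm (W * (1 / Complex (1 - a) (- t))) \<le> norm W * 2" unfolding norm_mult norm_divide by (intro mult_left_mono) auto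
    then show ?thesis using abs_Re_le_cmod[of "W * (1 / Complex (1 - a) (- t))"] by linarith
  qed
  have ind: "exp (- C) / 2 / a * indicator {- (a / sqrt B)..a / sqrt B} t \<le> norm W / (a * 2)"
  proof (cases "t \<in> {- (a / sqrt B)..a / sqrt B}")
    case True
    then have "\<bar>t\<bar> \<le> a / sqrt B" by auto
    then have "\<bar>u\<bar> \<le> 1 / sqrt B" using a by (simp add: u_def field_simps)
    then have "\<bar>u\<bar>\<^sup>2 \<le> (1 / sqrt B)\<^sup>2" by (intro power_mono) auto
    then have "u\<^sup>2 \<le> 1 / B" using B by (simp add: power_divide)
    then have "B * u\<^sup>2 \<le> 1" using B by (simp add: field_simps)
    then have "C * (B * u\<^sup>2) \<le> C * 1" using C by (intro mult_left_mono) auto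
    then have "exp (- C) \<le> exp (- (C * B * u\<^sup>2))" by (simp add: mult.assoc)
    then have "exp (- C) \<le> norm W" using lo unfolding u_def by linarith
    then have "exp (- C) / (a * 2) \<le> norm W / (a * 2)" using a by (intro divide_right_mono) auto
    then show ?thesis using True by (simp add: mult.commute)
  next
    case False
    then show ?thesis using a by simp
  qed
  have neg: "norm W * (w\<^sup>2 + \<bar>u\<bar> * w) / a + 2 * norm W \<le> (C\<^sup>2 + C + 2) / (a * B) * (norm W * (1 + y) ^ 3)"
  proof -
    have wy: "w\<^sup>2 = (1 / B) * (C\<^sup>2 * y ^ 3)" "\<bar>u\<bar> * w = (1 / B) * (C * y\<^sup>2)"
    proof -
      have "w\<^sup>2 = C\<^sup>2 * B\<^sup>2 * (\<bar>u\<bar>\<^sup>2) ^ 3" unfolding w_def by (simp add: power_mult_distrib power_mult[symmetric])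
      then show "w\<^sup>2 = (1 / B) * (C\<^sup>2 * y ^ 3)" unfolding y_def using B by (simp add: power_mult_distrib eval_nat_numeral)
      have "\<bar>u\<bar> * w = C * B * (\<bar>u\<bar>\<^sup>2)\<^sup>2" unfolding w_def by (simp add: eval_nat_numeral)
      then show "\<bar>u\<bar> * w = (1 / B) * (C * y\<^sup>2)" unfolding y_def using B by (simp add: power_mult_distrib eval_nat_numeral)
    qed
    have p: "y\<^sup>2 \<le> (1 + y) ^ 3" "y ^ 3 \<le> (1 + y) ^ 3" "1 \<le> (1 + y) ^ 3"
      using y by (auto simp: power3_eq_cube power2_eq_square algebra_simps)
    have "C\<^sup>2 * y ^ 3 \<le> C\<^sup>2 * (1 + y) ^ 3" "C * y\<^sup>2 \<le> C * (1 + y) ^ 3" using p C by (auto intro!: mult_left_mono)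
    then have "C\<^sup>2 * y ^ 3 + C * y\<^sup>2 \<le> (C\<^sup>2 + C) * (1 + y) ^ 3" by (simp add: distrib_right)
    then have "(1 / B) * (C\<^sup>2 * y ^ 3 + C * y\<^sup>2) \<le> (1 / B) * ((C\<^sup>2 + C) * (1 + y) ^ 3)" using B by (intro mult_left_mono) auto
    then have 1: "w\<^sup>2 + \<bar>u\<bar> * w \<le> (1 / B) * ((C\<^sup>2 + C) * (1 + y) ^ 3)" unfolding wy by (simp add: distrib_left)
    have "a * 1 \<le> 1 / B * (1 + y) ^ 3" using Ba p a B by (intro mult_mono) auto
    then have 2: "2 * a \<le> (1 / B) * (2 * (1 + y) ^ 3)" by simp
    have "norm W * (w\<^sup>2 + \<bar>u\<bar> * w) / a + 2 * norm W = norm W * ((w\<^sup>2 + \<bar>u\<bar> * w) + 2 * a) / a" using a by (simp add: field_simps)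
    also have "\<dots> \<le> norm W * ((1 / B) * ((C\<^sup>2 + C) * (1 + y) ^ 3) + (1 / B) * (2 * (1 + y) ^ 3)) / a"
      using 1 2 a by (intro divide_right_mono mult_left_mono add_mono) auto
    also have "\<dots> = (C\<^sup>2 + C + 2) / (a * B) * (norm W * (1 + y) ^ 3)" using a B by (simp add: field_simps)
    finally show ?thesis .
  qed
  have "Re (W * two_exp_ft a (1 - a) t) = Re (W * (1 / Complex a t)) + Re (W * (1 / Complex (1 - a) (- t)))"
    unfolding K distrib_left by simp
  then show ?thesis using R1 R2 ind neg unfolding y_def u_def by linarith
qed

lemma integral_abs_le:
  fixes f D :: "real \<Rightarrow> real"
  assumes "integrable lborel f" "integrable lborel D" "\<And>t. \<bar>f t\<bar> \<le> D t"
  shows "\<bar>integral\<^sup>L lborel f\<bar> \<le> integral\<^sup>L lborel D"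
proof -
  have "\<bar>integral\<^sup>L lborel f\<bar> \<le> (\<integral>t. \<bar>f t\<bar> \<partial>lborel)" using integral_norm_bound[of lborel f] by simp
  also have "\<dots> \<le> integral\<^sup>L lborel D" by (intro integral_mono) (use assms in auto)
  finally show ?thesis .
qed

text \<open>With B = 1 / (a ln (1 / a)) the peak has width a / sqrt B and the kernel height 1 / a,
  which accounts for the lower bound of order 1 / sqrt B. The difference is smaller by a factor a /
  B. Three majorants cover the line: \<open>X\<close> for |t| <= a / 8, \<open>Y\<close> from there
  to 1 / (2 ln (1 / a)), \<open>Z\<close> beyond.\<close>

lemma saddle_integral_estimates:
  assumes \<theta>: "0 < \<theta>" "\<theta> < 1"
  defines "\<mu> \<equiv> \<theta> / (1 - \<theta>)"
  defines "I \<equiv> (\<lambda>A a. \<integral>t. Re (tilted_char a t * two_exp_ft A (1 - a) t) \<partial>lborel)"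
  obtains C c where "C > 0" "c > 0" "\<forall>\<^sub>F a in at_right 0.
     \<bar>I (\<mu> + a) a - a / \<theta> * I a a\<bar> \<le> C * (a * (a * ln (1 / a)) powr (3 / 2)) \<and>
     c * (a * ln (1 / a)) powr (1 / 2) \<le> I a a"
proof -
  obtain C1 where C1: "C1 > 0" "\<forall>\<^sub>F a in at_right 0. \<forall>t. \<bar>t\<bar> \<le> a / 8 \<longrightarrow>
    \<bar>Im (tilted_char a t)\<bar> \<le> norm (tilted_char a t) * (C1 / (a * ln (1 / a)) * \<bar>t / a\<bar> ^ 3) \<and>
    norm (tilted_char a t) * (1 - (C1 / (a * ln (1 / a)) * \<bar>t / a\<bar> ^ 3)\<^sup>2 / 2) \<le> Re (tilted_char a t) \<and>
    exp (- (C1 / (a * ln (1 / a)) * (t / a)\<^sup>2)) \<le> norm (tilted_char a t)"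
    by (rule tilted_char_central) blast
  obtain c2 where c2: "c2 > 0" "\<forall>\<^sub>F a in at_right 0. \<forall>t. \<bar>t\<bar> \<le> 1 / (2 * ln (1 / a)) \<longrightarrow>
    norm (tilted_char a t) \<le> exp (- (c2 / (a * ln (1 / a)) * ((t / a)\<^sup>2 / (1 + (t / a)\<^sup>2))))"
    by (rule tilted_char_decay) blast
  obtain C3 where C3: "C3 > 0" "\<forall>\<^sub>F a in at_right 0. \<forall>t. \<bar>t\<bar> \<ge> 1 / (2 * ln (1 / a)) \<longrightarrow>
    norm (tilted_char a t) \<le> C3 * a ^ 3 * (ln (1 / a)) ^ 3 * (1 + \<bar>t\<bar>) powr (3 / 4)"
    by (rule tilted_char_far) blast
  have c2h: "c2 / 2 > 0" using c2 by simp
  obtain K where K: "K > 0" "\<And>y. y \<ge> 0 \<Longrightarrow> exp (- (c2 / 2 * y)) * (1 + y) ^ 3 \<le> K * (1 / (1 + y))"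
    using exp_times_power_bounded[OF c2h] by blast
  define CH where "CH = 2 / min 1 \<mu>"
  define E0 where "E0 = CH * (1 + \<mu>) * (1 + C1) + CH\<^sup>2 * (2 + \<mu>) * (1 + \<mu>) + CH / \<theta>"
  define E2 where "E2 = CH * ((1 + \<mu>) + 1 / \<theta>)"
  define E3 where "E3 = C1\<^sup>2 + C1 + 2"
  define J where "J = (\<integral>t. (1 + \<bar>t\<bar>) powr (3 / 4) * (1 / (1 + (t::real)\<^sup>2)) \<partial>lborel)"
  define e0 where "e0 = exp (- C1) / 2"
  \<comment> \<open>For |t| > a / 8 one has u^2 >= 1/64, hence u^2 / (1 + u^2) >= 1/65.\<close>
  define d where "d = c2 / 65"
  have mu: "\<mu> > 0" using \<theta> by (simp add: \<mu>_def)
  have CH0: "CH > 0" using mu by (simp add: CH_def)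
  have E0p: "E0 > 0" unfolding E0_def using CH0 mu C1 \<theta> by (intro add_pos_pos mult_pos_pos) auto
  have E2p: "E2 > 0" unfolding E2_def using CH0 mu \<theta> by (intro add_pos_pos mult_pos_pos) auto
  have E3p: "E3 > 0" unfolding E3_def using C1 by (intro add_pos_pos) auto
  have e0p: "e0 > 0" by (simp add: e0_def)
  have dp: "d > 0" using c2 by (simp add: d_def)
  have J0: "J \<ge> 0" unfolding J_def by (intro integral_nonneg_AE AE_I2) (auto intro!: mult_nonneg_nonneg)
  have a01: "\<forall>\<^sub>F a in at_right (0::real). a \<in> {0<..<1/2}" by (rule eventually_at_right_real) simp
  have v1: "\<forall>\<^sub>F a in at_right (0::real). 1 \<le> ln (1 / a)" by real_asymp
  have v2: "\<forall>\<^sub>F a in at_right (0::real). a / 8 \<le> 1 / (2 * ln (1 / a))" by real_asymp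
  have v3: "\<forall>\<^sub>F a in at_right (0::real). a * ln (1 / a) \<le> 1 / 64" by real_asymp
  have v4: "\<forall>\<^sub>F a in at_right (0::real). exp (- (d / (a * ln (1 / a)))) \<le> a * (a * ln (1 / a)) powr (3 / 2)"
    using dp by real_asymp
  \<comment> \<open>Here the number of zeta factors matters: with two of them the left side would be
    a^2 (ln (1 / a))^2, which exceeds the right side for small a.\<close>
  have v5: "\<forall>\<^sub>F a in at_right (0::real). a ^ 3 * (ln (1 / a)) ^ 3 \<le> a * (a * ln (1 / a)) powr (3 / 2)" by real_asymp
  \<comment> \<open>Chosen so that the error terms of the lower bound add up to at most a third of
    e0 (a ln (1 / a))^(1/2), while the indicator contributes twice that quantity.\<close>
  define \<eta> where "\<eta> = e0 / (3 * (E3 * K * pi + pi + C3 * J + 1))"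
  have den: "E3 * K * pi + pi + C3 * J + 1 > 0" using E3p K C3 J0 by (intro add_nonneg_pos add_nonneg_nonneg) auto
  have etap: "\<eta> > 0" unfolding \<eta>_def using e0p den by simp
  have v6: "\<forall>\<^sub>F a in at_right (0::real). (a * ln (1 / a)) powr (3 / 2) \<le> \<eta> * (a * ln (1 / a)) powr (1 / 2)"
    using etap by real_asymp
  have v7: "\<forall>\<^sub>F a in at_right (0::real). 1 / a\<^sup>2 * exp (- (d / (a * ln (1 / a)))) \<le> \<eta> * (a * ln (1 / a)) powr (1 / 2)"
    using etap dp by real_asymp
  have v8: "\<forall>\<^sub>F a in at_right (0::real). a * (ln (1 / a)) ^ 3 \<le> \<eta> * (a * ln (1 / a)) powr (1 / 2)"
    using etap by real_asymp
  show ?thesis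
  proof (rule that[of "E0 * K * pi + E2 * pi + E2 * C3 * J" e0])
    show "E0 * K * pi + E2 * pi + E2 * C3 * J > 0"
      using E0p K E2p C3 J0 by (intro add_pos_nonneg add_pos_pos) auto
    show "e0 > 0" by fact
    show "\<forall>\<^sub>F a in at_right 0.
       \<bar>I (\<mu> + a) a - a / \<theta> * I a a\<bar> \<le> (E0 * K * pi + E2 * pi + E2 * C3 * J) * (a * (a * ln (1 / a)) powr (3 / 2)) \<and>
       e0 * (a * ln (1 / a)) powr (1 / 2) \<le> I a a"
      using a01 C1(2) c2(2) C3(2) v1 v2 v3 v4 v5 v6 v7 v8
    proof eventually_elim
      case (elim a)
      define L where "L = ln (1 / a)"
      define B where "B = 1 / (a * L)"
      define k where "k = sqrt B / a"
      define q where "q = (a * L) powr (1 / 2)"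
      define W where "W = tilted_char a"
      define M where "M = (\<lambda>t. two_exp_ft (\<mu> + a) (1 - a) t - of_real (a / \<theta>) * two_exp_ft a (1 - a) t)"
      define X where "X = (\<lambda>t. 1 / (1 + (k * t)\<^sup>2))"
      define Y where "Y = (\<lambda>t::real. 1 / (1 + t\<^sup>2))"
      define Z where "Z = (\<lambda>t::real. (1 + \<bar>t\<bar>) powr (3 / 4) * (1 / (1 + t\<^sup>2)))"
      define ee where "ee = exp (- (d * B))"
      have a: "0 < a" "a \<le> 1 / 2" "a < 1" and L: "L \<ge> 1" using elim by (auto simp: L_def)
      have aL: "a * L > 0" using a L by simp
      have B: "B > 0" using aL by (simp add: B_def)
      have Bi: "1 / B = a * L" by (simp add: B_def)
      have Ba: "a \<le> 1 / B" unfolding Bi using a L by simp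
      have B64: "B \<ge> 64"
      proof -
        have "a * L \<le> 1 / 64" using elim(7) by (simp add: L_def)
        then have "1 / (1 / 64) \<le> 1 / (a * L)" using aL by (intro frac_le) auto
        then show ?thesis by (simp add: B_def)
      qed
      have k: "k > 0" using B a by (simp add: k_def)
      have kt: "(k * t)\<^sup>2 = B * (t / a)\<^sup>2" for t using B by (simp add: k_def power_mult_distrib power_divide)
      have q: "q > 0" "q = sqrt (a * L)" unfolding q_def using aL by (auto simp: powr_half_sqrt)
      have qB: "1 / sqrt B = q" unfolding q(2) B_def using aL by (simp add: real_sqrt_divide)
      have q3: "(a * L) powr (3 / 2) = a * L * q"
      proof -
        have "(a * L) powr (3 / 2) = (a * L) powr (1 + 1 / 2)" by simp
        then show ?thesis unfolding powr_add q_def using aL by simp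
      qed
      have pk: "pi / k = pi * (a * q)" unfolding k_def qB[symmetric] by simp
      have XYZ0: "0 \<le> X t" "0 \<le> Y t" "0 \<le> Z t" "Y t > 0" for t
        unfolding X_def Y_def Z_def by (auto intro!: mult_nonneg_nonneg add_nonneg_nonneg add_pos_nonneg)
      have Xi: "integrable lborel X" "integral\<^sup>L lborel X = pi * (a * q)"
        unfolding X_def using integral_inverse_1_plus_scaled[OF k] pk by auto
      have Yi: "integrable lborel Y" "integral\<^sup>L lborel Y = pi"
        unfolding Y_def using integral_inverse_1_plus_scaled[of 1] by auto
      have Zi: "integrable lborel Z" "integral\<^sup>L lborel Z = J"
        unfolding Z_def J_def using integrable_powr_over_1_plus_sq by auto
      have central: "\<bar>Im (W t)\<bar> \<le> norm (W t) * (C1 * B * \<bar>t / a\<bar> ^ 3)"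
        "norm (W t) * (1 - (C1 * B * \<bar>t / a\<bar> ^ 3)\<^sup>2 / 2) \<le> Re (W t)"
        "exp (- (C1 * B * (t / a)\<^sup>2)) \<le> norm (W t)" if "\<bar>t\<bar> \<le> a / 8" for t
        using elim(2) that unfolding W_def B_def L_def by auto
      have decay: "norm (W t) \<le> exp (- (c2 * B * ((t / a)\<^sup>2 / (1 + (t / a)\<^sup>2))))" if "\<bar>t\<bar> \<le> 1 / (2 * L)" for t
        using elim(3) that unfolding W_def B_def L_def by auto
      have far: "norm (W t) \<le> C3 * (a ^ 3 * L ^ 3) * (1 + \<bar>t\<bar>) powr (3 / 4)" if "\<bar>t\<bar> \<ge> 1 / (2 * L)" for t
        using elim(4) that unfolding W_def L_def by (auto simp: mult.assoc)
      have cen: "norm (W t) * (1 + B * (t / a)\<^sup>2) ^ 3 \<le> K * X t" if t: "\<bar>t\<bar> \<le> a / 8" for t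
      proof -
        define u where "u = t / a"
        have "\<bar>u\<bar> \<le> 1 / 8" using t a by (simp add: u_def field_simps)
        then have "\<bar>u\<bar>\<^sup>2 \<le> 1\<^sup>2" by (intro power_mono) auto
        then have u1: "u\<^sup>2 \<le> 1" by simp
        have "\<bar>t\<bar> \<le> 1 / (2 * L)" using t elim(6) by (simp add: L_def)
        from decay[OF this] have "norm (W t) \<le> exp (- (c2 * B * (u\<^sup>2 / (1 + u\<^sup>2))))" by (simp add: u_def)
        also have "\<dots> \<le> exp (- (c2 / 2 * (B * u\<^sup>2)))"
        proof -
          have "u\<^sup>2 / 2 \<le> u\<^sup>2 / (1 + u\<^sup>2)" using u1 by (intro divide_left_mono mult_pos_pos) (auto intro: add_pos_nonneg)
          then have "c2 * B * (u\<^sup>2 / 2) \<le> c2 * B * (u\<^sup>2 / (1 + u\<^sup>2))" using c2 B by (intro mult_left_mono) auto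
          then show ?thesis by (simp add: mult_ac)
        qed
        finally have "norm (W t) * (1 + B * u\<^sup>2) ^ 3 \<le> exp (- (c2 / 2 * (B * u\<^sup>2))) * (1 + B * u\<^sup>2) ^ 3"
          using B by (intro mult_right_mono) auto
        also have "\<dots> \<le> K * (1 / (1 + B * u\<^sup>2))" using B by (intro K(2)) auto
        finally show ?thesis unfolding X_def kt u_def .
      qed
      have mid: "norm (W t) \<le> ee" if t: "\<not> \<bar>t\<bar> \<le> a / 8" "\<bar>t\<bar> \<le> 1 / (2 * L)" for t
      proof -
        define u where "u = t / a"
        have "1 / 8 \<le> \<bar>u\<bar>" using t a by (simp add: u_def field_simps)
        then have "(1 / 8)\<^sup>2 \<le> \<bar>u\<bar>\<^sup>2" by (intro power_mono) auto
        then have u1: "1 / 64 \<le> u\<^sup>2" by (simp add: power2_eq_square)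
        have "1 / 65 \<le> u\<^sup>2 / (1 + u\<^sup>2)" using u1 by (subst pos_le_divide_eq) (auto intro: add_pos_nonneg)
        then have "c2 * B * (1 / 65) \<le> c2 * B * (u\<^sup>2 / (1 + u\<^sup>2))" using c2 B by (intro mult_left_mono) auto
        then have "exp (- (c2 * B * (u\<^sup>2 / (1 + u\<^sup>2)))) \<le> ee" by (simp add: ee_def d_def)
        then show ?thesis using decay[OF t(2)] unfolding u_def by linarith
      qed
      have outer: "\<bar>Re (W t * z)\<bar> \<le> G * (ee * Y t) + G * (C3 * (a ^ 3 * L ^ 3) * Z t)"
        if t: "\<not> \<bar>t\<bar> \<le> a / 8" and z: "norm z \<le> G * Y t" and G: "G \<ge> 0" for t z G
      proof -
        have "\<bar>Re (W t * z)\<bar> \<le> norm (W t) * norm z" using abs_Re_le_cmod[of "W t * z"] by (simp add: norm_mult)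
        also have "\<dots> \<le> norm (W t) * (G * Y t)" using z by (intro mult_left_mono) auto
        also have "\<dots> \<le> G * (ee * Y t) + G * (C3 * (a ^ 3 * L ^ 3) * Z t)"
        proof (cases "\<bar>t\<bar> \<le> 1 / (2 * L)")
          case True
          have "norm (W t) * (G * Y t) \<le> ee * (G * Y t)" using mid[OF t True] G XYZ0 by (intro mult_right_mono) auto
          moreover have "0 \<le> G * (C3 * (a ^ 3 * L ^ 3) * Z t)" using G C3 a L XYZ0 by (intro mult_nonneg_nonneg) auto
          ultimately show ?thesis by (simp add: mult_ac)
        next
          case False
          then have "norm (W t) * (G * Y t) \<le> (C3 * (a ^ 3 * L ^ 3) * (1 + \<bar>t\<bar>) powr (3 / 4)) * (G * Y t)"
            using far[of t] G XYZ0 by (intro mult_right_mono) auto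
          also have "\<dots> = G * (C3 * (a ^ 3 * L ^ 3) * Z t)" unfolding Z_def Y_def by (simp add: mult_ac)
          finally have "norm (W t) * (G * Y t) \<le> G * (C3 * (a ^ 3 * L ^ 3) * Z t)" .
          moreover have "0 \<le> G * (ee * Y t)" using G XYZ0 by (intro mult_nonneg_nonneg) (auto simp: ee_def)
          ultimately show ?thesis by linarith
        qed
        finally show ?thesis .
      qed
      have mua: "\<mu> + a > 0" using mu a by simp
      have i1: "integrable lborel (\<lambda>t. W t * two_exp_ft (\<mu> + a) (1 - a) t)"
        unfolding W_def by (rule tilted_char_integral(1)) (use a mua in auto)
      have i2: "integrable lborel (\<lambda>t. W t * two_exp_ft a (1 - a) t)"
        unfolding W_def by (rule tilted_char_integral(1)) (use a in auto)
      have r1: "integrable lborel (\<lambda>t. Re (W t * two_exp_ft (\<mu> + a) (1 - a) t))"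
        and r2: "integrable lborel (\<lambda>t. Re (W t * two_exp_ft a (1 - a) t))"
        by (rule integrable_Re[OF i1], rule integrable_Re[OF i2])
      have MI: "I (\<mu> + a) a - a / \<theta> * I a a = (\<integral>t. Re (W t * M t) \<partial>lborel)"
        and Mint: "integrable lborel (\<lambda>t. Re (W t * M t))"
      proof -
        have e: "Re (W t * M t) = Re (W t * two_exp_ft (\<mu> + a) (1 - a) t) - a / \<theta> * Re (W t * two_exp_ft a (1 - a) t)" for t
        proof -
          have "W t * M t = W t * two_exp_ft (\<mu> + a) (1 - a) t - of_real (a / \<theta>) * (W t * two_exp_ft a (1 - a) t)"
            unfolding M_def by (simp add: algebra_simps)
          then show ?thesis by (simp only: minus_complex.sel Re_of_real_times)
        qed
        show "integrable lborel (\<lambda>t. Re (W t * M t))" unfolding e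
          by (intro Bochner_Integration.integrable_diff integrable_mult_right r1 r2)
        show "I (\<mu> + a) a - a / \<theta> * I a a = (\<integral>t. Re (W t * M t) \<partial>lborel)"
          unfolding e Bochner_Integration.integral_diff[OF r1 integrable_mult_right[OF r2]]
            integral_mult_right_zero unfolding I_def W_def ..
      qed
      define D where "D = (\<lambda>t. E0 * K * (1 / B) * X t + E2 * ee * Y t + E2 * C3 * (a ^ 3 * L ^ 3) * Z t)"
      have DI: "integrable lborel D" "integral\<^sup>L lborel D = E0 * K * (1 / B) * (pi * (a * q)) + E2 * ee * pi + E2 * C3 * (a ^ 3 * L ^ 3) * J"
        unfolding D_def using Xi Yi Zi by simp_all
      have Mbound: "\<bar>Re (W t * M t)\<bar> \<le> D t" for t
      proof (cases "\<bar>t\<bar> \<le> a / 8")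
        case True
        have "\<bar>Re (W t * M t)\<bar> \<le> E0 * (1 / B) * (norm (W t) * (1 + B * (t / a)\<^sup>2) ^ 3)"
          unfolding M_def E0_def CH_def \<mu>_def by (rule central_upper_bound[OF \<theta> a(1,2) True Ba B C1(1) central(1)[OF True]])
        also have "\<dots> \<le> E0 * (1 / B) * (K * X t)" using cen[OF True] E0p B by (intro mult_left_mono) auto
        also have "\<dots> \<le> D t" unfolding D_def using E2p C3 a L XYZ0 by (simp add: mult_ac ee_def)
        finally show ?thesis .
      next
        case False
        have "norm (M t) \<le> E2 * Y t"
        proof -
          have "M t = regular_kernel \<mu> a t * (of_real (1 + \<mu>) * (\<i> * of_real t / Complex a t) - of_real (a / \<theta>))"
            unfolding M_def \<mu>_def by (rule kernel_difference[OF \<theta> a(1,3)])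
          then have "norm (M t) = norm (regular_kernel \<mu> a t) * norm (of_real (1 + \<mu>) * (\<i> * of_real t / Complex a t) - of_real (a / \<theta>))"
            by (simp only: norm_mult)
          also have "\<dots> \<le> (CH * Y t) * ((1 + \<mu>) + 1 / \<theta>)"
          proof (rule mult_mono)
            show "norm (regular_kernel \<mu> a t) \<le> CH * Y t" unfolding CH_def Y_def by (rule regular_kernel_bounds(1)[OF mu a(1,2)])
            have n1: "norm (of_real (1 + \<mu>) * (\<i> * of_real t / Complex a t)) \<le> (1 + \<mu>) * 1"
              unfolding norm_mult[of "of_real (1 + \<mu>)"] norm_of_real using Re_times_ratio(2)[OF a(1), of t] mu by (intro mult_mono) auto
            have n2: "norm (complex_of_real (a / \<theta>)) \<le> 1 / \<theta>"
              unfolding norm_of_real using a \<theta> by (simp add: divide_right_mono)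
            show "norm (of_real (1 + \<mu>) * (\<i> * of_real t / Complex a t) - of_real (a / \<theta>)) \<le> (1 + \<mu>) + 1 / \<theta>"
              using order_trans[OF norm_triangle_ineq4 add_mono[OF n1 n2]] by (simp only: mult_1_right)
            show "0 \<le> CH * Y t" using CH0 XYZ0 by simp
          qed simp
          finally show ?thesis by (simp add: E2_def mult_ac)
        qed
        from outer[OF False this] E2p
        have "\<bar>Re (W t * M t)\<bar> \<le> E2 * (ee * Y t) + E2 * (C3 * (a ^ 3 * L ^ 3) * Z t)" by simp
        also have "\<dots> \<le> D t" unfolding D_def using E0p K B XYZ0 by (simp add: mult_ac)
        finally show ?thesis .
      qed
      have "\<bar>I (\<mu> + a) a - a / \<theta> * I a a\<bar> \<le> E0 * K * (1 / B) * (pi * (a * q)) + E2 * ee * pi + E2 * C3 * (a ^ 3 * L ^ 3) * J"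
        unfolding MI using integral_abs_le[OF Mint DI(1) Mbound] DI(2) by simp
      also have "\<dots> \<le> E0 * K * pi * (a * (a * L * q)) + E2 * pi * (a * (a * L * q)) + E2 * C3 * J * (a * (a * L * q))"
      proof -
        have "ee \<le> a * (a * L * q)" using elim(8) unfolding ee_def B_def L_def[symmetric] q3[symmetric] by simp
        then have "E2 * pi * ee \<le> E2 * pi * (a * (a * L * q))" using E2p by (intro mult_left_mono) auto
        moreover have "a ^ 3 * L ^ 3 \<le> a * (a * L * q)" using elim(9) unfolding L_def[symmetric] q3[symmetric] by simp
        then have "E2 * C3 * J * (a ^ 3 * L ^ 3) \<le> E2 * C3 * J * (a * (a * L * q))" using E2p C3 J0 by (intro mult_left_mono) auto
        moreover have "E0 * K * (1 / B) * (pi * (a * q)) = E0 * K * pi * (a * (a * L * q))" unfolding Bi by (simp add: mult_ac)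
        ultimately show ?thesis by (simp add: mult_ac)
      qed
      also have "\<dots> = (E0 * K * pi + E2 * pi + E2 * C3 * J) * (a * (a * L) powr (3 / 2))" unfolding q3 by (simp add: algebra_simps)
      finally have first: "\<bar>I (\<mu> + a) a - a / \<theta> * I a a\<bar> \<le> (E0 * K * pi + E2 * pi + E2 * C3 * J) * (a * (a * L) powr (3 / 2))" .
      \<comment> \<open>By \<open>norm_two_exp_ft_le\<close> with m = a the kernel 1 / (s (1 - s))
        is at most a^(-2) / (1 + t^2).\<close>
      define G where "G = 1 / a\<^sup>2"
      define D2 where "D2 = (\<lambda>t. E3 / (a * B) * K * X t + G * ee * Y t + G * C3 * (a ^ 3 * L ^ 3) * Z t)"
      define ind where "ind = (\<lambda>t::real. e0 / a * indicator {- (a / sqrt B)..a / sqrt B} t)"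
      have D2I: "integrable lborel D2" "integral\<^sup>L lborel D2 = E3 / (a * B) * K * (pi * (a * q)) + G * ee * pi + G * C3 * (a ^ 3 * L ^ 3) * J"
        unfolding D2_def using Xi Yi Zi by simp_all
      have rB: "a / sqrt B = a * q" using qB by (metis mult.right_neutral times_divide_eq_right)
      have indI: "integrable lborel ind" "integral\<^sup>L lborel ind = e0 / a * (2 * (a * q))"
        unfolding ind_def rB using a q by auto
      have lower: "ind t - D2 t \<le> Re (W t * two_exp_ft a (1 - a) t)" for t
      proof (cases "\<bar>t\<bar> \<le> a / 8")
        case True
        have "ind t - E3 / (a * B) * (norm (W t) * (1 + B * (t / a)\<^sup>2) ^ 3) \<le> Re (W t * two_exp_ft a (1 - a) t)"
          unfolding ind_def e0_def E3_def by (rule central_lower_bound[OF a(1,2) True Ba B C1(1) central[OF True]])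
        moreover have "E3 / (a * B) * (norm (W t) * (1 + B * (t / a)\<^sup>2) ^ 3) \<le> E3 / (a * B) * (K * X t)"
          using cen[OF True] E3p B a by (intro mult_left_mono) auto
        moreover have "E3 / (a * B) * (K * X t) \<le> D2 t"
          unfolding D2_def G_def using C3 a L XYZ0 by (simp add: ee_def mult.assoc)
        ultimately show ?thesis by linarith
      next
        case False
        have G0: "G \<ge> 0" by (simp add: G_def)
        have "norm (two_exp_ft a (1 - a) t) \<le> G * Y t"
          using norm_two_exp_ft_le[of a a "1 - a" t] a unfolding G_def Y_def by simp
        from outer[OF False this G0]
        have "- (G * (ee * Y t) + G * (C3 * (a ^ 3 * L ^ 3) * Z t)) \<le> Re (W t * two_exp_ft a (1 - a) t)" by linarith
        \<comment> \<open>\<open>B64\<close> places the interval of the indicator inside |t| <= a /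
          8.\<close>
        moreover have "ind t = 0"
        proof -
          have "sqrt 64 \<le> sqrt B" using B64 by (rule real_sqrt_le_mono)
          moreover have "sqrt 64 = (8::real)" by (rule real_sqrt_unique) auto
          ultimately have "a / sqrt B \<le> a / 8" using a B by (intro divide_left_mono) auto
          then have "\<not> \<bar>t\<bar> \<le> a / sqrt B" using False by linarith
          then have "t \<notin> {- (a / sqrt B)..a / sqrt B}" by auto
          then show ?thesis by (simp add: ind_def)
        qed
        moreover have "0 \<le> E3 / (a * B) * K * X t" using E3p K a B XYZ0 by simp
        ultimately show ?thesis unfolding D2_def by (simp add: mult.assoc)
      qed
      have "e0 / a * (2 * (a * q)) - (E3 / (a * B) * K * (pi * (a * q)) + G * ee * pi + G * C3 * (a ^ 3 * L ^ 3) * J) = (\<integral>t. ind t - D2 t \<partial>lborel)"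
        using indI D2I by simp
      also have "\<dots> \<le> (\<integral>t. Re (W t * two_exp_ft a (1 - a) t) \<partial>lborel)"
        by (intro integral_mono Bochner_Integration.integrable_diff indI D2I r2 lower)
      also have "\<dots> = I a a" unfolding I_def W_def ..
      finally have low: "2 * e0 * q - (E3 / (a * B) * K * (pi * (a * q)) + G * ee * pi + G * C3 * (a ^ 3 * L ^ 3) * J) \<le> I a a"
        using a by simp
      have "E3 / (a * B) * K * (pi * (a * q)) + G * ee * pi + G * C3 * (a ^ 3 * L ^ 3) * J \<le> e0 * q"
      proof -
        have t1: "E3 / (a * B) * K * (pi * (a * q)) = E3 * K * pi * (a * L * q)"
        proof -
          have "E3 / (a * B) * K * (pi * (a * q)) = E3 * K * pi * ((1 / B) * q) * (a / a)" by simp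
          then show ?thesis unfolding Bi using a by simp
        qed
        have "a * L * q \<le> \<eta> * q" using elim(10) unfolding L_def[symmetric] q3 q_def[symmetric] .
        then have t1': "E3 * K * pi * (a * L * q) \<le> E3 * K * pi * (\<eta> * q)" using E3p K by (intro mult_left_mono) auto
        have "G * ee \<le> \<eta> * q" using elim(11) unfolding G_def ee_def B_def q_def L_def[symmetric] by simp
        then have t2: "pi * (G * ee) \<le> pi * (\<eta> * q)" by (intro mult_left_mono) auto
        have "G * (a ^ 3 * L ^ 3) = a * L ^ 3" unfolding G_def using a by (simp add: power3_eq_cube power2_eq_square)
        moreover have "a * L ^ 3 \<le> \<eta> * q" using elim(12) unfolding q_def L_def[symmetric] .
        ultimately have "G * (a ^ 3 * L ^ 3) \<le> \<eta> * q" by (rule ord_eq_le_trans)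
        then have t3: "C3 * J * (G * (a ^ 3 * L ^ 3)) \<le> C3 * J * (\<eta> * q)" using C3 J0 by (intro mult_left_mono) auto
        have "E3 / (a * B) * K * (pi * (a * q)) + G * ee * pi + G * C3 * (a ^ 3 * L ^ 3) * J = E3 * K * pi * (a * L * q) + pi * (G * ee) + C3 * J * (G * (a ^ 3 * L ^ 3))"
          unfolding t1 by (simp add: mult_ac)
        also have "\<dots> \<le> E3 * K * pi * (\<eta> * q) + pi * (\<eta> * q) + C3 * J * (\<eta> * q)" using t1' t2 t3 by linarith
        also have "\<dots> \<le> (E3 * K * pi + pi + C3 * J + 1) * (\<eta> * q)" using etap q by (simp add: distrib_right)
        also have "\<dots> = e0 / 3 * q"
        proof -
          define Z where "Z = E3 * K * pi + pi + C3 * J + 1"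
          have "Z > 0" "\<eta> = e0 / (3 * Z)" using den unfolding Z_def \<eta>_def by (simp_all add: mult.commute)
          then show ?thesis unfolding Z_def[symmetric] by simp
        qed
        also have "\<dots> \<le> e0 * q" using e0p q by simp
        finally show ?thesis .
      qed
      then have "e0 * q \<le> I a a" using low by linarith
      then show ?case using first unfolding q_def L_def by blast
    qed
  qed
qed

section \<open>Squarefree multiples\<close>

text \<open>The source of the constant in F: the reciprocal of the Euler product for
  zeta(2).\<close>

lemma euler_product_zeta_2: "(\<lambda>N. \<Prod>p\<in>primes_le N. 1 - 1 / (real p)\<^sup>2) \<longlonglongrightarrow> 6 / pi\<^sup>2"
proof -
  have "(\<Sum>n. real n powr (- (1 + 1))) = pi\<^sup>2 / 6"
  proof -
    have "(\<lambda>n. real (Suc n) powr (- (1 + 1))) sums (pi\<^sup>2 / 6)"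
    proof -
      have "real (Suc n) powr (- (1 + 1)) = 1 / real ((n + 1)\<^sup>2)" for n
      proof -
        have "real (Suc n) powr (- (1 + 1)) = inverse (real (Suc n) powr real 2)" by (subst powr_minus) simp
        also have "real (Suc n) powr real 2 = real (Suc n) ^ 2" by (rule powr_realpow) simp
        finally show ?thesis by (simp add: divide_inverse add.commute)
      qed
      then show ?thesis using inverse_squares_sums by (simp only:)
    qed
    then have "(\<lambda>n. real n powr (- (1 + 1))) sums (pi\<^sup>2 / 6 + real 0 powr (- (1 + 1)))" by (subst (asm) sums_Suc_iff)
    then show ?thesis by (simp add: sums_iff)
  qed
  then have "(\<lambda>N. \<Prod>p\<in>primes_le N. 1 + 1 / (real p powr (1 + 1) - 1)) \<longlonglongrightarrow> pi\<^sup>2 / 6"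
    using zeta_real_props(2)[OF zero_less_one] by (simp only:)
  then have "(\<lambda>N. inverse (\<Prod>p\<in>primes_le N. 1 + 1 / (real p powr (1 + 1) - 1))) \<longlonglongrightarrow> inverse (pi\<^sup>2 / 6)"
    by (rule tendsto_inverse) simp
  moreover have "inverse (\<Prod>p\<in>primes_le N. 1 + 1 / (real p powr (1 + 1) - 1)) = (\<Prod>p\<in>primes_le N. 1 - 1 / (real p)\<^sup>2)" for N
    unfolding prod_inversef[symmetric]
  proof (rule prod.cong)
    fix p assume "p \<in> primes_le N"
    then have "real p > 1" using prime_gt_1_nat primes_leD by auto
    then have "(real p)\<^sup>2 > 1" by (simp add: one_less_power)
    moreover have "real p powr (1 + 1) = (real p)\<^sup>2" using \<open>real p > 1\<close> by (simp add: powr_numeral)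
    moreover have "inverse (1 + 1 / (Q - 1)) = 1 - 1 / Q" if "Q > 1" for Q :: real
    proof -
      have "1 + 1 / (Q - 1) = Q / (Q - 1)" using that by (simp add: field_simps)
      then show ?thesis using that by (simp add: diff_divide_distrib)
    qed
    ultimately show "(inverse \<circ> (\<lambda>p. 1 + 1 / (real p powr (1 + 1) - 1))) p = 1 - 1 / (real p)\<^sup>2"
      by (simp only: o_def)
  qed simp
  ultimately show ?thesis by simp
qed

definition sieve_count :: "nat set \<Rightarrow> (nat \<Rightarrow> nat) \<Rightarrow> real \<Rightarrow> nat" where
  "sieve_count P q z = card {l. 1 \<le> l \<and> real l \<le> z \<and> (\<forall>p\<in>P. \<not> q p dvd l)}"

lemma finite_nat_le_real: "finite {l::nat. 1 \<le> l \<and> real l \<le> z \<and> Q l}"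
  by (rule finite_subset[of _ "{..nat \<lfloor>z\<rfloor>}"]) (auto simp: le_nat_floor)

text \<open>The numbers removed are the multiples of \<open>q p\<close>. By coprimality the cofactor
  is subject to the same conditions for \<open>P\<close>, and its bound is z divided by
  \<open>q p\<close>.\<close>

lemma sieve_count_insert:
  assumes q0: "q p > 0" and cop: "\<And>p'. p' \<in> P \<Longrightarrow> coprime (q p') (q p)"
  shows "real (sieve_count (insert p P) q z) = real (sieve_count P q z) - real (sieve_count P q (z / real (q p)))"
proof -
  define A where "A = {l. 1 \<le> l \<and> real l \<le> z \<and> (\<forall>p\<in>P. \<not> q p dvd l)}"
  define B where "B = {l. 1 \<le> l \<and> real l \<le> z / real (q p) \<and> (\<forall>p\<in>P. \<not> q p dvd l)}"
  have fin: "finite A" unfolding A_def by (rule finite_nat_le_real)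
  have img: "{l \<in> A. q p dvd l} = (\<lambda>l. q p * l) ` B"
  proof (intro equalityI subsetI)
    fix l assume l: "l \<in> {l \<in> A. q p dvd l}"
    then obtain m where m: "l = q p * m" by auto
    have "m \<in> B"
    proof -
      have "m \<ge> 1" using l m by (cases m) (auto simp: A_def)
      moreover have "real m \<le> z / real (q p)" using l m q0 by (simp add: A_def pos_le_divide_eq mult.commute)
      moreover have "\<not> q p' dvd m" if "p' \<in> P" for p' using l m that by (auto simp: A_def)
      ultimately show ?thesis by (simp add: B_def)
    qed
    then show "l \<in> (\<lambda>l. q p * l) ` B" using m by blast
  next
    fix l assume "l \<in> (\<lambda>l. q p * l) ` B"
    then obtain m where m: "l = q p * m" "m \<in> B" by blast
    have "\<not> q p' dvd l" if "p' \<in> P" for p'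
      using m that cop[OF that] by (simp add: B_def coprime_dvd_mult_right_iff)
    then show "l \<in> {l \<in> A. q p dvd l}"
      using m q0 by (auto simp: A_def B_def pos_le_divide_eq mult.commute Suc_le_eq)
  qed
  have "{l. 1 \<le> l \<and> real l \<le> z \<and> (\<forall>p'\<in>insert p P. \<not> q p' dvd l)} = A - {l \<in> A. q p dvd l}"
    by (auto simp: A_def)
  then have "sieve_count (insert p P) q z = card A - card {l \<in> A. q p dvd l}"
    unfolding sieve_count_def using fin by (subst card_Diff_subset[symmetric]) auto
  moreover have "card {l \<in> A. q p dvd l} \<le> card A" by (rule card_mono[OF fin]) auto
  moreover have "card {l \<in> A. q p dvd l} = card B" unfolding img using q0 by (intro card_image) (auto simp: inj_on_def)
  ultimately show ?thesis by (simp add: sieve_count_def A_def B_def of_nat_diff)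
qed

text \<open>Removing one prime at a time multiplies the density by \<open>1 - 1/q\<close> and the error constant by
  \<open>1 + q powr (\<eta> - 1)\<close>, since the error is homogeneous of degree \<open>1 - \<eta>\<close> in \<open>z\<close>.\<close>

lemma sieve_count_estimate:
  assumes "finite P" and \<eta>: "0 \<le> \<eta>" "\<eta> < 1" and q0: "\<And>p. p \<in> P \<Longrightarrow> q p > 0"
    and cop: "\<And>p p'. p \<in> P \<Longrightarrow> p' \<in> P \<Longrightarrow> p \<noteq> p' \<Longrightarrow> coprime (q p') (q p)" and z: "z > 0"
  shows "\<bar>real (sieve_count P q z) - z * (\<Prod>p\<in>P. 1 - 1 / real (q p))\<bar> \<le> z powr (1 - \<eta>) * (\<Prod>p\<in>P. 1 + real (q p) powr (\<eta> - 1))"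
  using assms
proof (induction P arbitrary: z rule: finite_induct)
  case empty
  have "{l::nat. 1 \<le> l \<and> real l \<le> z} = {1..nat \<lfloor>z\<rfloor>}" using empty by (auto simp: le_nat_iff le_floor_iff)
  then have c: "real (sieve_count {} q z) = of_int \<lfloor>z\<rfloor>" using empty by (simp add: sieve_count_def)
  \<comment> \<open>The power covers both ranges: for z < 1 the integer part is 0 and the error is z
    itself; for z >= 1 the error is at most 1.\<close>
  have "\<bar>of_int \<lfloor>z\<rfloor> - z\<bar> \<le> z powr (1 - \<eta>)"
  proof (cases "z < 1")
    case True
    then have "\<lfloor>z\<rfloor> = 0" using empty by (simp add: floor_eq_iff)
    moreover have "z powr 1 \<le> z powr (1 - \<eta>)" using True empty by (intro powr_mono') auto
    ultimately show ?thesis using empty by simp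
  next
    case False
    have "\<bar>of_int \<lfloor>z\<rfloor> - z\<bar> \<le> 1" by linarith
    also have "1 \<le> z powr (1 - \<eta>)" using False empty by (intro ge_one_powr_ge_zero) auto
    finally show ?thesis .
  qed
  then show ?case using c by simp
next
  case (insert p P)
  define c where "c = (\<Prod>p\<in>P. 1 - 1 / real (q p))"
  define h where "h = (\<Prod>p\<in>P. 1 + real (q p) powr (\<eta> - 1))"
  have qp: "real (q p) > 0" using insert.prems by simp
  have IH: "\<bar>real (sieve_count P q y) - y * c\<bar> \<le> y powr (1 - \<eta>) * h" if "y > 0" for y
    unfolding c_def h_def using insert.prems that by (intro insert.IH) auto
  have "real (sieve_count (insert p P) q z) = real (sieve_count P q z) - real (sieve_count P q (z / real (q p)))"
    using insert.hyps insert.prems by (intro sieve_count_insert) auto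
  moreover have "z * (\<Prod>p\<in>insert p P. 1 - 1 / real (q p)) = z * c - z / real (q p) * c"
    using insert.hyps by (simp add: c_def algebra_simps)
  moreover have "z powr (1 - \<eta>) * (\<Prod>p\<in>insert p P. 1 + real (q p) powr (\<eta> - 1)) = z powr (1 - \<eta>) * h + (z / real (q p)) powr (1 - \<eta>) * h"
  proof -
    have "(z / real (q p)) powr (1 - \<eta>) = z powr (1 - \<eta>) / real (q p) powr (1 - \<eta>)" using qp insert.prems by (simp add: powr_divide)
    also have "\<dots> = z powr (1 - \<eta>) * real (q p) powr (\<eta> - 1)" using powr_minus[of "real (q p)" "1 - \<eta>"] by (simp add: divide_inverse)
    finally show ?thesis using insert.hyps by (simp add: h_def algebra_simps)
  qed
  moreover have "\<bar>real (sieve_count P q z) - z * c\<bar> \<le> z powr (1 - \<eta>) * h" using insert.prems by (intro IH) auto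
  moreover have "\<bar>real (sieve_count P q (z / real (q p))) - z / real (q p) * c\<bar> \<le> (z / real (q p)) powr (1 - \<eta>) * h"
    using qp insert.prems by (intro IH) auto
  ultimately show ?case by linarith
qed

section \<open>Squarefree kernels and their squarefree multiples\<close>

lemma sqfree_kernel_props:
  assumes "m > 0"
  shows "sqfree_kernel m > 0" "prime_factors (sqfree_kernel m) = prime_factors m" "squarefree (sqfree_kernel m)" "sqfree_kernel m dvd m"
proof -
  have pr: "\<And>p. p \<in> prime_factors m \<Longrightarrow> prime p" by (auto simp: in_prime_factors_iff)
  show pos: "sqfree_kernel m > 0" unfolding sqfree_kernel_def using pr by (intro prod_pos) (auto simp: prime_gt_0_nat)
  have dv: "p dvd sqfree_kernel m \<longleftrightarrow> p \<in> prime_factors m" if "prime p" for p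
  proof -
    have "p dvd sqfree_kernel m \<longleftrightarrow> (\<exists>q\<in>prime_factors m. p dvd q)"
      unfolding sqfree_kernel_def using that by (intro prime_dvd_prod_iff) auto
    also have "\<dots> \<longleftrightarrow> p \<in> prime_factors m" using pr that by (metis primes_dvd_imp_eq dvd_refl)
    finally show ?thesis .
  qed
  show "prime_factors (sqfree_kernel m) = prime_factors m"
    using dv pr pos by (auto simp: in_prime_factors_iff)
  show "squarefree (sqfree_kernel m)" unfolding sqfree_kernel_def
    by (rule squarefree_prod_coprime) (auto simp: squarefree_prime pr primes_coprime)
  show "sqfree_kernel m dvd m"
  proof -
    have "finite S \<Longrightarrow> S \<subseteq> prime_factors m \<Longrightarrow> (\<Prod>p\<in>S. p) dvd m" for S
    proof (induction S rule: finite_induct)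
      case (insert p S)
      then have "coprime p (\<Prod>q\<in>S. q)" using pr by (intro prod_coprime_right primes_coprime) auto
      moreover have "p dvd m" "(\<Prod>q\<in>S. q) dvd m" using insert by (auto simp: in_prime_factors_iff)
      ultimately have "p * (\<Prod>q\<in>S. q) dvd m" using divides_mult by blast
      then show ?case using insert by simp
    qed auto
    then show ?thesis unfolding sqfree_kernel_def by simp
  qed
qed

lemma sqfree_kernel_squarefree:
  assumes "squarefree k"
  shows "sqfree_kernel k = k"
proof -
  have k0: "k > 0" using assms by (intro Nat.gr0I) auto
  have "(\<Prod>p\<in>prime_factors k. p ^ multiplicity p k) = k" using k0 prod_prime_factors[of k] by simp
  moreover have "p ^ multiplicity p k = p" if "p \<in> prime_factors k" for p
  proof -
    have "multiplicity p k = 1" using that assms squarefree_factorial_semiring'[of k] k0 by auto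
    then show ?thesis by simp
  qed
  ultimately show ?thesis unfolding sqfree_kernel_def by simp
qed

lemma sqfree_kernel_mult:
  assumes "squarefree k" "sqfree_kernel d dvd k" "d > 0"
  shows "sqfree_kernel (k * d) = k"
proof -
  have k0: "k > 0" using assms by (intro Nat.gr0I) auto
  have "prime_factors d \<subseteq> prime_factors k"
    using sqfree_kernel_props(2)[OF assms(3)] dvd_prime_factors[OF _ assms(2)] k0 by auto
  then have "prime_factors (k * d) = prime_factors k" using k0 assms by (auto simp: prime_factorization_mult)
  then have "sqfree_kernel (k * d) = sqfree_kernel k" by (simp add: sqfree_kernel_def)
  then show ?thesis using sqfree_kernel_squarefree[OF assms(1)] by simp
qed

definition multiple_count :: "real \<Rightarrow> nat \<Rightarrow> nat" where
  "multiple_count y d = card {k::nat. squarefree k \<and> sqfree_kernel d dvd k \<and> real k \<le> y}"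

text \<open>Write k = r l with r the kernel of d. Then k is squarefree if and only if l is
  squarefree and coprime to r, that is, no prime p dividing d and no p^2 divides l. Since l <= N,
  the primes up to N detect this.\<close>

lemma multiple_count_sieve:
  assumes d: "d > 0" and N: "y / real (sqfree_kernel d) \<le> real N"
  shows "multiple_count y d = sieve_count (primes_le N) (\<lambda>p. if p dvd d then p else p\<^sup>2) (y / real (sqfree_kernel d))"
proof -
  define r where "r = sqfree_kernel d"
  define q where "q = (\<lambda>p. if p dvd d then p else p\<^sup>2)"
  define A where "A = {l. 1 \<le> l \<and> real l \<le> y / real r \<and> (\<forall>p\<in>primes_le N. \<not> q p dvd l)}"
  have r: "r > 0" "prime_factors r = prime_factors d" "squarefree r" using sqfree_kernel_props[OF d] by (auto simp: r_def)
  have pdr: "p dvd r \<longleftrightarrow> p dvd d" if "prime p" for p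
    using r(2) that r(1) d by (metis in_prime_factors_iff not_gr_zero)
  have iff: "(\<forall>p\<in>primes_le N. \<not> q p dvd l) \<longleftrightarrow> squarefree l \<and> coprime r l" if l: "1 \<le> l" "l \<le> N" for l
  proof
    assume h: "\<forall>p\<in>primes_le N. \<not> q p dvd l"
    have nd: "\<not> q p dvd l" if "prime p" "p dvd l" for p
    proof -
      have "p \<le> l" using that l by (intro dvd_imp_le) auto
      then show ?thesis using h that l by (auto simp: primes_le_def)
    qed
    have "squarefree l"
    proof (subst squarefree_factorial_semiring)
      show "l \<noteq> 0" using l by simp
      show "\<forall>p. prime p \<longrightarrow> \<not> p\<^sup>2 dvd l"
      proof (intro allI impI notI)
        fix p assume p: "prime p" "p\<^sup>2 dvd l"
        have "p dvd l" using p(2) by (meson dvd_power dvd_trans pos2)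
        moreover have "q p dvd l" using p \<open>p dvd l\<close> by (simp add: q_def)
        ultimately show False using nd p by blast
      qed
    qed
    moreover have "coprime r l"
    proof (rule ccontr)
      assume "\<not> coprime r l"
      then have "gcd r l \<noteq> 1" by (simp add: coprime_iff_gcd_eq_1)
      then obtain p where "prime p" "p dvd gcd r l" using prime_factor_nat by blast
      then have "prime p" "p dvd r" "p dvd l" by auto
      then show False using nd[of p] pdr[of p] by (simp add: q_def)
    qed
    ultimately show "squarefree l \<and> coprime r l" by blast
  next
    assume h: "squarefree l \<and> coprime r l"
    show "\<forall>p\<in>primes_le N. \<not> q p dvd l"
    proof (intro ballI notI)
      fix p assume p: "p \<in> primes_le N" "q p dvd l"
      have pp: "prime p" using p by (simp add: primes_leD)
      show False
      proof (cases "p dvd d")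
        case True
        then have "p dvd r" "p dvd l" using pdr[OF pp] p by (auto simp: q_def)
        then have "is_unit p" using h coprime_common_divisor by blast
        then show False using pp not_prime_unit by blast
      next
        case False
        then have "p\<^sup>2 dvd l" using p by (simp add: q_def)
        then have "is_unit p" using h squarefreeD by blast
        then show False using pp not_prime_unit by blast
      qed
    qed
  qed
  have "{k. squarefree k \<and> r dvd k \<and> real k \<le> y} = (\<lambda>l. r * l) ` A"
  proof (intro equalityI subsetI)
    fix k assume k: "k \<in> {k. squarefree k \<and> r dvd k \<and> real k \<le> y}"
    then obtain l where l: "k = r * l" by auto
    have k0: "k > 0" using k by (intro Nat.gr0I) auto
    then have l1: "1 \<le> l" using l by (cases l) auto
    have ly: "real l \<le> y / real r" using k l r by (simp add: pos_le_divide_eq mult.commute)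
    have lN: "l \<le> N" using ly N by (simp add: r_def)
    have "squarefree l" using k l squarefree_mono[of l k] by auto
    moreover have "coprime r l"
    proof (rule ccontr)
      assume "\<not> coprime r l"
      then have "gcd r l \<noteq> 1" by (simp add: coprime_iff_gcd_eq_1)
      then obtain p where p: "prime p" "p dvd gcd r l" using prime_factor_nat by blast
      then have "p * p dvd r * l" by (intro mult_dvd_mono) auto
      then have "p\<^sup>2 dvd k" using l by (simp add: power2_eq_square)
      then have "is_unit p" using k squarefreeD by blast
      then show False using p not_prime_unit by blast
    qed
    ultimately have "l \<in> A" unfolding A_def using iff[OF l1 lN] l1 ly by simp
    then show "k \<in> (\<lambda>l. r * l) ` A" using l by blast
  next
    fix k assume "k \<in> (\<lambda>l. r * l) ` A"
    then obtain l where l: "k = r * l" "l \<in> A" by blast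
    have l1: "1 \<le> l" "real l \<le> y / real r" using l by (auto simp: A_def)
    have lN: "l \<le> N" using l1 N by (simp add: r_def)
    have "squarefree l \<and> coprime r l" using l iff[OF l1(1) lN] by (simp add: A_def)
    then have "squarefree k" unfolding l(1) using r by (intro squarefree_mult_coprime) auto
    moreover have "real k \<le> y" using l1 l r by (simp add: pos_le_divide_eq mult.commute)
    ultimately show "k \<in> {k. squarefree k \<and> r dvd k \<and> real k \<le> y}" using l by simp
  qed
  then have "multiple_count y d = card ((\<lambda>l. r * l) ` A)" unfolding multiple_count_def r_def by simp
  also have "\<dots> = card A" using r by (intro card_image) (auto simp: inj_on_def)
  finally show ?thesis unfolding sieve_count_def A_def q_def r_def .
qed

text \<open>The dependence of the sieve error on d: p^(\<eta> - 1) stems from (y / r)^(1 - \<eta>),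
  where r is the kernel of d, and 1 + p^(-3/4) bounds the sieve factor 1 + p^(\<eta> - 1) of a prime
  dividing d when \<eta> <= 1/4.\<close>

definition error_coeff :: "real \<Rightarrow> nat \<Rightarrow> real" where
  "error_coeff \<eta> p = real p powr (\<eta> - 1) * (1 + real p powr (- 3 / 4))"

text \<open>The sieve estimate as N tends to infinity. The error product stays bounded because a
  prime not dividing d is sieved by p^2 and costs p^(2 \<eta> - 2) <= p^(-3/2). In the main term a
  prime dividing d gives 1 - 1/p = (p / (p + 1)) (1 - 1/p^2), and the division of y by r turns p /
  (p + 1) into 1 / (p + 1).\<close>

lemma multiple_count_estimate:
  obtains E where "E > 0" "\<And>y d \<eta>. d > 0 \<Longrightarrow> y > 0 \<Longrightarrow> 0 \<le> \<eta> \<Longrightarrow> \<eta> \<le> 1 / 4 \<Longrightarrow>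
    \<bar>real (multiple_count y d) - 6 / pi\<^sup>2 * y * psi_coeff d\<bar> \<le> E * y powr (1 - \<eta>) * kernel_coeff (error_coeff \<eta>) d"
proof -
  have s32: "summable (\<lambda>n. real n powr (- 3 / 2))" using summable_real_powr_iff[of "- 3 / 2"] by simp
  define E where "E = exp (\<Sum>n. real n powr (- 3 / 2))"
  show ?thesis
  proof (rule that[of E])
    show "E > 0" by (simp add: E_def)
    fix y :: real and d :: nat and \<eta> :: real
    assume d: "d > 0" and y: "y > 0" and \<eta>: "0 \<le> \<eta>" "\<eta> \<le> 1 / 4"
    define r where "r = sqfree_kernel d"
    define q where "q = (\<lambda>p. if p dvd d then p else p\<^sup>2)"
    define z where "z = y / real r"
    define c where "c = (\<Prod>p\<in>prime_factors d. real p / (real p + 1))"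
    define h where "h = (\<Prod>p\<in>prime_factors d. 1 + real p powr (- 3 / 4))"
    have r: "r > 0" using sqfree_kernel_props[OF d] by (simp add: r_def)
    have z: "z > 0" using y r by (simp add: z_def)
    have h0: "h \<ge> 0" unfolding h_def by (intro prod_nonneg) auto
    have rr: "real r = (\<Prod>p\<in>prime_factors d. real p)" by (simp add: r_def sqfree_kernel_def)
    have pf: "prime_factors d \<subseteq> primes_le N" if "N \<ge> d" for N
      using that d by (auto simp: primes_le_def in_prime_factors_iff intro: order_trans[OF dvd_imp_le])
    have pfi: "primes_le N \<inter> {p. p dvd d} = prime_factors d" if "N \<ge> d" for N
      using pf[OF that] d by (auto simp: primes_le_def in_prime_factors_iff)
    have cN: "(\<Prod>p\<in>primes_le N. 1 - 1 / real (q p)) = c * (\<Prod>p\<in>primes_le N. 1 - 1 / (real p)\<^sup>2)" if "N \<ge> d" for N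
    proof -
      have "c = (\<Prod>p\<in>primes_le N. if p dvd d then real p / (real p + 1) else 1)"
        unfolding c_def using pfi[OF that] by (simp add: prod.If_cases)
      moreover have "1 - 1 / real (q p) = (if p dvd d then real p / (real p + 1) else 1) * (1 - 1 / (real p)\<^sup>2)" if "p \<in> primes_le N" for p
      proof (cases "p dvd d")
        case True
        have p1: "real p > 1" using that prime_gt_1_nat primes_leD by auto
        have alg: "P / (P + 1) * (1 - 1 / P\<^sup>2) = 1 - 1 / P" if "P > 0" for P :: real
        proof -
          have "1 - 1 / P\<^sup>2 = (P + 1) * (P - 1) / (P * P)" using that by (simp add: field_simps power2_eq_square)
          then have "P / (P + 1) * (1 - 1 / P\<^sup>2) = ((P + 1) / (P + 1)) * (P / P) * ((P - 1) / P)" by (simp only: times_divide_times_eq times_divide_eq_left times_divide_eq_right) (simp add: mult_ac)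
          then show ?thesis using that by (simp add: diff_divide_distrib)
        qed
        have "real p / (real p + 1) * (1 - 1 / (real p)\<^sup>2) = 1 - 1 / real p" using p1 by (intro alg) auto
        then show ?thesis using True by (simp add: q_def)
      qed (simp add: q_def)
      ultimately show ?thesis by (simp add: prod.distrib[symmetric])
    qed
    have hN: "(\<Prod>p\<in>primes_le N. 1 + real (q p) powr (\<eta> - 1)) \<le> h * E" if "N \<ge> d" for N
    proof -
      have "(\<Prod>p\<in>primes_le N. 1 + real (q p) powr (\<eta> - 1)) \<le> (\<Prod>p\<in>primes_le N. (if p dvd d then 1 + real p powr (- 3 / 4) else 1) * (1 + real p powr (- 3 / 2)))"
      proof (rule prod_mono, intro conjI)
        fix p assume "p \<in> primes_le N"
        then have p1: "real p > 1" using prime_gt_1_nat primes_leD by auto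
        show "0 \<le> 1 + real (q p) powr (\<eta> - 1)" by (simp add: add_nonneg_nonneg)
        show "1 + real (q p) powr (\<eta> - 1) \<le> (if p dvd d then 1 + real p powr (- 3 / 4) else 1) * (1 + real p powr (- 3 / 2))"
        proof (cases "p dvd d")
          case True
          have "real p powr (\<eta> - 1) \<le> real p powr (- 3 / 4)" using p1 \<eta> by (intro powr_mono) auto
          then have "1 + real p powr (\<eta> - 1) \<le> (1 + real p powr (- 3 / 4)) * 1" by simp
          also have "\<dots> \<le> (1 + real p powr (- 3 / 4)) * (1 + real p powr (- 3 / 2))" by (intro mult_left_mono) auto
          finally show ?thesis using True by (simp add: q_def)
        next
          case False
          have "real (q p) powr (\<eta> - 1) = (real p powr 2) powr (\<eta> - 1)" using False p1 by (simp add: q_def powr_numeral)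
          also have "\<dots> = real p powr (2 * (\<eta> - 1))" by (rule powr_powr)
          also have "\<dots> \<le> real p powr (- 3 / 2)" using p1 \<eta> by (intro powr_mono) auto
          finally show ?thesis using False by simp
        qed
      qed
      also have "\<dots> = h * (\<Prod>p\<in>primes_le N. 1 + real p powr (- 3 / 2))"
        unfolding prod.distrib h_def using pfi[OF that] by (simp add: prod.If_cases)
      also have "\<dots> \<le> h * E"
      proof (rule mult_left_mono[OF _ h0])
        have "(\<Prod>p\<in>primes_le N. 1 + real p powr (- 3 / 2)) \<le> exp (\<Sum>p\<in>primes_le N. real p powr (- 3 / 2))"
          by (rule prod_one_plus_le_exp) auto
        also have "\<dots> \<le> E" unfolding E_def exp_le_cancel_iff by (intro sum_le_suminf s32) auto
        finally show "(\<Prod>p\<in>primes_le N. 1 + real p powr (- 3 / 2)) \<le> E" .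
      qed
      finally show ?thesis .
    qed
    have step: "\<bar>real (multiple_count y d) - z * (c * (\<Prod>p\<in>primes_le N. 1 - 1 / (real p)\<^sup>2))\<bar> \<le> z powr (1 - \<eta>) * (h * E)"
      if N: "N \<ge> max d (nat \<lceil>z\<rceil>)" for N
    proof -
      have zN: "z \<le> real N" using N by linarith
      have "\<bar>real (sieve_count (primes_le N) q z) - z * (\<Prod>p\<in>primes_le N. 1 - 1 / real (q p))\<bar> \<le> z powr (1 - \<eta>) * (\<Prod>p\<in>primes_le N. 1 + real (q p) powr (\<eta> - 1))"
      proof (rule sieve_count_estimate)
        show "q p > 0" if "p \<in> primes_le N" for p using that prime_gt_0_nat by (auto simp: q_def primes_le_def)
        show "coprime (q p') (q p)" if "p \<in> primes_le N" "p' \<in> primes_le N" "p \<noteq> p'" for p p'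
          using primes_coprime[of p' p] that by (auto simp: q_def primes_le_def)
      qed (use \<eta> z in auto)
      also have "\<dots> \<le> z powr (1 - \<eta>) * (h * E)" using hN[of N] N by (intro mult_left_mono) auto
      finally show ?thesis
        using multiple_count_sieve[OF d, of y N] zN N cN[of N] unfolding z_def r_def q_def by simp
    qed
    have "(\<lambda>N. \<bar>real (multiple_count y d) - z * (c * (\<Prod>p\<in>primes_le N. 1 - 1 / (real p)\<^sup>2))\<bar>) \<longlonglongrightarrow> \<bar>real (multiple_count y d) - z * (c * (6 / pi\<^sup>2))\<bar>"
      by (intro tendsto_intros euler_product_zeta_2)
    then have "\<bar>real (multiple_count y d) - z * (c * (6 / pi\<^sup>2))\<bar> \<le> z powr (1 - \<eta>) * (h * E)"
      by (rule LIMSEQ_le_const2) (use step in blast)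
    moreover have "z * (c * (6 / pi\<^sup>2)) = 6 / pi\<^sup>2 * y * psi_coeff d"
    proof -
      have "c = real r * psi_coeff d" unfolding c_def rr kernel_coeff_def prod.distrib[symmetric] by simp
      then show ?thesis using r by (simp add: z_def)
    qed
    moreover have "z powr (1 - \<eta>) * (h * E) = E * y powr (1 - \<eta>) * kernel_coeff (error_coeff \<eta>) d"
    proof -
      have "real r powr (\<eta> - 1) = (\<Prod>p\<in>prime_factors d. real p powr (\<eta> - 1))"
        unfolding rr by (rule prod_powr_distrib)
      then have "kernel_coeff (error_coeff \<eta>) d = real r powr (\<eta> - 1) * h"
        unfolding kernel_coeff_def error_coeff_def h_def by (simp add: prod.distrib)
      moreover have "z powr (1 - \<eta>) = y powr (1 - \<eta>) * real r powr (\<eta> - 1)"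
      proof -
        have "z powr (1 - \<eta>) = y powr (1 - \<eta>) / real r powr (1 - \<eta>)" unfolding z_def by (rule powr_divide)
        then show ?thesis using powr_minus[of "real r" "1 - \<eta>"] by (simp add: divide_inverse)
      qed
      ultimately show ?thesis by (simp add: mult_ac)
    qed
    ultimately show "\<bar>real (multiple_count y d) - 6 / pi\<^sup>2 * y * psi_coeff d\<bar> \<le> E * y powr (1 - \<eta>) * kernel_coeff (error_coeff \<eta>) d" by (simp only:)
  qed
qed

section \<open>Decomposition by squarefree kernel\<close>

text \<open>The error series has to be compared with \<Phi>(a). Put w = p^(a/2) and u = p^a - 1 = (w
  - 1) (w + 1); then w / u = 1 / (w + 1) + 1 / u. The first part contributes O(p^(-1 - a/2)). The
  second is the Euler weight of \<Phi> plus O(p^(-3/4) / (p u)), where u may be of order a. This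
  excess is measured against the numerator u + q of the Euler factor, q = 1 / (p + 1): u + q >= 2
  sqrt (u q) >= sqrt (a / p).\<close>

lemma error_factor_le:
  assumes p: "prime p" and a: "0 < a" "a \<le> 1 / 2"
  shows "1 + error_coeff (a / 2) p / (real p powr a - 1) \<le>
    (1 + euler_weight p a) * exp (2 * real p powr (- (1 + a / 2)) + 2 * a powr (- 1 / 2) * real p powr (- 5 / 4))"
proof -
  define P where "P = real p"
  define w where "w = P powr (a / 2)"
  define u where "u = P powr a - 1"
  define e where "e = P powr (- 3 / 4)"
  define q where "q = 1 / (P + 1)"
  define s where "s = sqrt (a / P)"
  define X where "X = 2 * P powr (- (1 + a / 2))"
  define Y where "Y = 2 * e / (P * s)"
  have P: "P \<ge> 2" using prime_ge_2_nat[OF p] by (simp add: P_def)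
  have w: "w > 1" unfolding w_def using P a by (intro gr_one_powr) auto
  have uw: "u = (w - 1) * (w + 1)"
  proof -
    have "w * w = P powr a" unfolding w_def powr_add[symmetric] by simp
    then show ?thesis by (simp add: u_def algebra_simps)
  qed
  then have u: "u > 0" using w by simp
  have s: "s > 0" unfolding s_def using a P by simp
  have q: "q > 0" unfolding q_def using P by simp
  have e: "0 < e" "e \<le> 1" "1 / P \<le> e"
  proof -
    show "0 < e" unfolding e_def using P by simp
    have "P powr (- 3 / 4) \<le> P powr 0" using P by (intro powr_mono) auto
    then show "e \<le> 1" unfolding e_def using P by simp
    have "P powr (- 1) \<le> P powr (- 3 / 4)" using P by (intro powr_mono) auto
    then show "1 / P \<le> e" unfolding e_def using P powr_neg_one[of P] by simp
  qed
  have A: "1 + euler_weight p a = (u + q) / u"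
  proof -
    have "euler_weight p a = q / u" unfolding euler_weight_def u_def q_def P_def ..
    then show ?thesis using u by (simp add: add_divide_distrib)
  qed
  have us: "s \<le> u + q"
  proof (rule power2_le_imp_le)
    have "a / 2 \<le> u"
    proof -
      have "ln 2 \<le> ln P" using P by simp
      then have "1 / 2 \<le> ln P" using ln_2_ge_half by linarith
      then have "a * (1 / 2) \<le> a * ln P" using a by (intro mult_left_mono) auto
      also have "\<dots> \<le> u" unfolding u_def using P by (intro powr_minus_1_ge) auto
      finally show ?thesis by simp
    qed
    moreover have "1 / (2 * P) \<le> q" unfolding q_def using P by (intro divide_left_mono) auto
    ultimately have "a / 2 * (1 / (2 * P)) \<le> u * q" using a P u by (intro mult_mono) auto
    moreover have "4 * (u * q) \<le> (u + q)\<^sup>2" using zero_le_power2[of "u - q"] by (simp add: power2_eq_square algebra_simps)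
    ultimately have "a / P \<le> (u + q)\<^sup>2" by simp
    then show "s\<^sup>2 \<le> (u + q)\<^sup>2" unfolding s_def using a P by simp
    show "0 \<le> u + q" using u q by simp
  qed
  have "error_coeff (a / 2) p / u = (1 + e) / P * (1 / (w + 1)) + (1 + e) / P / u"
  proof -
    have "error_coeff (a / 2) p = w / P * (1 + e)"
    proof -
      have "P powr (a / 2 - 1) = w / P powr 1" unfolding w_def by (rule powr_diff)
      also have "P powr 1 = P" using P by simp
      finally show ?thesis unfolding error_coeff_def P_def[symmetric] e_def by (simp only:)
    qed
    then have "error_coeff (a / 2) p / u = (1 + e) / P * (w / u)" by simp
    also have "w / u = 1 / (w + 1) + 1 / u"
    proof -
      have "1 / (w + 1) = (w - 1) / u" unfolding uw using w by simp
      then show ?thesis by (simp add: add_divide_distrib[symmetric])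
    qed
    finally show ?thesis by (simp add: distrib_left)
  qed
  also have "(1 + e) / P * (1 / (w + 1)) \<le> 2 / P * (1 / w)"
    using e P w by (intro mult_mono divide_right_mono divide_left_mono) auto
  also have "2 / P * (1 / w) = X"
  proof -
    have "P powr (- (1 + a / 2)) = inverse (P * w)" unfolding w_def powr_minus powr_add using P by simp
    then show ?thesis unfolding X_def by (simp only: divide_inverse inverse_mult_distrib mult_1_left mult_ac)
  qed
  also have "(1 + e) / P / u \<le> q / u + 2 * e / P / u"
  proof -
    have "1 / P - q = q / P" unfolding q_def using P by (simp add: field_simps)
    also have "\<dots> \<le> e / P"
    proof (rule divide_right_mono)
      have "q \<le> 1 / P" unfolding q_def using P by (intro divide_left_mono) auto
      then show "q \<le> e" using e by linarith
    qed (use P in simp)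
    finally have "(1 + e) / P \<le> q + 2 * e / P" by (simp add: add_divide_distrib)
    then have "(1 + e) / P / u \<le> (q + 2 * e / P) / u" using u by (intro divide_right_mono) auto
    then show ?thesis by (simp add: add_divide_distrib)
  qed
  finally have 1: "1 + error_coeff (a / 2) p / u \<le> (u + q) / u + X + 2 * e / P / u"
    using u by (simp add: add_divide_distrib)
  have "2 * e / P / u \<le> (u + q) / u * Y"
  proof -
    have "2 * e / P / u = s / u * Y" unfolding Y_def using s by simp
    also have "\<dots> \<le> (u + q) / u * Y" using us u e P s unfolding Y_def by (intro mult_right_mono divide_right_mono) auto
    finally show ?thesis .
  qed
  moreover have "X \<le> (u + q) / u * X"
  proof -
    have "1 * X \<le> (u + q) / u * X" using u q unfolding X_def by (intro mult_right_mono) auto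
    then show ?thesis by simp
  qed
  ultimately have "1 + error_coeff (a / 2) p / u \<le> (u + q) / u * (1 + (X + Y))" using 1 by (simp add: distrib_left)
  also have "\<dots> \<le> (u + q) / u * exp (X + Y)" using u q by (intro mult_left_mono exp_ge_add_one_self) auto
  also have "Y = 2 * a powr (- 1 / 2) * P powr (- 5 / 4)"
  proof -
    have "s = a powr (1 / 2) * P powr (- 1 / 2)"
    proof -
      have "s = a powr (1 / 2) / P powr (1 / 2)" unfolding s_def powr_divide[symmetric] using a P by (simp add: powr_half_sqrt)
      moreover have "P powr (- 1 / 2) = 1 / P powr (1 / 2)" using powr_minus_divide[of P "1 / 2"] by simp
      ultimately show ?thesis by (simp only: times_divide_eq_right mult_1_right)
    qed
    then have "Y = 2 * (e / (P powr 1 * P powr (- 1 / 2))) / a powr (1 / 2)" unfolding Y_def using P by simp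
    also have "e / (P powr 1 * P powr (- 1 / 2)) = P powr (- 5 / 4)"
      unfolding e_def powr_add[symmetric] powr_diff[symmetric] by simp
    also have "2 * P powr (- 5 / 4) / a powr (1 / 2) = 2 * a powr (- 1 / 2) * P powr (- 5 / 4)"
    proof -
      have "a powr (- 1 / 2) = 1 / a powr (1 / 2)" using powr_minus_divide[of a "1 / 2"] by simp
      then show ?thesis by (simp only: times_divide_eq_right times_divide_eq_left mult_1_right)
    qed
    finally show ?thesis .
  qed
  finally show ?thesis unfolding A X_def u_def P_def .
qed

lemma zeta_real_le:
  assumes "b > 0"
  shows "(\<Sum>n. real n powr (- (1 + b))) \<le> 2 + b + 1 / b"
proof -
  have "dirichlet_term (\<lambda>_. 1) (of_real (1 + b)) n = of_real (real n powr (- (1 + b)))" for n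
    unfolding dirichlet_term_of_real by simp
  then have "dirichlet_term (\<lambda>_. 1) (1 + of_real b) = (\<lambda>n. of_real (real n powr (- (1 + b))))" by (simp only: of_real_add of_real_1) blast
  then have "zeta_series (of_real b) = of_real (\<Sum>n. real n powr (- (1 + b)))"
    unfolding zeta_series_def using suminf_of_real[OF zeta_real_props(1)[OF assms], where 'a = complex] by (simp only:)
  then have "\<bar>\<Sum>n. real n powr (- (1 + b))\<bar> = norm (zeta_series (of_real b))" by (simp only: norm_of_real)
  also have "\<dots> \<le> 1 + ln (real 1) + 1 / norm (of_real b :: complex) + norm (1 + of_real b :: complex) / real 1"
    using assms by (intro norm_zeta_series_le) auto
  also have "norm (1 + of_real b :: complex) = 1 + b"
    using assms norm_of_real[of "1 + b", where 'a = complex] by simp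
  finally show ?thesis using assms by simp
qed

text \<open>By e^t <= 1 / (1 - t) each exponential is at most the corresponding factor of zeta(1 +
  b).\<close>

lemma exp_sum_prime_powr_le:
  assumes "b > 0"
  shows "exp (\<Sum>p\<in>primes_le N. real p powr (- (1 + b))) \<le> 2 + b + 1 / b"
proof -
  have "exp (\<Sum>p\<in>primes_le N. real p powr (- (1 + b))) = (\<Prod>p\<in>primes_le N. exp (real p powr (- (1 + b))))"
    by (rule exp_sum[OF finite_primes_le])
  also have "\<dots> \<le> (\<Prod>p\<in>primes_le N. 1 + 1 / (real p powr (1 + b) - 1))"
  proof (rule prod_mono, intro conjI)
    fix p assume "p \<in> primes_le N"
    then have Q: "real p powr (1 + b) > 1" using prime_powr_gt_1[of p "1 + b"] primes_leD assms by auto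
    define t where "t = real p powr (- (1 + b))"
    have t: "t = 1 / real p powr (1 + b)" unfolding t_def by (rule powr_minus_divide)
    then have t': "t < 1" using Q by (simp only: divide_less_eq_1_pos[OF less_trans[OF zero_less_one Q]])
    have "1 - t \<le> exp (- t)" using exp_ge_add_one_self[of "- t"] by simp
    then have "exp t \<le> 1 / (1 - t)" using t' by (simp add: exp_minus field_simps)
    also have "\<dots> = 1 + 1 / (real p powr (1 + b) - 1)"
    proof -
      have "1 / (1 - 1 / Z) = 1 + 1 / (Z - 1)" if "Z > 1" for Z :: real using that by (simp add: field_simps)
      then show ?thesis unfolding t using Q by blast
    qed
    finally show "exp (real p powr (- (1 + b))) \<le> 1 + 1 / (real p powr (1 + b) - 1)" unfolding t_def .
  qed simp
  also have "\<dots> \<le> (\<Sum>n. real n powr (- (1 + b)))" by (rule zeta_real_props(3)[OF assms])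
  also have "\<dots> \<le> 2 + b + 1 / b" by (rule zeta_real_le[OF assms])
  finally show ?thesis .
qed

text \<open>The prime sum of p^(-1 - a/2) costs (4 / a)^2 through zeta(1 + a/2). The prime sum of
  p^(-5/4) is bounded, so its coefficient a^(-1/2) ends up in the exponential.\<close>

lemma error_series_bound:
  obtains E where "E > 0"
    "\<And>a. 0 < a \<Longrightarrow> a \<le> 1 / 2 \<Longrightarrow> summable (\<lambda>n. kernel_coeff (error_coeff (a / 2)) n * real n powr (- a))"
    "\<And>a. 0 < a \<Longrightarrow> a \<le> 1 / 2 \<Longrightarrow> (\<Sum>n. kernel_coeff (error_coeff (a / 2)) n * real n powr (- a)) \<le>
       psi_series_real a * (16 / a\<^sup>2 * exp (E * a powr (- 1 / 2)))"
proof -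
  have s54: "summable (\<lambda>n. real n powr (- 5 / 4))" using summable_real_powr_iff[of "- 5 / 4"] by simp
  define E where "E = 2 * (\<Sum>n. real n powr (- 5 / 4)) + 1"
  have E: "2 * (\<Sum>p\<in>primes_le N. real p powr (- 5 / 4)) \<le> E" for N
    unfolding E_def using sum_le_suminf[OF s54 finite_primes_le, of N] by simp
  have E0: "E > 0" unfolding E_def using suminf_nonneg[OF s54] by simp
  have bound: "(\<Prod>p\<in>primes_le N. 1 + error_coeff (a / 2) p / (real p powr a - 1)) \<le> psi_series_real a * (16 / a\<^sup>2 * exp (E * a powr (- 1 / 2)))"
    if a: "0 < a" "a \<le> 1 / 2" for a N
  proof -
    define T where "T = (\<Sum>p\<in>primes_le N. real p powr (- (1 + a / 2)))"
    have "(\<Prod>p\<in>primes_le N. 1 + error_coeff (a / 2) p / (real p powr a - 1)) \<le>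
      (\<Prod>p\<in>primes_le N. (1 + euler_weight p a) * exp (2 * real p powr (- (1 + a / 2)) + 2 * a powr (- 1 / 2) * real p powr (- 5 / 4)))"
    proof (rule prod_mono, intro conjI)
      fix p assume "p \<in> primes_le N"
      then have p: "prime p" by (simp add: primes_leD)
      show "0 \<le> 1 + error_coeff (a / 2) p / (real p powr a - 1)"
        unfolding error_coeff_def using prime_powr_gt_1[OF p a(1)] by (intro add_nonneg_nonneg divide_nonneg_nonneg mult_nonneg_nonneg) auto
      show "1 + error_coeff (a / 2) p / (real p powr a - 1) \<le>
        (1 + euler_weight p a) * exp (2 * real p powr (- (1 + a / 2)) + 2 * a powr (- 1 / 2) * real p powr (- 5 / 4))"
        by (rule error_factor_le[OF p a])
    qed
    also have "\<dots> = (\<Prod>p\<in>primes_le N. 1 + euler_weight p a) * exp (2 * T + a powr (- 1 / 2) * (2 * (\<Sum>p\<in>primes_le N. real p powr (- 5 / 4))))"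
      unfolding prod.distrib exp_sum[OF finite_primes_le, symmetric] T_def by (simp add: sum.distrib sum_distrib_left mult_ac)
    also have "\<dots> \<le> psi_series_real a * exp (2 * T + a powr (- 1 / 2) * E)"
      using psi_series_real_props(3,4)[OF a(1)] E[of N] by (intro mult_mono) (auto intro!: mult_left_mono)
    also have "exp (2 * T + a powr (- 1 / 2) * E) = (exp T)\<^sup>2 * exp (E * a powr (- 1 / 2))"
      unfolding exp_add exp_double by (simp only: mult.commute)
    also have "psi_series_real a * ((exp T)\<^sup>2 * exp (E * a powr (- 1 / 2))) \<le> psi_series_real a * (16 / a\<^sup>2 * exp (E * a powr (- 1 / 2)))"
    proof (intro mult_left_mono mult_right_mono)
      have "exp T \<le> 2 + a / 2 + 1 / (a / 2)" unfolding T_def using a by (intro exp_sum_prime_powr_le) auto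
      also have "\<dots> \<le> 4 / a"
      proof -
        have "a * a \<le> 1 / 2 * (1 / 2)" using a by (intro mult_mono) auto
        then have "(2 + a / 2 + 2 / a) * a \<le> 4" using a by (simp add: distrib_right)
        then show ?thesis using a by (simp add: pos_le_divide_eq)
      qed
      finally have "(exp T)\<^sup>2 \<le> (4 / a)\<^sup>2" by (intro power_mono) auto
      then show "(exp T)\<^sup>2 \<le> 16 / a\<^sup>2" by (simp add: power_divide)
    qed (use psi_series_real_props(4)[OF a(1)] in auto)
    finally show ?thesis .
  qed
  have nn: "error_coeff \<eta> p \<ge> 0" for \<eta> p unfolding error_coeff_def by simp
  show ?thesis
  proof (rule that[OF E0])
    fix a :: real assume a: "0 < a" "a \<le> 1 / 2"
    note D = dirichlet_euler_product_real[of "error_coeff (a / 2)" a, OF nn a(1) bound[OF a]]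
    show "summable (\<lambda>n. kernel_coeff (error_coeff (a / 2)) n * real n powr (- a))" by (rule D(1))
    show "(\<Sum>n. kernel_coeff (error_coeff (a / 2)) n * real n powr (- a)) \<le> psi_series_real a * (16 / a\<^sup>2 * exp (E * a powr (- 1 / 2)))"
      by (rule D(2))
  qed
qed

lemma sqfree_kernel_dvd_mono:
  assumes "d dvd m" "m > 0"
  shows "sqfree_kernel d dvd sqfree_kernel m"
  unfolding sqfree_kernel_def using assms by (intro prod_dvd_prod_subset dvd_prime_factors) auto

lemma kernel_le_powr_iff:
  assumes \<theta>: "0 < \<theta>" "\<theta> < 1" and "k > 0" "d > 0"
  shows "real k \<le> real (k * d) powr \<theta> \<longleftrightarrow> real k \<le> real d powr (\<theta> / (1 - \<theta>))"
proof -
  have kd: "real k > 0" "real d > 0" using assms by auto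
  have "real k \<le> real (k * d) powr \<theta> \<longleftrightarrow> ln (real k) \<le> ln (real (k * d) powr \<theta>)"
    using kd by (intro ln_le_cancel_iff[symmetric]) auto
  also have "ln (real (k * d) powr \<theta>) = \<theta> * (ln (real k) + ln (real d))" using kd by (simp add: ln_powr ln_mult)
  also have "ln (real k) \<le> \<theta> * (ln (real k) + ln (real d)) \<longleftrightarrow> ln (real k) \<le> \<theta> / (1 - \<theta>) * ln (real d)"
    using \<theta> by (simp add: field_simps)
  also have "\<theta> / (1 - \<theta>) * ln (real d) = ln (real d powr (\<theta> / (1 - \<theta>)))" using kd by (simp add: ln_powr)
  also have "ln (real k) \<le> ln (real d powr (\<theta> / (1 - \<theta>))) \<longleftrightarrow> real k \<le> real d powr (\<theta> / (1 - \<theta>))"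
    using kd by (intro ln_le_cancel_iff) auto
  finally show ?thesis .
qed

definition kernel_cutoff :: "real \<Rightarrow> real \<Rightarrow> nat \<Rightarrow> real" where
  "kernel_cutoff \<theta> x d = min (real d powr (\<theta> / (1 - \<theta>))) (x / real d)"

text \<open>Every \<open>m\<close> is \<open>k * d\<close> with \<open>k\<close> its squarefree kernel; the condition \<open>k \<le> m powr \<theta>\<close> becomes
  \<open>k \<le> d powr (\<theta> / (1 - \<theta>))\<close>.\<close>

lemma S_count_sums:
  assumes \<theta>: "0 < \<theta>" "\<theta> < 1" and x: "x > 0"
  shows "(\<lambda>d. real (multiple_count (kernel_cutoff \<theta> x d) d)) sums real (S_count \<theta> x)"
proof -
  define X where "X = nat \<lfloor>x\<rfloor>"
  define K where "K = (\<lambda>d. {k. squarefree k \<and> sqfree_kernel d dvd k \<and> real k \<le> kernel_cutoff \<theta> x d})"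
  define A where "A = {m::nat. 1 \<le> m \<and> real m \<le> x \<and> real (sqfree_kernel m) \<le> real m powr \<theta>}"
  have mc: "multiple_count (kernel_cutoff \<theta> x d) d = card (K d)" for d by (simp add: multiple_count_def K_def)
  have k0: "k > 0" if "k \<in> K d" for k d using that by (intro Nat.gr0I) (auto simp: K_def)
  have finK: "finite (K d)" for d
    by (rule finite_subset[of _ "{..nat \<lfloor>kernel_cutoff \<theta> x d\<rfloor>}"]) (auto simp: K_def le_nat_floor)
  have iff: "k * d \<in> A \<and> sqfree_kernel (k * d) = k \<longleftrightarrow> k \<in> K d" if d: "d > 0" for k d
  proof
    assume h: "k * d \<in> A \<and> sqfree_kernel (k * d) = k"
    then have kd: "k * d > 0" "k > 0" by (auto simp: A_def)
    have "squarefree k" using sqfree_kernel_props(3)[OF kd(1)] h by simp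
    moreover have "sqfree_kernel d dvd k" using sqfree_kernel_dvd_mono[of d "k * d"] h kd by simp
    moreover have "real k \<le> real d powr (\<theta> / (1 - \<theta>))"
      using h kernel_le_powr_iff[OF \<theta> kd(2) d] by (simp add: A_def)
    moreover have "real k \<le> x / real d" using h d by (simp add: A_def pos_le_divide_eq)
    ultimately show "k \<in> K d" by (simp add: K_def kernel_cutoff_def)
  next
    assume h: "k \<in> K d"
    have kp: "k > 0" by (rule k0[OF h])
    have s: "sqfree_kernel (k * d) = k" using h d by (intro sqfree_kernel_mult) (auto simp: K_def)
    have "real k \<le> real (k * d) powr \<theta>" using h kernel_le_powr_iff[OF \<theta> kp d] by (simp add: K_def kernel_cutoff_def)
    moreover have "real (k * d) \<le> x" using h d by (simp add: K_def kernel_cutoff_def pos_le_divide_eq)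
    moreover have "1 \<le> k * d" using kp d by simp
    ultimately show "k * d \<in> A \<and> sqfree_kernel (k * d) = k" using s by (simp add: A_def)
  qed
  have Ke: "K d = {}" if "d \<notin> {1..X}" for d
  proof (rule ccontr)
    assume "K d \<noteq> {}"
    then obtain k where k: "k \<in> K d" by blast
    have kp: "k > 0" by (rule k0[OF k])
    have kx: "real k \<le> x / real d" using k by (simp add: K_def kernel_cutoff_def)
    then have d: "d > 0" using kp by (cases "d = 0") auto
    have "1 \<le> x / real d" using kp kx by linarith
    then have "real d \<le> x" using d by (simp add: pos_le_divide_eq)
    then have "d \<le> X" by (simp add: X_def le_nat_floor)
    then show False using that d by simp
  qed
  have "bij_betw (\<lambda>(d, k). k * d) (SIGMA d:{1..X}. K d) A"
  proof (rule bij_betw_imageI)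
    show "inj_on (\<lambda>(d, k). k * d) (SIGMA d:{1..X}. K d)"
    proof (rule inj_onI, clarify)
      fix d k d' k' assume h: "d \<in> {1..X}" "d' \<in> {1..X}" "k \<in> K d" "k' \<in> K d'" "k * d = k' * d'"
      have "k = k'" using iff[of d k] iff[of d' k'] h by auto
      then show "d = d' \<and> k = k'" using h k0 by auto
    qed
    show "(\<lambda>(d, k). k * d) ` (SIGMA d:{1..X}. K d) = A"
    proof (intro equalityI subsetI)
      fix m assume "m \<in> (\<lambda>(d, k). k * d) ` (SIGMA d:{1..X}. K d)"
      then obtain d k where "m = k * d" "d \<in> {1..X}" "k \<in> K d" by auto
      then show "m \<in> A" using iff[of d k] by auto
    next
      fix m assume m: "m \<in> A"
      then have m0: "m > 0" by (simp add: A_def)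
      define k where "k = sqfree_kernel m"
      obtain d where d: "m = k * d" using sqfree_kernel_props(4)[OF m0] by (auto simp: k_def)
      have d0: "d > 0" using d m0 by (cases d) auto
      have "k \<in> K d" using iff[OF d0, of k] m unfolding d[symmetric] k_def[symmetric] by blast
      moreover have "d \<in> {1..X}" using Ke[of d] \<open>k \<in> K d\<close> by blast
      ultimately show "m \<in> (\<lambda>(d, k). k * d) ` (SIGMA d:{1..X}. K d)" using d by (intro image_eqI[of _ _ "(d, k)"]) auto
    qed
  qed
  then have "card (SIGMA d:{1..X}. K d) = card A" by (rule bij_betw_same_card)
  then have "(\<Sum>d=1..X. card (K d)) = S_count \<theta> x" using finK by (simp add: card_SigmaI S_count_def A_def)
  then have "real (S_count \<theta> x) = (\<Sum>d=1..X. real (card (K d)))" by (simp flip: of_nat_sum)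
  moreover have "(\<lambda>d. real (card (K d))) sums (\<Sum>d=1..X. real (card (K d)))"
    by (rule sums_finite) (auto simp: Ke)
  ultimately show ?thesis by (simp add: mc)
qed

section \<open>The cutoff in exponential coordinates, and tilting\<close>

lemma kernel_cutoff_eq:
  assumes \<theta>: "0 < \<theta>" "\<theta> < 1" and x: "x > 0" and d: "d > 0"
  defines "u \<equiv> (1 - \<theta>) * ln x - ln (real d)"
  shows "kernel_cutoff \<theta> x d = x powr \<theta> * min (exp (- (\<theta> / (1 - \<theta>)) * u)) (exp u)"
proof -
  have "x powr \<theta> * exp (- (\<theta> / (1 - \<theta>)) * u) = exp (\<theta> * ln x - \<theta> / (1 - \<theta>) * u)"
    using x by (simp add: powr_def exp_diff exp_minus divide_inverse)
  also have "\<theta> * ln x - \<theta> / (1 - \<theta>) * u = \<theta> / (1 - \<theta>) * ln (real d)" unfolding u_def using \<theta> by (simp add: field_simps)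
  also have "exp (\<theta> / (1 - \<theta>) * ln (real d)) = real d powr (\<theta> / (1 - \<theta>))" using d by (simp add: powr_def)
  finally have 1: "x powr \<theta> * exp (- (\<theta> / (1 - \<theta>)) * u) = real d powr (\<theta> / (1 - \<theta>))" .
  have "x powr \<theta> * exp u = exp (\<theta> * ln x + u)" using x by (simp add: powr_def exp_add)
  also have "\<theta> * ln x + u = ln x - ln (real d)" unfolding u_def by (simp add: algebra_simps)
  also have "exp \<dots> = x / real d" using x d by (simp add: exp_diff)
  finally have 2: "x powr \<theta> * exp u = x / real d" .
  show ?thesis unfolding kernel_cutoff_def 1[symmetric] 2[symmetric] by (subst min_mult_distrib_left) simp
qed

text \<open>The tilt parameter is free: the right side does not contain a. Taking \<mu> = 0 gives
  the terms of F, and \<mu> = \<theta> / (1 - \<theta>) those of the count, so the same a serves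
  both.\<close>

lemma exp_times_two_exp: "exp (a * u) * two_exp (\<mu> + a) (1 - a) u = min (exp (- \<mu> * u)) (exp u)"
proof -
  have "exp (a * u) * two_exp (\<mu> + a) (1 - a) u = min (exp (a * u) * exp (- (\<mu> + a) * u)) (exp (a * u) * exp ((1 - a) * u))"
    unfolding two_exp_def by (simp add: min_mult_distrib_left)
  also have "exp (a * u) * exp (- (\<mu> + a) * u) = exp (- \<mu> * u)" unfolding exp_add[symmetric] by (simp add: algebra_simps)
  also have "exp (a * u) * exp ((1 - a) * u) = exp u" unfolding exp_add[symmetric] by (simp add: algebra_simps)
  finally show ?thesis .
qed

lemma exp_tilt: "n > 0 \<Longrightarrow> exp (a * (v - ln (real n))) = exp (a * v) * real n powr (- a)"
  by (simp add: powr_def right_diff_distrib exp_diff exp_minus divide_inverse)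

lemma kernel_cutoff_two_exp:
  assumes \<theta>: "0 < \<theta>" "\<theta> < 1" and x: "x > 0"
  shows "kernel_cutoff \<theta> x d = x powr \<theta> * exp (a * ((1 - \<theta>) * ln x)) *
    (real d powr (- a) * two_exp (\<theta> / (1 - \<theta>) + a) (1 - a) ((1 - \<theta>) * ln x - ln (real d)))"
proof (cases "d = 0")
  case False
  define u where "u = (1 - \<theta>) * ln x - ln (real d)"
  have "kernel_cutoff \<theta> x d = x powr \<theta> * (exp (a * u) * two_exp (\<theta> / (1 - \<theta>) + a) (1 - a) u)"
    unfolding exp_times_two_exp u_def using kernel_cutoff_eq[OF \<theta> x, of d] False by simp
  also have "exp (a * u) = exp (a * ((1 - \<theta>) * ln x)) * real d powr (- a)" unfolding u_def using False by (intro exp_tilt) auto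
  finally show ?thesis unfolding u_def by (simp add: mult_ac)
qed (simp add: kernel_cutoff_def)

text \<open>The saving in the sieve error, for \<eta> = a / 2. The factor x^\<theta> gains
  x^(-\<theta> a / 2), while the minimum raised to the power 1 - a / 2 is still at most exp (a u):
  for u >= 0 because the minimum is at most 1, for u < 0 because 1 - a / 2 >= a.\<close>

lemma kernel_cutoff_powr_le:
  assumes \<theta>: "0 < \<theta>" "\<theta> < 1" and x: "x > 0" and d: "d > 0" and a: "0 < a" "a \<le> 1 / 2"
  shows "kernel_cutoff \<theta> x d powr (1 - a / 2) \<le>
    x powr \<theta> * exp (- (\<theta> * a / 2 * ln x)) * (exp (a * ((1 - \<theta>) * ln x)) * real d powr (- a))"
proof -
  define u where "u = (1 - \<theta>) * ln x - ln (real d)"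
  define m where "m = min (exp (- (\<theta> / (1 - \<theta>)) * u)) (exp u)"
  have m: "m > 0" unfolding m_def by simp
  have eq: "kernel_cutoff \<theta> x d powr (1 - a / 2) = (x powr \<theta>) powr (1 - a / 2) * m powr (1 - a / 2)"
    unfolding kernel_cutoff_eq[OF \<theta> x d] u_def[symmetric] m_def[symmetric] by (rule powr_mult)
  have eq2: "(x powr \<theta>) powr (1 - a / 2) = x powr \<theta> * exp (- (\<theta> * a / 2 * ln x))"
    unfolding powr_powr using x by (simp add: powr_def exp_add[symmetric] algebra_simps)
  have "m powr (1 - a / 2) \<le> exp (a * u)"
  proof (cases "u \<ge> 0")
    case True
    have "m \<le> exp (- (\<theta> / (1 - \<theta>)) * u)" unfolding m_def by simp
    also have "\<dots> \<le> exp 0" unfolding exp_le_cancel_iff using True \<theta> by (simp add: mult_nonneg_nonneg)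
    finally have "m powr (1 - a / 2) \<le> 1 powr (1 - a / 2)" using m a by (intro powr_mono2) auto
    also have "1 powr (1 - a / 2) \<le> exp (a * u)" using True a by simp
    finally show ?thesis .
  next
    case False
    have "m \<le> exp u" unfolding m_def by simp
    then have "m powr (1 - a / 2) \<le> exp u powr (1 - a / 2)" using m a by (intro powr_mono2) auto
    also have "\<dots> = exp ((1 - a / 2) * u)" by (simp add: powr_def)
    also have "\<dots> \<le> exp (a * u)" unfolding exp_le_cancel_iff using False a by (intro mult_right_mono_neg) auto
    finally show ?thesis .
  qed
  also have "exp (a * u) = exp (a * ((1 - \<theta>) * ln x)) * real d powr (- a)" unfolding u_def using d by (intro exp_tilt) auto
  finally show ?thesis unfolding eq eq2 by (intro mult_left_mono) auto
qed

lemma F_fn_sums: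
  assumes "0 < a" "a < 1"
  shows "F_fn v = 6 / pi\<^sup>2 * exp (a * v) * (\<Sum>n. psi_coeff n * real n powr (- a) * two_exp a (1 - a) (v - ln (real n)))"
    and "summable (\<lambda>n. psi_coeff n * real n powr (- a) * two_exp a (1 - a) (v - ln (real n)))"
    and "v \<ge> 0 \<Longrightarrow> 6 / pi\<^sup>2 \<le> F_fn v"
proof -
  define g where "g = (\<lambda>n. psi_coeff n * real n powr (- a) * two_exp a (1 - a) (v - ln (real n)))"
  define f where "f = (\<lambda>n. 1 / real (psi_fn (Suc n)) * min 1 (exp v / real (Suc n)))"
  show sg: "summable g"
  proof (rule summable_comparison_test[OF _ psi_series_real_props(1)[OF assms(1)]], intro exI allI impI)
    fix n
    have "psi_coeff n * real n powr (- a) * two_exp a (1 - a) (v - ln (real n)) \<le> psi_coeff n * real n powr (- a) * 1"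
      using assms two_exp_le_1[of a "1 - a"] psi_coeff_bounds(1)[of n] by (intro mult_left_mono) auto
    moreover have "0 \<le> g n" unfolding g_def using two_exp_nonneg psi_coeff_bounds(1)[of n] by (intro mult_nonneg_nonneg) auto
    ultimately show "norm (g n) \<le> psi_coeff n * real n powr (- a)" by (simp add: g_def)
  qed
  have fg: "f n = exp (a * v) * g (Suc n)" for n
  proof -
    define u where "u = v - ln (real (Suc n))"
    have "exp v / real (Suc n) = exp u" unfolding u_def by (simp add: exp_diff)
    then have "f n = psi_coeff (Suc n) * min (exp (- 0 * u)) (exp u)" unfolding f_def kernel_coeff_psi by simp
    also have "min (exp (- 0 * u)) (exp u) = exp (a * u) * two_exp a (1 - a) u" using exp_times_two_exp[of a u 0] by simp
    also have "exp (a * u) = exp (a * v) * real (Suc n) powr (- a)" unfolding u_def by (rule exp_tilt) simp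
    finally show ?thesis unfolding g_def u_def by (simp add: mult_ac)
  qed
  have "summable (\<lambda>n. g (Suc n))" using sg by (simp add: summable_Suc_iff)
  then have sf: "summable f" unfolding fg[abs_def] by (rule summable_mult)
  have "suminf f = exp (a * v) * (\<Sum>n. g (Suc n))" unfolding fg[abs_def] by (rule suminf_mult) fact
  also have "(\<Sum>n. g (Suc n)) = suminf g - g 0" by (rule suminf_split_head[OF sg])
  also have "g 0 = 0" by (simp add: g_def)
  finally have "suminf f = exp (a * v) * suminf g" by simp
  moreover have F: "F_fn v = 6 / pi\<^sup>2 * suminf f" unfolding F_fn_def f_def ..
  ultimately show "F_fn v = 6 / pi\<^sup>2 * exp (a * v) * suminf g" by simp
  show "6 / pi\<^sup>2 \<le> F_fn v" if "v \<ge> 0"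
  proof -
    have "f 0 = 1" using that by (simp add: f_def psi_fn_def)
    moreover have "sum f {0} \<le> suminf f" by (rule sum_le_suminf[OF sf]) (auto simp: f_def)
    ultimately have "6 / pi\<^sup>2 * 1 \<le> 6 / pi\<^sup>2 * suminf f" by (intro mult_left_mono) auto
    then show ?thesis unfolding F by simp
  qed
qed

text \<open>The error is summed over d term by term. By \<open>kernel_cutoff_powr_le\<close> it
  carries the same tilt exp (a v) d^(-a) as the main term, so the sum over d is the series of
  \<open>error_series_bound\<close>. The equation between x and a identifies v with the centre of
  the inversion formula.\<close>

lemma S_count_estimate:
  obtains E where "E > 0" "\<And>\<theta> x a. 0 < \<theta> \<Longrightarrow> \<theta> < 1 \<Longrightarrow> 0 < a \<Longrightarrow> a \<le> 1 / 2 \<Longrightarrow> x > 0 \<Longrightarrow>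
    (1 - \<theta>) * ln x = saddle_sum a \<Longrightarrow>
    \<bar>real (S_count \<theta> x) - x powr \<theta> * exp (a * saddle_sum a) *
       (6 / pi\<^sup>2 * (psi_series_real a / (2 * pi) * (\<integral>t. Re (tilted_char a t * two_exp_ft (\<theta> / (1 - \<theta>) + a) (1 - a) t) \<partial>lborel)))\<bar>
    \<le> x powr \<theta> * exp (a * saddle_sum a) * psi_series_real a *
       (E * (exp (- (\<theta> * a / 2 * ln x)) * (16 / a\<^sup>2 * exp (E * a powr (- 1 / 2)))))"
proof -
  obtain E1 where E1: "E1 > 0" "\<And>y d \<eta>. d > 0 \<Longrightarrow> y > 0 \<Longrightarrow> 0 \<le> \<eta> \<Longrightarrow> \<eta> \<le> 1 / 4 \<Longrightarrow>
    \<bar>real (multiple_count y d) - 6 / pi\<^sup>2 * y * psi_coeff d\<bar> \<le> E1 * y powr (1 - \<eta>) * kernel_coeff (error_coeff \<eta>) d"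
    by (rule multiple_count_estimate) blast
  obtain E2 where E2: "E2 > 0"
    "\<And>a. 0 < a \<Longrightarrow> a \<le> 1 / 2 \<Longrightarrow> summable (\<lambda>n. kernel_coeff (error_coeff (a / 2)) n * real n powr (- a))"
    "\<And>a. 0 < a \<Longrightarrow> a \<le> 1 / 2 \<Longrightarrow> (\<Sum>n. kernel_coeff (error_coeff (a / 2)) n * real n powr (- a)) \<le>
       psi_series_real a * (16 / a\<^sup>2 * exp (E2 * a powr (- 1 / 2)))"
    by (rule error_series_bound) blast
  define E where "E = max E1 E2"
  show ?thesis
  proof (rule that[of E])
    show "E > 0" using E1 by (simp add: E_def)
    fix \<theta> x a :: real
    assume \<theta>: "0 < \<theta>" "\<theta> < 1" and a: "0 < a" "a \<le> 1 / 2" and x: "x > 0" and v: "(1 - \<theta>) * ln x = saddle_sum a"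
    define Q where "Q = x powr \<theta> * exp (a * saddle_sum a)"
    define A where "A = \<theta> / (1 - \<theta>) + a"
    define J where "J = psi_series_real a / (2 * pi) * (\<integral>t. Re (tilted_char a t * two_exp_ft A (1 - a) t) \<partial>lborel)"
    define R where "R = exp (- (\<theta> * a / 2 * ln x))"
    define k where "k = (\<lambda>n. kernel_coeff (error_coeff (a / 2)) n * real n powr (- a))"
    define y where "y = kernel_cutoff \<theta> x"
    have Q: "Q > 0" unfolding Q_def using x by simp
    have A: "A > 0" unfolding A_def using \<theta> a by (simp add: add_pos_pos)
    have main: "(\<lambda>n. 6 / pi\<^sup>2 * y n * psi_coeff n) sums (Q * (6 / pi\<^sup>2 * J))"
    proof -
      have "(\<lambda>n. Q * (6 / pi\<^sup>2) * (psi_coeff n * real n powr (- a) * two_exp A (1 - a) (saddle_sum a - ln (real n)))) sums (Q * (6 / pi\<^sup>2) * J)"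
        unfolding J_def using tilted_char_integral(2)[of a A "1 - a"] a A by (intro sums_mult) auto
      moreover have "Q * (6 / pi\<^sup>2) * (psi_coeff n * real n powr (- a) * two_exp A (1 - a) (saddle_sum a - ln (real n))) = 6 / pi\<^sup>2 * y n * psi_coeff n" for n
        unfolding y_def kernel_cutoff_two_exp[OF \<theta> x, of n a] v Q_def[symmetric] A_def[symmetric] by (simp add: mult_ac)
      ultimately show ?thesis by (simp only: mult.assoc)
    qed
    define D where "D = (\<lambda>n. real (multiple_count (y n) n) - 6 / pi\<^sup>2 * y n * psi_coeff n)"
    have Ds: "D sums (real (S_count \<theta> x) - Q * (6 / pi\<^sup>2 * J))"
      unfolding D_def y_def by (intro sums_diff S_count_sums[OF \<theta> x] main[unfolded y_def])
    have sk: "summable k" unfolding k_def by (rule E2(2)[OF a])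
    have k0: "k n \<ge> 0" for n unfolding k_def kernel_coeff_def error_coeff_def by (intro mult_nonneg_nonneg prod_nonneg) auto
    have Dn: "\<bar>D n\<bar> \<le> E1 * R * Q * k n" for n
    proof (cases "n = 0")
      case True
      \<comment> \<open>At d = 0 the cutoff is 0, as 0 powr y and x / 0 are both 0, and no
        squarefree number is at most 0.\<close>
      have "{k. squarefree k \<and> sqfree_kernel 0 dvd k \<and> real k \<le> 0} = {}" by auto
      then have "D n = 0" unfolding D_def y_def multiple_count_def using True by (simp add: kernel_cutoff_def)
      then show ?thesis using True by (simp add: k_def)
    next
      case False
      have y0: "y n > 0" unfolding y_def kernel_cutoff_def using False x by simp
      have "\<bar>D n\<bar> \<le> E1 * y n powr (1 - a / 2) * kernel_coeff (error_coeff (a / 2)) n"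
        unfolding D_def using False y0 a by (intro E1(2)) auto
      also have "\<dots> \<le> E1 * (x powr \<theta> * R * (exp (a * saddle_sum a) * real n powr (- a))) * kernel_coeff (error_coeff (a / 2)) n"
      proof (intro mult_right_mono mult_left_mono)
        show "y n powr (1 - a / 2) \<le> x powr \<theta> * R * (exp (a * saddle_sum a) * real n powr (- a))"
          unfolding y_def R_def using kernel_cutoff_powr_le[OF \<theta> x _ a, of n] False unfolding v by simp
        show "0 \<le> kernel_coeff (error_coeff (a / 2)) n" unfolding kernel_coeff_def error_coeff_def by (intro prod_nonneg) auto
      qed (use E1 in auto)
      also have "\<dots> = E1 * R * Q * k n" unfolding Q_def k_def by (simp add: mult_ac)
      finally show ?thesis .
    qed
    have sD: "summable (\<lambda>n. \<bar>D n\<bar>)"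
      by (rule summable_comparison_test[OF _ summable_mult[OF sk, of "E1 * R * Q"]]) (use Dn in auto)
    have "\<bar>real (S_count \<theta> x) - Q * (6 / pi\<^sup>2 * J)\<bar> = \<bar>suminf D\<bar>" using Ds by (simp add: sums_iff)
    also have "\<dots> \<le> (\<Sum>n. \<bar>D n\<bar>)" by (rule summable_rabs[OF sD])
    also have "\<dots> \<le> (\<Sum>n. E1 * R * Q * k n)" by (rule suminf_le[OF _ sD summable_mult[OF sk]]) (rule Dn)
    also have "\<dots> = E1 * R * Q * suminf k" by (rule suminf_mult[OF sk])
    also have "\<dots> \<le> E * R * Q * (psi_series_real a * (16 / a\<^sup>2 * exp (E * a powr (- 1 / 2))))"
    proof (intro mult_mono)
      have "suminf k \<le> psi_series_real a * (16 / a\<^sup>2 * exp (E2 * a powr (- 1 / 2)))" unfolding k_def by (rule E2(3)[OF a])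
      also have "\<dots> \<le> psi_series_real a * (16 / a\<^sup>2 * exp (E * a powr (- 1 / 2)))"
        using psi_series_real_props(4)[OF a(1)] by (intro mult_left_mono) (auto simp: E_def mult_right_mono)
      finally show "suminf k \<le> psi_series_real a * (16 / a\<^sup>2 * exp (E * a powr (- 1 / 2)))" .
      show "0 \<le> suminf k" by (rule suminf_nonneg[OF sk k0])
    qed (use E1 Q in \<open>auto simp: E_def R_def\<close>)
    also have "\<dots> = Q * psi_series_real a * (E * (R * (16 / a\<^sup>2 * exp (E * a powr (- 1 / 2)))))" by (simp add: mult_ac)
    finally show "\<bar>real (S_count \<theta> x) - x powr \<theta> * exp (a * saddle_sum a) *
       (6 / pi\<^sup>2 * (psi_series_real a / (2 * pi) * (\<integral>t. Re (tilted_char a t * two_exp_ft (\<theta> / (1 - \<theta>) + a) (1 - a) t) \<partial>lborel)))\<bar>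
    \<le> x powr \<theta> * exp (a * saddle_sum a) * psi_series_real a *
       (E * (exp (- (\<theta> * a / 2 * ln x)) * (16 / a\<^sup>2 * exp (E * a powr (- 1 / 2)))))"
      unfolding Q_def J_def A_def R_def .
  qed
qed

section \<open>The saddle point as a function of the cutoff\<close>

text \<open>Termwise comparison; the prime 2 alone makes the inequality strict.\<close>

lemma saddle_sum_strict_antimono:
  assumes "0 < a" "a < b"
  shows "saddle_sum b < saddle_sum a"
proof -
  have sm: "alpha_term a summable_on {p. prime p}" "alpha_term b summable_on {p. prime p}"
    using saddle_sum_limit(1)[of a] saddle_sum_limit(1)[of b] assms by auto
  have "0 < (\<Sum>p\<in>{2}. alpha_term a p - alpha_term b p)" using alpha_term_strict_antimono[of 2 a b] assms by simp
  also have "\<dots> \<le> (\<Sum>\<^sub>\<infinity>p\<in>{p. prime p}. alpha_term a p - alpha_term b p)"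
  proof (rule finite_sum_le_infsum)
    show "(\<lambda>p. alpha_term a p - alpha_term b p) summable_on {p. prime p}"
      using summable_on_add[OF sm(1) summable_on_uminus[THEN iffD2, OF sm(2)]] by simp
    show "0 \<le> alpha_term a p - alpha_term b p" if "p \<in> {p. prime p} - {2}" for p
      using alpha_term_strict_antimono[of p a b] that assms by simp
  qed auto
  also have "\<dots> = saddle_sum a - saddle_sum b" unfolding saddle_sum_def
    using infsum_add[OF sm(1) summable_on_uminus[THEN iffD2, OF sm(2)]] by (simp add: infsum_uminus)
  finally show ?thesis by simp
qed

text \<open>Weierstrass test on a > e with majorant 1 / (e^2 p ln p). Continuity being local, all e
  > 0 together give the half line.\<close>

lemma continuous_on_saddle_sum: "continuous_on {0<..} saddle_sum"
proof -
  obtain T where T: "T > 0" "\<And>N. (\<Sum>p\<in>primes_le N. 1 / (real p * ln (real p))) \<le> T"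
    using sum_prime_inverse_ln_bounded by blast
  have cont: "continuous_on {e<..} saddle_sum" if e: "e > 0" for e
  proof -
    define M where "M = (\<lambda>p. 1 / e\<^sup>2 * (1 / (real p * ln (real p))))"
    have M0: "(\<lambda>p. 1 / (real p * ln (real p))) summable_on {p. prime p}"
      using prime_gt_1_nat by (intro prime_infsum(1)[OF _ T(2)]) (auto intro!: mult_nonneg_nonneg ln_ge_zero simp: Suc_le_eq prime_gt_0_nat)
    then have M: "M summable_on {p. prime p}" unfolding M_def by (rule summable_on_cmult_right)
    have "uniform_limit {e<..} (\<lambda>P a. \<Sum>p\<in>P. alpha_term a p) (\<lambda>a. \<Sum>\<^sub>\<infinity>p\<in>{p. prime p}. alpha_term a p) (finite_subsets_at_top {p. prime p})"
    proof (rule Weierstrass_m_test_general[OF _ M])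
      fix p :: nat and a :: real assume h: "p \<in> {p. prime p}" "a \<in> {e<..}"
      then have p: "prime p" and a: "a > 0" "a > e" using e by auto
      have p1: "real p > 1" using prime_gt_1_nat[OF p] by simp
      have "norm (alpha_term a p) = alpha_term a p" using alpha_term_bounds(1)[OF p a(1)] by simp
      also have "\<dots> \<le> 1 / a\<^sup>2 * (1 / (real p * ln (real p)))" by (rule alpha_term_bounds(2)[OF p a(1)])
      also have "\<dots> \<le> M p" unfolding M_def using e a p1
        by (intro mult_right_mono divide_left_mono power_mono divide_nonneg_nonneg mult_nonneg_nonneg ln_ge_zero mult_pos_pos) auto
      finally show "norm (alpha_term a p) \<le> M p" .
    qed
    moreover have "\<forall>\<^sub>F P in finite_subsets_at_top {p. prime p}. continuous_on {e<..} (\<lambda>a. \<Sum>p\<in>P. alpha_term a p)"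
    proof (rule eventually_finite_subsets_at_top_weakI)
      fix P :: "nat set" assume P: "P \<subseteq> {p. prime p}"
      have "continuous_on {e<..} (\<lambda>a. alpha_term a p)" if "p \<in> P" for p
      proof -
        have p: "prime p" using that P by auto
        have nz: "real p powr a - 1 > 0" if "a > e" for a using prime_powr_gt_1[OF p, of a] that e by simp
        have p0: "real p \<noteq> 0" using p by auto
        have "(real p powr a - 1) * (1 + (real p + 1) * (real p powr a - 1)) \<noteq> 0" if "a > e" for a
        proof -
          have "0 < (real p powr a - 1) * (1 + (real p + 1) * (real p powr a - 1))"
            using nz[OF that] by (intro mult_pos_pos add_pos_nonneg mult_nonneg_nonneg) auto
          then show ?thesis by linarith
        qed
        then show ?thesis unfolding alpha_term_def using p0 by (intro continuous_intros) auto
      qed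
      then show "continuous_on {e<..} (\<lambda>a. \<Sum>p\<in>P. alpha_term a p)" by (rule continuous_on_sum)
    qed
    ultimately show ?thesis unfolding saddle_sum_def[abs_def] by (intro uniform_limit_theorem) auto
  qed
  have "isCont saddle_sum a" if "a > 0" for a
    using cont[of "a / 2"] that by (auto simp: continuous_on_eq_continuous_at)
  then show ?thesis by (auto intro: continuous_at_imp_continuous_on)
qed

lemma saddle_sum_eventually_ge: "\<forall>\<^sub>F a in at_right 0. 1 / (2 * a\<^sup>2 * ln (1 / a)) \<le> saddle_sum a"
proof -
  have "\<forall>\<^sub>F a in at_right 0. 1 / 2 < saddle_sum a * (a\<^sup>2 * ln (1 / a))"
    by (rule order_tendstoD(1)[OF saddle_sum_asymp]) simp
  moreover have "\<forall>\<^sub>F a in at_right (0::real). a\<^sup>2 * ln (1 / a) > 0" by real_asymp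
  ultimately show ?thesis
  proof eventually_elim
    case (elim a)
    then have "1 / 2 / (a\<^sup>2 * ln (1 / a)) \<le> saddle_sum a" by (subst pos_divide_le_eq) auto
    then show ?case by (simp add: mult.assoc)
  qed
qed

lemma filterlim_saddle_sum: "filterlim saddle_sum at_top (at_right 0)"
proof (rule filterlim_at_top_mono[OF _ saddle_sum_eventually_ge])
  show "filterlim (\<lambda>a::real. 1 / (2 * a\<^sup>2 * ln (1 / a))) at_top (at_right 0)" by real_asymp
qed

text \<open>Justifies the definite description in \<open>alpha_fn\<close>. Strict monotonicity gives
  uniqueness; existence follows from the intermediate value theorem, as the sum tends to infinity at
  0 and is at most T / a^2.\<close>

lemma alpha_fn_props:
  assumes \<theta>: "\<theta> < 1" and x: "x > 1"
  shows "alpha_fn \<theta> x > 0" "saddle_sum (alpha_fn \<theta> x) = (1 - \<theta>) * ln x"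
proof -
  define v where "v = (1 - \<theta>) * ln x"
  have v: "v > 0" unfolding v_def using assms by simp
  obtain T where T: "T > 0" "\<And>a. a > 0 \<Longrightarrow> saddle_sum a \<le> T / a\<^sup>2" by (rule saddle_sum_le) blast
  \<comment> \<open>At this point the upper bound T / b^2 equals \<open>v\<close>.\<close>
  define b where "b = sqrt (T / v)"
  have b: "b > 0" unfolding b_def using T v by simp
  have sb: "saddle_sum b \<le> v" using T(2)[OF b] T(1) v by (simp add: b_def)
  have "\<forall>\<^sub>F a in at_right 0. v \<le> saddle_sum a" using filterlim_saddle_sum by (auto simp: filterlim_at_top)
  moreover have "\<forall>\<^sub>F a in at_right 0. a \<in> {0<..<b}" using b by (rule eventually_at_right_real)
  ultimately have "\<forall>\<^sub>F a in at_right 0. v \<le> saddle_sum a \<and> a \<in> {0<..<b}" by eventually_elim auto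
  then obtain a where a: "v \<le> saddle_sum a" "0 < a" "a < b"
    using eventually_happens'[of "at_right (0::real)"] by (auto simp: trivial_limit_at_right_real)
  have "\<exists>c\<ge>a. c \<le> b \<and> saddle_sum c = v"
    using a sb by (intro IVT2' continuous_on_subset[OF continuous_on_saddle_sum]) auto
  then obtain c where "c \<ge> a" "saddle_sum c = v" by blast
  then have c: "c > 0" "saddle_sum c = v" using a(2) by linarith+
  have "\<exists>!c. c > 0 \<and> saddle_sum c = v"
  proof (rule ex1I[of _ c])
    fix d assume d: "d > 0 \<and> saddle_sum d = v"
    show "d = c" using d c saddle_sum_strict_antimono[of d c] saddle_sum_strict_antimono[of c d] by (cases d c rule: linorder_cases) auto
  qed (use c in auto)
  from theI'[OF this] show "alpha_fn \<theta> x > 0" "saddle_sum (alpha_fn \<theta> x) = (1 - \<theta>) * ln x"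
    unfolding alpha_fn_def saddle_sum_def v_def by auto
qed

lemma alpha_fn_less:
  assumes "\<theta> < 1" "x > 1" "a > 0" "saddle_sum a < (1 - \<theta>) * ln x"
  shows "alpha_fn \<theta> x < a"
proof (rule ccontr)
  assume "\<not> alpha_fn \<theta> x < a"
  then consider "alpha_fn \<theta> x = a" | "a < alpha_fn \<theta> x" by linarith
  then show False
    using saddle_sum_strict_antimono[of a "alpha_fn \<theta> x"] assms alpha_fn_props(2)[OF assms(1,2)] by cases auto
qed

lemma filterlim_alpha_fn:
  assumes "\<theta> < 1"
  shows "filterlim (alpha_fn \<theta>) (at_right 0) at_top"
proof (rule tendsto_imp_filterlim_at_right)
  have x1: "\<forall>\<^sub>F x in at_top. x > (1::real)" by (rule eventually_gt_at_top)
  then show "\<forall>\<^sub>F x in at_top. 0 < alpha_fn \<theta> x" by eventually_elim (rule alpha_fn_props(1)[OF assms])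
  show "(alpha_fn \<theta> \<longlongrightarrow> 0) at_top"
  proof (rule order_tendstoI)
    fix a :: real assume "a < 0"
    then show "\<forall>\<^sub>F x in at_top. a < alpha_fn \<theta> x"
      by (intro eventually_mono[OF x1] less_trans[OF _ alpha_fn_props(1)[OF assms]])
  next
    fix a :: real assume a: "0 < a"
    have "filterlim (\<lambda>x::real. (1 - \<theta>) * ln x) at_top at_top" using assms by real_asymp
    then have "\<forall>\<^sub>F x in at_top. saddle_sum a < (1 - \<theta>) * ln x" by (auto simp: filterlim_at_top_dense)
    with x1 show "\<forall>\<^sub>F x in at_top. alpha_fn \<theta> x < a"
      by eventually_elim (rule alpha_fn_less[OF assms _ a])
  qed
qed

text \<open>The count and F share the factors exp (a v) and \<Phi>(a), so only the two integrals are
  compared. With L = ln (1 / a), a difference O(a (a L)^(3/2)) is divided by a / \<theta> times an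
  integral of at least c (a L)^(1/2); what remains is O(a L).\<close>

lemma S_count_relative_error:
  assumes \<theta>: "0 < \<theta>" "\<theta> < 1"
  obtains C where "C > 0" "\<forall>\<^sub>F a in at_right 0. \<forall>x>0. (1 - \<theta>) * ln x = saddle_sum a \<longrightarrow>
    \<bar>real (S_count \<theta> x) - x powr \<theta> * F_fn (saddle_sum a) * a / \<theta>\<bar> \<le> C * (x powr \<theta> * F_fn (saddle_sum a) * a / \<theta>) * (a * ln (1 / a))"
proof -
  define I where "I = (\<lambda>A a. \<integral>t. Re (tilted_char a t * two_exp_ft A (1 - a) t) \<partial>lborel)"
  obtain C c where C: "C > 0" and c: "c > 0" and est: "\<forall>\<^sub>F a in at_right 0.
     \<bar>I (\<theta> / (1 - \<theta>) + a) a - a / \<theta> * I a a\<bar> \<le> C * (a * (a * ln (1 / a)) powr (3 / 2)) \<and>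
     c * (a * ln (1 / a)) powr (1 / 2) \<le> I a a"
    unfolding I_def by (rule saddle_integral_estimates[OF \<theta>]) blast
  obtain E where E: "E > 0" "\<And>\<theta> x a. 0 < \<theta> \<Longrightarrow> \<theta> < 1 \<Longrightarrow> 0 < a \<Longrightarrow> a \<le> 1 / 2 \<Longrightarrow> x > 0 \<Longrightarrow>
    (1 - \<theta>) * ln x = saddle_sum a \<Longrightarrow>
    \<bar>real (S_count \<theta> x) - x powr \<theta> * exp (a * saddle_sum a) *
       (6 / pi\<^sup>2 * (psi_series_real a / (2 * pi) * I (\<theta> / (1 - \<theta>) + a) a))\<bar>
    \<le> x powr \<theta> * exp (a * saddle_sum a) * psi_series_real a *
       (E * (exp (- (\<theta> * a / 2 * ln x)) * (16 / a\<^sup>2 * exp (E * a powr (- 1 / 2)))))"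
    unfolding I_def by (rule S_count_estimate) blast
  define \<kappa> where "\<kappa> = 6 / pi\<^sup>2 / (2 * pi)"
  \<comment> \<open>From ln x = v / (1 - \<theta>) and v >= 1 / (2 a^2 L) the exponent \<theta> a ln
    x / 2 is at least c5 / (a L), where L = ln (1 / a).\<close>
  define c5 where "c5 = \<theta> / (4 * (1 - \<theta>))"
  have \<kappa>: "\<kappa> > 0" unfolding \<kappa>_def by simp
  have c5: "c5 > 0" unfolding c5_def using \<theta> by simp
  have e1: "\<forall>\<^sub>F a in at_right (0::real). a \<in> {0<..<1 / 2}" by (rule eventually_at_right_real) simp
  \<comment> \<open>1 / (a ln (1 / a)) grows faster than a^(-1/2), so the saving outweighs the loss
    in the error series.\<close>
  have e2: "\<forall>\<^sub>F a in at_right (0::real). E * (exp (- (c5 / (a * ln (1 / a)))) * (16 / a\<^sup>2 * exp (E * a powr (- 1 / 2)))) \<le> a * (a * ln (1 / a)) powr (3 / 2)"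
    using E(1) c5 by real_asymp
  have e3: "\<forall>\<^sub>F a in at_right (0::real). a * ln (1 / a) > 0" by real_asymp
  define C' where "C' = (\<kappa> * C + 1) * \<theta> / (\<kappa> * c)"
  have C'0: "C' > 0" unfolding C'_def using C \<kappa> c \<theta> by (intro divide_pos_pos mult_pos_pos add_pos_pos) auto
  show ?thesis
  proof (rule that[OF C'0])
    show "\<forall>\<^sub>F a in at_right 0. \<forall>x>0. (1 - \<theta>) * ln x = saddle_sum a \<longrightarrow>
      \<bar>real (S_count \<theta> x) - x powr \<theta> * F_fn (saddle_sum a) * a / \<theta>\<bar> \<le> C' * (x powr \<theta> * F_fn (saddle_sum a) * a / \<theta>) * (a * ln (1 / a))"
      using est e1 e2 e3 saddle_sum_eventually_ge
    proof eventually_elim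
      case (elim a)
      have a: "0 < a" "a \<le> 1 / 2" using elim(2) by auto
      define s where "s = saddle_sum a"
      define L where "L = ln (1 / a)"
      define R where "R = psi_series_real a"
      define q where "q = (a * L) powr (1 / 2)"
      define q3 where "q3 = (a * L) powr (3 / 2)"
      have aL: "a * L > 0" using elim(4) by (simp add: L_def)
      have qq: "q3 = q * (a * L)"
      proof -
        have "q * (a * L) powr 1 = q3" unfolding q_def q3_def powr_add[symmetric] by simp
        then show ?thesis using aL by simp
      qed
      have R: "R \<ge> 1" unfolding R_def by (rule psi_series_real_props(4)[OF a(1)])
      have F: "F_fn s = exp (a * s) * R * \<kappa> * I a a"
      proof -
        have "F_fn s = 6 / pi\<^sup>2 * exp (a * s) * (\<Sum>n. psi_coeff n * real n powr (- a) * two_exp a (1 - a) (s - ln (real n)))"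
          using a by (intro F_fn_sums) auto
        also have "(\<Sum>n. psi_coeff n * real n powr (- a) * two_exp a (1 - a) (s - ln (real n))) = R / (2 * pi) * I a a"
          unfolding R_def I_def s_def using tilted_char_integral(2)[of a a "1 - a"] a by (intro sums_unique[symmetric]) auto
        finally show ?thesis unfolding \<kappa>_def by simp
      qed
      show ?case
      proof (intro allI impI)
        fix x :: real assume x: "x > 0" and v: "(1 - \<theta>) * ln x = saddle_sum a"
        define Q where "Q = x powr \<theta> * exp (a * s)"
        define M where "M = x powr \<theta> * F_fn s * a / \<theta>"
        have Q: "Q > 0" unfolding Q_def using x by simp
        have M: "M = Q * R * (\<kappa> * (a / \<theta> * I a a))" unfolding M_def F Q_def by simp
        have eps: "E * (exp (- (\<theta> * a / 2 * ln x)) * (16 / a\<^sup>2 * exp (E * a powr (- 1 / 2)))) \<le> a * q3"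
        proof -
          have "c5 / (a * L) \<le> \<theta> * a / 2 * ln x"
          proof -
            have lx: "ln x = s / (1 - \<theta>)" using v \<theta> by (simp add: s_def field_simps)
            have "c5 / (a * L) = \<theta> * a / 2 / (1 - \<theta>) * (1 / (2 * a\<^sup>2 * L))"
              unfolding c5_def using a by (simp add: power2_eq_square)
            also have "\<dots> \<le> \<theta> * a / 2 / (1 - \<theta>) * s" using elim(5) \<theta> a unfolding L_def s_def by (intro mult_left_mono) auto
            finally show ?thesis unfolding lx by simp
          qed
          then have "E * (exp (- (\<theta> * a / 2 * ln x)) * (16 / a\<^sup>2 * exp (E * a powr (- 1 / 2)))) \<le> E * (exp (- (c5 / (a * L))) * (16 / a\<^sup>2 * exp (E * a powr (- 1 / 2))))"
            using E(1) by (intro mult_left_mono mult_right_mono) auto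
          also have "\<dots> \<le> a * q3" using elim(3) unfolding L_def q3_def .
          finally show ?thesis .
        qed
        have "\<bar>real (S_count \<theta> x) - Q * R * (\<kappa> * I (\<theta> / (1 - \<theta>) + a) a)\<bar> \<le> Q * R * (a * q3)"
        proof -
          have "Q * (6 / pi\<^sup>2 * (R / (2 * pi) * I (\<theta> / (1 - \<theta>) + a) a)) = Q * R * (\<kappa> * I (\<theta> / (1 - \<theta>) + a) a)"
            unfolding \<kappa>_def by simp
          moreover have "\<bar>real (S_count \<theta> x) - Q * (6 / pi\<^sup>2 * (R / (2 * pi) * I (\<theta> / (1 - \<theta>) + a) a))\<bar> \<le>
            Q * R * (E * (exp (- (\<theta> * a / 2 * ln x)) * (16 / a\<^sup>2 * exp (E * a powr (- 1 / 2)))))"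
            unfolding Q_def s_def R_def by (rule E(2)[OF \<theta> a x v])
          moreover have "\<dots> \<le> Q * R * (a * q3)" using Q R eps by (intro mult_left_mono) auto
          ultimately show ?thesis by linarith
        qed
        moreover have "\<bar>Q * R * (\<kappa> * I (\<theta> / (1 - \<theta>) + a) a) - M\<bar> \<le> Q * R * (\<kappa> * (C * (a * q3)))"
        proof -
          have "\<bar>Q * R * (\<kappa> * I (\<theta> / (1 - \<theta>) + a) a) - M\<bar> = Q * R * (\<kappa> * \<bar>I (\<theta> / (1 - \<theta>) + a) a - a / \<theta> * I a a\<bar>)"
          proof -
            have "Q * R * (\<kappa> * I (\<theta> / (1 - \<theta>) + a) a) - M = Q * R * \<kappa> * (I (\<theta> / (1 - \<theta>) + a) a - a / \<theta> * I a a)"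
              unfolding M by (simp only: right_diff_distrib mult.assoc)
            moreover have "R > 0" using R by simp
            ultimately show ?thesis using Q \<kappa> by (simp only: abs_mult abs_of_pos mult.assoc)
          qed
          also have "\<dots> \<le> Q * R * (\<kappa> * (C * (a * q3)))"
            using elim(1) Q R \<kappa> unfolding q3_def L_def by (intro mult_left_mono) auto
          finally show ?thesis .
        qed
        ultimately have "\<bar>real (S_count \<theta> x) - M\<bar> \<le> Q * R * (a * q3) + Q * R * (\<kappa> * (C * (a * q3)))" by linarith
        also have "\<dots> = Q * R * (\<kappa> * C + 1) * (a * q3)" by (simp add: algebra_simps)
        also have "\<dots> = C' * (Q * R * (\<kappa> * (a / \<theta> * (c * q)))) * (a * L)"
          unfolding C'_def qq using \<kappa> c \<theta> by simp
        also have "\<dots> \<le> C' * M * (a * L)"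
        proof -
          have "c * q \<le> I a a" using elim(1) unfolding q_def L_def by simp
          then have "Q * R * (\<kappa> * (a / \<theta> * (c * q))) \<le> M" unfolding M using Q R \<kappa> a \<theta> by (intro mult_left_mono) auto
          then show ?thesis using C'0 aL by (intro mult_right_mono mult_left_mono) auto
        qed
        finally show "\<bar>real (S_count \<theta> x) - x powr \<theta> * F_fn (saddle_sum a) * a / \<theta>\<bar> \<le> C' * (x powr \<theta> * F_fn (saddle_sum a) * a / \<theta>) * (a * ln (1 / a))"
          unfolding M_def s_def L_def .
      qed
    qed
  qed
qed

text \<open>Keeps ln ln x positive on the range of the theorem. It follows from 16 <= 27 and ln 2 >=
  1/2.\<close>

lemma ln_27_ge: "ln 27 \<ge> (2::real)"
proof -
  have "ln (16::real) = ln (2 ^ 4)" by simp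
  also have "\<dots> = 4 * ln 2" by (subst ln_realpow) auto
  finally have "2 \<le> ln (16::real)" using ln_2_ge_half by linarith
  also have "ln 16 \<le> ln (27::real)" by simp
  finally show ?thesis .
qed

lemma S_count_le: "x \<ge> 0 \<Longrightarrow> real (S_count \<theta> x) \<le> x"
proof -
  assume x: "x \<ge> 0"
  have "S_count \<theta> x \<le> card {1..nat \<lfloor>x\<rfloor>}" unfolding S_count_def
    by (rule card_mono) (auto simp: le_nat_floor)
  also have "\<dots> = nat \<lfloor>x\<rfloor>" by simp
  finally show ?thesis using x by linarith
qed

text \<open>With L = ln (1 / a) and v = (1 - \<theta>) ln x one has (a L)^2 v = L (a^2 L v) <= 2 L,
  and 1 / a <= v gives L <= ln v <= ln ln x. This converts the error a L into the error of the
  theorem.\<close>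

lemma saddle_width_le:
  assumes \<theta>: "0 < \<theta>" "\<theta> < 1"
  shows "\<forall>\<^sub>F a in at_right 0. \<forall>x\<ge>27. (1 - \<theta>) * ln x = saddle_sum a \<longrightarrow>
    a * ln (1 / a) \<le> sqrt (2 / (1 - \<theta>)) * sqrt (ln (ln x) / ln x)"
proof -
  have "\<forall>\<^sub>F a in at_right 0. saddle_sum a * (a\<^sup>2 * ln (1 / a)) < 2"
    by (rule order_tendstoD(2)[OF saddle_sum_asymp]) simp
  moreover have "\<forall>\<^sub>F a in at_right (0::real). 1 / a \<le> 1 / (2 * a\<^sup>2 * ln (1 / a))" by real_asymp
  moreover have "\<forall>\<^sub>F a in at_right (0::real). a \<in> {0<..<1}" by (rule eventually_at_right_real) simp
  ultimately show ?thesis using saddle_sum_eventually_ge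
  proof eventually_elim
    case (elim a)
    define s where "s = saddle_sum a"
    define L where "L = ln (1 / a)"
    have a: "0 < a" "a < 1" using elim by auto
    have L: "L > 0" unfolding L_def using a by simp
    have sa: "1 / a \<le> s" using elim(2,4) unfolding s_def by linarith
    then have s0: "s > 0" using a by (smt (verit) zero_less_divide_1_iff)
    have "L \<le> ln s" unfolding L_def using sa a s0 by simp
    show ?case
    proof (intro allI impI)
      fix x :: real assume x: "x \<ge> 27" and v: "(1 - \<theta>) * ln x = saddle_sum a"
      have lx: "ln x \<ge> 2" using ln_27_ge ln_mono[of 27 x] x by linarith
      have "s \<le> 1 * ln x" unfolding s_def v[symmetric] using \<theta> lx by (intro mult_right_mono) auto
      then have "ln s \<le> ln (ln x)" using s0 by simp
      with \<open>L \<le> ln s\<close> have LL: "L \<le> ln (ln x)" by simp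
      have "(a * L)\<^sup>2 * s = L * (s * (a\<^sup>2 * L))" by (simp add: power2_eq_square)
      also have "\<dots> \<le> ln (ln x) * 2"
        using elim(1) LL L s0 a lx unfolding s_def[symmetric] L_def[symmetric] by (intro mult_mono) auto
      finally have "(a * L)\<^sup>2 \<le> 2 * ln (ln x) / s" using s0 by (simp add: pos_le_divide_eq)
      also have "\<dots> = 2 / (1 - \<theta>) * (ln (ln x) / ln x)" unfolding s_def v[symmetric] by simp
      finally have "sqrt ((a * L)\<^sup>2) \<le> sqrt (2 / (1 - \<theta>) * (ln (ln x) / ln x))" by (rule real_sqrt_le_mono)
      moreover have "sqrt ((a * L)\<^sup>2) = a * L" using a L by simp
      ultimately show "a * ln (1 / a) \<le> sqrt (2 / (1 - \<theta>)) * sqrt (ln (ln x) / ln x)"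
        unfolding L_def by (simp only: real_sqrt_mult)
    qed
  qed
qed

text \<open>With v the saddle sum at a and L = ln (1 / a): since v a^2 L tends to 1, ln v is
  asymptotic to 2 L, so a^2 v ln v tends to 2, and v = (1 - \<theta>) ln x. The function
  \<open>g\<close> is the square of the quotient in the statement, expressed through a.\<close>

lemma alpha_fn_limit:
  assumes \<theta>: "0 < \<theta>" "\<theta> < 1"
  shows "((\<lambda>x. alpha_fn \<theta> x / ((2 / (1 - \<theta>)) powr (1 / 2) * (ln x * ln (ln x)) powr (- 1 / 2))) \<longlongrightarrow> 1) at_top"
proof -
  define f where "f = (\<lambda>a. saddle_sum a * (a\<^sup>2 * ln (1 / a)))"
  define g where "g = (\<lambda>a. a\<^sup>2 * (saddle_sum a / (1 - \<theta>) * ln (saddle_sum a / (1 - \<theta>))) / (2 / (1 - \<theta>)))"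
  have t: "1 - \<theta> > 0" using \<theta> by simp
  have f: "(f \<longlongrightarrow> 1) (at_right 0)" unfolding f_def by (rule saddle_sum_asymp)
  \<comment> \<open>The bracket is ln (v / (1 - \<theta>)) / L, split into ln (f a) / L, which tends
    to 0, and an elementary part, which tends to 2.\<close>
  have "((\<lambda>a. f a / 2 * (ln (f a) * (1 / ln (1 / a)) + (- ln (a\<^sup>2 * ln (1 / a) * (1 - \<theta>))) / ln (1 / a))) \<longlongrightarrow> 1 / 2 * (ln 1 * 0 + 2)) (at_right 0)"
  proof (intro tendsto_mult tendsto_add tendsto_divide f tendsto_ln tendsto_const)
    show "((\<lambda>a::real. 1 / ln (1 / a)) \<longlongrightarrow> 0) (at_right 0)" by real_asymp
    show "((\<lambda>a::real. (- ln (a\<^sup>2 * ln (1 / a) * (1 - \<theta>))) / ln (1 / a)) \<longlongrightarrow> 2) (at_right 0)"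
      using t by real_asymp
  qed auto
  moreover have "\<forall>\<^sub>F a in at_right 0. f a / 2 * (ln (f a) * (1 / ln (1 / a)) + (- ln (a\<^sup>2 * ln (1 / a) * (1 - \<theta>))) / ln (1 / a)) = g a"
  proof -
    have "\<forall>\<^sub>F a in at_right 0. f a > 0" by (rule order_tendstoD(1)[OF f]) simp
    moreover have "\<forall>\<^sub>F a in at_right (0::real). ln (1 / a) > 0 \<and> a > 0"
      by (intro eventually_conj eventually_at_right_less) real_asymp
    ultimately show ?thesis
    proof eventually_elim
      case (elim a)
      define L where "L = ln (1 / a)"
      define s where "s = saddle_sum a"
      have L: "L > 0" and a: "a > 0" using elim by (auto simp: L_def)
      have fa: "f a = s * (a\<^sup>2 * L)" by (simp add: f_def s_def L_def)
      have "a\<^sup>2 * L > 0" using a L by simp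
      then have s: "s > 0" using elim(1) unfolding fa by (rule zero_less_mult_pos2[rotated])
      have "ln (f a) - ln (a\<^sup>2 * L * (1 - \<theta>)) = ln (f a / (a\<^sup>2 * L * (1 - \<theta>)))" using elim(1) L a t by (simp add: ln_div)
      also have "f a / (a\<^sup>2 * L * (1 - \<theta>)) = s / (1 - \<theta>)" unfolding fa using L a by simp
      finally have ln: "ln (f a) - ln (a\<^sup>2 * L * (1 - \<theta>)) = ln (s / (1 - \<theta>))" .
      have "f a / 2 * (ln (f a) * (1 / L) + (- ln (a\<^sup>2 * L * (1 - \<theta>))) / L) = f a / 2 * ((ln (f a) - ln (a\<^sup>2 * L * (1 - \<theta>))) / L)"
        by (simp add: diff_divide_distrib)
      also have "\<dots> = g a" unfolding ln unfolding fa g_def s_def[symmetric] using L t by simp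
      finally show ?case unfolding L_def .
    qed
  qed
  ultimately have "(g \<longlongrightarrow> 1 / 2 * (ln 1 * 0 + 2)) (at_right 0)" by (rule Lim_transform_eventually)
  then have "(g \<longlongrightarrow> 1) (at_right 0)" by simp
  then have "((\<lambda>a. g a powr (1 / 2)) \<longlongrightarrow> 1 powr (1 / 2)) (at_right 0)" by (intro tendsto_intros) auto
  then have "((\<lambda>x. g (alpha_fn \<theta> x) powr (1 / 2)) \<longlongrightarrow> 1) at_top"
    using filterlim_compose[OF _ filterlim_alpha_fn[OF \<theta>(2)]] by force
  moreover have "\<forall>\<^sub>F x in at_top. g (alpha_fn \<theta> x) powr (1 / 2) =
      alpha_fn \<theta> x / ((2 / (1 - \<theta>)) powr (1 / 2) * (ln x * ln (ln x)) powr (- 1 / 2))"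
    using eventually_ge_at_top[of "27::real"]
  proof eventually_elim
    case (elim x)
    define a where "a = alpha_fn \<theta> x"
    have a: "a > 0" "saddle_sum a / (1 - \<theta>) = ln x" unfolding a_def using alpha_fn_props[of \<theta> x] \<theta> elim by auto
    have "g a powr (1 / 2) = (a\<^sup>2) powr (1 / 2) * (ln x * ln (ln x)) powr (1 / 2) / (2 / (1 - \<theta>)) powr (1 / 2)"
      unfolding g_def a(2) by (simp only: powr_divide powr_mult)
    also have "(a\<^sup>2) powr (1 / 2) = a" using a by (simp add: powr_half_sqrt)
    also have "(ln x * ln (ln x)) powr (1 / 2) = 1 / (ln x * ln (ln x)) powr (- 1 / 2)"
      using powr_minus_divide[of "ln x * ln (ln x)" "- 1 / 2"] by simp
    finally show ?case unfolding a_def by (simp only: times_divide_eq_right divide_divide_eq_left mult_1_right mult.commute)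
  qed
  ultimately show ?thesis by (rule Lim_transform_eventually)
qed

theorem theorem1:
  fixes \<theta> :: real
  assumes "0 < \<theta>" and "\<theta> < 1"
  shows "(\<exists>C>0. \<forall>x::real. x \<ge> 27 \<longrightarrow>
            \<bar>real (S_count \<theta> x) - x powr \<theta> * F_fn ((1 - \<theta>) * ln x) * alpha_fn \<theta> x / \<theta>\<bar>
              \<le> C * (x powr \<theta> * F_fn ((1 - \<theta>) * ln x) * alpha_fn \<theta> x / \<theta>) * sqrt (ln (ln x) / ln x))
       \<and> (\<lambda>x. real (S_count \<theta> x)) \<sim>[at_top]
           (\<lambda>x. x powr \<theta> * F_fn ((1 - \<theta>) * ln x) * (1 / \<theta>) * (2 / (1 - \<theta>)) powr (1/2)
                 * (ln x * ln (ln x)) powr (-1/2))"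
proof -
  note \<theta> = assms
  define M where "M = (\<lambda>x. x powr \<theta> * F_fn ((1 - \<theta>) * ln x) * alpha_fn \<theta> x / \<theta>)"
  define r where "r = (\<lambda>x::real. sqrt (ln (ln x) / ln x))"
  have lnx: "ln x \<ge> 2" if "x \<ge> 27" for x :: real using ln_27_ge ln_mono[of 27 x] that by linarith
  have F0: "F_fn ((1 - \<theta>) * ln x) \<ge> 6 / pi\<^sup>2" if "x \<ge> 27" for x
    using F_fn_sums(3)[of "1 / 2" "(1 - \<theta>) * ln x"] lnx[OF that] \<theta> by simp
  have M0: "M x > 0" if "x \<ge> 27" for x
  proof -
    have "0 < 6 / pi\<^sup>2" by simp
    then have "F_fn ((1 - \<theta>) * ln x) > 0" using F0[OF that] by (rule less_le_trans)
    moreover have "alpha_fn \<theta> x > 0" using alpha_fn_props(1)[of \<theta> x] \<theta> that by simp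
    ultimately show ?thesis unfolding M_def using \<theta> that by simp
  qed
  obtain C1 where C1: "C1 > 0" "\<forall>\<^sub>F a in at_right 0. \<forall>x>0. (1 - \<theta>) * ln x = saddle_sum a \<longrightarrow>
    \<bar>real (S_count \<theta> x) - x powr \<theta> * F_fn (saddle_sum a) * a / \<theta>\<bar> \<le> C1 * (x powr \<theta> * F_fn (saddle_sum a) * a / \<theta>) * (a * ln (1 / a))"
    by (rule S_count_relative_error[OF \<theta>]) blast
  define C2 where "C2 = C1 * sqrt (2 / (1 - \<theta>))"
  have C2: "C2 > 0" unfolding C2_def using C1 \<theta> by simp
  have "\<forall>\<^sub>F a in at_right 0. \<forall>x\<ge>27. (1 - \<theta>) * ln x = saddle_sum a \<longrightarrow>
    \<bar>real (S_count \<theta> x) - x powr \<theta> * F_fn (saddle_sum a) * a / \<theta>\<bar> \<le> C2 * (x powr \<theta> * F_fn (saddle_sum a) * a / \<theta>) * r x"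
    using C1(2) saddle_width_le[OF \<theta>] eventually_at_right_less
  proof eventually_elim
    case (elim a)
    show ?case
    proof (intro allI impI)
      fix x :: real assume x: "x \<ge> 27" and v: "(1 - \<theta>) * ln x = saddle_sum a"
      define m where "m = x powr \<theta> * F_fn (saddle_sum a) * a / \<theta>"
      have "0 \<le> 6 / pi\<^sup>2" by simp
      then have "F_fn (saddle_sum a) \<ge> 0" using F0[OF x] unfolding v by (rule order_trans)
      then have m: "m \<ge> 0" unfolding m_def using elim(3) \<theta> by (intro divide_nonneg_nonneg mult_nonneg_nonneg) auto
      have "\<bar>real (S_count \<theta> x) - m\<bar> \<le> C1 * m * (a * ln (1 / a))" using elim(1) x v unfolding m_def by simp
      also have "\<dots> \<le> C1 * m * (sqrt (2 / (1 - \<theta>)) * r x)"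
        using elim(2) x v C1(1) m unfolding r_def by (intro mult_left_mono) auto
      also have "\<dots> = C2 * m * r x" unfolding C2_def by simp
      finally show "\<bar>real (S_count \<theta> x) - x powr \<theta> * F_fn (saddle_sum a) * a / \<theta>\<bar> \<le> C2 * (x powr \<theta> * F_fn (saddle_sum a) * a / \<theta>) * r x"
        unfolding m_def .
    qed
  qed
  then obtain b where b: "b > 0" "\<And>a x. 0 < a \<Longrightarrow> a < b \<Longrightarrow> x \<ge> 27 \<Longrightarrow> (1 - \<theta>) * ln x = saddle_sum a \<Longrightarrow>
    \<bar>real (S_count \<theta> x) - x powr \<theta> * F_fn (saddle_sum a) * a / \<theta>\<bar> \<le> C2 * (x powr \<theta> * F_fn (saddle_sum a) * a / \<theta>) * r x"
    unfolding eventually_at_right_field by blast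
  have large: "\<bar>real (S_count \<theta> x) - M x\<bar> \<le> C2 * M x * r x" if x: "x \<ge> 27" "alpha_fn \<theta> x < b" for x
    using b(2)[of "alpha_fn \<theta> x" x] alpha_fn_props[of \<theta> x] x \<theta> unfolding M_def by simp
  \<comment> \<open>Where \<alpha> is not below the threshold \<open>b\<close>, monotonicity of the
    saddle sum forces x <= X. On this bounded range the count is at most X, the main term at least
    \<open>m0\<close> and the rate at least \<open>r0\<close>, so a large constant does. The maximum
    with 1 in \<open>r0\<close> keeps the denominator positive.\<close>
  define X where "X = exp (saddle_sum b / (1 - \<theta>))"
  define m0 where "m0 = 6 / pi\<^sup>2 * b / \<theta>"
  define r0 where "r0 = sqrt (ln (ln 27) / max 1 (ln X))"
  have m0: "m0 > 0" unfolding m0_def using b \<theta> by simp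
  have r0: "r0 > 0" unfolding r0_def using ln_27_ge by simp
  define C3 where "C3 = (X / m0 + 1) / r0"
  have C3: "C3 > 0" unfolding C3_def using m0 r0 by (intro divide_pos_pos add_pos_pos) (auto simp: X_def)
  have small: "\<bar>real (S_count \<theta> x) - M x\<bar> \<le> C3 * M x * r x" if x: "x \<ge> 27" "\<not> alpha_fn \<theta> x < b" for x
  proof -
    have "\<not> saddle_sum b < (1 - \<theta>) * ln x" using alpha_fn_less[of \<theta> x b] x \<theta> b by auto
    then have lX: "ln x \<le> saddle_sum b / (1 - \<theta>)" using \<theta> by (simp add: pos_le_divide_eq mult.commute)
    then have "exp (ln x) \<le> X" unfolding X_def by simp
    then have xX: "x \<le> X" using x by simp
    have lnX: "ln x \<le> max 1 (ln X)" using lX unfolding X_def by simp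
    have "ln (ln 27) \<le> ln (ln x)" using ln_27_ge ln_mono[of 27 x] x by simp
    then have "ln (ln 27) / max 1 (ln X) \<le> ln (ln x) / ln x"
      using lnX lnx[OF x(1)] ln_27_ge by (intro frac_le) auto
    then have rr: "r0 \<le> r x" unfolding r0_def r_def by (rule real_sqrt_le_mono)
    have mM: "m0 \<le> M x"
    proof -
      have "1 * (6 / pi\<^sup>2) * b \<le> x powr \<theta> * F_fn ((1 - \<theta>) * ln x) * alpha_fn \<theta> x"
      proof (intro mult_mono)
        show "1 \<le> x powr \<theta>" using x \<theta> by (intro ge_one_powr_ge_zero) auto
        show "6 / pi\<^sup>2 \<le> F_fn ((1 - \<theta>) * ln x)" by (rule F0[OF x(1)])
        show "b \<le> alpha_fn \<theta> x" using x by simp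
        show "0 \<le> x powr \<theta> * F_fn ((1 - \<theta>) * ln x)"
          using order_trans[OF _ F0[OF x(1)], of 0] by (intro mult_nonneg_nonneg) auto
      qed (use b in auto)
      then show ?thesis unfolding m0_def M_def using \<theta> by (intro divide_right_mono) auto
    qed
    have "\<bar>real (S_count \<theta> x) - M x\<bar> \<le> real (S_count \<theta> x) + M x" using M0[OF x(1)] by simp
    also have "\<dots> \<le> X + M x" using S_count_le[of x \<theta>] x xX by simp
    also have "X + M x \<le> X / m0 * M x + M x"
    proof -
      have "X = X / m0 * m0" using m0 by simp
      also have "\<dots> \<le> X / m0 * M x" using mM m0 by (intro mult_left_mono) (auto simp: X_def)
      finally show ?thesis by simp
    qed
    also have "X / m0 * M x + M x = C3 * M x * r0"
    proof -
      have "X / m0 * M x + M x = (X / m0 + 1) * M x" by (simp only: distrib_right mult_1_left)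
      also have "X / m0 + 1 = C3 * r0" unfolding C3_def using r0 by simp
      finally show ?thesis by (simp only: mult_ac)
    qed
    also have "\<dots> \<le> C3 * M x * r x" using rr C3 M0[OF x(1)] by (intro mult_left_mono) auto
    finally show ?thesis .
  qed
  have r_nonneg: "r x \<ge> 0" if "x \<ge> 27" for x unfolding r_def using lnx[OF that] by simp
  define C where "C = max C2 C3"
  have bound: "\<bar>real (S_count \<theta> x) - M x\<bar> \<le> C * M x * r x" if x: "x \<ge> 27" for x
  proof (cases "alpha_fn \<theta> x < b")
    case True
    have "C2 * M x * r x \<le> C * M x * r x" using M0[OF x] r_nonneg[OF x] by (intro mult_right_mono) (auto simp: C_def)
    then show ?thesis using large[OF x True] by linarith
  next
    case False
    have "C3 * M x * r x \<le> C * M x * r x" using M0[OF x] r_nonneg[OF x] by (intro mult_right_mono) (auto simp: C_def)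
    then show ?thesis using small[OF x False] by linarith
  qed
  have "((\<lambda>x. real (S_count \<theta> x) / M x) \<longlongrightarrow> 1) at_top"
  proof -
    have "((\<lambda>x. real (S_count \<theta> x) / M x - 1) \<longlongrightarrow> 0) at_top"
    proof (rule Lim_null_comparison)
      show "((\<lambda>x. C * r x) \<longlongrightarrow> 0) at_top" unfolding r_def by real_asymp
      show "\<forall>\<^sub>F x in at_top. norm (real (S_count \<theta> x) / M x - 1) \<le> C * r x"
        using eventually_ge_at_top[of "27::real"]
      proof eventually_elim
        case (elim x)
        have "real (S_count \<theta> x) / M x - 1 = (real (S_count \<theta> x) - M x) / M x" using M0[OF elim] by (simp add: diff_divide_distrib)
        then have "norm (real (S_count \<theta> x) / M x - 1) = \<bar>real (S_count \<theta> x) - M x\<bar> / M x" using M0[OF elim] by (simp add: abs_divide)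
        also have "\<dots> \<le> C * r x" using bound[OF elim] M0[OF elim] by (simp add: pos_divide_le_eq mult_ac)
        finally show ?case .
      qed
    qed
    then show ?thesis by (simp add: LIM_zero_iff)
  qed
  \<comment> \<open>By the first claim the count divided by \<open>M\<close> tends to 1; since
    \<open>M\<close> contains \<alpha> as a factor, \<open>alpha_fn_limit\<close> exchanges it for
    its asymptotic value.\<close>
  note lim = tendsto_mult[OF this alpha_fn_limit[OF \<theta>], unfolded mult_1_left]
  have ev: "\<forall>\<^sub>F x in at_top. real (S_count \<theta> x) / M x * (alpha_fn \<theta> x / ((2 / (1 - \<theta>)) powr (1 / 2) * (ln x * ln (ln x)) powr (- 1 / 2))) =
      real (S_count \<theta> x) / (x powr \<theta> * F_fn ((1 - \<theta>) * ln x) * (1 / \<theta>) * (2 / (1 - \<theta>)) powr (1/2) * (ln x * ln (ln x)) powr (-1/2))"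
    using eventually_ge_at_top[of "27::real"]
  proof eventually_elim
    case (elim x)
    have alg: "S / (xp * F * al / th) * (al / (u * w)) = S / (xp * F * (1 / th) * u * w)" if "al > 0" for S xp F al th u w :: real
      using that by (simp add: field_simps)
    show ?case unfolding M_def using alpha_fn_props(1)[of \<theta> x] \<theta> elim by (intro alg) auto
  qed
  have "(\<lambda>x. real (S_count \<theta> x)) \<sim>[at_top]
           (\<lambda>x. x powr \<theta> * F_fn ((1 - \<theta>) * ln x) * (1 / \<theta>) * (2 / (1 - \<theta>)) powr (1/2)
                 * (ln x * ln (ln x)) powr (-1/2))"
    by (rule asymp_equivI'[OF Lim_transform_eventually[OF lim ev]])
  moreover have "C > 0" using C2 by (simp add: C_def)
  ultimately show ?thesis using bound unfolding M_def r_def by blast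
qed

end
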